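(* Let $\beta,\nu>0$ and $\delta\ge0$ be constants and consider the periodically forced Duffing oscillator with $a=0$, $$\dot{x}_1=x_2,\qquad \dot{x}_2=-x_1^3+\epsilon(\beta\cos\phi-\delta x_2),\qquad \dot\phi=\nu,$$ where $\epsilon$ is a small parameter. For $\alpha\in(0,\infty)$ let $$x^\alpha(t)=\bigl(\alpha\,\mathrm{cn}(\alpha t),\ -\alpha^2\,\mathrm{sn}(\alpha t)\,\mathrm{dn}(\alpha t)\bigr),$$ with elliptic modulus $1/\sqrt2$, which is a periodic orbit of the $x$-system at $\epsilon=0$ with period $T^\alpha=4K(1/\sqrt2)/\alpha$. Let $l,n>0$ be relatively prime integers and let $\alpha=\alpha^{l/n}$ satisfy the resonance condition $$nT^\alpha=\frac{2\pi l}{\nu},\quad\text{i.e.}\quad \nu=\frac{\pi l\alpha}{2nK(1/\sqrt2)} .$$ Let $\hat\Gamma$ be a domain in $\mathbb{C}/(2\pi l/\nu)\mathbb{Z}$ containing $\mathbb{R}/(2\pi l/\nu)\mathbb{Z}$ and the point $\tau=iK(1/\sqrt2)/\alpha$. Then the system is not meromorphically integrable in the Bogoyavlenskij sense near any periodic orbit on the resonant torus $$\mathscr{T}^\alpha=\{(x^\alpha(\tau),\nu\tau+\theta)\mid\tau\in\hat\Gamma,\ \theta\in\mathbb{S}^1,\ \alpha=\alpha^{l/n}\}$$ in such a way that the first integrals and commutative vector fields also depend meromorphically on $\epsilon$ near $\epsilon=0$.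
   Context: $\mathrm{sn},\mathrm{cn},\mathrm{dn}$ are the Jacobi elliptic functions, here with elliptic modulus $k=1/\sqrt2$, and $K(k)$ is the complete elliptic integral of the first kind. $\mathbb{S}^1=\mathbb{R}/2\pi\mathbb{Z}$. Time and the state variables $(x_1,x_2,\phi)$ are complexified, the state space becoming $\mathbb{C}^2\times(\mathbb{C}/2\pi\mathbb{Z})$. A periodic orbit on $\mathscr{T}^\alpha$ is $\mathcal{O}=\{(x^\alpha(\tau),\nu\tau+\theta)\mid\tau\in\hat\Gamma\}$ for fixed $\theta\in\mathbb{S}^1$ (at those $\tau$ which are not poles of $x^\alpha$). Bogoyavlenskij integrability: an $N$-dimensional system $\dot y=f(y)$ is $(q,N-q)$-integrable, or simply integrable, if there are $q$ vector fields $f_1:=f,f_2,\dots,f_q$ and $N-q$ scalar functions $F_1,\dots,F_{N-q}$ such that (i) $f_1,\dots,f_q$ are linearly independent almost everywhere and commute, $[f_j,f_k]=\mathrm{D}f_k\,f_j-\mathrm{D}f_j\,f_k\equiv0$; (ii) $\mathrm{D}F_1,\dots,\mathrm{D}F_{N-q}$ are linearly independent almost everywhere and $\mathrm{D}F_k\cdot f_j\equiv0$ for all $j,k$. It is meromorphically integrable if the $f_j$ and $F_k$ are meromorphic. For a family $\dot y=f(y;\epsilon)$, "not meromorphically integrable near an orbit $\mathcal{O}$ such that the first integrals and commutative vector fields also depend meromorphically on $\epsilon$ near $\epsilon=0$" means: for no $q\in\{1,\dots,N\}$ and no neighborhood of $\mathcal{O}\times\{\epsilon=0\}$ in the complexified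 (state, parameter) space do there exist $f_1=f(\cdot;\epsilon),f_2,\dots,f_q$ and $F_1,\dots,F_{N-q}$, meromorphic in $(y,\epsilon)$ on that neighborhood, satisfying (i) and (ii) (brackets and derivatives taken in $y$, identities holding identically in $(y,\epsilon)$, independence almost everywhere). Here $N=3$ and $y=(x_1,x_2,\phi)$. *)

theory Defs
  imports "HOL-Complex_Analysis.Complex_Analysis"
begin

unbundle no fps_syntax

section \<open>Elliptic integrals and Jacobi elliptic functions\<close>

text \<open>The argument \<open>k\<close> is always the elliptic modulus (not the parameter \<open>k^2\<close>), with
  \<open>\<bar>k\<bar> < 1\<close>.\<close>

definition elliptic_F :: "real \<Rightarrow> real \<Rightarrow> real" where
  "elliptic_F k \<phi> = (LBINT t=0..\<phi>. 1 / sqrt (1 - k\<^sup>2 * (sin t)\<^sup>2))"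

definition elliptic_K :: "real \<Rightarrow> real" where
  "elliptic_K k = elliptic_F k (pi / 2)"

definition jacobi_am :: "real \<Rightarrow> real \<Rightarrow> real" where
  "jacobi_am k = inv (elliptic_F k)"

text \<open>By the identity theorem a function satisfying the condition below is unique if it exists;
  \<open>nicely_meromorphic_on\<close> fixes the value \<open>0\<close> at the poles.\<close>

definition meromorphic_continuation :: "(real \<Rightarrow> real) \<Rightarrow> complex \<Rightarrow> complex" where
  "meromorphic_continuation f =
     (THE g. g nicely_meromorphic_on UNIV \<and> (\<forall>t::real. g (of_real t) = of_real (f t)))"

definition jacobi_sn :: "real \<Rightarrow> complex \<Rightarrow> complex" where
  "jacobi_sn k = meromorphic_continuation (\<lambda>u. sin (jacobi_am k u))"

definition jacobi_cn :: "real \<Rightarrow> complex \<Rightarrow> complex" where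
  "jacobi_cn k = meromorphic_continuation (\<lambda>u. cos (jacobi_am k u))"

definition jacobi_dn :: "real \<Rightarrow> complex \<Rightarrow> complex" where
  "jacobi_dn k = meromorphic_continuation (\<lambda>u. sqrt (1 - k\<^sup>2 * (sin (jacobi_am k u))\<^sup>2))"


section \<open>Meromorphic functions of the state and the parameter\<close>

text \<open>A point \<open>(y, \<epsilon>)\<close> consists of a state \<open>y\<close> in \<open>\<complex>\<^sup>N\<close>, \<open>N = CARD('n)\<close>, and a parameter.\<close>

type_synonym 'n spt = "(complex ^ 'n) \<times> complex"

text \<open>Holomorphy in several variables: at every point there is a complex-linear
  Frechet derivative.\<close>

definition mv_holomorphic_on :: "('n::finite spt \<Rightarrow> complex) \<Rightarrow> 'n spt set \<Rightarrow> bool" where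
  "mv_holomorphic_on g V \<longleftrightarrow>
     (\<forall>z\<in>V. \<exists>D. (g has_derivative D) (at z) \<and>
        (\<forall>c v. D (c *s fst v, c * snd v) = c * D v))"

text \<open>Locally a quotient of holomorphic functions whose denominator is not identically zero on any
  nonempty open set.  The value of \<open>g\<close> at zeros of the denominator is irrelevant.\<close>

definition mv_meromorphic_on :: "('n::finite spt \<Rightarrow> complex) \<Rightarrow> 'n spt set \<Rightarrow> bool" where
  "mv_meromorphic_on g U \<longleftrightarrow>
     (\<forall>p\<in>U. \<exists>V a b. open V \<and> p \<in> V \<and> V \<subseteq> U \<and>
        mv_holomorphic_on a V \<and> mv_holomorphic_on b V \<and>
        interior {z\<in>V. b z = 0} = {} \<and>
        (\<forall>z\<in>V. b z \<noteq> 0 \<longrightarrow> g z = a z / b z))"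

text \<open>Identities between meromorphic functions are required at the points where the
  functions involved are holomorphic; these form a dense open set.\<close>

definition mv_regular_at :: "('n::finite spt \<Rightarrow> complex) \<Rightarrow> 'n spt \<Rightarrow> bool" where
  "mv_regular_at g z \<longleftrightarrow> (\<exists>V. open V \<and> z \<in> V \<and> mv_holomorphic_on g V)"

definition vf_meromorphic_on :: "('n::finite spt \<Rightarrow> complex ^ 'n) \<Rightarrow> 'n spt set \<Rightarrow> bool" where
  "vf_meromorphic_on X U \<longleftrightarrow> (\<forall>i. mv_meromorphic_on (\<lambda>z. X z $ i) U)"

definition vf_regular_at :: "('n::finite spt \<Rightarrow> complex ^ 'n) \<Rightarrow> 'n spt \<Rightarrow> bool" where
  "vf_regular_at X z \<longleftrightarrow> (\<forall>i. mv_regular_at (\<lambda>w. X w $ i) z)"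


section \<open>Bogoyavlenskij integrability\<close>

definition state_deriv ::
    "('n::finite spt \<Rightarrow> 'b::real_normed_vector) \<Rightarrow> 'n spt \<Rightarrow> complex ^ 'n \<Rightarrow> 'b" where
  "state_deriv g z v = frechet_derivative (\<lambda>y. g (y, snd z)) (at (fst z)) v"

definition state_grad :: "('n::finite spt \<Rightarrow> complex) \<Rightarrow> 'n spt \<Rightarrow> complex ^ 'n" where
  "state_grad F z = (\<chi> i. state_deriv F z (axis i 1))"

definition state_bracket ::
    "('n::finite spt \<Rightarrow> complex ^ 'n) \<Rightarrow> ('n spt \<Rightarrow> complex ^ 'n) \<Rightarrow> 'n spt \<Rightarrow> complex ^ 'n" where
  "state_bracket X Y z = state_deriv Y z (X z) - state_deriv X z (Y z)"

definition lin_indep_family :: "nat set \<Rightarrow> (nat \<Rightarrow> complex ^ 'n::finite) \<Rightarrow> bool" where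
  "lin_indep_family I v \<longleftrightarrow> inj_on v I \<and> vec.independent (v ` I)"

text \<open>State spaces \<open>\<complex>\<^sup>N / \<int>\<omega>\<close> such as \<open>\<complex>\<^sup>2 \<times> (\<complex> / 2\<pi>\<int>)\<close> are handled on the universal cover: a subset
  of the quotient is given by its preimage, which is invariant under translation by \<open>\<omega>\<close>, and a
  function on it by a function invariant under this translation.\<close>

definition shift_state :: "complex ^ 'n \<Rightarrow> 'n spt \<Rightarrow> 'n spt" where
  "shift_state \<omega> z = (fst z + \<omega>, snd z)"

definition shift_invariant_set :: "complex ^ 'n \<Rightarrow> 'n spt set \<Rightarrow> bool" where
  "shift_invariant_set \<omega> U \<longleftrightarrow> (\<forall>z. z \<in> U \<longleftrightarrow> shift_state \<omega> z \<in> U)"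

definition shift_invariant_on :: "complex ^ 'n \<Rightarrow> 'n spt set \<Rightarrow> ('n spt \<Rightarrow> 'b) \<Rightarrow> bool" where
  "shift_invariant_on \<omega> U g \<longleftrightarrow> (\<forall>z\<in>U. g (shift_state \<omega> z) = g z)"

definition bogoyavlenskij_system ::
    "complex ^ 'n::finite \<Rightarrow> (complex \<Rightarrow> complex ^ 'n \<Rightarrow> complex ^ 'n) \<Rightarrow> nat \<Rightarrow> 'n spt set \<Rightarrow>
     (nat \<Rightarrow> 'n spt \<Rightarrow> complex ^ 'n) \<Rightarrow> (nat \<Rightarrow> 'n spt \<Rightarrow> complex) \<Rightarrow> bool" where
  "bogoyavlenskij_system \<omega> f q U X F \<longleftrightarrow>
     (\<forall>z\<in>U. X 1 z = f (snd z) (fst z)) \<and>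
     (\<forall>j\<in>{1..q}. vf_meromorphic_on (X j) U \<and> shift_invariant_on \<omega> U (X j)) \<and>
     (\<forall>k\<in>{1..CARD('n) - q}. mv_meromorphic_on (F k) U \<and> shift_invariant_on \<omega> U (F k)) \<and>
     (AE z\<in>U in lborel. lin_indep_family {1..q} (\<lambda>j. X j z)) \<and>
     (\<forall>j\<in>{1..q}. \<forall>k\<in>{1..q}. \<forall>z\<in>U. vf_regular_at (X j) z \<and> vf_regular_at (X k) z \<longrightarrow>
        state_bracket (X j) (X k) z = 0) \<and>
     (AE z\<in>U in lborel. lin_indep_family {1..CARD('n) - q} (\<lambda>k. state_grad (F k) z)) \<and>
     (\<forall>j\<in>{1..q}. \<forall>k\<in>{1..CARD('n) - q}. \<forall>z\<in>U. vf_regular_at (X j) z \<and> mv_regular_at (F k) z \<longrightarrow>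
        state_deriv (F k) z (X j z) = 0)"

text \<open>Integrability, near the set \<open>S\<close> of states, of the family \<open>f \<epsilon>\<close> on \<open>\<complex>\<^sup>N / \<int>\<omega>\<close>, with vector fields
  and first integrals meromorphic in \<open>(y, \<epsilon>)\<close> near \<open>\<epsilon> = 0\<close>.\<close>

definition meromorphically_integrable_near ::
    "complex ^ 'n::finite \<Rightarrow> (complex \<Rightarrow> complex ^ 'n \<Rightarrow> complex ^ 'n) \<Rightarrow> (complex ^ 'n) set \<Rightarrow> bool" where
  "meromorphically_integrable_near \<omega> f S \<longleftrightarrow>
     (\<exists>q\<in>{1..CARD('n)}. \<exists>U X F. open U \<and> shift_invariant_set \<omega> U \<and> S \<times> {0} \<subseteq> U \<and>
        bogoyavlenskij_system \<omega> f q U X F)"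


section \<open>The forced Duffing oscillator\<close>

text \<open>States are \<open>(x\<^sub>1, x\<^sub>2, \<phi>)\<close>; \<open>\<phi>\<close> is \<open>2\<pi>\<close>-periodic.\<close>

definition phase_period :: "complex ^ 3" where
  "phase_period = axis 3 (2 * of_real pi)"

definition duffing_field ::
    "real \<Rightarrow> real \<Rightarrow> real \<Rightarrow> complex \<Rightarrow> complex ^ 3 \<Rightarrow> complex ^ 3" where
  "duffing_field \<beta> \<delta> \<nu> \<epsilon> y =
     vector [y $ 2,
             - ((y $ 1) ^ 3) + \<epsilon> * (of_real \<beta> * cos (y $ 3) - of_real \<delta> * y $ 2),
             of_real \<nu>]"

abbreviation duffing_modulus :: real where
  "duffing_modulus \<equiv> 1 / sqrt 2"

definition duffing_x1 :: "real \<Rightarrow> complex \<Rightarrow> complex" where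
  "duffing_x1 \<alpha> t = of_real \<alpha> * jacobi_cn duffing_modulus (of_real \<alpha> * t)"

definition duffing_x2 :: "real \<Rightarrow> complex \<Rightarrow> complex" where
  "duffing_x2 \<alpha> t = - (of_real \<alpha>)\<^sup>2 * jacobi_sn duffing_modulus (of_real \<alpha> * t)
                       * jacobi_dn duffing_modulus (of_real \<alpha> * t)"

definition duffing_period :: "real \<Rightarrow> real" where
  "duffing_period \<alpha> = 4 * elliptic_K duffing_modulus / \<alpha>"

text \<open>Preimage in \<open>\<complex>\<close> of a domain (connected open set) in \<open>\<complex> / p\<int>\<close>.  The quotient is identified with
  \<open>\<complex> - {0}\<close> via \<open>\<tau> \<mapsto> exp (2\<pi>i\<tau>/p)\<close>, so connectedness is that of the image under this map.\<close>

definition domain_mod :: "real \<Rightarrow> complex set \<Rightarrow> bool" where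
  "domain_mod p G \<longleftrightarrow> open G \<and> (\<forall>\<tau>. \<tau> \<in> G \<longleftrightarrow> \<tau> + of_real p \<in> G) \<and>
     connected ((\<lambda>\<tau>. exp (2 * of_real pi * \<i> * \<tau> / of_real p)) ` G)"

definition duffing_orbit :: "real \<Rightarrow> real \<Rightarrow> real \<Rightarrow> complex set \<Rightarrow> (complex ^ 3) set" where
  "duffing_orbit \<alpha> \<nu> \<theta> G =
     {vector [duffing_x1 \<alpha> \<tau>, duffing_x2 \<alpha> \<tau>, of_real \<nu> * \<tau> + of_real \<theta>] |\<tau>.
        \<tau> \<in> G \<and> \<not> is_pole (duffing_x1 \<alpha>) \<tau> \<and> \<not> is_pole (duffing_x2 \<alpha>) \<tau>}"

end

theory Submission
  imports Defs
begin

text \<open>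
  In the coordinates \<open>x\<close> (amplitude), \<open>y\<close> (phase at the pole \<open>\<i> K\<close> of \<open>cn\<close>) and \<open>u\<close> (scaled time) the unperturbed
  field is \<open>x \<partial>\<^sub>u\<close>.  Divide a first integral by a power of \<open>\<epsilon>\<close> so that its leading coefficient \<open>A\<close> is not
  zero; order \<open>0\<close> of the equation says that \<open>A\<close> depends on \<open>x\<close> and \<open>y\<close> only.  Order \<open>1\<close>, integrated over a
  small circle around the pole, gives \<open>sin y \<partial>\<^sub>x A = 0\<close>, because the perturbation has a nonzero residue there.
  Continuation along the real period gives \<open>A(x, y) = A(x, y + \<kappa>(x))\<close>, where \<open>\<kappa>\<close> is not constant and vanishes
  at the resonant amplitude.  Hence \<open>A\<close> is constant.  Subtracting from the integral its value at a point (a function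
  of \<open>\<epsilon>\<close>) makes this constant zero, a contradiction unless the integral depends on \<open>\<epsilon>\<close> only.
  If \<open>q = 3\<close> there is no first integral; the same argument applies to the two components of a commuting field transverse
  to the flow, whose leading coefficients \<open>p\<close>, \<open>q\<close> satisfy
  \<open>sin y \<partial>\<^sub>x p = - 3 sin y p / x + cos y q\<close>, \<open>sin y \<partial>\<^sub>x q = 0\<close> and a unipotent twist, hence vanish.
\<close>

section \<open>Jacobi elliptic functions\<close>

text \<open>Integrals and fields are given only near the orbit, which omits the poles of cn; nothing
  is known at \<open>\<i> K\<close>, so residues are read off on an annulus around it. The
  first-order coefficient in \<epsilon> is never constructed: for \<epsilon> \<noteq> 0 the
  u-derivative of a single-valued function integrates to zero over a circle, and the rest of the
  equation, divided by \<epsilon>, has a limit. A second obstacle: zero sets of denominators may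
  meet any prescribed circle or base point. They are avoided one variable at a time: one-variable
  holomorphic functions have countably many zeros, so a generic x, then a generic y, leave countably
  many bad times, which neither disconnect the time domain nor meet every circle. Generic identities
  extend by continuity. The phase at the pole is the right coordinate because the forcing multiplies
  cos \<phi> by cn', whose double pole turns the cosine into its derivative; damping has no residue,
  since (cn')^2 has a single-valued primitive. The modulus 1/sqrt 2 is its own complementary
  modulus, so \<open>cn (\<i> z) = 1 / cn z\<close> makes the pole at \<open>\<i> K\<close> the
  image of the zero at K.\<close>

lemma gronwall_zero:
  fixes f f' :: "real \<Rightarrow> 'a::real_inner"
  assumes d: "\<And>t. t \<in> {0..T} \<Longrightarrow> (f has_vector_derivative f' t) (at t within {0..T})"
    and b: "\<And>t. t \<in> {0..T} \<Longrightarrow> norm (f' t) \<le> M * norm (f t)"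
    and "f 0 = 0" and t: "t \<in> {0..T}"
  shows "f t = 0"
proof -
  \<comment> \<open>The weight turns the bound
    \<open>(f \<bullet> f)' \<le> 2 * M * (f \<bullet> f)\<close> into monotonicity:
    \<open>g\<close> is nonincreasing, nonnegative and starts at 0.\<close>
  define g where "g = (\<lambda>t. exp (- 2 * M * t) * (f t \<bullet> f t))"
  define g' where "g' = (\<lambda>t. exp (- 2 * M * t) * (2 * (f t \<bullet> f' t) - 2 * M * (f t \<bullet> f t)))"
  have dg: "(g has_vector_derivative g' t) (at t within {0..T})" if "t \<in> {0..T}" for t
  proof -
    have "((\<lambda>x. f x \<bullet> f x) has_real_derivative 2 * (f t \<bullet> f' t)) (at t within {0..T})"
      using bounded_bilinear.has_vector_derivative[OF bounded_bilinear_inner d[OF that] d[OF that]]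
      by (simp add: has_real_derivative_iff_has_vector_derivative inner_commute)
    then show ?thesis
      unfolding g_def g'_def has_real_derivative_iff_has_vector_derivative[symmetric]
      by (auto intro!: derivative_eq_intros simp: algebra_simps)
  qed
  have neg: "g' s \<le> 0" if "s \<in> {0..T}" for s
  proof -
    have "f s \<bullet> f' s \<le> norm (f s) * norm (f' s)" by (rule norm_cauchy_schwarz)
    also have "\<dots> \<le> norm (f s) * (M * norm (f s))"
      using b[OF that] by (intro mult_left_mono) auto
    also have "\<dots> = M * (f s \<bullet> f s)" by (simp add: dot_square_norm power2_eq_square)
    finally show ?thesis unfolding g'_def by (simp add: mult_nonneg_nonpos)
  qed
  have "g t \<le> g 0"
  proof (rule DERIV_nonpos_imp_decreasing_open[of 0 t g])
    show "0 \<le> t" using t by auto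
    show "\<exists>y. (g has_real_derivative y) (at x) \<and> y \<le> 0" if "0 < x" "x < t" for x
    proof -
      have x: "x \<in> {0..T}" and "x \<in> interior {0..T}" using that t by auto
      then have "(g has_vector_derivative g' x) (at x)"
        using dg[OF x] at_within_interior by metis
      with neg[OF x] show ?thesis
        by (auto simp: has_real_derivative_iff_has_vector_derivative)
    qed
    have "continuous_on {0..T} g"
      using dg has_vector_derivative_continuous continuous_on_eq_continuous_within by metis
    then show "continuous_on {0..t} g" by (rule continuous_on_subset) (use t in auto)
  qed
  then have "f t \<bullet> f t \<le> 0" using \<open>f 0 = 0\<close> by (simp add: g_def mult_le_0_iff)
  then show ?thesis by (metis inner_ge_zero inner_eq_zero_iff order_antisym)
qed

text \<open>The system solved by (sn, cn, dn) at the argument \<open>\<mu> * t\<close>, with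
  parameter \<open>m = k^2\<close>. A complex speed \<open>\<mu>\<close> covers real rays, imaginary
  rays and the doubling of the argument.\<close>

definition jacobi_ode ::
    "complex \<Rightarrow> complex \<Rightarrow> real \<Rightarrow> (real \<Rightarrow> complex) \<Rightarrow> (real \<Rightarrow> complex) \<Rightarrow> (real \<Rightarrow> complex) \<Rightarrow> bool" where
  "jacobi_ode m \<mu> T s c d \<longleftrightarrow> (\<forall>t\<in>{0..T}.
     (s has_vector_derivative \<mu> * (c t * d t)) (at t within {0..T}) \<and>
     (c has_vector_derivative - \<mu> * (s t * d t)) (at t within {0..T}) \<and>
     (d has_vector_derivative - \<mu> * m * (s t * c t)) (at t within {0..T}))"

text \<open>The right-hand side is quadratic, hence Lipschitz as long as both solutions stay
  bounded, which compactness of the interval provides; Gronwall does the rest. The duplication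
  formulas on the real line and the imaginary transformation are both obtained from this.\<close>

lemma jacobi_ode_unique:
  assumes 1: "jacobi_ode m \<mu> T s c d" and 2: "jacobi_ode m \<mu> T s' c' d'"
    and init: "s 0 = s' 0" "c 0 = c' 0" "d 0 = d' 0" and t: "t \<in> {0..T}"
  shows "s t = s' t" "c t = c' t" "d t = d' t"
proof -
  have cont: "continuous_on {0..T} f"
    if "\<And>t. t \<in> {0..T} \<Longrightarrow> \<exists>f'. (f has_vector_derivative f') (at t within {0..T})" for f :: "real \<Rightarrow> complex"
    using that has_vector_derivative_continuous continuous_on_eq_continuous_within by metis
  have bd: "\<exists>B. \<forall>t\<in>{0..T}. norm (f t) \<le> B"
    if "\<And>t. t \<in> {0..T} \<Longrightarrow> \<exists>f'. (f has_vector_derivative f') (at t within {0..T})" for f :: "real \<Rightarrow> complex"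
    using compact_imp_bounded[OF compact_continuous_image[OF cont[OF that] compact_Icc]]
    by (auto simp: bounded_iff)
  obtain B1 B2 B3 B4 B5 B6 where B: "\<And>t. t \<in> {0..T} \<Longrightarrow> norm (s t) \<le> B1 \<and> norm (c t) \<le> B2 \<and> norm (d t) \<le> B3
      \<and> norm (s' t) \<le> B4 \<and> norm (c' t) \<le> B5 \<and> norm (d' t) \<le> B6"
    using bd[of s] bd[of c] bd[of d] bd[of s'] bd[of c'] bd[of d'] 1 2 unfolding jacobi_ode_def by metis
  define B where "B = \<bar>B1\<bar> + \<bar>B2\<bar> + \<bar>B3\<bar> + \<bar>B4\<bar> + \<bar>B5\<bar> + \<bar>B6\<bar>"
  have Bb: "norm (s t) \<le> B \<and> norm (c t) \<le> B \<and> norm (d t) \<le> B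
      \<and> norm (s' t) \<le> B \<and> norm (c' t) \<le> B \<and> norm (d' t) \<le> B" if "t \<in> {0..T}" for t
    using B[OF that] unfolding B_def by linarith
  have B0: "0 \<le> B" unfolding B_def by auto
  define \<Delta> where "\<Delta> = (\<lambda>t. (s t - s' t, c t - c' t, d t - d' t))"
  define \<Delta>' where "\<Delta>' = (\<lambda>t. (\<mu> * (c t * d t) - \<mu> * (c' t * d' t),
      - \<mu> * (s t * d t) - - \<mu> * (s' t * d' t), - \<mu> * m * (s t * c t) - - \<mu> * m * (s' t * c' t)))"
  have prod: "norm (a * b - a' * b') \<le> 2 * B * N"
    if "norm b \<le> B" "norm a' \<le> B" "norm (a - a') \<le> N" "norm (b - b') \<le> N" for a b a' b' :: complex and N
  proof -
    have "a * b - a' * b' = (a - a') * b + a' * (b - b')" by (simp add: algebra_simps)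
    then have "norm (a * b - a' * b') \<le> norm (a - a') * norm b + norm a' * norm (b - b')"
      by (metis norm_mult norm_triangle_ineq)
    also have "\<dots> \<le> N * B + B * N"
      using that B0 norm_ge_zero[of "a - a'"] by (intro add_mono mult_mono) (auto intro: order_trans[OF norm_ge_zero])
    finally show ?thesis by simp
  qed
  have "\<Delta> t = 0"
  proof (rule gronwall_zero[of T \<Delta> \<Delta>' "(norm \<mu> * 2 * B) * (2 + norm m)"])
    show "(\<Delta> has_vector_derivative \<Delta>' t) (at t within {0..T})" if "t \<in> {0..T}" for t
      unfolding \<Delta>_def \<Delta>'_def using 1 2 that unfolding jacobi_ode_def
      by (intro has_vector_derivative_Pair has_vector_derivative_diff) auto
    show "norm (\<Delta>' t) \<le> (norm \<mu> * 2 * B) * (2 + norm m) * norm (\<Delta> t)" if "t \<in> {0..T}" for t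
    proof -
      define N where "N = norm (\<Delta> t)"
      have N1: "norm (s t - s' t) \<le> N" unfolding N_def \<Delta>_def by (metis norm_fst_le fst_conv)
      have N23: "norm (c t - c' t, d t - d' t) \<le> N" unfolding N_def \<Delta>_def by (metis norm_snd_le snd_conv)
      have N2: "norm (c t - c' t) \<le> N" using N23 by (metis norm_fst_le fst_conv order_trans)
      have N3: "norm (d t - d' t) \<le> N" using N23 by (metis norm_snd_le snd_conv order_trans)
      have p1: "norm (c t * d t - c' t * d' t) \<le> 2 * B * N"
        and p2: "norm (s t * d t - s' t * d' t) \<le> 2 * B * N"
        and p3: "norm (s t * c t - s' t * c' t) \<le> 2 * B * N"
        using N1 N2 N3 Bb[OF that] by (auto intro!: prod)
      have q1: "norm (\<mu> * (c t * d t) - \<mu> * (c' t * d' t)) \<le> norm \<mu> * (2 * B * N)"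
        using p1 by (simp add: norm_mult right_diff_distrib[symmetric] mult_left_mono)
      have q2: "norm (- \<mu> * (s t * d t) - - \<mu> * (s' t * d' t)) \<le> norm \<mu> * (2 * B * N)"
      proof -
        have "- \<mu> * (s t * d t) - - \<mu> * (s' t * d' t) = - (\<mu> * (s t * d t - s' t * d' t))"
          by (simp add: algebra_simps)
        then show ?thesis using p2 by (simp add: norm_mult mult_left_mono)
      qed
      have q3: "norm (- \<mu> * m * (s t * c t) - - \<mu> * m * (s' t * c' t)) \<le> norm \<mu> * norm m * (2 * B * N)"
      proof -
        have "- \<mu> * m * (s t * c t) - - \<mu> * m * (s' t * c' t) = - (\<mu> * m * (s t * c t - s' t * c' t))"
          by (simp add: algebra_simps)
        then show ?thesis using p3 by (simp add: norm_mult mult_left_mono)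
      qed
      have "norm (\<Delta>' t) \<le> norm \<mu> * (2 * B * N) + (norm \<mu> * (2 * B * N) + norm \<mu> * norm m * (2 * B * N))"
        unfolding \<Delta>'_def
        by (rule order_trans[OF norm_Pair_le add_mono[OF q1 order_trans[OF norm_Pair_le add_mono[OF q2 q3]]]])
      then show ?thesis unfolding N_def by (simp add: algebra_simps)
    qed
    show "\<Delta> 0 = 0" using init by (simp add: \<Delta>_def zero_prod_def)
  qed (rule t)
  then show "s t = s' t" "c t = c' t" "d t = d' t" by (auto simp: \<Delta>_def zero_prod_def)
qed

section \<open>Duplication of the argument\<close>

definition jacobi_invariants :: "complex \<Rightarrow> complex \<Rightarrow> complex \<Rightarrow> complex \<Rightarrow> bool" where
  "jacobi_invariants m s c d \<longleftrightarrow> s\<^sup>2 + c\<^sup>2 = 1 \<and> d\<^sup>2 + m * s\<^sup>2 = 1"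

text \<open>Jacobi's formulas for sn, cn and dn at twice the argument, in terms of the values s, c,
  d at the argument.\<close>

definition dup_s :: "complex \<Rightarrow> complex \<Rightarrow> complex \<Rightarrow> complex \<Rightarrow> complex" where
  "dup_s m s c d = 2 * s * c * d / (1 - m * s ^ 4)"
definition dup_c :: "complex \<Rightarrow> complex \<Rightarrow> complex \<Rightarrow> complex \<Rightarrow> complex" where
  "dup_c m s c d = (c\<^sup>2 - s\<^sup>2 * d\<^sup>2) / (1 - m * s ^ 4)"
definition dup_d :: "complex \<Rightarrow> complex \<Rightarrow> complex \<Rightarrow> complex \<Rightarrow> complex" where
  "dup_d m s c d = (d\<^sup>2 - m * s\<^sup>2 * c\<^sup>2) / (1 - m * s ^ 4)"

lemma has_vector_derivative_divide:
  fixes f g :: "real \<Rightarrow> complex"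
  assumes "(f has_vector_derivative f') (at t within S)" "(g has_vector_derivative g') (at t within S)" "g t \<noteq> 0"
  shows "((\<lambda>t. f t / g t) has_vector_derivative (f' * g t - f t * g') / (g t)\<^sup>2) (at t within S)"
proof -
  have i: "((\<lambda>t. inverse (g t)) has_vector_derivative g' * (- (inverse (g t) ^ Suc (Suc 0)))) (at t within S)"
    using field_vector_diff_chain_within[OF assms(2), of inverse "- (inverse (g t) ^ Suc (Suc 0))"]
      DERIV_inverse[OF assms(3)] by (simp add: o_def)
  show ?thesis
    unfolding divide_inverse
    by (rule has_vector_derivative_eq_rhs[OF has_vector_derivative_mult[OF assms(1) i]])
       (use assms(3) in \<open>simp add: power2_eq_square field_simps\<close>)
qed

lemma has_vector_derivative_power2:
  fixes f :: "real \<Rightarrow> complex"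
  assumes "(f has_vector_derivative f') (at t within S)"
  shows "((\<lambda>t. (f t)\<^sup>2) has_vector_derivative 2 * f t * f') (at t within S)"
  using has_vector_derivative_mult[OF assms assms] by (simp add: power2_eq_square algebra_simps)

text \<open>Differentiating the quotients leaves polynomial identities that hold modulo the two
  invariants. Together with uniqueness this justifies doubling the radius of a continuation.\<close>

lemma jacobi_ode_dup:
  assumes ode: "jacobi_ode m \<mu> T s c d"
    and inv: "\<And>t. t \<in> {0..T} \<Longrightarrow> jacobi_invariants m (s t) (c t) (d t)"
    and nz: "\<And>t. t \<in> {0..T} \<Longrightarrow> m * s t ^ 4 \<noteq> 1"
  shows "jacobi_ode m (2 * \<mu>) T (\<lambda>t. dup_s m (s t) (c t) (d t)) (\<lambda>t. dup_c m (s t) (c t) (d t))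
           (\<lambda>t. dup_d m (s t) (c t) (d t))"
  unfolding jacobi_ode_def
proof
  fix t assume t: "t \<in> {0..T}"
  note ds = ode[unfolded jacobi_ode_def, rule_format, OF t, THEN conjunct1]
    and dc = ode[unfolded jacobi_ode_def, rule_format, OF t, THEN conjunct2, THEN conjunct1]
    and dd = ode[unfolded jacobi_ode_def, rule_format, OF t, THEN conjunct2, THEN conjunct2]
  define S where "S = s t" define C where "C = c t" define D where "D = d t"
  have C2: "C\<^sup>2 = 1 - S\<^sup>2" and D2: "D\<^sup>2 = 1 - m * S\<^sup>2"
    using inv[OF t] by (auto simp: jacobi_invariants_def S_def C_def D_def algebra_simps)
  define n where "n = 1 - m * S ^ 4"
  have n: "n \<noteq> 0" using nz[OF t] by (auto simp: S_def n_def)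
  have d4: "((\<lambda>t. 1 - m * s t ^ 4) has_vector_derivative - 4 * \<mu> * m * S ^ 3 * C * D) (at t within {0..T})"
  proof -
    have "((\<lambda>t. (s t)\<^sup>2 ^ 2) has_vector_derivative 2 * (s t)\<^sup>2 * (2 * s t * (\<mu> * (c t * d t)))) (at t within {0..T})"
      by (intro has_vector_derivative_power2 ds)
    then have "((\<lambda>t. s t ^ 4) has_vector_derivative 4 * \<mu> * S ^ 3 * C * D) (at t within {0..T})"
      by (simp add: S_def C_def D_def power2_eq_square power3_eq_cube power4_eq_xxxx algebra_simps)
    then have "((\<lambda>t. 1 - m * s t ^ 4) has_vector_derivative 0 - m * (4 * \<mu> * S ^ 3 * C * D)) (at t within {0..T})"
      by (intro has_vector_derivative_diff has_vector_derivative_const has_vector_derivative_mult_right)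
    then show ?thesis by (simp add: algebra_simps)
  qed
  have ns: "((\<lambda>t. 2 * s t * c t * d t) has_vector_derivative
      2 * \<mu> * (C\<^sup>2 * D\<^sup>2 - S\<^sup>2 * D\<^sup>2 - m * S\<^sup>2 * C\<^sup>2)) (at t within {0..T})"
    by (rule has_vector_derivative_eq_rhs[OF has_vector_derivative_mult[OF
          has_vector_derivative_mult[OF has_vector_derivative_mult_right[OF ds, of 2] dc] dd]])
       (simp add: S_def C_def D_def power2_eq_square algebra_simps)
  have nc: "((\<lambda>t. (c t)\<^sup>2 - (s t)\<^sup>2 * (d t)\<^sup>2) has_vector_derivative
      \<mu> * S * C * D * (- 2 - 2 * D\<^sup>2 + 2 * m * S\<^sup>2)) (at t within {0..T})"
    by (rule has_vector_derivative_eq_rhs[OF has_vector_derivative_diff[OF has_vector_derivative_power2[OF dc]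
         has_vector_derivative_mult[OF has_vector_derivative_power2[OF ds] has_vector_derivative_power2[OF dd]]]])
       (simp add: S_def C_def D_def power2_eq_square algebra_simps)
  have nd: "((\<lambda>t. (d t)\<^sup>2 - m * (s t)\<^sup>2 * (c t)\<^sup>2) has_vector_derivative
      \<mu> * m * S * C * D * (- 2 - 2 * C\<^sup>2 + 2 * S\<^sup>2)) (at t within {0..T})"
    by (rule has_vector_derivative_eq_rhs[OF has_vector_derivative_diff[OF has_vector_derivative_power2[OF dd]
         has_vector_derivative_mult[OF has_vector_derivative_mult_right[OF has_vector_derivative_power2[OF ds], of m]
           has_vector_derivative_power2[OF dc]]]])
       (simp add: S_def C_def D_def power2_eq_square algebra_simps)
  \<comment> \<open>All three derivatives have the shape X / n^2, so it suffices to factor the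
    numerators X.\<close>
  have quot: "X / n\<^sup>2 = k * ((a / n) * (b / n))" if "X = k * (a * b)" for X k a b
    using that by (simp add: power2_eq_square)
  have e1: "((2 * \<mu> * (C\<^sup>2 * D\<^sup>2 - S\<^sup>2 * D\<^sup>2 - m * S\<^sup>2 * C\<^sup>2)) * n - 2 * S * C * D * (- 4 * \<mu> * m * S ^ 3 * C * D)) / n\<^sup>2
      = 2 * \<mu> * (((C\<^sup>2 - S\<^sup>2 * D\<^sup>2) / n) * ((D\<^sup>2 - m * S\<^sup>2 * C\<^sup>2) / n))"
  proof -
    have "(2 * \<mu> * (C\<^sup>2 * D\<^sup>2 - S\<^sup>2 * D\<^sup>2 - m * S\<^sup>2 * C\<^sup>2)) * n - 2 * S * C * D * (- 4 * \<mu> * m * S ^ 3 * C * D)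
       = 2 * \<mu> * ((C\<^sup>2 * D\<^sup>2 - S\<^sup>2 * D\<^sup>2 - m * S\<^sup>2 * C\<^sup>2) * n + 4 * m * S^4 * C\<^sup>2 * D\<^sup>2)"
      by (simp add: algebra_simps power2_eq_square power3_eq_cube power4_eq_xxxx)
    also have "\<dots> = 2 * \<mu> * ((C\<^sup>2 - S\<^sup>2 * D\<^sup>2) * (D\<^sup>2 - m * S\<^sup>2 * C\<^sup>2))"
      unfolding C2 D2 n_def by (simp add: algebra_simps power2_eq_square power3_eq_cube power4_eq_xxxx)
    finally show ?thesis by (rule quot)
  qed
  have e2: "((\<mu> * S * C * D * (- 2 - 2 * D\<^sup>2 + 2 * m * S\<^sup>2)) * n - (C\<^sup>2 - S\<^sup>2 * D\<^sup>2) * (- 4 * \<mu> * m * S ^ 3 * C * D)) / n\<^sup>2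
      = - (2 * \<mu>) * ((2 * S * C * D / n) * ((D\<^sup>2 - m * S\<^sup>2 * C\<^sup>2) / n))"
  proof -
    have "(\<mu> * S * C * D * (- 2 - 2 * D\<^sup>2 + 2 * m * S\<^sup>2)) * n - (C\<^sup>2 - S\<^sup>2 * D\<^sup>2) * (- 4 * \<mu> * m * S ^ 3 * C * D)
       = \<mu> * S * C * D * ((- 2 - 2 * D\<^sup>2 + 2 * m * S\<^sup>2) * n + 4 * m * S\<^sup>2 * (C\<^sup>2 - S\<^sup>2 * D\<^sup>2))"
      by (simp add: algebra_simps power2_eq_square power3_eq_cube power4_eq_xxxx)
    also have "(- 2 - 2 * D\<^sup>2 + 2 * m * S\<^sup>2) * n + 4 * m * S\<^sup>2 * (C\<^sup>2 - S\<^sup>2 * D\<^sup>2) = - 4 * (D\<^sup>2 - m * S\<^sup>2 * C\<^sup>2)"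
      unfolding C2 D2 n_def by (simp add: algebra_simps power2_eq_square power3_eq_cube power4_eq_xxxx)
    also have "\<mu> * S * C * D * (- 4 * (D\<^sup>2 - m * S\<^sup>2 * C\<^sup>2)) = - (2 * \<mu>) * ((2 * S * C * D) * (D\<^sup>2 - m * S\<^sup>2 * C\<^sup>2))"
      by (simp add: algebra_simps)
    finally show ?thesis by (rule quot)
  qed
  have e3: "((\<mu> * m * S * C * D * (- 2 - 2 * C\<^sup>2 + 2 * S\<^sup>2)) * n - (D\<^sup>2 - m * S\<^sup>2 * C\<^sup>2) * (- 4 * \<mu> * m * S ^ 3 * C * D)) / n\<^sup>2
      = - (2 * \<mu>) * m * ((2 * S * C * D / n) * ((C\<^sup>2 - S\<^sup>2 * D\<^sup>2) / n))"
  proof -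
    have "(\<mu> * m * S * C * D * (- 2 - 2 * C\<^sup>2 + 2 * S\<^sup>2)) * n - (D\<^sup>2 - m * S\<^sup>2 * C\<^sup>2) * (- 4 * \<mu> * m * S ^ 3 * C * D)
       = \<mu> * m * S * C * D * ((- 2 - 2 * C\<^sup>2 + 2 * S\<^sup>2) * n + 4 * S\<^sup>2 * (D\<^sup>2 - m * S\<^sup>2 * C\<^sup>2))"
      by (simp add: algebra_simps power2_eq_square power3_eq_cube power4_eq_xxxx)
    also have "(- 2 - 2 * C\<^sup>2 + 2 * S\<^sup>2) * n + 4 * S\<^sup>2 * (D\<^sup>2 - m * S\<^sup>2 * C\<^sup>2) = - 4 * (C\<^sup>2 - S\<^sup>2 * D\<^sup>2)"
      unfolding C2 D2 n_def by (simp add: algebra_simps power2_eq_square power3_eq_cube power4_eq_xxxx)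
    also have "\<mu> * m * S * C * D * (- 4 * (C\<^sup>2 - S\<^sup>2 * D\<^sup>2)) = - (2 * \<mu>) * m * ((2 * S * C * D) * (C\<^sup>2 - S\<^sup>2 * D\<^sup>2))"
      by (simp add: algebra_simps)
    finally show ?thesis by (rule quot)
  qed
  have nt: "1 - m * s t ^ 4 \<noteq> 0" using n by (simp add: n_def S_def)
  show "((\<lambda>t. dup_s m (s t) (c t) (d t)) has_vector_derivative
          2 * \<mu> * (dup_c m (s t) (c t) (d t) * dup_d m (s t) (c t) (d t))) (at t within {0..T}) \<and>
         ((\<lambda>t. dup_c m (s t) (c t) (d t)) has_vector_derivative
          - (2 * \<mu>) * (dup_s m (s t) (c t) (d t) * dup_d m (s t) (c t) (d t))) (at t within {0..T}) \<and>
         ((\<lambda>t. dup_d m (s t) (c t) (d t)) has_vector_derivative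
          - (2 * \<mu>) * m * (dup_s m (s t) (c t) (d t) * dup_c m (s t) (c t) (d t))) (at t within {0..T})"
    unfolding dup_s_def dup_c_def dup_d_def
    using has_vector_derivative_divide[OF ns d4 nt] has_vector_derivative_divide[OF nc d4 nt]
      has_vector_derivative_divide[OF nd d4 nt]
    unfolding S_def[symmetric] C_def[symmetric] D_def[symmetric] n_def[symmetric] e1 e2 e3
    by blast
qed

section \<open>The elliptic integral, the amplitude and dn on the real line\<close>

lemma modulus_pos:
  fixes k y :: real
  assumes "\<bar>k\<bar> < 1" "\<bar>y\<bar> \<le> 1"
  shows "0 < 1 - k\<^sup>2 * y\<^sup>2" "1 - k\<^sup>2 * y\<^sup>2 \<le> 1"
proof -
  have "k\<^sup>2 < 1" using assms(1) by (simp add: abs_square_less_1)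
  moreover have "y\<^sup>2 \<le> 1" using assms(2) by (simp add: abs_square_le_1)
  ultimately have "k\<^sup>2 * y\<^sup>2 < 1"
    using mult_mono[of "k\<^sup>2" "k\<^sup>2" "y\<^sup>2" 1] by simp
  then show "0 < 1 - k\<^sup>2 * y\<^sup>2" "1 - k\<^sup>2 * y\<^sup>2 \<le> 1" by auto
qed

context
  fixes k :: real
  assumes k: "\<bar>k\<bar> < 1"
begin

lemma elliptic_F_derivative:
  "(elliptic_F k has_real_derivative 1 / sqrt (1 - k\<^sup>2 * (sin x)\<^sup>2)) (at x)"
proof -
  define f where "f = (\<lambda>t. 1 / sqrt (1 - k\<^sup>2 * (sin t)\<^sup>2))"
  \<comment> \<open>A symmetric interval has both 0 and x in its interior, so both signs of x are
    treated alike.\<close>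
  have "((\<lambda>u. LBINT y=0..u. f y) has_vector_derivative f x) (at x within {-(\<bar>x\<bar> + 1)..\<bar>x\<bar> + 1})"
    unfolding zero_ereal_def
  proof (rule interval_integral_FTC2)
    show "continuous_on {- (\<bar>x\<bar> + 1)..\<bar>x\<bar> + 1} f"
      unfolding f_def using modulus_pos(1)[OF k abs_sin_le_one]
      by (intro continuous_intros) (auto simp: less_le)
  qed auto
  moreover have "at x within {-(\<bar>x\<bar> + 1)..\<bar>x\<bar> + 1} = at x"
    by (rule at_within_interior) auto
  ultimately show ?thesis
    by (simp add: f_def elliptic_F_def[abs_def] has_real_derivative_iff_has_vector_derivative)
qed

lemma elliptic_F_0: "elliptic_F k 0 = 0"
  by (simp add: elliptic_F_def zero_ereal_def)

text \<open>The integrand is at least 1. Growth at least that of the identity yields injectivity and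
  surjectivity of \<open>elliptic_F\<close> and positivity of K.\<close>

lemma elliptic_F_diff_ge:
  assumes "x \<le> y" shows "y - x \<le> elliptic_F k y - elliptic_F k x"
proof -
  have "elliptic_F k x - x \<le> elliptic_F k y - y"
  proof (rule DERIV_nonneg_imp_nondecreasing[OF assms])
    fix z
    have "1 / sqrt (1 - k\<^sup>2 * (sin z)\<^sup>2) - 1 \<ge> 0"
      using modulus_pos[OF k abs_sin_le_one, of z] by simp
    moreover have "((\<lambda>x. elliptic_F k x - x) has_real_derivative 1 / sqrt (1 - k\<^sup>2 * (sin z)\<^sup>2) - 1) (at z)"
      by (intro derivative_intros elliptic_F_derivative)
    ultimately show "\<exists>y. ((\<lambda>x. elliptic_F k x - x) has_real_derivative y) (at z) \<and> 0 \<le> y"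
      by blast
  qed
  then show ?thesis by simp
qed

lemma continuous_elliptic_F: "continuous_on A (elliptic_F k)"
  using elliptic_F_derivative DERIV_isCont continuous_at_imp_continuous_on by blast

lemma bij_elliptic_F: "bij (elliptic_F k)"
proof (rule bijI)
  show "inj (elliptic_F k)"
  proof (rule injI)
    fix x y assume eq: "elliptic_F k x = elliptic_F k y"
    have "x \<le> y \<Longrightarrow> y - x \<le> 0" "y \<le> x \<Longrightarrow> x - y \<le> 0"
      using elliptic_F_diff_ge[of x y] elliptic_F_diff_ge[of y x] unfolding eq by simp_all
    then show "x = y" by linarith
  qed
  show "surj (elliptic_F k)"
    unfolding surj_def
  proof
    fix u :: real
    have "\<exists>x\<ge>-\<bar>u\<bar>. x \<le> \<bar>u\<bar> \<and> elliptic_F k x = u"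
    proof (rule IVT')
      show "elliptic_F k (- \<bar>u\<bar>) \<le> u" "u \<le> elliptic_F k \<bar>u\<bar>"
        using elliptic_F_diff_ge[of "-\<bar>u\<bar>" 0] elliptic_F_diff_ge[of 0 "\<bar>u\<bar>"] elliptic_F_0 by linarith+
    qed (auto intro: continuous_elliptic_F)
    then show "\<exists>x. u = elliptic_F k x" by blast
  qed
qed

lemma elliptic_F_am: "elliptic_F k (jacobi_am k u) = u"
  unfolding jacobi_am_def by (simp add: bij_elliptic_F bij_is_surj surj_f_inv_f)

lemma am_elliptic_F: "jacobi_am k (elliptic_F k x) = x"
  unfolding jacobi_am_def by (simp add: bij_elliptic_F bij_is_inj)

lemma am_0: "jacobi_am k 0 = 0"
  using am_elliptic_F[of 0] by (simp add: elliptic_F_0)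

lemma am_K: "jacobi_am k (elliptic_K k) = pi / 2"
  unfolding elliptic_K_def by (rule am_elliptic_F)

lemma elliptic_K_pos: "elliptic_K k > 0"
proof -
  have "0 < pi / 2" by simp
  also have "\<dots> \<le> elliptic_F k (pi / 2)"
    using elliptic_F_diff_ge[of 0 "pi/2"] by (simp add: elliptic_F_0)
  finally show ?thesis by (simp add: elliptic_K_def)
qed

text \<open>The integrand has period pi, so the increment over a period does not depend on x; at x =
  - pi/2 oddness of \<open>elliptic_F\<close> turns it into 2 K.\<close>

lemma elliptic_F_add_pi: "elliptic_F k (x + pi) = elliptic_F k x + 2 * elliptic_K k"
proof -
  have "((\<lambda>x. elliptic_F k (x + pi) - elliptic_F k x) has_real_derivative 0) (at x)" for x
    using DERIV_diff[OF DERIV_shift[THEN iffD1, OF elliptic_F_derivative[of "x + pi"]] elliptic_F_derivative[of x]]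
    by (simp add: sin_add)
  then have c: "elliptic_F k (x + pi) - elliptic_F k x = elliptic_F k (y + pi) - elliptic_F k y" for x y
    using DERIV_isconst_all[of "\<lambda>x. elliptic_F k (x + pi) - elliptic_F k x" x y] by blast
  have "((\<lambda>x. elliptic_F k (- x) + elliptic_F k x) has_real_derivative 0) (at x)" for x
    using DERIV_add[OF DERIV_mirror[THEN iffD1, OF elliptic_F_derivative[of "-x"]] elliptic_F_derivative[of x]]
    by simp
  then have "elliptic_F k (- x) + elliptic_F k x = 0" for x
    using DERIV_isconst_all[of "\<lambda>x. elliptic_F k (-x) + elliptic_F k x" x 0] by (simp add: elliptic_F_0)
  from this[of "pi/2"] c[of x "-pi/2"] show ?thesis by (simp add: elliptic_K_def)
qed

lemma am_add_2K: "jacobi_am k (u + 2 * elliptic_K k) = jacobi_am k u + pi"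
  using elliptic_F_add_pi[of "jacobi_am k u"] am_elliptic_F[of "jacobi_am k u + pi"]
  by (simp add: elliptic_F_am)

definition real_dn :: "real \<Rightarrow> real" where
  "real_dn u = sqrt (1 - k\<^sup>2 * (sin (jacobi_am k u))\<^sup>2)"

lemma real_dn_pos: "real_dn u > 0"
  using modulus_pos(1)[OF k abs_sin_le_one] by (simp add: real_dn_def)

lemma am_derivative: "(jacobi_am k has_real_derivative real_dn u) (at u)"
proof -
  have "(jacobi_am k has_real_derivative inverse (1 / sqrt (1 - k\<^sup>2 * (sin (jacobi_am k u))\<^sup>2))) (at u)"
  proof (rule DERIV_inverse_function[where f = "elliptic_F k" and a = "u - 1" and b = "u + 1"])
    show "isCont (jacobi_am k) u"
    proof (rule isCont_inverse_function[where f = "elliptic_F k" and x = "jacobi_am k u" and d = 1, unfolded elliptic_F_am])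
    qed (auto simp: am_elliptic_F intro: DERIV_isCont elliptic_F_derivative)
    show "1 / sqrt (1 - k\<^sup>2 * (sin (jacobi_am k u))\<^sup>2) \<noteq> 0"
      using modulus_pos(1)[OF k abs_sin_le_one, of "jacobi_am k u"] by simp
  qed (auto simp: elliptic_F_am intro: elliptic_F_derivative)
  then show ?thesis by (simp add: real_dn_def)
qed

lemma real_dn_derivative:
  "(real_dn has_real_derivative - k\<^sup>2 * sin (jacobi_am k u) * cos (jacobi_am k u)) (at u)"
proof -
  have p: "0 < 1 - k\<^sup>2 * (sin (jacobi_am k u))\<^sup>2" by (rule modulus_pos(1)[OF k abs_sin_le_one])
  have "((\<lambda>u. sqrt (1 - k\<^sup>2 * (sin (jacobi_am k u))\<^sup>2)) has_real_derivative
      - k\<^sup>2 * sin (jacobi_am k u) * cos (jacobi_am k u)) (at u)"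
    using p real_dn_pos[of u]
    by (auto intro!: derivative_eq_intros am_derivative simp: real_dn_def field_simps)
  then show ?thesis by (simp add: real_dn_def[abs_def])
qed

text \<open>The three functions on a ray with slope \<open>x\<close>, so that both signs of the argument are covered.\<close>

lemma jacobi_ode_real:
  "jacobi_ode (of_real (k\<^sup>2)) (of_real x) T (\<lambda>t. of_real (sin (jacobi_am k (t * x))))
     (\<lambda>t. of_real (cos (jacobi_am k (t * x)))) (\<lambda>t. of_real (real_dn (t * x)))"
proof -
  have of: "((\<lambda>t. complex_of_real (f t)) has_vector_derivative of_real f') (at t within {0..T})"
    if "(f has_real_derivative f') (at t)" for f f' t
    using that by (metis has_vector_derivative_of_real has_field_derivative_at_within
       has_real_derivative_iff_has_vector_derivative)
  have a: "((\<lambda>t. jacobi_am k (t * x)) has_real_derivative real_dn (t * x) * x) (at t)" for t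
    by (rule DERIV_chain2[OF am_derivative]) (auto intro!: derivative_eq_intros)
  have s: "((\<lambda>t. sin (jacobi_am k (t * x))) has_real_derivative x * (cos (jacobi_am k (t * x)) * real_dn (t * x))) (at t)" for t
    by (auto intro!: derivative_eq_intros a)
  have c: "((\<lambda>t. cos (jacobi_am k (t * x))) has_real_derivative - x * (sin (jacobi_am k (t * x)) * real_dn (t * x))) (at t)" for t
    by (auto intro!: derivative_eq_intros a)
  have d: "((\<lambda>t. real_dn (t * x)) has_real_derivative - x * k\<^sup>2 * (sin (jacobi_am k (t * x)) * cos (jacobi_am k (t * x)))) (at t)" for t
    by (rule DERIV_cong[OF DERIV_chain2[OF real_dn_derivative]]) (auto intro!: derivative_eq_intros)
  show ?thesis
    unfolding jacobi_ode_def using of[OF s] of[OF c] of[OF d] by simp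
qed

lemma jacobi_invariants_real:
  "jacobi_invariants (of_real (k\<^sup>2)) (of_real (sin (jacobi_am k u))) (of_real (cos (jacobi_am k u))) (of_real (real_dn u))"
proof -
  have "(real_dn u)\<^sup>2 + k\<^sup>2 * (sin (jacobi_am k u))\<^sup>2 = 1"
    using modulus_pos(1)[OF k abs_sin_le_one, of "jacobi_am k u"] by (simp add: real_dn_def)
  moreover have "(sin (jacobi_am k u))\<^sup>2 + (cos (jacobi_am k u))\<^sup>2 = 1" by simp
  ultimately show ?thesis
    unfolding jacobi_invariants_def by (metis of_real_add of_real_mult of_real_power of_real_1)
qed

text \<open>The denominator of the duplication formulas has no real zero, so doubling stays analytic
  along the real line.\<close>

lemma sin_am_denominator: "complex_of_real (k\<^sup>2) * of_real (sin (jacobi_am k u)) ^ 4 \<noteq> 1"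
proof -
  have "k\<^sup>2 * ((sin (jacobi_am k u))\<^sup>2)\<^sup>2 < 1"
    using modulus_pos(1)[OF k, of "(sin (jacobi_am k u))\<^sup>2"] by (simp add: abs_square_le_1)
  then have "k\<^sup>2 * sin (jacobi_am k u) ^ 4 \<noteq> 1" by simp
  then show ?thesis by (metis of_real_eq_1_iff of_real_mult of_real_power)
qed

text \<open>Both sides solve the system with speed x on the unit interval and agree at t = 0; the
  claim is their equality at t = 1. The speed x/2 of the ray through the half argument is doubled by
  \<open>jacobi_ode_dup\<close>.\<close>

lemma dup_real:
  fixes x :: real
  defines "s \<equiv> complex_of_real (sin (jacobi_am k (x/2)))" and "c \<equiv> complex_of_real (cos (jacobi_am k (x/2)))"
    and "d \<equiv> complex_of_real (real_dn (x/2))" and "m \<equiv> complex_of_real (k\<^sup>2)"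
  shows "dup_s m s c d = of_real (sin (jacobi_am k x))" "dup_c m s c d = of_real (cos (jacobi_am k x))"
    "dup_d m s c d = of_real (real_dn x)"
proof -
  have "jacobi_ode m (2 * of_real (x/2)) 1 (\<lambda>t. dup_s m (of_real (sin (jacobi_am k (t*(x/2))))) (of_real (cos (jacobi_am k (t*(x/2))))) (of_real (real_dn (t*(x/2)))))
    (\<lambda>t. dup_c m (of_real (sin (jacobi_am k (t*(x/2))))) (of_real (cos (jacobi_am k (t*(x/2))))) (of_real (real_dn (t*(x/2)))))
    (\<lambda>t. dup_d m (of_real (sin (jacobi_am k (t*(x/2))))) (of_real (cos (jacobi_am k (t*(x/2))))) (of_real (real_dn (t*(x/2)))))"
    unfolding m_def by (intro jacobi_ode_dup jacobi_ode_real jacobi_invariants_real sin_am_denominator)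
  then have o: "jacobi_ode m (of_real x) 1 (\<lambda>t. dup_s m (of_real (sin (jacobi_am k (t*(x/2))))) (of_real (cos (jacobi_am k (t*(x/2))))) (of_real (real_dn (t*(x/2)))))
    (\<lambda>t. dup_c m (of_real (sin (jacobi_am k (t*(x/2))))) (of_real (cos (jacobi_am k (t*(x/2))))) (of_real (real_dn (t*(x/2)))))
    (\<lambda>t. dup_d m (of_real (sin (jacobi_am k (t*(x/2))))) (of_real (cos (jacobi_am k (t*(x/2))))) (of_real (real_dn (t*(x/2)))))"
    by simp
  note u = jacobi_ode_unique[OF o jacobi_ode_real[of x 1, folded m_def]]
  have "real_dn 0 = 1" by (simp add: real_dn_def am_0)
  then show "dup_s m s c d = of_real (sin (jacobi_am k x))" "dup_c m s c d = of_real (cos (jacobi_am k x))"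
    "dup_d m s c d = of_real (real_dn x)"
    using u[of 1] by (simp_all add: s_def c_def d_def am_0 dup_s_def dup_c_def dup_d_def)
qed

end

section \<open>Meromorphic continuation\<close>

lemma frequently_zero_real:
  assumes "\<And>t::real. \<bar>t\<bar> < r \<Longrightarrow> f (of_real t) = (0::complex)" "r > 0"
  shows "frequently (\<lambda>z. f z = 0) (at (0::complex))"
proof -
  \<comment> \<open>The offset 2 keeps every term nonzero and strictly inside radius
    \<open>r\<close>, also for n = 0.\<close>
  have lim: "filterlim (\<lambda>n. complex_of_real (r / real (n + 2))) (at 0) sequentially"
  proof (rule filterlim_atI)
    have "(\<lambda>n. r / real (n + 2)) \<longlonglongrightarrow> 0" by real_asymp
    then show "(\<lambda>n. complex_of_real (r / real (n + 2))) \<longlonglongrightarrow> 0"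
      using tendsto_of_real[of _ 0 sequentially, where 'a = complex] by fastforce
    show "\<forall>\<^sub>F n in sequentially. complex_of_real (r / real (n + 2)) \<noteq> 0"
      using assms(2) by (intro always_eventually allI) (simp only: of_real_eq_0_iff, simp)
  qed
  have z: "f (complex_of_real (r / real (n + 2))) = 0" for n
    using assms by (intro assms(1)) (auto simp: divide_less_eq)
  show ?thesis
    unfolding frequently_def
  proof
    assume "\<forall>\<^sub>F z in at 0. f z \<noteq> 0"
    from eventually_compose_filterlim[OF this lim] show False by (simp only: z) simp
  qed
qed

lemma meromorphic_zero:
  assumes "f meromorphic_on A" "open A" "connected A" "z0 \<in> A" "frequently (\<lambda>z. f z = 0) (at z0)"
  shows "\<forall>\<^sub>\<approx>z\<in>A. f z = 0"
proof -
  have "\<not> (\<forall>\<^sub>\<approx>z\<in>A. f z \<noteq> 0)"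
    using assms(4,5) eventually_cosparse_imp_eventually_at unfolding frequently_def by blast
  then show ?thesis using meromorphic_imp_constant_or_avoid[OF assms(1-3), of 0] by blast
qed

lemma meromorphic_zero_analytic:
  assumes "f meromorphic_on A" "open A" "connected A" "z0 \<in> A" "frequently (\<lambda>z. f z = 0) (at z0)"
    and "z \<in> A" "f analytic_on {z}"
  shows "f z = 0"
proof -
  have "\<forall>\<^sub>F w in at z. f w = 0"
    using meromorphic_zero[OF assms(1-5)] assms(6) eventually_cosparse_imp_eventually_at by blast
  moreover have "isCont f z" using assms(7) analytic_at_imp_isCont by blast
  ultimately show ?thesis
    using tendsto_eventually[of f 0 "at z"] LIM_unique unfolding isCont_def by blast
qed

text \<open>The identity theorem gives equality near z but not at z. A nicely meromorphic function
  is recovered from its punctured germ, the value 0 at poles included, so equality holds at every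
  point.\<close>

lemma nicely_meromorphic_eq:
  assumes "f nicely_meromorphic_on A" "g nicely_meromorphic_on A" "open A" "connected A"
    and "z0 \<in> A" "frequently (\<lambda>z. f z = g z) (at z0)" "z \<in> A"
  shows "f z = g z"
proof -
  have m: "(\<lambda>z. f z - g z) meromorphic_on A"
    using assms(1,2) unfolding nicely_meromorphic_on_def by (intro meromorphic_intros) auto
  have "\<forall>\<^sub>F w in at z. f w - g w = 0"
    using meromorphic_zero[OF m assms(3-5)] assms(6,7) eventually_cosparse_imp_eventually_at by auto
  then have ev: "\<forall>\<^sub>F w in at z. f w = g w" by simp
  have n: "h z = remove_sings h z" if "h nicely_meromorphic_on A" for h
  proof (cases "is_pole h z")
    case True
    then have "\<not> h \<midarrow>z\<rightarrow> h z"
      using is_pole_def not_tendsto_and_filterlim_at_infinity trivial_limit_at by blast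
    then have "h z = 0" using that assms(7) unfolding nicely_meromorphic_on_def by blast
    with True show ?thesis by simp
  next
    case False
    then show ?thesis using nicely_meromorphic_on_imp_analytic_at[OF that assms(7)] by simp
  qed
  show ?thesis
    using remove_sings_cong[OF ev] n[OF assms(1)] n[OF assms(2)] by simp
qed

text \<open>sn inverts the elliptic integral: a primitive \<open>E\<close> of
  \<open>1 / (csqrt (1 - z^2) * csqrt (1 - m * z^2))\<close> has nonzero derivative at 0, its local
  inverse is sn, and the two square roots evaluated on the inverse are cn and dn, with the branch
  fixed by the value 1 at 0.\<close>

lemma jacobi_local_solution:
  fixes m :: complex
  obtains r s c d where "r > 0" "s 0 = 0" "c 0 = 1" "d 0 = 1"
    "\<And>z. z \<in> ball 0 r \<Longrightarrow> (s has_field_derivative c z * d z) (at z)"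
    "\<And>z. z \<in> ball 0 r \<Longrightarrow> (c has_field_derivative - (s z * d z)) (at z)"
    "\<And>z. z \<in> ball 0 r \<Longrightarrow> (d has_field_derivative - m * (s z * c z)) (at z)"
proof -
  \<comment> \<open>Small enough for \<open>z^2\<close> and \<open>m * z^2\<close> to have modulus
    below 1, which keeps both radicands off the cut of \<open>csqrt\<close>.\<close>
  define \<rho> where "\<rho> = 1 / (2 * (1 + norm m))"
  have \<rho>: "\<rho> > 0" "\<rho> \<le> 1/2" "norm m * \<rho> < 1"
    unfolding \<rho>_def using norm_ge_zero[of m] by (auto simp: divide_simps simp del: norm_ge_zero)
  have small: "norm (z\<^sup>2) < 1 \<and> norm (m * z\<^sup>2) < 1" if "z \<in> ball 0 \<rho>" for z
  proof -
    have "norm z < \<rho>" using that by simp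
    then have "norm (z\<^sup>2) \<le> \<rho> * 1"
      unfolding power2_eq_square norm_mult using \<rho> by (intro mult_mono) auto
    moreover from this have "norm m * norm (z\<^sup>2) \<le> norm m * \<rho>" by (intro mult_left_mono) auto
    ultimately show ?thesis using \<rho> by (auto simp: norm_mult)
  qed
  have nr: "1 - w \<notin> \<real>\<^sub>\<le>\<^sub>0" if "norm w < 1" for w :: complex
    using that abs_Re_le_cmod[of w] by (auto simp: complex_nonpos_Reals_iff)
  have nr1: "1 - z\<^sup>2 \<notin> \<real>\<^sub>\<le>\<^sub>0" "1 - m * z\<^sup>2 \<notin> \<real>\<^sub>\<le>\<^sub>0" if "z \<in> ball 0 \<rho>" for z
    using small[OF that] nr by auto
  then have nz: "csqrt (1 - z\<^sup>2) \<noteq> 0" "csqrt (1 - m * z\<^sup>2) \<noteq> 0" if "z \<in> ball 0 \<rho>" for z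
    using that by (metis csqrt_eq_0 nonpos_Reals_zero_I)+
  define f where "f = (\<lambda>z. 1 / (csqrt (1 - z\<^sup>2) * csqrt (1 - m * z\<^sup>2)))"
  have "f holomorphic_on ball 0 \<rho>"
    unfolding f_def using nr1 nz by (intro holomorphic_intros) auto
  then obtain E0 where E0: "\<And>z. z \<in> ball 0 \<rho> \<Longrightarrow> (E0 has_field_derivative f z) (at z)"
    using holomorphic_convex_primitive'[of "ball 0 \<rho>" f] by (metis at_within_open convex_ball open_ball)
  define E where "E = (\<lambda>z. E0 z - E0 0)"
  have E: "(E has_field_derivative f z) (at z)" if "z \<in> ball 0 \<rho>" for z
    unfolding E_def using E0[OF that] by (auto intro!: derivative_eq_intros)
  have E_hol: "E holomorphic_on ball 0 \<rho>"
    using E by (meson field_differentiable_at_within field_differentiable_def holomorphic_on_def)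
  have dE: "deriv E z = f z" if "z \<in> ball 0 \<rho>" for z using E[OF that] by (rule DERIV_imp_deriv)
  have fz: "f z \<noteq> 0" if "z \<in> ball 0 \<rho>" for z using nz[OF that] by (simp add: f_def)
  have z0: "0 \<in> ball 0 \<rho>" using \<rho> by simp
  have dE0: "deriv E 0 \<noteq> 0" using dE[OF z0] fz[OF z0] by simp
  obtain r1 where r1: "r1 > 0" "ball (0::complex) r1 \<subseteq> ball 0 \<rho>" "inj_on E (ball 0 r1)"
    by (rule has_complex_derivative_locally_injective[OF E_hol z0 open_ball dE0]) (rule that, assumption+)
  have Eh1: "E holomorphic_on ball 0 r1" using E_hol r1(2) holomorphic_on_subset by blast
  obtain g where g: "g holomorphic_on (E ` ball 0 r1)" "\<And>z. z \<in> ball 0 r1 \<Longrightarrow> deriv E z * deriv g (E z) = 1"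
     "\<And>z. z \<in> ball 0 r1 \<Longrightarrow> g (E z) = z"
    using holomorphic_has_inverse[OF Eh1 open_ball r1(3)] by blast
  have op: "open (E ` ball 0 r1)" by (rule open_mapping_thm3[OF Eh1 open_ball r1(3)])
  have "0 \<in> E ` ball 0 r1" using r1(1) by (force simp: E_def)
  then obtain r where r: "r > 0" "ball 0 r \<subseteq> E ` ball 0 r1" using op open_contains_ball by blast
  have gd: "(g has_field_derivative csqrt (1 - (g w)\<^sup>2) * csqrt (1 - m * (g w)\<^sup>2)) (at w) \<and> g w \<in> ball 0 \<rho>"
    if wr: "w \<in> ball 0 r" for w
  proof -
    obtain z where z: "z \<in> ball 0 r1" "w = E z" using wr r(2) by blast
    have zr: "z \<in> ball 0 \<rho>" using z r1 by auto
    have gw: "g w = z" using g(3)[OF z(1)] z(2) by simp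
    have "f z * deriv g w = 1" using g(2)[OF z(1)] dE[OF zr] z(2) by simp
    then have "deriv g w = csqrt (1 - z\<^sup>2) * csqrt (1 - m * z\<^sup>2)"
      using nz[OF zr] by (simp add: f_def field_simps)
    moreover have "(g has_field_derivative deriv g w) (at w)"
      by (rule holomorphic_derivI[OF g(1) op]) (use z in auto)
    ultimately show ?thesis using gw zr by simp
  qed
  have g0: "g 0 = 0" using g(3)[of 0] r1(1) by (simp add: E_def)
  show ?thesis
  proof (rule that[of r g "\<lambda>w. csqrt (1 - (g w)\<^sup>2)" "\<lambda>w. csqrt (1 - m * (g w)\<^sup>2)"])
    fix z :: complex assume z: "z \<in> ball 0 r"
    note gz = gd[OF z, THEN conjunct1] and gb = gd[OF z, THEN conjunct2]
    show "(g has_field_derivative csqrt (1 - (g z)\<^sup>2) * csqrt (1 - m * (g z)\<^sup>2)) (at z)" by (rule gz)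
    have a: "((\<lambda>w. 1 - (g w)\<^sup>2) has_field_derivative - 2 * g z * (csqrt (1 - (g z)\<^sup>2) * csqrt (1 - m * (g z)\<^sup>2))) (at z)"
      by (auto intro!: derivative_eq_intros gz)
    have b: "((\<lambda>w. 1 - m * (g w)\<^sup>2) has_field_derivative - 2 * m * g z * (csqrt (1 - (g z)\<^sup>2) * csqrt (1 - m * (g z)\<^sup>2))) (at z)"
      by (auto intro!: derivative_eq_intros gz)
    show "((\<lambda>w. csqrt (1 - (g w)\<^sup>2)) has_field_derivative - (g z * csqrt (1 - m * (g z)\<^sup>2))) (at z)"
      by (rule DERIV_cong[OF DERIV_chain2[OF has_field_derivative_csqrt[OF nr1(1)[OF gb]] a]])
         (use nz[OF gb] in \<open>simp add: field_simps\<close>)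
    show "((\<lambda>w. csqrt (1 - m * (g w)\<^sup>2)) has_field_derivative - m * (g z * csqrt (1 - (g z)\<^sup>2))) (at z)"
      by (rule DERIV_cong[OF DERIV_chain2[OF has_field_derivative_csqrt[OF nr1(2)[OF gb]] b]])
         (use nz[OF gb] in \<open>simp add: field_simps\<close>)
  qed (use r g0 in auto)
qed

text \<open>A stage of the meromorphic continuation, on a disc of finite radius. Analyticity at real
  points is recorded separately, because agreement of values on the real line alone would not
  exclude poles there.\<close>

definition real_continuation :: "(real \<Rightarrow> real) \<Rightarrow> real \<Rightarrow> (complex \<Rightarrow> complex) \<Rightarrow> bool" where
  "real_continuation f R g \<longleftrightarrow> g meromorphic_on ball 0 R \<and>
     (\<forall>x::real. \<bar>x\<bar> < R \<longrightarrow> g analytic_on {of_real x} \<and> g (of_real x) = of_real (f x))"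

text \<open>Stages on growing discs agree on the real line, hence, by the identity theorem, wherever
  both are defined once removable singularities are filled in; the global function is their
  union.\<close>

lemma real_continuation_global:
  assumes ext: "\<And>n::nat. \<exists>g. real_continuation f (2 ^ n * r) g" and r: "r > 0"
  obtains g where "g nicely_meromorphic_on UNIV" "\<And>x::real. g analytic_on {of_real x}"
    "\<And>x::real. g (of_real x) = of_real (f x)"
proof -
  define R where "R = (\<lambda>n::nat. 2 ^ n * r)"
  have Rpos: "R n > 0" for n using r by (simp add: R_def)
  obtain h where h: "\<And>n. real_continuation f (R n) (h n)" using ext unfolding R_def by metis
  define g where "g = (\<lambda>n. remove_sings (h n))"
  have gn: "g n nicely_meromorphic_on ball 0 (R n)" for n
    unfolding g_def using h[of n] by (intro remove_sings_nicely_meromorphic) (simp add: real_continuation_def)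
  have gx: "g n (of_real x) = of_real (f x)" "g n analytic_on {of_real x}" if "\<bar>x\<bar> < R n" for n x
    using h[of n] that unfolding real_continuation_def g_def
    by (auto intro: remove_sings_analytic_on)
  have RR: "\<exists>n. z \<in> ball 0 (R n)" for z :: complex
  proof -
    obtain n :: nat where "norm z / r < 2 ^ n" using real_arch_pow[of 2 "norm z / r"] by auto
    then show ?thesis using r by (auto simp: R_def divide_less_eq)
  qed
  have eq: "g m z = g n z" if "m \<le> n" "z \<in> ball 0 (R m)" for m n z
  proof -
    have sub: "ball 0 (R m) \<subseteq> ball (0::complex) (R n)"
      using that(1) r by (intro subset_ball) (simp add: R_def power_increasing)
    have "frequently (\<lambda>z. g m z - g n z = 0) (at (0::complex))"
      by (rule frequently_zero_real[OF _ Rpos[of m]])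
         (use sub gx in \<open>auto simp: R_def intro: less_le_trans\<close>,
           metis (no_types, lifting) \<open>m \<le> n\<close> gx(1) R_def less_le_trans mult_right_mono power_increasing
             one_le_numeral r less_imp_le right_minus_eq)
    then have "frequently (\<lambda>z. g m z = g n z) (at (0::complex))" by simp
    then show ?thesis
      using nicely_meromorphic_eq[OF gn nicely_meromorphic_on_subset[OF gn sub] open_ball connected_ball, of 0 z]
        that(2) Rpos[of m] by simp
  qed
  \<comment> \<open>The least stage is only a canonical choice: by \<open>eq\<close> every stage
    whose disc contains z gives the same value.\<close>
  define N where "N = (\<lambda>z. LEAST n. z \<in> ball (0::complex) (R n))"
  define G where "G = (\<lambda>z. g (N z) z)"
  have G: "G z = g n z" if "z \<in> ball 0 (R n)" for z n
  proof -
    have "N z \<le> n" "z \<in> ball 0 (R (N z))" unfolding N_def using that by (auto intro: Least_le LeastI)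
    then show ?thesis using eq unfolding G_def by blast
  qed
  have ev: "\<forall>\<^sub>F w in nhds z. G w = g n w" if "z \<in> ball 0 (R n)" for z n
    using G that eventually_nhds_in_open[OF open_ball that] by (auto elim: eventually_mono)
  show ?thesis
  proof
    show an: "G analytic_on {of_real x}" for x :: real
    proof -
      obtain n where n: "complex_of_real x \<in> ball 0 (R n)" using RR by blast
      then have "g n analytic_on {of_real x}" by (intro gx) simp
      then show ?thesis using analytic_at_cong[OF ev[OF n] refl] by simp
    qed
    show "G (of_real x) = of_real (f x)" for x :: real
    proof -
      obtain n where n: "complex_of_real x \<in> ball 0 (R n)" using RR by blast
      then show ?thesis using G[OF n] gx(1)[of x n] by simp
    qed
    show "G nicely_meromorphic_on UNIV"
      unfolding nicely_meromorphic_on_def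
    proof (intro conjI ballI)
      have loc: "G meromorphic_on {z} \<and> (is_pole G z \<and> G z = 0 \<or> G \<midarrow>z\<rightarrow> G z)" for z
      proof -
        obtain n where n: "z \<in> ball 0 (R n)" using RR by blast
        have ea: "\<forall>\<^sub>F w in at z. G w = g n w"
          using ev[OF n] eventually_nhds_conv_at by blast
        have gm: "g n meromorphic_on {z}" 
          using gn[of n] n meromorphic_on_subset unfolding nicely_meromorphic_on_def by blast
        have "G meromorphic_on {z}"
          using meromorphic_on_cong[of "{z}" G "g n"] ea gm by auto
        moreover have "is_pole (g n) z \<and> g n z = 0 \<or> g n \<midarrow>z\<rightarrow> g n z"
          using gn[of n] n unfolding nicely_meromorphic_on_def by blast
        ultimately show ?thesis
          using is_pole_cong[OF ea refl] G[OF n] tendsto_cong[OF ea, of "G z"] by simp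
      qed
      show "G meromorphic_on UNIV" using loc meromorphic_on_meromorphic_at by blast
      show "is_pole G z \<and> G z = 0 \<or> G \<midarrow>z\<rightarrow> G z" for z using loc by blast
    qed
  qed
qed

lemma meromorphic_continuation_props:
  assumes "\<And>n::nat. \<exists>g. real_continuation f (2 ^ n * r) g" and "r > 0"
  shows "meromorphic_continuation f nicely_meromorphic_on UNIV"
    "\<And>x::real. meromorphic_continuation f analytic_on {of_real x}"
    "\<And>x::real. meromorphic_continuation f (of_real x) = of_real (f x)"
proof -
  obtain g where g: "g nicely_meromorphic_on UNIV" "\<And>x::real. g analytic_on {of_real x}"
    "\<And>x::real. g (of_real x) = of_real (f x)"
    using real_continuation_global[OF assms] by blast
  have "meromorphic_continuation f = g"
    unfolding meromorphic_continuation_def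
  proof (rule the_equality)
    fix h assume h: "h nicely_meromorphic_on UNIV \<and> (\<forall>t::real. h (of_real t) = of_real (f t))"
    have "frequently (\<lambda>z. h z - g z = 0) (at (0::complex))"
      by (rule frequently_zero_real[of 1]) (use h g in auto)
    then show "h = g"
      using nicely_meromorphic_eq[of h UNIV g 0] h g by auto
  qed (use g in auto)
  with g show "meromorphic_continuation f nicely_meromorphic_on UNIV"
    "\<And>x::real. meromorphic_continuation f analytic_on {of_real x}"
    "\<And>x::real. meromorphic_continuation f (of_real x) = of_real (f x)" by auto
qed

text \<open>The local solution agrees with the real functions, since both solve the system on a ray
  through 0. The duplication formulas at z/2 then double the radius, and on the real line they
  return the real functions with nonvanishing denominator. The three functions are continued
  together because each doubling uses all of them.\<close>

lemma real_continuations_jacobi: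
  assumes k: "\<bar>k\<bar> < 1"
  shows "\<exists>r>0. \<forall>n::nat. \<exists>S C D.
    real_continuation (\<lambda>u. sin (jacobi_am k u)) (2 ^ n * r) S \<and>
    real_continuation (\<lambda>u. cos (jacobi_am k u)) (2 ^ n * r) C \<and>
    real_continuation (real_dn k) (2 ^ n * r) D"
proof -
  define m where "m = complex_of_real (k\<^sup>2)"
  obtain r s c d where l: "r > 0" "s 0 = 0" "c 0 = 1" "d 0 = 1"
    "\<And>z. z \<in> ball 0 r \<Longrightarrow> (s has_field_derivative c z * d z) (at z)"
    "\<And>z. z \<in> ball 0 r \<Longrightarrow> (c has_field_derivative - (s z * d z)) (at z)"
    "\<And>z. z \<in> ball 0 r \<Longrightarrow> (d has_field_derivative - m * (s z * c z)) (at z)"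
    using jacobi_local_solution[of m] by blast
  have an: "f analytic_on ball 0 r" if "\<And>z. z \<in> ball 0 r \<Longrightarrow> \<exists>f'. (f has_field_derivative f') (at z)" for f
    using that unfolding analytic_on_open[OF open_ball] holomorphic_on_open[OF open_ball] by blast
  have "\<exists>S C D.
    real_continuation (\<lambda>u. sin (jacobi_am k u)) (2 ^ n * r) S \<and>
    real_continuation (\<lambda>u. cos (jacobi_am k u)) (2 ^ n * r) C \<and>
    real_continuation (real_dn k) (2 ^ n * r) D" for n :: nat
  proof (induction n)
    case 0
    have "s (of_real x) = of_real (sin (jacobi_am k x)) \<and> c (of_real x) = of_real (cos (jacobi_am k x))
        \<and> d (of_real x) = of_real (real_dn k x)" if x: "\<bar>x\<bar> < r" for x
    proof -
      have tx: "complex_of_real (t * x) \<in> ball 0 r" if "t \<in> {0..1}" for t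
        using that x mult_left_le_one_le[of "\<bar>x\<bar>" t] by (auto simp: abs_mult norm_mult)
      have vd: "((\<lambda>t. f (of_real (t * x))) has_vector_derivative of_real x * f') (at t within {0..1})"
        if "(f has_field_derivative f') (at (of_real (t * x)))" for f :: "complex \<Rightarrow> complex" and f' and t
      proof -
        have "((\<lambda>t. complex_of_real (t * x)) has_vector_derivative of_real x) (at t within {0..1})"
          by (auto intro!: derivative_eq_intros)
        from field_vector_diff_chain_within[OF this has_field_derivative_at_within[OF that]]
        show ?thesis by (simp add: o_def)
      qed
      have o: "jacobi_ode m (of_real x) 1 (\<lambda>t. s (of_real (t * x))) (\<lambda>t. c (of_real (t * x))) (\<lambda>t. d (of_real (t * x)))"
        unfolding jacobi_ode_def
      proof
        fix t :: real assume t: "t \<in> {0..1}"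
        show "((\<lambda>t. s (of_real (t * x))) has_vector_derivative of_real x * (c (of_real (t * x)) * d (of_real (t * x)))) (at t within {0..1}) \<and>
         ((\<lambda>t. c (of_real (t * x))) has_vector_derivative - of_real x * (s (of_real (t * x)) * d (of_real (t * x)))) (at t within {0..1}) \<and>
         ((\<lambda>t. d (of_real (t * x))) has_vector_derivative - of_real x * m * (s (of_real (t * x)) * c (of_real (t * x)))) (at t within {0..1})"
          using vd[OF l(5)[OF tx[OF t]]] vd[OF l(6)[OF tx[OF t]]] vd[OF l(7)[OF tx[OF t]]] by (simp add: mult.assoc)
      qed
      note u = jacobi_ode_unique[OF o jacobi_ode_real[OF k, of x 1, folded m_def]]
      have "real_dn k 0 = 1" using k by (simp add: real_dn_def[OF k] am_0)
      then show ?thesis using u[of 1] l(2-4) k by (simp add: am_0)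
    qed
    moreover have "s analytic_on ball 0 r" "c analytic_on ball 0 r" "d analytic_on ball 0 r"
      using an l(5-7) by blast+
    ultimately have "real_continuation (\<lambda>u. sin (jacobi_am k u)) (2 ^ 0 * r) s \<and>
      real_continuation (\<lambda>u. cos (jacobi_am k u)) (2 ^ 0 * r) c \<and> real_continuation (real_dn k) (2 ^ 0 * r) d"
      unfolding real_continuation_def
      by (auto intro: analytic_on_imp_meromorphic_on elim: analytic_on_subset)
    then show ?case by blast
  next
    case (Suc n)
    then obtain S C D where SCD:
      "real_continuation (\<lambda>u. sin (jacobi_am k u)) (2 ^ n * r) S"
      "real_continuation (\<lambda>u. cos (jacobi_am k u)) (2 ^ n * r) C"
      "real_continuation (real_dn k) (2 ^ n * r) D" by blast
    define S' where "S' = (\<lambda>z. dup_s m (S (z/2)) (C (z/2)) (D (z/2)))"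
    define C' where "C' = (\<lambda>z. dup_c m (S (z/2)) (C (z/2)) (D (z/2)))"
    define D' where "D' = (\<lambda>z. dup_d m (S (z/2)) (C (z/2)) (D (z/2)))"
    have half: "(\<lambda>z. f (z/2)) meromorphic_on ball 0 (2 ^ Suc n * r)"
      if "f meromorphic_on ball 0 (2 ^ n * r)" for f
      using that by (rule meromorphic_on_compose) (auto intro!: analytic_intros simp: dist_norm norm_divide)
    have hm: "(\<lambda>z. S (z/2)) meromorphic_on ball 0 (2 ^ Suc n * r)" "(\<lambda>z. C (z/2)) meromorphic_on ball 0 (2 ^ Suc n * r)"
       "(\<lambda>z. D (z/2)) meromorphic_on ball 0 (2 ^ Suc n * r)"
      using SCD unfolding real_continuation_def by (blast intro: half)+
    have mer: "S' meromorphic_on ball 0 (2 ^ Suc n * r)" "C' meromorphic_on ball 0 (2 ^ Suc n * r)"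
       "D' meromorphic_on ball 0 (2 ^ Suc n * r)"
      unfolding S'_def C'_def D'_def dup_s_def dup_c_def dup_d_def
      by (intro meromorphic_intros hm)+
    have re: "S' analytic_on {of_real x} \<and> S' (of_real x) = of_real (sin (jacobi_am k x)) \<and>
       C' analytic_on {of_real x} \<and> C' (of_real x) = of_real (cos (jacobi_am k x)) \<and>
       D' analytic_on {of_real x} \<and> D' (of_real x) = of_real (real_dn k x)" if x: "\<bar>x\<bar> < 2 ^ Suc n * r" for x
    proof -
      have x2: "\<bar>x/2\<bar> < 2 ^ n * r" using x by simp
      have v: "S (of_real x / 2) = of_real (sin (jacobi_am k (x/2)))" "C (of_real x / 2) = of_real (cos (jacobi_am k (x/2)))"
         "D (of_real x / 2) = of_real (real_dn k (x/2))"
        using SCD x2 unfolding real_continuation_def by (metis of_real_divide of_real_numeral)+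
      have a: "(\<lambda>z. f (z/2)) analytic_on {of_real x}" if "f analytic_on {of_real (x/2)}" for f
      proof -
        have "(f \<circ> (\<lambda>z. z/2)) analytic_on {of_real x}"
          by (rule analytic_on_compose) (use that in \<open>auto intro!: analytic_intros\<close>)
        then show ?thesis by (simp add: o_def)
      qed
      have a3: "(\<lambda>z. S (z/2)) analytic_on {of_real x}" "(\<lambda>z. C (z/2)) analytic_on {of_real x}" "(\<lambda>z. D (z/2)) analytic_on {of_real x}"
        using SCD x2 unfolding real_continuation_def by (blast intro: a)+
      have n0: "1 - m * S (of_real x / 2) ^ 4 \<noteq> 0" unfolding v m_def using sin_am_denominator[OF k, of "x/2"] by simp
      show ?thesis
        unfolding S'_def C'_def D'_def v m_def dup_real[OF k]
        unfolding dup_s_def dup_c_def dup_d_def m_def[symmetric]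
        by (intro conjI analytic_intros a3 refl) (use n0 in auto)
    qed
    have "real_continuation (\<lambda>u. sin (jacobi_am k u)) (2 ^ Suc n * r) S'"
      "real_continuation (\<lambda>u. cos (jacobi_am k u)) (2 ^ Suc n * r) C'"
      "real_continuation (real_dn k) (2 ^ Suc n * r) D'"
      unfolding real_continuation_def using mer re by blast+
    then show ?case by blast
  qed
  with l(1) show ?thesis by blast
qed

lemma jacobi_functions_props:
  assumes k: "\<bar>k\<bar> < 1"
  shows "jacobi_sn k nicely_meromorphic_on UNIV" "jacobi_sn k analytic_on {of_real x}"
      "jacobi_sn k (of_real x) = of_real (sin (jacobi_am k x))"
    "jacobi_cn k nicely_meromorphic_on UNIV" "jacobi_cn k analytic_on {of_real x}"
      "jacobi_cn k (of_real x) = of_real (cos (jacobi_am k x))"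
    "jacobi_dn k nicely_meromorphic_on UNIV" "jacobi_dn k analytic_on {of_real x}"
      "jacobi_dn k (of_real x) = of_real (real_dn k x)"
proof -
  obtain r where r: "r > 0" "\<And>n::nat. \<exists>g. real_continuation (\<lambda>u. sin (jacobi_am k u)) (2 ^ n * r) g"
    "\<And>n::nat. \<exists>g. real_continuation (\<lambda>u. cos (jacobi_am k u)) (2 ^ n * r) g"
    "\<And>n::nat. \<exists>g. real_continuation (real_dn k) (2 ^ n * r) g"
    using real_continuations_jacobi[OF k] by metis
  note m = meromorphic_continuation_props[OF r(2) r(1)] meromorphic_continuation_props[OF r(3) r(1)]
     meromorphic_continuation_props[OF r(4) r(1)]
  have dn: "jacobi_dn k = meromorphic_continuation (real_dn k)"
    unfolding jacobi_dn_def real_dn_def[OF k, abs_def] by simp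
  show "jacobi_sn k nicely_meromorphic_on UNIV" "jacobi_sn k analytic_on {of_real x}"
      "jacobi_sn k (of_real x) = of_real (sin (jacobi_am k x))"
    "jacobi_cn k nicely_meromorphic_on UNIV" "jacobi_cn k analytic_on {of_real x}"
      "jacobi_cn k (of_real x) = of_real (cos (jacobi_am k x))"
    "jacobi_dn k nicely_meromorphic_on UNIV" "jacobi_dn k analytic_on {of_real x}"
      "jacobi_dn k (of_real x) = of_real (real_dn k x)"
    using m unfolding jacobi_sn_def jacobi_cn_def dn by blast+
qed

section \<open>Identities carried from the real line to the complex plane\<close>

context
  fixes k :: real
  assumes k: "\<bar>k\<bar> < 1"
begin

lemma jacobi_meromorphic:
  "jacobi_sn k meromorphic_on A" "jacobi_cn k meromorphic_on A" "jacobi_dn k meromorphic_on A"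
  using jacobi_functions_props(1,4,7)[OF k] meromorphic_on_subset unfolding nicely_meromorphic_on_def by blast+

lemma meromorphic_zero_real:
  assumes "f meromorphic_on UNIV" "\<And>x::real. f (of_real x) = 0"
  shows "\<forall>\<^sub>F w in at z. f w = (0::complex)" "f analytic_on {z} \<Longrightarrow> f z = 0"
proof -
  have fr: "frequently (\<lambda>z. f z = 0) (at (0::complex))"
    by (rule frequently_zero_real[of 1]) (use assms in auto)
  show "\<forall>\<^sub>F w in at z. f w = 0"
    using meromorphic_zero[OF assms(1) open_UNIV connected_UNIV UNIV_I fr] eventually_cosparse_imp_eventually_at by blast
  show "f analytic_on {z} \<Longrightarrow> f z = 0"
    using meromorphic_zero_analytic[OF assms(1) open_UNIV connected_UNIV UNIV_I fr] by blast
qed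

lemma jacobi_invariants_of_real:
  "(jacobi_sn k (of_real x))\<^sup>2 + (jacobi_cn k (of_real x))\<^sup>2 - 1 = 0"
  "(jacobi_dn k (of_real x))\<^sup>2 + of_real (k\<^sup>2) * (jacobi_sn k (of_real x))\<^sup>2 - 1 = 0"
  using jacobi_invariants_real[OF k, of x] unfolding jacobi_invariants_def jacobi_functions_props[OF k] by auto

lemma jacobi_invariants_near:
  "\<forall>\<^sub>F w in at z. (jacobi_sn k w)\<^sup>2 + (jacobi_cn k w)\<^sup>2 - 1 = 0"
  "\<forall>\<^sub>F w in at z. (jacobi_dn k w)\<^sup>2 + of_real (k\<^sup>2) * (jacobi_sn k w)\<^sup>2 - 1 = 0"
  by (rule meromorphic_zero_real(1), intro meromorphic_intros jacobi_meromorphic, rule jacobi_invariants_of_real)+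

lemma not_pole_power2:
  assumes ev: "\<forall>\<^sub>F w in at z. (f w)\<^sup>2 = g w" and "g analytic_on {z}"
  shows "\<not> is_pole f (z::complex)"
proof
  assume "is_pole f z"
  then have "is_pole (\<lambda>w. (f w)\<^sup>2) z" 
    unfolding is_pole_def filterlim_at_infinity_conv_norm_at_top
    by (simp add: power2_eq_square norm_mult filterlim_at_top_mult_at_top)
  then have "is_pole g z" using is_pole_cong[OF ev refl] by simp
  then show False using assms(2) analytic_at_imp_no_pole by blast
qed

text \<open>The quadratic relations make the squares of sn and dn analytic wherever cn is, so
  neither has a pole there. From here on the poles of cn are the only exceptional set.\<close>

lemma jacobi_analytic:
  assumes "\<not> is_pole (jacobi_cn k) z"
  shows "jacobi_cn k analytic_on {z}" "jacobi_sn k analytic_on {z}" "jacobi_dn k analytic_on {z}"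
proof -
  show c: "jacobi_cn k analytic_on {z}"
    by (rule nicely_meromorphic_on_imp_analytic_at[OF jacobi_functions_props(4)[OF k] UNIV_I assms])
  have "\<forall>\<^sub>F w in at z. (jacobi_sn k w)\<^sup>2 = 1 - (jacobi_cn k w)\<^sup>2"
    using jacobi_invariants_near(1) by eventually_elim (simp add: algebra_simps)
  then have "\<not> is_pole (jacobi_sn k) z"
    by (rule not_pole_power2) (intro analytic_intros c)
  then show s: "jacobi_sn k analytic_on {z}"
    by (rule nicely_meromorphic_on_imp_analytic_at[OF jacobi_functions_props(1)[OF k] UNIV_I])
  have "\<forall>\<^sub>F w in at z. (jacobi_dn k w)\<^sup>2 = 1 - of_real (k\<^sup>2) * (jacobi_sn k w)\<^sup>2"
    using jacobi_invariants_near(2) by eventually_elim (simp add: algebra_simps)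
  then have "\<not> is_pole (jacobi_dn k) z"
    by (rule not_pole_power2) (intro analytic_intros s)
  then show "jacobi_dn k analytic_on {z}"
    by (rule nicely_meromorphic_on_imp_analytic_at[OF jacobi_functions_props(7)[OF k] UNIV_I])
qed

lemma jacobi_cn_no_real_pole: "\<not> is_pole (jacobi_cn k) (of_real x)"
  using jacobi_functions_props(5)[OF k] analytic_at_imp_no_pole by blast

lemma jacobi_identities:
  assumes "\<not> is_pole (jacobi_cn k) z"
  shows "(jacobi_sn k z)\<^sup>2 + (jacobi_cn k z)\<^sup>2 = 1"
    "(jacobi_dn k z)\<^sup>2 + of_real (k\<^sup>2) * (jacobi_sn k z)\<^sup>2 = 1"
proof -
  have "(jacobi_sn k z)\<^sup>2 + (jacobi_cn k z)\<^sup>2 - 1 = 0"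
    by (rule meromorphic_zero_real(2)[where f = "\<lambda>z. (jacobi_sn k z)\<^sup>2 + (jacobi_cn k z)\<^sup>2 - 1", OF _ jacobi_invariants_of_real(1)])
       (intro meromorphic_intros jacobi_meromorphic, intro analytic_intros jacobi_analytic[OF assms])
  moreover have "(jacobi_dn k z)\<^sup>2 + of_real (k\<^sup>2) * (jacobi_sn k z)\<^sup>2 - 1 = 0"
    by (rule meromorphic_zero_real(2)[where f = "\<lambda>z. (jacobi_dn k z)\<^sup>2 + of_real (k\<^sup>2) * (jacobi_sn k z)\<^sup>2 - 1", OF _ jacobi_invariants_of_real(2)])
       (intro meromorphic_intros jacobi_meromorphic, intro analytic_intros jacobi_analytic[OF assms])
  ultimately show "(jacobi_sn k z)\<^sup>2 + (jacobi_cn k z)\<^sup>2 = 1"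
    "(jacobi_dn k z)\<^sup>2 + of_real (k\<^sup>2) * (jacobi_sn k z)\<^sup>2 = 1" by auto
qed

lemma complex_deriv_of_real:
  assumes "f analytic_on {complex_of_real x}" "\<And>x. f (of_real x) = of_real (g x)"
    "(g has_real_derivative g') (at x)"
  shows "deriv f (of_real x) = of_real g'"
proof -
  have "(f has_field_derivative deriv f (of_real x)) (at (of_real x))"
    using assms(1) analytic_on_imp_differentiable_at DERIV_deriv_iff_field_differentiable by blast
  then have "((\<lambda>x. f (of_real x)) has_vector_derivative deriv f (of_real x)) (at x)"
    by (rule has_vector_derivative_real_field)
  moreover have "((\<lambda>x. f (of_real x)) has_vector_derivative of_real g') (at x)"
    unfolding assms(2) using assms(3)
    by (intro has_vector_derivative_of_real) (simp add: has_real_derivative_iff_has_vector_derivative)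
  ultimately show ?thesis by (rule vector_derivative_unique_at)
qed

lemma jacobi_derivatives:
  assumes "\<not> is_pole (jacobi_cn k) z"
  shows "(jacobi_sn k has_field_derivative jacobi_cn k z * jacobi_dn k z) (at z)"
    "(jacobi_cn k has_field_derivative - jacobi_sn k z * jacobi_dn k z) (at z)"
    "(jacobi_dn k has_field_derivative - of_real (k\<^sup>2) * jacobi_sn k z * jacobi_cn k z) (at z)"
proof -
  note an = jacobi_analytic[OF assms]
  have d1: "deriv (jacobi_sn k) z - jacobi_cn k z * jacobi_dn k z = 0"
  proof (rule meromorphic_zero_real(2)[where f = "\<lambda>z. deriv (jacobi_sn k) z - jacobi_cn k z * jacobi_dn k z"])
    fix x
    have "deriv (jacobi_sn k) (of_real x) = of_real (cos (jacobi_am k x) * real_dn k x)"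
      by (rule complex_deriv_of_real[where g = "\<lambda>x. sin (jacobi_am k x)", OF _ jacobi_functions_props(3)[OF k]])
         (auto intro!: jacobi_functions_props(2)[OF k] derivative_eq_intros am_derivative[OF k])
    then show "deriv (jacobi_sn k) (of_real x) - jacobi_cn k (of_real x) * jacobi_dn k (of_real x) = 0"
      by (simp add: jacobi_functions_props[OF k])
  qed (intro meromorphic_intros jacobi_meromorphic analytic_intros an)+
  have d2: "deriv (jacobi_cn k) z + jacobi_sn k z * jacobi_dn k z = 0"
  proof (rule meromorphic_zero_real(2)[where f = "\<lambda>z. deriv (jacobi_cn k) z + jacobi_sn k z * jacobi_dn k z"])
    fix x
    have "deriv (jacobi_cn k) (of_real x) = of_real (- sin (jacobi_am k x) * real_dn k x)"
      by (rule complex_deriv_of_real[where g = "\<lambda>x. cos (jacobi_am k x)", OF _ jacobi_functions_props(6)[OF k]])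
         (auto intro!: jacobi_functions_props(5)[OF k] derivative_eq_intros am_derivative[OF k])
    then show "deriv (jacobi_cn k) (of_real x) + jacobi_sn k (of_real x) * jacobi_dn k (of_real x) = 0"
      by (simp add: jacobi_functions_props[OF k])
  qed (intro meromorphic_intros jacobi_meromorphic analytic_intros an)+
  have d3: "deriv (jacobi_dn k) z + of_real (k\<^sup>2) * jacobi_sn k z * jacobi_cn k z = 0"
  proof (rule meromorphic_zero_real(2)[where f = "\<lambda>z. deriv (jacobi_dn k) z + of_real (k\<^sup>2) * jacobi_sn k z * jacobi_cn k z"])
    fix x
    have "deriv (jacobi_dn k) (of_real x) = of_real (- k\<^sup>2 * sin (jacobi_am k x) * cos (jacobi_am k x))"
      by (rule complex_deriv_of_real[where g = "real_dn k", OF _ jacobi_functions_props(9)[OF k] real_dn_derivative[OF k]])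
         (auto intro!: jacobi_functions_props(8)[OF k])
    then show "deriv (jacobi_dn k) (of_real x) + of_real (k\<^sup>2) * jacobi_sn k (of_real x) * jacobi_cn k (of_real x) = 0"
      by (simp add: jacobi_functions_props[OF k])
  qed (intro meromorphic_intros jacobi_meromorphic analytic_intros an)+
  have d: "(f has_field_derivative deriv f z) (at z)" if "f analytic_on {z}" for f
    using that analytic_on_imp_differentiable_at DERIV_deriv_iff_field_differentiable by blast
  show "(jacobi_sn k has_field_derivative jacobi_cn k z * jacobi_dn k z) (at z)"
    using d[OF an(2)] d1 by simp
  show "(jacobi_cn k has_field_derivative - jacobi_sn k z * jacobi_dn k z) (at z)"
    by (rule DERIV_cong[OF d[OF an(1)]]) (use d2 in algebra)
  show "(jacobi_dn k has_field_derivative - of_real (k\<^sup>2) * jacobi_sn k z * jacobi_cn k z) (at z)"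
    by (rule DERIV_cong[OF d[OF an(3)]]) (use d3 in algebra)
qed

lemma nicely_meromorphic_shift:
  assumes "f nicely_meromorphic_on UNIV"
  shows "(\<lambda>z. f (z + a)) nicely_meromorphic_on (UNIV :: complex set)"
  unfolding nicely_meromorphic_on_def
proof (intro conjI ballI)
  show "(\<lambda>z. f (z + a)) meromorphic_on UNIV"
    using assms unfolding nicely_meromorphic_on_def
    by (elim conjE, rule_tac meromorphic_on_compose[where g = f]) (auto intro!: analytic_intros)
  fix z
  have "filtermap (\<lambda>w. w + a) (at z) = at (z + a)"
    using filtermap_at_shift[of "-a" z] by (simp add: add.commute)
  then have eq: "filterlim (\<lambda>w. f (w + a)) F (at z) = filterlim f F (at (z + a))" for F
    unfolding filterlim_def by (metis (no_types) filtermap_filtermap)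
  show "is_pole (\<lambda>z. f (z + a)) z \<and> f (z + a) = 0 \<or> (\<lambda>z. f (z + a)) \<midarrow>z\<rightarrow> f (z + a)"
    using assms unfolding nicely_meromorphic_on_def is_pole_def eq by blast
qed

lemma jacobi_periodic:
  "jacobi_sn k (z + 4 * of_real (elliptic_K k)) = jacobi_sn k z"
  "jacobi_cn k (z + 4 * of_real (elliptic_K k)) = jacobi_cn k z"
  "jacobi_dn k (z + 4 * of_real (elliptic_K k)) = jacobi_dn k z"
proof -
  have am: "jacobi_am k (x + 4 * elliptic_K k) = jacobi_am k x + 2 * pi" for x
    using am_add_2K[OF k, of x] am_add_2K[OF k, of "x + 2 * elliptic_K k"] by (simp add: algebra_simps)
  have *: "f (z + 4 * of_real (elliptic_K k)) = f z"
    if f: "f nicely_meromorphic_on UNIV" "\<And>x. f (of_real x) = of_real (g x)" "\<And>x. g (x + 4 * elliptic_K k) = g x" for f g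
  proof (rule nicely_meromorphic_eq[OF nicely_meromorphic_shift[OF f(1)] f(1)])
    show "\<exists>\<^sub>F z in at 0. f (z + 4 * complex_of_real (elliptic_K k)) = f z"
    proof -
      have "f (of_real t + 4 * complex_of_real (elliptic_K k)) - f (of_real t) = 0" for t
      proof -
        have "complex_of_real t + 4 * complex_of_real (elliptic_K k) = of_real (t + 4 * elliptic_K k)" by simp
        then show ?thesis by (simp only: f) simp
      qed
      then have "\<exists>\<^sub>F z in at 0. f (z + 4 * complex_of_real (elliptic_K k)) - f z = 0"
        by (intro frequently_zero_real[of 1]) auto
      then show ?thesis by simp
    qed
  qed auto
  show "jacobi_sn k (z + 4 * of_real (elliptic_K k)) = jacobi_sn k z"
    by (rule *[OF jacobi_functions_props(1,3)[OF k]]) (simp add: am)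
  show "jacobi_cn k (z + 4 * of_real (elliptic_K k)) = jacobi_cn k z"
    by (rule *[OF jacobi_functions_props(4,6)[OF k]]) (simp add: am)
  show "jacobi_dn k (z + 4 * of_real (elliptic_K k)) = jacobi_dn k z"
    by (rule *[OF jacobi_functions_props(7,9)[OF k]]) (simp add: am real_dn_def[OF k])
qed

text \<open>Countability matters because a connected open set of the plane stays path-connected when
  a countable set is removed; the path towards the pole is built this way.\<close>

lemma countable_poles: "countable {z. is_pole (jacobi_cn k) z}"
proof -
  have "{z. is_pole (jacobi_cn k) z} sparse_in UNIV"
    using meromorphic_on_imp_not_pole_cosparse[OF jacobi_meromorphic(2)] by (simp add: eventually_cosparse)
  then show ?thesis
    using sparse_imp_countable[of UNIV "{z. is_pole (jacobi_cn k) z}"] by simp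
qed

lemma closed_poles: "closed {z. is_pole (jacobi_cn k) z}"
proof -
  have "{z. jacobi_cn k analytic_on {z}} = \<Union>{s. open s \<and> jacobi_cn k holomorphic_on s}"
    unfolding analytic_at by blast
  then have "open {z. jacobi_cn k analytic_on {z}}" by auto
  moreover have "{z. jacobi_cn k analytic_on {z}} = - {z. is_pole (jacobi_cn k) z}"
    using jacobi_analytic(1) analytic_at_imp_no_pole by auto
  ultimately show ?thesis by (simp add: closed_def)
qed

end

section \<open>The lemniscatic modulus\<close>

lemma duffing_modulus: "\<bar>duffing_modulus\<bar> < 1" "duffing_modulus\<^sup>2 = 1 / 2"
proof -
  show "duffing_modulus\<^sup>2 = 1 / 2" by (simp add: power_divide)
  show "\<bar>duffing_modulus\<bar> < 1" by simp
qed

abbreviation qK :: real where "qK \<equiv> elliptic_K duffing_modulus"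

text \<open>With \<open>k^2 = 1/2\<close> the function cn satisfies \<open>x'' = - x^3\<close>, the
  unperturbed oscillator; \<open>lcn'\<close> is its derivative off \<open>lpoles\<close>.\<close>

definition lcn :: "complex \<Rightarrow> complex" where "lcn = jacobi_cn duffing_modulus"
definition lcn' :: "complex \<Rightarrow> complex" where "lcn' z = - jacobi_sn duffing_modulus z * jacobi_dn duffing_modulus z"
definition lpoles :: "complex set" where "lpoles = {z. is_pole lcn z}"

lemma qK_pos: "qK > 0"
  by (rule elliptic_K_pos[OF duffing_modulus(1)])

lemma lcn_derivative: "z \<notin> lpoles \<Longrightarrow> (lcn has_field_derivative lcn' z) (at z)"
  unfolding lcn_def lcn'_def lpoles_def using jacobi_derivatives(2)[OF duffing_modulus(1)] by simp

text \<open>Conservation of energy: for \<open>k^2 = 1/2\<close> the quadratic terms in cn cancel in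
  the product of \<open>1 - cn^2\<close> and \<open>1 - sn^2 / 2\<close>.\<close>

lemma lcn'_square: "z \<notin> lpoles \<Longrightarrow> (lcn' z)\<^sup>2 = (1 - lcn z ^ 4) / 2"
proof -
  assume "z \<notin> lpoles"
  then have "(jacobi_sn duffing_modulus z)\<^sup>2 = 1 - (lcn z)\<^sup>2"
    "(jacobi_dn duffing_modulus z)\<^sup>2 = 1 - (jacobi_sn duffing_modulus z)\<^sup>2 / 2"
    using jacobi_identities[OF duffing_modulus(1), of z] duffing_modulus(2)
    unfolding lcn_def lpoles_def by (auto simp: algebra_simps power_divide)
  moreover have "(lcn' z)\<^sup>2 = (jacobi_sn duffing_modulus z)\<^sup>2 * (jacobi_dn duffing_modulus z)\<^sup>2"
    by (simp add: lcn'_def power_mult_distrib)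
  ultimately have "(lcn' z)\<^sup>2 = (1 - (lcn z)\<^sup>2) * (1 - (1 - (lcn z)\<^sup>2) / 2)" by simp
  also have "\<dots> = (1 - lcn z ^ 4) / 2" by (simp add: field_simps power2_eq_square power4_eq_xxxx)
  finally show ?thesis .
qed

lemma lcn'_derivative: "z \<notin> lpoles \<Longrightarrow> (lcn' has_field_derivative - (lcn z ^ 3)) (at z)"
proof -
  assume z: "z \<notin> lpoles"
  define s c d where "s = jacobi_sn duffing_modulus z" and "c = lcn z" and "d = jacobi_dn duffing_modulus z"
  have i: "s\<^sup>2 = 1 - c\<^sup>2" "d\<^sup>2 = 1 - s\<^sup>2 / 2"
    using z jacobi_identities[OF duffing_modulus(1), of z] duffing_modulus(2)
    unfolding lcn_def lpoles_def s_def c_def d_def by (auto simp: algebra_simps power_divide)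
  have m: "(complex_of_real duffing_modulus)\<^sup>2 = 1/2"
    using duffing_modulus(2) by (metis of_real_1 of_real_divide of_real_numeral of_real_power)
  have "(lcn' has_field_derivative (- (c * d)) * d + (- s) * (- (1/2) * s * c)) (at z)"
    unfolding lcn'_def[abs_def]
    using z jacobi_derivatives[OF duffing_modulus(1), of z]
    unfolding lpoles_def lcn_def
    by (auto intro!: derivative_eq_intros simp: s_def c_def d_def lcn_def m of_real_power simp del: of_real_divide)
  moreover have "(- (c * d)) * d + (- s) * (- (1/2) * s * c) = - (c ^ 3)"
  proof -
    have "(- (c * d)) * d + (- s) * (- (1/2) * s * c) = c * (s\<^sup>2 / 2 - d\<^sup>2)"
      by (simp add: algebra_simps power2_eq_square)
    also have "\<dots> = - (c ^ 3)" unfolding i by (simp add: algebra_simps power2_eq_square power3_eq_cube)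
    finally show ?thesis .
  qed
  ultimately show ?thesis by (simp add: c_def)
qed

lemma of_real_notin_lpoles: "of_real x \<notin> lpoles"
  unfolding lpoles_def lcn_def using jacobi_cn_no_real_pole[OF duffing_modulus(1)] by simp

lemma lcn_periodic: "lcn (z + 4 * of_real qK) = lcn z" "lcn' (z + 4 * of_real qK) = lcn' z"
  unfolding lcn_def lcn'_def jacobi_periodic[OF duffing_modulus(1)] by simp_all

lemma countable_lpoles: "countable lpoles" and closed_lpoles: "closed lpoles"
  unfolding lpoles_def lcn_def
  using countable_poles[OF duffing_modulus(1)] closed_poles[OF duffing_modulus(1)] by auto

text \<open>Jacobi's imaginary transformation: \<open>\<i> sn / cn\<close>, \<open>1 / cn\<close>
  and \<open>dn / cn\<close> solve the system with speed \<open>\<i>\<close> and the complementary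
  parameter 1 - m, which here equals m = 1/2. Uniqueness identifies them with sn, cn and dn on the
  imaginary axis.\<close>

lemma lcn_imaginary_near_0:
  "\<exists>T>0. \<forall>t\<in>{0..T}. lcn (\<i> * of_real t) * lcn (of_real t) = 1"
proof -
  let ?k = duffing_modulus
  have k: "\<bar>?k\<bar> < 1" by (rule duffing_modulus)
  define s c d where "s = (\<lambda>t. complex_of_real (sin (jacobi_am ?k t)))"
    and "c = (\<lambda>t. complex_of_real (cos (jacobi_am ?k t)))" and "d = (\<lambda>t. complex_of_real (real_dn ?k t))"
  have "open (- lpoles)" using closed_lpoles by auto
  moreover have "0 \<in> - lpoles" using of_real_notin_lpoles[of 0] by simp
  ultimately obtain e where e: "e > 0" "ball 0 e \<subseteq> - lpoles" using open_contains_ball by blast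
  \<comment> \<open>The bound from \<open>e\<close> keeps the imaginary segment off the poles, the
    bound from K keeps cn nonzero on the real segment.\<close>
  define T where "T = min (e/2) (qK/2)"
  have T: "T > 0" "T < e" "T < qK" using e qK_pos by (auto simp: T_def min_def)
  have np: "\<i> * of_real t \<notin> lpoles" if "t \<in> {0..T}" for t
  proof -
    have "\<i> * of_real t \<in> ball 0 e" using that T by (simp add: norm_mult)
    then show ?thesis using e(2) by blast
  qed
  have cpos: "c t \<noteq> 0" if "t \<in> {0..T}" for t
  proof -
    have "(jacobi_am ?k) t < jacobi_am ?k qK \<and> jacobi_am ?k t \<ge> 0"
    proof -
      have mono: "jacobi_am ?k x \<le> jacobi_am ?k y" if "x \<le> y" for x y
        using am_derivative[OF k] real_dn_pos[OF k] that
        by (intro DERIV_nonneg_imp_nondecreasing[OF that]) (auto intro: less_imp_le)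
      have "jacobi_am ?k t \<noteq> jacobi_am ?k qK"
        using elliptic_F_am[OF k, of t] elliptic_F_am[OF k, of qK] that T by auto
      then show ?thesis using mono[of t qK] mono[of 0 t] am_0[OF k] that T by auto
    qed
    then have "cos (jacobi_am ?k t) > 0" using am_K[OF k] by (intro cos_gt_zero_pi) auto
    then show ?thesis by (simp add: c_def)
  qed
  define S C D where "S = (\<lambda>t. jacobi_sn ?k (\<i> * of_real t))" and "C = (\<lambda>t. jacobi_cn ?k (\<i> * of_real t))"
    and "D = (\<lambda>t. jacobi_dn ?k (\<i> * of_real t))"
  have m: "complex_of_real (?k\<^sup>2) = 1/2" unfolding duffing_modulus(2) by simp
  have vd: "((\<lambda>t. f (\<i> * of_real t)) has_vector_derivative \<i> * f') (at t within {0..T})"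
    if "(f has_field_derivative f') (at (\<i> * of_real t))" for f :: "complex \<Rightarrow> complex" and f' t
  proof -
    have "((\<lambda>t. \<i> * complex_of_real t) has_vector_derivative \<i>) (at t within {0..T})"
      by (auto intro!: derivative_eq_intros)
    from field_vector_diff_chain_within[OF this has_field_derivative_at_within[OF that]]
    show ?thesis by (simp add: o_def)
  qed
  have o1: "jacobi_ode (1/2) \<i> T S C D"
    unfolding jacobi_ode_def
  proof
    fix t assume t: "t \<in> {0..T}"
    have "\<not> is_pole (jacobi_cn ?k) (\<i> * of_real t)" using np[OF t] by (simp add: lpoles_def lcn_def)
    note j = jacobi_derivatives[OF k this]
    show "(S has_vector_derivative \<i> * (C t * D t)) (at t within {0..T}) \<and>
          (C has_vector_derivative - \<i> * (S t * D t)) (at t within {0..T}) \<and>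
          (D has_vector_derivative - \<i> * (1 / 2) * (S t * C t)) (at t within {0..T})"
      using vd[OF j(1)] vd[OF j(2)] vd[OF j(3)] unfolding m S_def C_def D_def by (simp add: algebra_simps)
  qed
  have "jacobi_ode (1/2) 1 T s c d"
    using jacobi_ode_real[OF k, of 1 T] unfolding m by (simp add: s_def c_def d_def)
  then have o0: "(s has_vector_derivative c t * d t) (at t within {0..T})"
    "(c has_vector_derivative - (s t * d t)) (at t within {0..T})"
    "(d has_vector_derivative - (1/2) * (s t * c t)) (at t within {0..T})" if "t \<in> {0..T}" for t
    using that by (auto simp: jacobi_ode_def)
  have o2: "jacobi_ode (1/2) \<i> T (\<lambda>t. \<i> * s t / c t) (\<lambda>t. 1 / c t) (\<lambda>t. d t / c t)"
    unfolding jacobi_ode_def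
  proof (intro ballI conjI)
    fix t assume t: "t \<in> {0..T}"
    note o = o0[OF t] and c0 = cpos[OF t]
    have i: "(s t)\<^sup>2 = 1 - (c t)\<^sup>2" "(d t)\<^sup>2 = 1 - (s t)\<^sup>2 / 2"
      using jacobi_invariants_real[OF k, of t] unfolding m jacobi_invariants_def s_def c_def d_def by (auto simp: algebra_simps)
    show "((\<lambda>t. \<i> * s t / c t) has_vector_derivative \<i> * (1 / c t * (d t / c t))) (at t within {0..T})"
    proof (rule has_vector_derivative_eq_rhs[OF has_vector_derivative_divide[OF has_vector_derivative_mult_right[OF o(1)] o(2) c0]])
      have "\<i> * (c t * d t) * c t - \<i> * s t * - (s t * d t) = \<i> * d t * ((s t)\<^sup>2 + (c t)\<^sup>2)"
        by (simp add: algebra_simps power2_eq_square)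
      then show "(\<i> * (c t * d t) * c t - \<i> * s t * - (s t * d t)) / (c t)\<^sup>2 = \<i> * (1 / c t * (d t / c t))"
        using i by (simp add: power2_eq_square)
    qed
    show "((\<lambda>t. 1 / c t) has_vector_derivative - \<i> * (\<i> * s t / c t * (d t / c t))) (at t within {0..T})"
      by (rule has_vector_derivative_eq_rhs[OF has_vector_derivative_divide[OF has_vector_derivative_const o(2) c0]])
         (simp add: power2_eq_square mult.assoc[symmetric])
    show "((\<lambda>t. d t / c t) has_vector_derivative - \<i> * (1/2) * (\<i> * s t / c t * (1 / c t))) (at t within {0..T})"
    proof (rule has_vector_derivative_eq_rhs[OF has_vector_derivative_divide[OF o(3) o(2) c0]])
      have "- (1/2) * (s t * c t) * c t - d t * - (s t * d t) = s t * ((d t)\<^sup>2 - (c t)\<^sup>2 / 2)"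
        by (simp add: algebra_simps power2_eq_square)
      also have "\<dots> = s t / 2" unfolding i by (simp add: field_simps)
      finally show "(- (1/2) * (s t * c t) * c t - d t * - (s t * d t)) / (c t)\<^sup>2 = - \<i> * (1/2) * (\<i> * s t / c t * (1 / c t))"
        by (simp only:) (simp add: power2_eq_square)
    qed
  qed
  have z: "jacobi_sn ?k 0 = 0" "jacobi_cn ?k 0 = 1" "jacobi_dn ?k 0 = 1"
    using jacobi_functions_props(3,6,9)[OF k, of 0] by (simp_all add: am_0[OF k] real_dn_def[OF k])
  have "C t = 1 / c t" if "t \<in> {0..T}" for t
    by (rule jacobi_ode_unique(2)[OF o1 o2 _ _ _ that])
       (simp_all add: S_def C_def D_def s_def c_def d_def z am_0[OF k] real_dn_def[OF k])
  then have "lcn (\<i> * of_real t) * lcn (of_real t) = 1" if "t \<in> {0..T}" for t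
    using that cpos[OF that] jacobi_functions_props(6)[OF k, of t] by (simp add: lcn_def C_def c_def)
  with T(1) show ?thesis by blast
qed

lemma lcn_meromorphic: "lcn meromorphic_on A"
  unfolding lcn_def by (rule jacobi_meromorphic[OF duffing_modulus(1)])

lemma lcn_imaginary: "\<forall>\<^sub>F z in at w. lcn (\<i> * z) * lcn z - 1 = 0"
proof -
  have m: "(\<lambda>z. lcn (\<i> * z) * lcn z - 1) meromorphic_on UNIV"
    by (intro meromorphic_intros lcn_meromorphic meromorphic_on_compose[OF lcn_meromorphic[of UNIV]])
       (auto intro!: analytic_intros)
  obtain T where T: "T > 0" "\<And>t. t \<in> {0..T} \<Longrightarrow> lcn (\<i> * of_real t) * lcn (of_real t) = 1"
    using lcn_imaginary_near_0 by blast
  \<comment> \<open>The sequence approaches T/2 from the right and stays in the interval from 0 to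
    T, where the relation is known.\<close>
  have "frequently (\<lambda>z. lcn (\<i> * z) * lcn z - 1 = 0) (at (of_real (T/2)))"
  proof -
    have "filterlim (\<lambda>n. complex_of_real (T/2 + T / real (n + 2) / 2)) (at (of_real (T/2))) sequentially"
    proof (rule filterlim_atI)
      have "(\<lambda>n. T/2 + T / real (n + 2) / 2) \<longlonglongrightarrow> T/2" by real_asymp
      then show "(\<lambda>n. complex_of_real (T/2 + T / real (n + 2) / 2)) \<longlonglongrightarrow> of_real (T/2)"
        using tendsto_of_real[of _ "T/2" sequentially, where 'a = complex] by fastforce
      show "\<forall>\<^sub>F n in sequentially. complex_of_real (T/2 + T / real (n + 2) / 2) \<noteq> of_real (T/2)"
        using T(1) by (intro always_eventually allI) (simp only: of_real_eq_iff, simp)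
    qed
    note lim = this
    have z: "lcn (\<i> * complex_of_real (T/2 + T / real (n + 2) / 2)) * lcn (complex_of_real (T/2 + T / real (n + 2) / 2)) - 1 = 0" for n
    proof -
      define q where "q = T / real (n + 2)"
      have "q \<le> T" "0 \<le> q" using T(1) by (auto simp: q_def divide_le_eq)
      then have "T/2 + T / real (n + 2) / 2 \<in> {0..T}"
        unfolding q_def[symmetric] using T(1) by auto
      then show ?thesis using T(2) by (metis right_minus_eq)
    qed
    show ?thesis
      unfolding frequently_def
    proof
      assume "\<forall>\<^sub>F z in at (complex_of_real (T/2)). lcn (\<i> * z) * lcn z - 1 \<noteq> 0"
      from eventually_compose_filterlim[OF this lim] show False by (simp only: z) simp
    qed
  qed
  from meromorphic_zero[OF m open_UNIV connected_UNIV UNIV_I this]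
  show ?thesis using eventually_cosparse_imp_eventually_at by blast
qed

text \<open>Near the pole, \<open>lcn z = h z / (z - \<i> K)\<close>: this is the imaginary transformation \<open>cn (\<i> z) = 1 / cn z\<close>
  at the simple zero \<open>K\<close> of \<open>cn\<close>.\<close>

lemma lcn_pole:
  obtains r h where "r > 0" "h holomorphic_on ball (\<i> * of_real qK) r" "h (\<i> * of_real qK) \<noteq> 0"
    "\<And>z. z \<in> ball (\<i> * of_real qK) r - {\<i> * of_real qK} \<Longrightarrow> z \<notin> lpoles \<and> lcn z = h z / (z - \<i> * of_real qK)"
proof -
  let ?c = "\<i> * complex_of_real qK" and ?K = "complex_of_real qK"
  have k: "\<bar>duffing_modulus\<bar> < 1" by (rule duffing_modulus)
  have K0: "lcn ?K = 0"
    using jacobi_functions_props(6)[OF k, of qK] by (simp add: lcn_def am_K[OF k])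
  have "(lcn' ?K)\<^sup>2 = 1/2" using lcn'_square[OF of_real_notin_lpoles, of qK] K0 by simp
  then have d0: "lcn' ?K \<noteq> 0" by auto
  have "lcn analytic_on {?K}"
    unfolding lcn_def by (rule jacobi_functions_props(5)[OF k])
  then obtain r0 where r0: "r0 > 0" "lcn holomorphic_on ball ?K r0"
    unfolding analytic_on_def by auto
  have dl: "deriv lcn ?K = lcn' ?K" by (rule DERIV_imp_deriv[OF lcn_derivative[OF of_real_notin_lpoles]])
  define g where "g = (\<lambda>w. if w = ?K then deriv lcn ?K else (lcn w - lcn ?K) / (w - ?K))"
  have gh: "g holomorphic_on ball ?K r0"
    unfolding g_def by (rule pole_theorem_open[OF r0(2)] pole_lemma_open[OF r0(2) open_ball])
  have gK: "g ?K \<noteq> 0" by (simp add: g_def dl d0)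
  have "isCont g ?K"
    using gh r0(1) holomorphic_on_imp_continuous_on continuous_on_eq_continuous_at[OF open_ball] centre_in_ball by blast
  then have "\<forall>\<^sub>F w in at ?K. g w \<noteq> 0"
    using gK unfolding isCont_def by (rule tendsto_imp_eventually_ne)
  then have "\<forall>\<^sub>F w in nhds ?K. g w \<noteq> 0"
    using gK eventually_nhds_conv_at by blast
  then obtain r1 where r1: "r1 > 0" "\<And>w. dist w ?K < r1 \<Longrightarrow> g w \<noteq> 0" unfolding eventually_nhds_metric by blast
  obtain r2 where r2: "r2 > 0" "\<And>w. w \<noteq> ?K \<Longrightarrow> dist w ?K < r2 \<Longrightarrow> lcn (\<i> * w) * lcn w - 1 = 0"
    using lcn_imaginary[of ?K] unfolding eventually_at by auto
  obtain r3 where r3: "r3 > 0" "\<And>z. z \<noteq> ?c \<Longrightarrow> dist z ?c < r3 \<Longrightarrow> \<not> is_pole lcn z"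
  proof -
    have "\<forall>\<^sub>F z in at ?c. \<not> is_pole lcn z"
      using eventually_cosparse_imp_eventually_at[OF meromorphic_on_imp_not_pole_cosparse[OF lcn_meromorphic[of UNIV]]] by blast
    then show ?thesis using that unfolding eventually_at by auto
  qed
  define r where "r = Min {r0, r1, r2, r3}"
  have r: "r > 0" "r \<le> r0" "r \<le> r1" "r \<le> r2" "r \<le> r3" using r0 r1 r2 r3 by (auto simp: r_def)
  \<comment> \<open>For \<open>w = - \<i> * z\<close> one has \<open>lcn z = 1 / lcn w\<close> and
    \<open>lcn w = g w * (w - K)\<close>, where \<open>w - K = (z - \<i> K) / \<i>\<close>; this
    dictates \<open>h\<close>.\<close>
  define h where "h = (\<lambda>z. \<i> / g (- \<i> * z))"
  have dist: "dist (- \<i> * z) ?K = dist z ?c" for z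
  proof -
    have "- \<i> * z - ?K = - \<i> * (z - ?c)" by (simp add: algebra_simps)
    then show ?thesis by (simp add: dist_norm norm_mult)
  qed
  show ?thesis
  proof
    show "r > 0" by fact
    have sub: "(\<lambda>z. - \<i> * z) ` ball ?c r \<subseteq> ball ?K r0"
      using r dist by (auto simp: dist_commute)
    have "(g \<circ> (\<lambda>z. - \<i> * z)) holomorphic_on ball ?c r"
      by (rule holomorphic_on_compose_gen[OF _ gh sub]) (intro holomorphic_intros)
    moreover have "g (- \<i> * z) \<noteq> 0" if "z \<in> ball ?c r" for z
      using r1(2)[of "- \<i> * z"] that r dist[of z] by (simp add: dist_commute)
    ultimately show "h holomorphic_on ball ?c r"
      unfolding h_def by (intro holomorphic_intros) (auto simp: o_def)
    show "h ?c \<noteq> 0" using gK by (simp add: h_def)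
    fix z assume z: "z \<in> ball ?c r - {?c}"
    define w where "w = - \<i> * z"
    have wK: "w \<noteq> ?K" using z dist[of z] by (metis DiffD2 dist_eq_0_iff singletonI w_def)
    have wd: "dist w ?K < r" using z dist[of z] by (simp add: w_def dist_commute)
    have "\<i> * w = z" by (simp add: w_def)
    moreover have "lcn (\<i> * w) * lcn w = 1" using r2(2)[OF wK] wd r by simp
    moreover have "lcn w = g w * (w - ?K)" using wK by (simp add: g_def K0)
    moreover have "w - ?K = (z - ?c) / \<i>" by (simp add: w_def field_simps)
    ultimately have 1: "lcn z * (g w * ((z - ?c) / \<i>)) = 1" by simp
    have "z - ?c \<noteq> 0" "g w \<noteq> 0" using z r1(2)[of w] wd r by auto
    moreover have "a = \<i> / b / y" if "a * (b * (y / \<i>)) = 1" "y \<noteq> 0" "b \<noteq> 0" for a b y :: complex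
    proof -
      define w where "w = y / \<i>"
      have y: "y = \<i> * w" and "a * (b * w) = 1" "w \<noteq> 0" using that by (auto simp: w_def)
      then show ?thesis using that(3) unfolding y by (simp add: field_simps)
    qed
    ultimately have "lcn z = h z / (z - ?c)"
      using 1 unfolding h_def w_def[symmetric] by blast
    then show "z \<notin> lpoles \<and> lcn z = h z / (z - ?c)"
      using r3(2)[of z] z r by (auto simp: lpoles_def dist_commute)
  qed
qed

section \<open>Functions holomorphic in four variables\<close>

text \<open>Genericity of leading coefficients rests on this one-variable fact, applied to one
  coordinate after another, instead of on the structure of analytic sets in several
  variables.\<close>

lemma countable_zeros:
  assumes "f holomorphic_on S" "open S" "connected S" "z \<in> S" "f z \<noteq> 0"
  shows "countable {w \<in> S. f w = 0}"
proof (cases "f constant_on S")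
  case True
  then have "{w \<in> S. f w = 0} = {}" using assms(4,5) unfolding constant_on_def by auto
  then show ?thesis by (simp only: countable_empty)
next
  case False
  then show ?thesis
    using holomorphic_countable_zeros[OF assms(1-3)] open_Union_compact_subsets[OF assms(2)]
    unfolding fsigma_Union_compact by (metis (no_types, lifting) image_subset_iff mem_Collect_eq)
qed

section \<open>Dependence on parameters through Cauchy integrals\<close>

lemma circlepath_mem: "circlepath z r x \<in> sphere z \<bar>r\<bar>"
  unfolding circlepath by (simp add: dist_norm norm_mult)

lemma continuous_on_contour_integral_circlepath:
  fixes g :: "'b::t2_space \<Rightarrow> complex \<Rightarrow> complex"
  assumes g: "continuous_on (U \<times> sphere z r) (\<lambda>(y, \<zeta>). g y \<zeta>)" and r: "r > 0"
  shows "continuous_on U (\<lambda>y. contour_integral (circlepath z r) (g y))"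
proof -
  let ?c = "circlepath z r"
  have "continuous_on (U \<times> cbox 0 (1::real)) (\<lambda>(y, x). g y (?c x) * (2 * pi * \<i> * r * exp (2 * of_real pi * \<i> * x)))"
  proof -
    have "continuous_on (U \<times> {0..1}) (\<lambda>p. ?c (snd p))"
      unfolding circlepath by (intro continuous_intros)
    then have "continuous_on (U \<times> {0..1}) (\<lambda>p. (\<lambda>(y, \<zeta>). g y \<zeta>) (fst p, ?c (snd p)))"
      using circlepath_mem[of z r] r
      by (intro continuous_on_compose2[OF g]) (auto intro!: continuous_intros)
    then show ?thesis unfolding cbox_interval by (auto simp: case_prod_unfold intro!: continuous_intros)
  qed
  from integral_continuous_on_param[OF this]
  show ?thesis
    by (simp add: contour_integral_integral vector_derivative_circlepath)
qed

text \<open>Cauchy's formula expresses the derivative at points near \<open>z0\<close> as an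
  integral over one fixed circle, with an integrand jointly continuous in the point and the
  parameters.\<close>

lemma continuous_on_deriv_param:
  fixes g :: "complex \<Rightarrow> 'b::t2_space \<Rightarrow> complex"
  assumes A: "open A" and g: "continuous_on (A \<times> T) (\<lambda>(z, y). g z y)"
    and h: "\<And>x y. x \<in> A \<Longrightarrow> y \<in> T \<Longrightarrow> (\<lambda>z. g z y) holomorphic_on A" and T: "open T"
  shows "continuous_on (A \<times> T) (\<lambda>(z, y). deriv (\<lambda>z. g z y) z)"
proof -
  have "continuous (at p) (\<lambda>(z, y). deriv (\<lambda>z. g z y) z)" if p: "p \<in> A \<times> T" for p
  proof -
    obtain z0 y0 where z0: "p = (z0, y0)" "z0 \<in> A" "y0 \<in> T" using p by auto
    obtain r where r: "r > 0" "cball z0 r \<subseteq> A" using A z0(2) open_contains_cball by blast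
    have "continuous_on ((ball z0 r \<times> T) \<times> sphere z0 r) (\<lambda>q. (\<lambda>(z, y). g z y) (snd q, snd (fst q)))"
      by (intro continuous_on_compose2[OF g]) (use r(2) in \<open>auto intro!: continuous_intros\<close>)
    then have "continuous_on ((ball z0 r \<times> T) \<times> sphere z0 r) (\<lambda>(q, \<zeta>). g \<zeta> (snd q) / (\<zeta> - fst q)\<^sup>2)"
      unfolding case_prod_unfold fst_conv snd_conv by (intro continuous_intros) auto
    from continuous_on_contour_integral_circlepath[OF this r(1)]
    have "continuous_on (ball z0 r \<times> T) (\<lambda>q. 1 / (2 * pi * \<i>) * contour_integral (circlepath z0 r) (\<lambda>\<zeta>. g \<zeta> (snd q) / (\<zeta> - fst q)\<^sup>2))"
      by (intro continuous_intros)
    moreover have "1 / (2 * pi * \<i>) * contour_integral (circlepath z0 r) (\<lambda>\<zeta>. g \<zeta> (snd q) / (\<zeta> - fst q)\<^sup>2)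
        = (\<lambda>(z, y). deriv (\<lambda>z. g z y) z) q" if q: "q \<in> ball z0 r \<times> T" for q
    proof -
      obtain z y where zy: "q = (z, y)" "z \<in> ball z0 r" "y \<in> T" using q by auto
      have hol: "(\<lambda>z. g z y) holomorphic_on cball z0 r" using h[OF z0(2) zy(3)] r(2) holomorphic_on_subset by blast
      have "((\<lambda>z. g z y) has_field_derivative 1 / (2 * of_real pi * \<i>) * contour_integral (circlepath z0 r) (\<lambda>\<zeta>. g \<zeta> y / (\<zeta> - z)\<^sup>2)) (at z)"
        by (rule Cauchy_derivative_integral_circlepath(2))
           (use hol zy(2) holomorphic_on_imp_continuous_on holomorphic_on_subset ball_subset_cball in blast)+
      then show ?thesis using zy by (simp add: DERIV_imp_deriv)
    qed
    ultimately have "continuous_on (ball z0 r \<times> T) (\<lambda>(z, y). deriv (\<lambda>z. g z y) z)"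
      using continuous_on_cong[OF refl] by (metis (no_types, lifting))
    moreover have "open (ball z0 r \<times> T)" "p \<in> ball z0 r \<times> T" using T z0 r by (auto intro: open_Times)
    ultimately show ?thesis using continuous_on_eq_continuous_at by blast
  qed
  then show ?thesis by (rule continuous_at_imp_continuous_on[rule_format])
qed

text \<open>The quotient g / e with its singularity at e = 0 filled in; meaningful where g vanishes
  at e = 0.\<close>

definition divide_var :: "(complex \<Rightarrow> 'b \<Rightarrow> complex) \<Rightarrow> complex \<Rightarrow> 'b \<Rightarrow> complex" where
  "divide_var g e y = (if e = 0 then deriv (\<lambda>e. g e y) 0 else g e y / e)"

lemma divide_var_holomorphic:
  assumes "open D" "(\<lambda>e. g e y) holomorphic_on D" "g 0 y = 0"
  shows "(\<lambda>e. divide_var g e y) holomorphic_on D"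
  using pole_lemma_open[OF assms(2,1), of 0] assms(3) by (simp add: divide_var_def cong: if_cong)

text \<open>Away from e = 0 this is a plain quotient. Near e = 0 Cauchy's formula recovers the
  function from a circle on which the quotient has no singularity. The two open pieces cover the
  domain.\<close>

lemma divide_var_continuous:
  fixes g :: "complex \<Rightarrow> 'b::t2_space \<Rightarrow> complex"
  assumes D: "open D" "0 \<in> D" and g: "continuous_on (D \<times> T) (\<lambda>(e, y). g e y)"
    and h: "\<And>y. y \<in> T \<Longrightarrow> (\<lambda>e. g e y) holomorphic_on D" and T: "open T" and 0: "\<And>y. y \<in> T \<Longrightarrow> g 0 y = 0"
  shows "continuous_on (D \<times> T) (\<lambda>(e, y). divide_var g e y)"
proof -
  obtain r where r: "r > 0" "cball 0 r \<subseteq> D" using D open_contains_cball by blast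
  have "continuous_on ((ball 0 r \<times> T) \<times> sphere 0 r) (\<lambda>q. (\<lambda>(z, y). g z y) (snd q, snd (fst q)))"
    by (intro continuous_on_compose2[OF g]) (use r(2) in \<open>auto intro!: continuous_intros\<close>)
  then have "continuous_on ((ball 0 r \<times> T) \<times> sphere 0 r) (\<lambda>(q, \<zeta>). g \<zeta> (snd q) / \<zeta> / (\<zeta> - fst q))"
    unfolding case_prod_unfold fst_conv snd_conv by (intro continuous_intros) (use r in auto)
  from continuous_on_contour_integral_circlepath[OF this r(1)]
  have "continuous_on (ball 0 r \<times> T) (\<lambda>q. contour_integral (circlepath 0 r) (\<lambda>\<zeta>. g \<zeta> (snd q) / \<zeta> / (\<zeta> - fst q)) / (2 * pi * \<i>))"
    by (intro continuous_intros) auto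
  moreover have "contour_integral (circlepath 0 r) (\<lambda>\<zeta>. g \<zeta> (snd q) / \<zeta> / (\<zeta> - fst q)) / (2 * pi * \<i>)
     = (\<lambda>(e, y). divide_var g e y) q" if q: "q \<in> ball 0 r \<times> T" for q
  proof -
    obtain z y where zy: "q = (z, y)" "z \<in> ball 0 r" "y \<in> T" using q by auto
    have "(\<lambda>e. divide_var g e y) holomorphic_on D" by (rule divide_var_holomorphic[where g=g, OF D(1) h[OF zy(3)] 0[OF zy(3)]])
    then have "((\<lambda>\<zeta>. divide_var g \<zeta> y / (\<zeta> - z)) has_contour_integral 2 * of_real pi * \<i> * divide_var g z y) (circlepath 0 r)"
      by (intro Cauchy_integral_circlepath_simple) (use zy(2) r(2) holomorphic_on_subset in auto)
    then have "((\<lambda>\<zeta>. g \<zeta> y / \<zeta> / (\<zeta> - z)) has_contour_integral 2 * of_real pi * \<i> * divide_var g z y) (circlepath 0 r)"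
    proof (rule has_contour_integral_eq)
      fix \<zeta> assume "\<zeta> \<in> path_image (circlepath 0 r)"
      then have "\<zeta> \<noteq> 0" using r(1) by auto
      then show "divide_var g \<zeta> y / (\<zeta> - z) = g \<zeta> y / \<zeta> / (\<zeta> - z)" by (simp add: divide_var_def)
    qed
    from contour_integral_unique[OF this] show ?thesis using zy by simp
  qed
  ultimately have 1: "continuous_on (ball 0 r \<times> T) (\<lambda>(e, y). divide_var g e y)"
    using continuous_on_cong[OF refl] by (metis (no_types, lifting))
  have "continuous_on ((D - {0}) \<times> T) (\<lambda>(e, y). g e y)"
    by (rule continuous_on_subset[OF g]) auto
  then have "continuous_on ((D - {0}) \<times> T) (\<lambda>(e, y). g e y / e)"
    unfolding case_prod_unfold by (intro continuous_intros) auto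
  then have 2: "continuous_on ((D - {0}) \<times> T) (\<lambda>(e, y). divide_var g e y)"
    by (rule continuous_on_eq) (auto simp: divide_var_def split: if_splits)
  have "D \<times> T = ball 0 r \<times> T \<union> (D - {0}) \<times> T" using r by force
  then show ?thesis
    using continuous_on_open_Un[OF _ _ 1 2] T D(1) by (simp add: open_Times open_delete)
qed

text \<open>Weierstrass' theorem: uniform continuity on compact sets makes slices with e \<noteq> 0
  converge locally uniformly to the slice e = 0. It supplies holomorphy in the remaining variables
  for a quotient by e at e = 0.\<close>

lemma holomorphic_limit_slice:
  fixes h :: "complex \<Rightarrow> complex \<Rightarrow> complex"
  assumes D: "open D" "0 \<in> D" and B: "open B" and c: "continuous_on (D \<times> B) (\<lambda>(e, x). h e x)"
    and hol: "\<And>e. e \<in> D \<Longrightarrow> e \<noteq> 0 \<Longrightarrow> (\<lambda>x. h e x) holomorphic_on B"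
  shows "(\<lambda>x. h 0 x) holomorphic_on B"
proof -
  obtain r where r: "r > 0" "cball 0 r \<subseteq> D" using D open_contains_cball by blast
  define s where "s = (\<lambda>n. complex_of_real (r / real (n + 2)))"
  have s_norm: "norm (s n) = r / real (n + 2)" for n using r(1) unfolding s_def norm_of_real by simp
  have s_mem: "s n \<in> cball 0 r" for n using r(1) s_norm[of n] by (simp add: divide_le_eq)
  have s_nz: "s n \<noteq> 0" for n using s_norm[of n] r(1) by auto
  have s_lim: "(\<lambda>n. norm (s n)) \<longlonglongrightarrow> 0" unfolding s_norm by real_asymp
  show ?thesis
  proof (rule holomorphic_uniform_sequence[OF B, where f = "\<lambda>n. h (s n)"])
    show "h (s n) holomorphic_on B" for n using hol[of "s n"] s_mem[of n] s_nz r(2) by auto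
    fix x assume "x \<in> B"
    then obtain d where d: "d > 0" "cball x d \<subseteq> B" using B open_contains_cball by blast
    have "uniformly_continuous_on (cball 0 r \<times> cball x d) (\<lambda>(e, x). h e x)"
      by (intro compact_uniformly_continuous continuous_on_subset[OF c] compact_Times) (use r d in auto)
    have "uniform_limit (cball x d) (\<lambda>n. h (s n)) (h 0) sequentially"
    proof (rule uniform_limitI)
      fix \<epsilon> :: real assume "\<epsilon> > 0"
      with \<open>uniformly_continuous_on _ _\<close> obtain \<delta> where \<delta>: "\<delta> > 0"
        "\<And>p q. p \<in> cball 0 r \<times> cball x d \<Longrightarrow> q \<in> cball 0 r \<times> cball x d \<Longrightarrow> dist q p < \<delta> \<Longrightarrow>
          dist ((\<lambda>(e, x). h e x) q) ((\<lambda>(e, x). h e x) p) < \<epsilon>"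
        unfolding uniformly_continuous_on_def by metis
      have "\<forall>\<^sub>F n in sequentially. norm (s n) < \<delta>"
        using order_tendstoD(2)[OF s_lim \<delta>(1)] .
      then show "\<forall>\<^sub>F n in sequentially. \<forall>y\<in>cball x d. dist (h (s n) y) (h 0 y) < \<epsilon>"
      proof eventually_elim
        case (elim n)
        show ?case
        proof
          fix y assume y: "y \<in> cball x d"
          have "dist (s n, y) (0, y) < \<delta>" using elim by (simp add: dist_Pair_Pair)
          then show "dist (h (s n) y) (h 0 y) < \<epsilon>"
            using \<delta>(2)[of "(0, y)" "(s n, y)"] y s_mem[of n] r(1) by auto
        qed
      qed
    qed
    then show "\<exists>d>0. cball x d \<subseteq> B \<and> uniform_limit (cball x d) (\<lambda>n. h (s n)) (h 0) sequentially"
      using d by blast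
  qed
qed

text \<open>On open sets this is holomorphy in four variables, by Osgood's lemma.\<close>

definition hol4 :: "(complex \<Rightarrow> complex \<Rightarrow> complex \<Rightarrow> complex \<Rightarrow> complex) \<Rightarrow>
    complex set \<Rightarrow> complex set \<Rightarrow> complex set \<Rightarrow> complex set \<Rightarrow> bool" where
  "hol4 g A B C D \<longleftrightarrow> continuous_on (A \<times> B \<times> C \<times> D) (\<lambda>(x, y, u, e). g x y u e) \<and>
     (\<forall>x\<in>A. \<forall>y\<in>B. \<forall>u\<in>C. \<forall>e\<in>D. (\<lambda>t. g t y u e) holomorphic_on A \<and> (\<lambda>t. g x t u e) holomorphic_on B \<and>
        (\<lambda>t. g x y t e) holomorphic_on C \<and> (\<lambda>t. g x y u t) holomorphic_on D)"

lemma hol4_slices: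
  assumes "hol4 g A B C D" "x \<in> A" "y \<in> B" "u \<in> C" "e \<in> D"
  shows "(\<lambda>t. g t y u e) holomorphic_on A" "(\<lambda>t. g x t u e) holomorphic_on B"
    "(\<lambda>t. g x y t e) holomorphic_on C" "(\<lambda>t. g x y u t) holomorphic_on D"
  using assms unfolding hol4_def by blast+

lemma hol4_continuous: "hol4 g A B C D \<Longrightarrow> continuous_on (A \<times> B \<times> C \<times> D) (\<lambda>(x, y, u, e). g x y u e)"
  unfolding hol4_def by blast

lemma hol4I:
  assumes "continuous_on (A \<times> B \<times> C \<times> D) (\<lambda>p. g (fst p) (fst (snd p)) (fst (snd (snd p))) (snd (snd (snd p))))"
    "\<And>x y u e. x \<in> A \<Longrightarrow> y \<in> B \<Longrightarrow> u \<in> C \<Longrightarrow> e \<in> D \<Longrightarrow> (\<lambda>t. g t y u e) holomorphic_on A"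
    "\<And>x y u e. x \<in> A \<Longrightarrow> y \<in> B \<Longrightarrow> u \<in> C \<Longrightarrow> e \<in> D \<Longrightarrow> (\<lambda>t. g x t u e) holomorphic_on B"
    "\<And>x y u e. x \<in> A \<Longrightarrow> y \<in> B \<Longrightarrow> u \<in> C \<Longrightarrow> e \<in> D \<Longrightarrow> (\<lambda>t. g x y t e) holomorphic_on C"
    "\<And>x y u e. x \<in> A \<Longrightarrow> y \<in> B \<Longrightarrow> u \<in> C \<Longrightarrow> e \<in> D \<Longrightarrow> (\<lambda>t. g x y u t) holomorphic_on D"
  shows "hol4 g A B C D"
  using assms unfolding hol4_def case_prod_unfold by blast

lemma hol4_subset:
  assumes g: "hol4 g A B C D" and s: "A' \<subseteq> A" "B' \<subseteq> B" "C' \<subseteq> C" "D' \<subseteq> D"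
  shows "hol4 g A' B' C' D'"
proof (rule hol4I)
  show "continuous_on (A' \<times> B' \<times> C' \<times> D') (\<lambda>p. g (fst p) (fst (snd p)) (fst (snd (snd p))) (snd (snd (snd p))))"
    using continuous_on_subset[OF hol4_continuous[OF g], of "A' \<times> B' \<times> C' \<times> D'"] s by (auto simp: case_prod_unfold)
  fix x y u e assume "x \<in> A'" "y \<in> B'" "u \<in> C'" "e \<in> D'"
  then have "x \<in> A" "y \<in> B" "u \<in> C" "e \<in> D" using s by auto
  note sl = hol4_slices[OF g this]
  show "(\<lambda>t. g t y u e) holomorphic_on A'" by (rule holomorphic_on_subset[OF sl(1) s(1)])
  show "(\<lambda>t. g x t u e) holomorphic_on B'" by (rule holomorphic_on_subset[OF sl(2) s(2)])
  show "(\<lambda>t. g x y t e) holomorphic_on C'" by (rule holomorphic_on_subset[OF sl(3) s(3)])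
  show "(\<lambda>t. g x y u t) holomorphic_on D'" by (rule holomorphic_on_subset[OF sl(4) s(4)])
qed

lemma hol4_add:
  assumes f: "hol4 f A B C D" and g: "hol4 g A B C D"
  shows "hol4 (\<lambda>x y u e. f x y u e + g x y u e) A B C D"
proof (rule hol4I)
  show "continuous_on (A \<times> B \<times> C \<times> D) (\<lambda>p. f (fst p) (fst (snd p)) (fst (snd (snd p))) (snd (snd (snd p)))
      + g (fst p) (fst (snd p)) (fst (snd (snd p))) (snd (snd (snd p))))"
    using continuous_on_add[OF hol4_continuous[OF f] hol4_continuous[OF g]] by (simp add: case_prod_unfold)
qed (rule holomorphic_on_add; rule hol4_slices[OF f] hol4_slices[OF g]; assumption)+

lemma hol4_diff:
  assumes f: "hol4 f A B C D" and g: "hol4 g A B C D"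
  shows "hol4 (\<lambda>x y u e. f x y u e - g x y u e) A B C D"
proof (rule hol4I)
  show "continuous_on (A \<times> B \<times> C \<times> D) (\<lambda>p. f (fst p) (fst (snd p)) (fst (snd (snd p))) (snd (snd (snd p)))
      - g (fst p) (fst (snd p)) (fst (snd (snd p))) (snd (snd (snd p))))"
    using continuous_on_diff[OF hol4_continuous[OF f] hol4_continuous[OF g]] by (simp add: case_prod_unfold)
qed (rule holomorphic_on_diff; rule hol4_slices[OF f] hol4_slices[OF g]; assumption)+

lemma hol4_mult:
  assumes f: "hol4 f A B C D" and g: "hol4 g A B C D"
  shows "hol4 (\<lambda>x y u e. f x y u e * g x y u e) A B C D"
proof (rule hol4I)
  show "continuous_on (A \<times> B \<times> C \<times> D) (\<lambda>p. f (fst p) (fst (snd p)) (fst (snd (snd p))) (snd (snd (snd p)))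
      * g (fst p) (fst (snd p)) (fst (snd (snd p))) (snd (snd (snd p))))"
    using continuous_on_mult[OF hol4_continuous[OF f] hol4_continuous[OF g]] by (simp add: case_prod_unfold)
qed (rule holomorphic_on_mult; rule hol4_slices[OF f] hol4_slices[OF g]; assumption)+

lemma hol4_const: "hol4 (\<lambda>x y u e. c) A B C D"
  by (rule hol4I) (auto intro!: continuous_intros holomorphic_intros)

lemma hol4_of_1: assumes "f holomorphic_on A" shows "hol4 (\<lambda>x y u e. f x) A B C D"
  by (rule hol4I)
     (use assms in \<open>auto intro!: continuous_on_compose2[OF holomorphic_on_imp_continuous_on[OF assms]] continuous_on_fst continuous_on_id\<close>)

lemma hol4_of_3: assumes "f holomorphic_on C" shows "hol4 (\<lambda>x y u e. f u) A B C D"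
  by (rule hol4I)
     (use assms in \<open>auto intro!: continuous_on_compose2[OF holomorphic_on_imp_continuous_on[OF assms]]
        continuous_on_fst continuous_on_snd continuous_on_id\<close>)

lemma hol4_of_4: assumes "f holomorphic_on D" shows "hol4 (\<lambda>x y u e. f e) A B C D"
  by (rule hol4I)
     (use assms in \<open>auto intro!: continuous_on_compose2[OF holomorphic_on_imp_continuous_on[OF assms]]
        continuous_on_fst continuous_on_snd continuous_on_id\<close>)

lemma hol4_deriv_continuous:
  assumes g: "hol4 g A B C D" and o: "open A" "open B" "open C" "open D"
  shows "continuous_on (A \<times> B \<times> C \<times> D) (\<lambda>(x, y, u, e). deriv (\<lambda>t. g t y u e) x)"
    "continuous_on (A \<times> B \<times> C \<times> D) (\<lambda>(x, y, u, e). deriv (\<lambda>t. g x t u e) y)"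
    "continuous_on (A \<times> B \<times> C \<times> D) (\<lambda>(x, y, u, e). deriv (\<lambda>t. g x y t e) u)"
proof -
  have c: "continuous_on S (\<lambda>p. g (f1 p) (f2 p) (f3 p) (f4 p))"
    if "continuous_on S (\<lambda>p. (f1 p, f2 p, f3 p, f4 p))"
       "\<And>p. p \<in> S \<Longrightarrow> f1 p \<in> A \<and> f2 p \<in> B \<and> f3 p \<in> C \<and> f4 p \<in> D" for S :: "'z::t2_space set" and f1 f2 f3 f4
    using continuous_on_compose2[OF hol4_continuous[OF g] that(1)] that(2) by (auto simp: case_prod_unfold)
  have "continuous_on (A \<times> (B \<times> C \<times> D)) (\<lambda>(t, q). deriv (\<lambda>t. g t (fst q) (fst (snd q)) (snd (snd q))) t)"
    by (rule continuous_on_deriv_param)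
       (use g o in \<open>auto simp: case_prod_unfold open_Times hol4_def intro!: c continuous_intros\<close>)
  then show "continuous_on (A \<times> B \<times> C \<times> D) (\<lambda>(x, y, u, e). deriv (\<lambda>t. g t y u e) x)"
    by (simp add: case_prod_unfold)
  have "continuous_on (B \<times> (A \<times> C \<times> D)) (\<lambda>(t, q). deriv (\<lambda>t. g (fst q) t (fst (snd q)) (snd (snd q))) t)"
    by (rule continuous_on_deriv_param)
       (use g o in \<open>auto simp: case_prod_unfold open_Times hol4_def intro!: c continuous_intros\<close>)
  from continuous_on_compose2[OF this, of "A \<times> B \<times> C \<times> D" "\<lambda>p. (fst (snd p), fst p, snd (snd p))"]
  show "continuous_on (A \<times> B \<times> C \<times> D) (\<lambda>(x, y, u, e). deriv (\<lambda>t. g x t u e) y)"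
    by (force simp: case_prod_unfold intro!: continuous_intros)
  have "continuous_on (C \<times> (A \<times> B \<times> D)) (\<lambda>(t, q). deriv (\<lambda>t. g (fst q) (fst (snd q)) t (snd (snd q))) t)"
    by (rule continuous_on_deriv_param)
       (use g o in \<open>auto simp: case_prod_unfold open_Times hol4_def intro!: c continuous_intros\<close>)
  from continuous_on_compose2[OF this, of "A \<times> B \<times> C \<times> D" "\<lambda>p. (fst (snd (snd p)), fst p, fst (snd p), snd (snd (snd p)))"]
  show "continuous_on (A \<times> B \<times> C \<times> D) (\<lambda>(x, y, u, e). deriv (\<lambda>t. g x y t e) u)"
    by (force simp: case_prod_unfold intro!: continuous_intros)
qed

lemma hol4_divide_var:
  assumes g: "hol4 g A B C D" and o: "open A" "open B" "open C" "open D" "0 \<in> D"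
    and 0: "\<And>x y u. x \<in> A \<Longrightarrow> y \<in> B \<Longrightarrow> u \<in> C \<Longrightarrow> g x y u 0 = 0"
  obtains h where "hol4 h A B C D" "\<And>x y u e. x \<in> A \<Longrightarrow> y \<in> B \<Longrightarrow> u \<in> C \<Longrightarrow> g x y u e = e * h x y u e"
proof
  define k where "k = (\<lambda>e q. g (fst q) (fst (snd q)) (snd (snd q)) e)"
  define h where "h = (\<lambda>x y u e. divide_var k e (x, y, u))"
  show "g x y u e = e * h x y u e" if "x \<in> A" "y \<in> B" "u \<in> C" for x y u e
    using 0[OF that] by (simp add: h_def divide_var_def k_def)
  have c: "continuous_on (D \<times> (A \<times> B \<times> C)) (\<lambda>(e, q). divide_var k e q)"
  proof (rule divide_var_continuous[OF o(4,5)])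
    have "continuous_on (D \<times> (A \<times> B \<times> C)) (\<lambda>p. (\<lambda>(x, y, u, e). g x y u e) (fst (snd p), fst (snd (snd p)), snd (snd (snd p)), fst p))"
      by (rule continuous_on_compose2[OF hol4_continuous[OF g]]) (auto intro!: continuous_intros)
    then show "continuous_on (D \<times> (A \<times> B \<times> C)) (\<lambda>(e, q). k e q)" by (simp add: case_prod_unfold k_def)
  qed (use g o 0 in \<open>auto simp: k_def hol4_def open_Times\<close>)
  have sl: "continuous_on (D \<times> S) (\<lambda>(e, t). divide_var k e (f t))"
    if "continuous_on S f" "\<And>t. t \<in> S \<Longrightarrow> f t \<in> A \<times> B \<times> C" for f :: "complex \<Rightarrow> _" and S
  proof -
    have "continuous_on (D \<times> S) (\<lambda>p. (\<lambda>(e, q). divide_var k e q) (fst p, f (snd p)))"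
    proof (rule continuous_on_compose2[OF c])
      show "continuous_on (D \<times> S) (\<lambda>p. (fst p, f (snd p)))"
        by (intro continuous_intros continuous_on_compose2[OF that(1)]) auto
      show "(\<lambda>p. (fst p, f (snd p))) ` (D \<times> S) \<subseteq> D \<times> (A \<times> B \<times> C)"
        by (intro image_subsetI SigmaI that(2)) auto
    qed
    then show ?thesis by (simp add: case_prod_unfold)
  qed
  have slice: "(\<lambda>t. divide_var k e (f t)) holomorphic_on S"
    if S: "open S" and f: "continuous_on S f" "\<And>t. t \<in> S \<Longrightarrow> f t \<in> A \<times> B \<times> C"
      and hk: "\<And>e. e \<in> D \<Longrightarrow> (\<lambda>t. k e (f t)) holomorphic_on S" and e: "e \<in> D" for f S e
  proof -
    have nz: "(\<lambda>t. divide_var k e (f t)) holomorphic_on S" if "e \<in> D" "e \<noteq> 0" for e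
      using hk[OF that(1)] that(2) by (auto simp: divide_var_def intro!: holomorphic_intros)
    show ?thesis
    proof (cases "e = 0")
      case True
      show ?thesis unfolding True
        by (rule holomorphic_limit_slice[OF o(4,5) S sl[OF f]]) (use nz in auto)
    qed (use nz e in auto)
  qed
  show "hol4 h A B C D"
    unfolding hol4_def
  proof (intro conjI ballI)
    have "continuous_on (A \<times> B \<times> C \<times> D) (\<lambda>p. (\<lambda>(e, q). divide_var k e q) (snd (snd (snd p)), (fst p, fst (snd p), fst (snd (snd p)))))"
      by (rule continuous_on_compose2[OF c]) (auto intro!: continuous_intros)
    then show "continuous_on (A \<times> B \<times> C \<times> D) (\<lambda>(x, y, u, e). h x y u e)" by (simp add: case_prod_unfold h_def)
    fix x y u e assume m: "x \<in> A" "y \<in> B" "u \<in> C" "e \<in> D"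
    show "(\<lambda>t. h t y u e) holomorphic_on A" unfolding h_def
      by (rule slice) (use m o hol4_slices[OF g] in \<open>auto simp: k_def intro!: continuous_intros\<close>)
    show "(\<lambda>t. h x t u e) holomorphic_on B" unfolding h_def
      by (rule slice) (use m o hol4_slices[OF g] in \<open>auto simp: k_def intro!: continuous_intros\<close>)
    show "(\<lambda>t. h x y t e) holomorphic_on C" unfolding h_def
      by (rule slice) (use m o hol4_slices[OF g] in \<open>auto simp: k_def intro!: continuous_intros\<close>)
    show "(\<lambda>t. h x y u t) holomorphic_on D" unfolding h_def
      by (rule divide_var_holomorphic) (use m o hol4_slices[OF g] 0 in \<open>auto simp: k_def\<close>)
  qed
qed

text \<open>If e could be divided out of both functions without end, then a slice in e through the
  given point would be divisible by every power of e, although it is not identically zero and so has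
  finite order at 0. Both functions lose the same power, which preserves linear relations between
  them; one of the two may still vanish at e = 0.\<close>

lemma hol4_factor_pair:
  assumes g: "hol4 g1 A B C (ball 0 r)" "hol4 g2 A B C (ball 0 r)" and o: "open A" "open B" "open C" "r > 0"
    and nz: "x0 \<in> A" "y0 \<in> B" "u0 \<in> C" "e0 \<in> ball 0 r" "g1 x0 y0 u0 e0 \<noteq> 0 \<or> g2 x0 y0 u0 e0 \<noteq> 0"
  obtains m h1 h2 where "hol4 h1 A B C (ball 0 r)" "hol4 h2 A B C (ball 0 r)"
    "\<And>x y u e. x \<in> A \<Longrightarrow> y \<in> B \<Longrightarrow> u \<in> C \<Longrightarrow> g1 x y u e = e ^ m * h1 x y u e"
    "\<And>x y u e. x \<in> A \<Longrightarrow> y \<in> B \<Longrightarrow> u \<in> C \<Longrightarrow> g2 x y u e = e ^ m * h2 x y u e"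
    "\<exists>x\<in>A. \<exists>y\<in>B. \<exists>u\<in>C. h1 x y u 0 \<noteq> 0 \<or> h2 x y u 0 \<noteq> 0"
proof -
  define P where "P = (\<lambda>m h1 h2. hol4 h1 A B C (ball 0 r) \<and> hol4 h2 A B C (ball 0 r) \<and>
    (\<forall>x\<in>A. \<forall>y\<in>B. \<forall>u\<in>C. \<forall>e. g1 x y u e = e ^ m * h1 x y u e \<and> g2 x y u e = e ^ m * h2 x y u e))"
  define Z where "Z = (\<lambda>(h1 :: complex \<Rightarrow> complex \<Rightarrow> complex \<Rightarrow> complex \<Rightarrow> complex) (h2 :: complex \<Rightarrow> complex \<Rightarrow> complex \<Rightarrow> complex \<Rightarrow> complex).
    \<forall>x\<in>A. \<forall>y\<in>B. \<forall>u\<in>C. h1 x y u 0 = 0 \<and> h2 x y u 0 = 0)"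
  have "\<exists>m h1 h2. P m h1 h2 \<and> \<not> Z h1 h2"
  proof (rule ccontr)
    assume neg: "\<not> ?thesis"
    have all: "\<exists>h1 h2. P m h1 h2" for m :: nat
    proof (induction m)
      case 0
      show ?case using g by (intro exI[of _ g1] exI[of _ g2]) (simp add: P_def)
    next
      case (Suc m)
      then obtain h1 h2 where P: "P m h1 h2" by blast
      then have "Z h1 h2" using neg by blast
      then have z: "\<And>x y u. x \<in> A \<Longrightarrow> y \<in> B \<Longrightarrow> u \<in> C \<Longrightarrow> h1 x y u 0 = 0"
        "\<And>x y u. x \<in> A \<Longrightarrow> y \<in> B \<Longrightarrow> u \<in> C \<Longrightarrow> h2 x y u 0 = 0" unfolding Z_def by auto
      have h: "hol4 h1 A B C (ball 0 r)" "hol4 h2 A B C (ball 0 r)" using P unfolding P_def by auto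
      have 0: "0 \<in> ball (0::complex) r" using o(4) by simp
      obtain k1 where k1: "hol4 k1 A B C (ball 0 r)"
        "\<And>x y u e. x \<in> A \<Longrightarrow> y \<in> B \<Longrightarrow> u \<in> C \<Longrightarrow> h1 x y u e = e * k1 x y u e"
        using hol4_divide_var[OF h(1) o(1-3) open_ball 0 z(1)] by blast
      obtain k2 where k2: "hol4 k2 A B C (ball 0 r)"
        "\<And>x y u e. x \<in> A \<Longrightarrow> y \<in> B \<Longrightarrow> u \<in> C \<Longrightarrow> h2 x y u e = e * k2 x y u e"
        using hol4_divide_var[OF h(2) o(1-3) open_ball 0 z(2)] by blast
      note k1 k2
      then show ?case using P unfolding P_def by (intro exI[of _ k1] exI[of _ k2]) auto
    qed
    define f where "f = (if g1 x0 y0 u0 e0 \<noteq> 0 then g1 x0 y0 u0 else g2 x0 y0 u0)"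
    have fh: "f holomorphic_on ball 0 r" and fe: "f e0 \<noteq> 0"
      using hol4_slices(4)[OF g(1) nz(1-4)] hol4_slices(4)[OF g(2) nz(1-4)] nz(5) by (auto simp: f_def)
    have fM: "\<exists>h. h holomorphic_on ball 0 r \<and> (\<forall>e. f e = e ^ m * h e)" for m
    proof -
      obtain h1 h2 where P: "P m h1 h2" using all by blast
      define h where "h = (if g1 x0 y0 u0 e0 \<noteq> 0 then h1 x0 y0 u0 else h2 x0 y0 u0)"
      have "h holomorphic_on ball 0 r"
        using P hol4_slices(4)[of h1, OF _ nz(1-4)] hol4_slices(4)[of h2, OF _ nz(1-4)] by (auto simp: h_def P_def)
      moreover have "f e = e ^ m * h e" for e using P nz(1-3) by (auto simp: f_def h_def P_def)
      ultimately show ?thesis by blast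
    qed
    have f0: "f 0 = 0" using fM[of 1] by auto
    have nc: "\<not> f constant_on ball 0 r"
      using f0 fe nz(4) o(4) unfolding constant_on_def by (metis centre_in_ball)
    obtain k s n where k: "0 < n" "0 < s" "ball (0::complex) s \<subseteq> ball 0 r" "k holomorphic_on ball 0 s"
      "\<And>w. w \<in> ball 0 s \<Longrightarrow> f w = (w - 0) ^ n * k w" "\<And>w. w \<in> ball 0 s \<Longrightarrow> k w \<noteq> 0"
      by (rule holomorphic_factor_zero_nonconstant[OF fh open_ball connected_ball _ f0 nc]) (use o(4) in auto)
    \<comment> \<open>Divisibility by \<open>e ^ Suc n\<close> contradicts the exact order
      \<open>n\<close>: the cofactor \<open>k\<close> equals \<open>w * h w\<close> near 0 and so
      vanishes at 0.\<close>
    obtain h where h: "h holomorphic_on ball 0 r" "\<And>e. f e = e ^ Suc n * h e" using fM by metis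
    have kw: "k w = w * h w" if "w \<in> ball 0 s - {0}" for w
      using k(5)[of w] h(2)[of w] that by auto
    have "\<forall>\<^sub>F w in at 0. w \<in> ball 0 s - {0}"
      using k(2) by (intro eventually_at_in_open) auto
    then have "\<forall>\<^sub>F w in at 0. k w = w * h w" by eventually_elim (rule kw)
    moreover have "((\<lambda>w. w * h w) \<longlongrightarrow> 0 * h 0) (at 0)"
    proof (intro tendsto_mult tendsto_ident_at)
      have "isCont h 0"
        using continuous_on_eq_continuous_at[OF open_ball, of 0 r h] holomorphic_on_imp_continuous_on[OF h(1)] o(4) by simp
      then show "(h \<longlongrightarrow> h 0) (at 0)" by (simp add: isCont_def)
    qed
    ultimately have "(k \<longlongrightarrow> 0) (at 0)" by (simp add: tendsto_cong)
    moreover have "(k \<longlongrightarrow> k 0) (at 0)"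
      using continuous_on_eq_continuous_at[OF open_ball, of 0 s k] holomorphic_on_imp_continuous_on[OF k(4)] k(2)
      by (simp add: isCont_def)
    ultimately have "k 0 = 0" using LIM_unique by blast
    then show False using k(2,6) by auto
  qed
  then obtain m h1 h2 where "P m h1 h2" "\<not> Z h1 h2" by blast
  then show ?thesis using that[of h1 h2 m] unfolding P_def Z_def by blast
qed

text \<open>Starting from a point of nonvanishing for each j, first x is moved, which excludes
  countably many values for each j, then y, and finally u is left free. Finitely many countable sets
  cannot exhaust an open set, so one x and one y serve all j.\<close>

lemma hol4_generic:
  assumes J: "finite J" and g: "\<And>j. j \<in> J \<Longrightarrow> hol4 (c j) A B (W j) D"
    and o: "open A" "connected A" "open B" "connected B" "\<And>j. j \<in> J \<Longrightarrow> open (W j) \<and> connected (W j)" "e \<in> D"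
    and nz: "\<And>j. j \<in> J \<Longrightarrow> \<exists>x\<in>A. \<exists>y\<in>B. \<exists>u\<in>W j. c j x y u e \<noteq> 0"
    and A': "open A'" "A' \<noteq> {}" "A' \<subseteq> A" and B': "open B'" "B' \<noteq> {}" "B' \<subseteq> B"
  obtains x y where "x \<in> A'" "y \<in> B'" "\<And>j. j \<in> J \<Longrightarrow> countable {u \<in> W j. c j x y u e = 0}"
proof -
  obtain p q s where pqs: "\<And>j. j \<in> J \<Longrightarrow> p j \<in> A \<and> q j \<in> B \<and> s j \<in> W j \<and> c j (p j) (q j) (s j) e \<noteq> 0"
    using nz by metis
  have unc: "uncountable S" if "open S" "S \<noteq> {}" for S :: "complex set"
  proof -
    obtain z where z: "z \<in> S" using \<open>S \<noteq> {}\<close> by auto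
    obtain r where "r > 0" "ball z r \<subseteq> S" using \<open>open S\<close> z by (meson open_contains_ball)
    then show ?thesis using uncountable_ball[of r z] by (metis countable_subset)
  qed
  have "countable {x \<in> A. c j x (q j) (s j) e = 0}" if "j \<in> J" for j
    using pqs[OF that] o hol4_slices(1)[OF g[OF that], of "p j" "q j" "s j" e] by (intro countable_zeros[of _ _ "p j"]) auto
  then have "countable (\<Union>j\<in>J. {x \<in> A. c j x (q j) (s j) e = 0})" using J by (intro countable_UN) (auto intro: countable_finite)
  then have "\<not> A' \<subseteq> (\<Union>j\<in>J. {x \<in> A. c j x (q j) (s j) e = 0})"
    using unc[OF A'(1,2)] countable_subset by blast
  then obtain x where x: "x \<in> A'" "\<And>j. j \<in> J \<Longrightarrow> c j x (q j) (s j) e \<noteq> 0"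
    using A'(3) by auto
  have xA: "x \<in> A" using x A' by auto
  have "countable {y \<in> B. c j x y (s j) e = 0}" if "j \<in> J" for j
    using pqs[OF that] o x(2)[OF that] hol4_slices(2)[OF g[OF that] xA, of "q j" "s j" e]
    by (intro countable_zeros[of _ _ "q j"]) auto
  then have "countable (\<Union>j\<in>J. {y \<in> B. c j x y (s j) e = 0})" using J by (intro countable_UN) (auto intro: countable_finite)
  then have "\<not> B' \<subseteq> (\<Union>j\<in>J. {y \<in> B. c j x y (s j) e = 0})"
    using unc[OF B'(1,2)] countable_subset by blast
  then obtain y where y: "y \<in> B'" "\<And>j. j \<in> J \<Longrightarrow> c j x y (s j) e \<noteq> 0"
    using B'(3) by auto
  have yB: "y \<in> B" using y B' by auto
  have "countable {u \<in> W j. c j x y u e = 0}" if "j \<in> J" for j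
    using pqs[OF that] o(5,6) that y(2)[OF that] hol4_slices(3)[OF g[OF that] xA yB, of "s j" e]
    by (intro countable_zeros[of _ _ "s j"]) auto
  then show ?thesis using that[OF x(1) y(1)] by blast
qed

section \<open>Leading coefficients in the perturbation parameter\<close>

text \<open>A pair \<open>g\<close> of meromorphic functions, represented by \<open>a/b\<close> on the patches \<open>W j\<close> of the \<open>u\<close>-plane, with
  \<open>x \<partial>\<^sub>u g + \<epsilon> (w\<^sub>x \<partial>\<^sub>x + w\<^sub>y \<partial>\<^sub>y + w\<^sub>u \<partial>\<^sub>u) g = \<epsilon> k g\<close>.  A first integral is a pair of equal components, with \<open>k = 0\<close>.
  The coefficients \<open>R\<close>, \<open>K\<close> are the integrals of \<open>w\<^sub>x\<close>, \<open>k\<close> around \<open>c0\<close>; the shift \<open>P0\<close> of \<open>u\<close> closes up after a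
  shift \<open>\<kappa> x\<close> of \<open>y\<close>.\<close>

locale perturbed_family =
  fixes A B :: "complex set" and J :: "'j set" and W :: "'j \<Rightarrow> complex set" and \<rho> :: real
    and g :: "bool \<Rightarrow> complex \<Rightarrow> complex \<Rightarrow> complex \<Rightarrow> complex \<Rightarrow> complex"
    and a :: "bool \<Rightarrow> 'j \<Rightarrow> complex \<Rightarrow> complex \<Rightarrow> complex \<Rightarrow> complex \<Rightarrow> complex"
    and b :: "'j \<Rightarrow> complex \<Rightarrow> complex \<Rightarrow> complex \<Rightarrow> complex \<Rightarrow> complex"
    and wx wy wu :: "complex \<Rightarrow> complex \<Rightarrow> complex \<Rightarrow> complex"
    and k :: "bool \<Rightarrow> bool \<Rightarrow> complex \<Rightarrow> complex \<Rightarrow> complex \<Rightarrow> complex"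
    and c0 :: complex and r1 r2 :: real
    and R :: "complex \<Rightarrow> complex \<Rightarrow> complex" and K :: "bool \<Rightarrow> bool \<Rightarrow> complex \<Rightarrow> complex \<Rightarrow> complex"
    and P0 :: complex and \<kappa> \<tau> :: "complex \<Rightarrow> complex"
  assumes AB: "open A" "connected A" "open B" "connected B" "0 \<notin> A"
    and J: "finite J" and W: "\<And>j. j \<in> J \<Longrightarrow> open (W j) \<and> connected (W j)"
    and conn: "connected (\<Union>j\<in>J. W j)" and \<rho>: "\<rho> > 0"
    and hol_a: "\<And>i j. j \<in> J \<Longrightarrow> hol4 (a i j) A B (W j) (ball 0 \<rho>)"
    and hol_b: "\<And>j. j \<in> J \<Longrightarrow> hol4 (b j) A B (W j) (ball 0 \<rho>)"
    and quot: "\<And>i j x y u e. j \<in> J \<Longrightarrow> x \<in> A \<Longrightarrow> y \<in> B \<Longrightarrow> u \<in> W j \<Longrightarrow> e \<in> ball 0 \<rho> \<Longrightarrow> e \<noteq> 0 \<Longrightarrow>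
        b j x y u e \<noteq> 0 \<Longrightarrow> g i x y u e = a i j x y u e / b j x y u e"
    and b0: "\<And>j. j \<in> J \<Longrightarrow> \<exists>x\<in>A. \<exists>y\<in>B. \<exists>u\<in>W j. b j x y u 0 \<noteq> 0"
    and pde: "\<And>i j x y u e. j \<in> J \<Longrightarrow> x \<in> A \<Longrightarrow> y \<in> B \<Longrightarrow> u \<in> W j \<Longrightarrow> e \<in> ball 0 \<rho> \<Longrightarrow> e \<noteq> 0 \<Longrightarrow>
        b j x y u e \<noteq> 0 \<Longrightarrow> \<exists>d1 d2 d3. ((\<lambda>t. g i t y u e) has_field_derivative d1) (at x) \<and>
          ((\<lambda>t. g i x t u e) has_field_derivative d2) (at y) \<and> ((\<lambda>t. g i x y t e) has_field_derivative d3) (at u) \<and>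
          (x + e * wu x y u) * d3 + e * (wx x y u * d1 + wy x y u * d2) =
            e * (k i True x y u * g True x y u e + k i False x y u * g False x y u e)"
    and nz: "\<exists>j\<in>J. \<exists>x\<in>A. \<exists>y\<in>B. \<exists>u\<in>W j. \<exists>e\<in>ball 0 \<rho>. \<exists>i. a i j x y u e \<noteq> 0"
    and ring: "0 < r1" "r1 < r2" "\<And>u. r1 \<le> dist c0 u \<Longrightarrow> dist c0 u \<le> r2 \<Longrightarrow> u \<in> (\<Union>j\<in>J. W j)"
    and cont_w: "\<And>x y. x \<in> A \<Longrightarrow> y \<in> B \<Longrightarrow> continuous_on (\<Union>j\<in>J. W j) (wx x y) \<and>
        continuous_on (\<Union>j\<in>J. W j) (wy x y) \<and> continuous_on (\<Union>j\<in>J. W j) (wu x y)"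
    and cont_k: "\<And>i i' x y. x \<in> A \<Longrightarrow> y \<in> B \<Longrightarrow> continuous_on (\<Union>j\<in>J. W j) (k i i' x y)"
    and int_w: "\<And>x y r. x \<in> A \<Longrightarrow> y \<in> B \<Longrightarrow> r1 < r \<Longrightarrow> r < r2 \<Longrightarrow>
        (wx x y has_contour_integral R x y) (circlepath c0 r) \<and> (wy x y has_contour_integral 0) (circlepath c0 r)"
    and int_k: "\<And>i i' x y r. x \<in> A \<Longrightarrow> y \<in> B \<Longrightarrow> r1 < r \<Longrightarrow> r < r2 \<Longrightarrow>
        (k i i' x y has_contour_integral K i i' x y) (circlepath c0 r)"
    and cont_R: "continuous_on (A \<times> B) (\<lambda>(x, y). R x y)" "\<And>i i'. continuous_on (A \<times> B) (\<lambda>(x, y). K i i' x y)"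
    and twist: "\<And>x y u e. x \<in> A \<Longrightarrow> y \<in> B \<Longrightarrow> y + \<kappa> x \<in> B \<Longrightarrow> e \<in> ball 0 \<rho> \<Longrightarrow> e \<noteq> 0 \<Longrightarrow>
        u \<in> (\<Union>j\<in>J. W j) \<Longrightarrow> u + P0 \<in> (\<Union>j\<in>J. W j) \<Longrightarrow>
        g True x y (u + P0) e = g True x (y + \<kappa> x) u e \<and>
        g False x y (u + P0) e = g False x (y + \<kappa> x) u e + \<tau> x * g True x (y + \<kappa> x) u e"
    and cont_tw: "continuous_on A \<kappa>" "continuous_on A \<tau>"
begin

abbreviation \<Omega> where "\<Omega> \<equiv> (\<Union>j\<in>J. W j)"

lemma open_\<Omega>: "open \<Omega>" using W by auto

lemma zero_mem: "0 \<in> ball (0::complex) \<rho>" using \<rho> by simp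

text \<open>Each patch has its own greatest power of e. The minimum over the patches can be divided
  out of all of them and leaves a nonzero value at e = 0 on a minimising patch. Patches on which
  both numerators vanish identically stay out of the minimum and keep numerator 0.\<close>

lemma normalise:
  obtains M \<alpha> where "\<And>i j. j \<in> J \<Longrightarrow> hol4 (\<alpha> i j) A B (W j) (ball 0 \<rho>)"
    "\<And>i j x y u e. j \<in> J \<Longrightarrow> x \<in> A \<Longrightarrow> y \<in> B \<Longrightarrow> u \<in> W j \<Longrightarrow> e \<in> ball 0 \<rho> \<Longrightarrow>
      a i j x y u e = e ^ M * \<alpha> i j x y u e"
    "\<exists>j\<in>J. \<exists>x\<in>A. \<exists>y\<in>B. \<exists>u\<in>W j. \<exists>i. \<alpha> i j x y u 0 \<noteq> 0"
proof -
  define J1 where "J1 = {j \<in> J. \<exists>x\<in>A. \<exists>y\<in>B. \<exists>u\<in>W j. \<exists>e\<in>ball 0 \<rho>. \<exists>i. a i j x y u e \<noteq> 0}"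
  have J1: "finite J1" "J1 \<noteq> {}" "J1 \<subseteq> J" using J nz unfolding J1_def by (simp, blast, blast)
  define P where "P = (\<lambda>j m h. (\<forall>i. hol4 (h i) A B (W j) (ball 0 \<rho>)) \<and>
     (\<forall>x\<in>A. \<forall>y\<in>B. \<forall>u\<in>W j. \<forall>e i. a i j x y u e = e ^ m * h i x y u e) \<and>
     (\<exists>x\<in>A. \<exists>y\<in>B. \<exists>u\<in>W j. \<exists>i. h i x y u 0 \<noteq> 0))"
  have "\<exists>m h. P j m h" if "j \<in> J1" for j
  proof -
    from that obtain x0 y0 u0 e0 i0 where z: "x0 \<in> A" "y0 \<in> B" "u0 \<in> W j" "e0 \<in> ball 0 \<rho>" "a i0 j x0 y0 u0 e0 \<noteq> 0"
      and j: "j \<in> J" unfolding J1_def by blast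
    have z2: "a True j x0 y0 u0 e0 \<noteq> 0 \<or> a False j x0 y0 u0 e0 \<noteq> 0" using z(5) by (cases i0) auto
    have oW: "open (W j)" using W j by blast
    obtain m h1 h2 where h: "hol4 h1 A B (W j) (ball 0 \<rho>)" "hol4 h2 A B (W j) (ball 0 \<rho>)"
      "\<And>x y u e. x \<in> A \<Longrightarrow> y \<in> B \<Longrightarrow> u \<in> W j \<Longrightarrow> a True j x y u e = e ^ m * h1 x y u e"
      "\<And>x y u e. x \<in> A \<Longrightarrow> y \<in> B \<Longrightarrow> u \<in> W j \<Longrightarrow> a False j x y u e = e ^ m * h2 x y u e"
      "\<exists>x\<in>A. \<exists>y\<in>B. \<exists>u\<in>W j. h1 x y u 0 \<noteq> 0 \<or> h2 x y u 0 \<noteq> 0"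
      by (rule hol4_factor_pair[OF hol_a[OF j] hol_a[OF j] AB(1,3) oW \<rho> z(1-4) z2]) blast
    have "P j m (\<lambda>i. if i then h1 else h2)"
      unfolding P_def
    proof (intro conjI allI ballI)
      show "\<exists>x\<in>A. \<exists>y\<in>B. \<exists>u\<in>W j. \<exists>i. (if i then h1 else h2) x y u 0 \<noteq> 0"
        using h(5) by (metis (full_types))
    qed (use h in auto)
    then show ?thesis by blast
  qed
  then obtain m h where mh: "\<And>j. j \<in> J1 \<Longrightarrow> P j (m j) (h j)" by metis
  define M where "M = Min (m ` J1)"
  have M_le: "M \<le> m j" if "j \<in> J1" for j using J1 that by (auto simp: M_def)
  have "M \<in> m ` J1" unfolding M_def using J1 by (intro Min_in) auto
  then obtain j1 where j1: "j1 \<in> J1" "m j1 = M" by auto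
  define \<alpha> where "\<alpha> = (\<lambda>i j x y u e. if j \<in> J1 then e ^ (m j - M) * h j i x y u e else 0)"
  show ?thesis
  proof
    show "hol4 (\<alpha> i j) A B (W j) (ball 0 \<rho>)" if "j \<in> J" for i j
    proof (cases "j \<in> J1")
      case True
      have "hol4 (\<lambda>x y u e. e ^ (m j - M) * h j i x y u e) A B (W j) (ball 0 \<rho>)"
        by (intro hol4_mult hol4_of_4 holomorphic_intros) (use mh[OF True] in \<open>auto simp: P_def\<close>)
      then show ?thesis using True by (simp add: \<alpha>_def)
    next
      case False
      then show ?thesis using hol4_const[of 0] by (simp add: \<alpha>_def)
    qed
    show "a i j x y u e = e ^ M * \<alpha> i j x y u e" if j: "j \<in> J" and m: "x \<in> A" "y \<in> B" "u \<in> W j" "e \<in> ball 0 \<rho>" for i j x y u e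
    proof (cases "j \<in> J1")
      case True
      then have "a i j x y u e = e ^ m j * h j i x y u e" using mh[OF True] m by (auto simp: P_def)
      also have "e ^ m j = e ^ M * e ^ (m j - M)" using M_le[OF True] by (simp add: power_add[symmetric])
      finally show ?thesis using True by (simp add: \<alpha>_def)
    next
      case False
      then have "a i j x y u e = 0" using j m by (auto simp: J1_def)
      then show ?thesis using False by (simp add: \<alpha>_def)
    qed
    obtain x y u i where "x \<in> A" "y \<in> B" "u \<in> W j1" "h j1 i x y u 0 \<noteq> 0" using mh[OF j1(1)] by (auto simp: P_def)
    then have "\<alpha> i j1 x y u 0 \<noteq> 0" using j1 by (simp add: \<alpha>_def)
    then show "\<exists>j\<in>J. \<exists>x\<in>A. \<exists>y\<in>B. \<exists>u\<in>W j. \<exists>i. \<alpha> i j x y u 0 \<noteq> 0"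
      using j1 J1 \<open>x \<in> A\<close> \<open>y \<in> B\<close> \<open>u \<in> W j1\<close> by blast
  qed
qed

end

lemma open_box4:
  assumes "open S" "(x, y, u, e) \<in> S"
  obtains \<delta> :: real where "\<delta> > 0" "\<And>x' y' u' e'. dist x x' < \<delta> \<Longrightarrow> dist y y' < \<delta> \<Longrightarrow> dist u u' < \<delta> \<Longrightarrow> dist e e' < \<delta> \<Longrightarrow>
    (x' :: complex, y' :: complex, u' :: complex, e' :: complex) \<in> S"
proof -
  obtain A1 S1 where 1: "open A1" "open S1" "x \<in> A1" "(y, u, e) \<in> S1" "A1 \<times> S1 \<subseteq> S"
    using open_prod_elim[OF assms] by (metis mem_Sigma_iff)
  obtain A2 S2 where 2: "open A2" "open S2" "y \<in> A2" "(u, e) \<in> S2" "A2 \<times> S2 \<subseteq> S1"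
    using open_prod_elim[OF 1(2,4)] by (metis mem_Sigma_iff)
  obtain A3 A4 where 3: "open A3" "open A4" "u \<in> A3" "e \<in> A4" "A3 \<times> A4 \<subseteq> S2"
    using open_prod_elim[OF 2(2,4)] by (metis mem_Sigma_iff)
  obtain d1 where d1: "d1 > 0" "ball x d1 \<subseteq> A1" using 1 open_contains_ball by blast
  obtain d2 where d2: "d2 > 0" "ball y d2 \<subseteq> A2" using 2 open_contains_ball by blast
  obtain d3 where d3: "d3 > 0" "ball u d3 \<subseteq> A3" using 3 open_contains_ball by blast
  obtain d4 where d4: "d4 > 0" "ball e d4 \<subseteq> A4" using 3 open_contains_ball by blast
  show ?thesis
  proof (rule that[of "min (min d1 d2) (min d3 d4)"])
    fix x' y' u' e' assume "dist x x' < min (min d1 d2) (min d3 d4)" "dist y y' < min (min d1 d2) (min d3 d4)"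
       "dist u u' < min (min d1 d2) (min d3 d4)" "dist e e' < min (min d1 d2) (min d3 d4)"
    then have "x' \<in> A1" "y' \<in> A2" "u' \<in> A3" "e' \<in> A4" using d1 d2 d3 d4 by auto
    then show "(x', y', u', e') \<in> S" using 1(5) 2(5) 3(5) by blast
  qed (use d1 d2 d3 d4 in auto)
qed

locale normalised_family = perturbed_family +
  fixes M :: nat and \<alpha>
  assumes hol_\<alpha>: "\<And>i j. j \<in> J \<Longrightarrow> hol4 (\<alpha> i j) A B (W j) (ball 0 \<rho>)"
    and a_eq: "\<And>i j x y u e. j \<in> J \<Longrightarrow> x \<in> A \<Longrightarrow> y \<in> B \<Longrightarrow> u \<in> W j \<Longrightarrow> e \<in> ball 0 \<rho> \<Longrightarrow>
      a i j x y u e = e ^ M * \<alpha> i j x y u e"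
    and \<alpha>_nz: "\<exists>j\<in>J. \<exists>x\<in>A. \<exists>y\<in>B. \<exists>u\<in>W j. \<exists>i. \<alpha> i j x y u 0 \<noteq> 0"
begin

definition ok where "ok j x y u e \<longleftrightarrow> j \<in> J \<and> x \<in> A \<and> y \<in> B \<and> u \<in> W j \<and> e \<in> ball 0 \<rho> \<and> b j x y u e \<noteq> 0"
definition Ok where "Ok j = {(x, y, u, e). ok j x y u e}"
text \<open>\<open>Gh\<close> extends \<open>g / \<epsilon>^M\<close> to \<open>\<epsilon> = 0\<close>; it is meaningful at \<open>ok\<close> points only.\<close>

definition gh where "gh i x y u e = g i x y u e / e ^ M"
definition Gh where "Gh i x y u e = (if e = 0 then Lim (at 0) (gh i x y u) else gh i x y u e)"

lemma okD: "ok j x y u e \<Longrightarrow> j \<in> J" "ok j x y u e \<Longrightarrow> x \<in> A" "ok j x y u e \<Longrightarrow> y \<in> B" "ok j x y u e \<Longrightarrow> u \<in> W j"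
  "ok j x y u e \<Longrightarrow> e \<in> ball 0 \<rho>" "ok j x y u e \<Longrightarrow> b j x y u e \<noteq> 0"
  by (auto simp: ok_def)

lemma open_dom: "j \<in> J \<Longrightarrow> open (A \<times> B \<times> W j \<times> ball 0 \<rho>)"
  using AB W by (intro open_Times) auto

lemma open_Ok: "open (Ok j)"
proof (cases "j \<in> J")
  case True
  have "open ((A \<times> B \<times> W j \<times> ball 0 \<rho>) \<inter> (\<lambda>(x, y, u, e). b j x y u e) -` (- {0}))"
    by (rule continuous_open_preimage[OF hol4_continuous[OF hol_b[OF True]] open_dom[OF True]]) auto
  also have "\<dots> = Ok j" using True by (auto simp: Ok_def ok_def)
  finally show ?thesis .
qed (simp add: Ok_def ok_def case_prod_unfold)

lemma ok_box:
  assumes "ok j x y u e"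
  obtains \<delta> where "\<delta> > 0" "\<And>x' y' u' e'. dist x x' < \<delta> \<Longrightarrow> dist y y' < \<delta> \<Longrightarrow> dist u u' < \<delta> \<Longrightarrow> dist e e' < \<delta> \<Longrightarrow> ok j x' y' u' e'"
proof -
  have "(x, y, u, e) \<in> Ok j" using assms by (simp add: Ok_def)
  from open_box4[OF open_Ok this] that show ?thesis unfolding Ok_def by auto
qed

lemma ok_nhds:
  assumes "ok j x y u e"
  shows "\<forall>\<^sub>F t in nhds x. ok j t y u e" "\<forall>\<^sub>F t in nhds y. ok j x t u e"
    "\<forall>\<^sub>F t in nhds u. ok j x y t e" "\<forall>\<^sub>F t in nhds e. ok j x y u t"
proof -
  obtain \<delta> where d: "\<delta> > 0" "\<And>x' y' u' e'. dist x x' < \<delta> \<Longrightarrow> dist y y' < \<delta> \<Longrightarrow> dist u u' < \<delta> \<Longrightarrow> dist e e' < \<delta> \<Longrightarrow> ok j x' y' u' e'"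
    by (rule ok_box[OF assms]) blast
  show "\<forall>\<^sub>F t in nhds x. ok j t y u e" "\<forall>\<^sub>F t in nhds y. ok j x t u e"
    "\<forall>\<^sub>F t in nhds u. ok j x y t e" "\<forall>\<^sub>F t in nhds e. ok j x y u t"
    unfolding eventually_nhds_metric using d by (auto simp: dist_commute intro!: exI[of _ \<delta>])
qed

lemma slice_isCont:
  assumes "f holomorphic_on S" "open S" "z \<in> S"
  shows "isCont f z" "(f has_field_derivative deriv f z) (at z)"
  using assms holomorphic_on_imp_continuous_on continuous_on_eq_continuous_at holomorphic_derivI by blast+

lemma Gh_lim_quot:
  assumes "ok j x y u 0"
  shows "(gh i x y u \<longlongrightarrow> \<alpha> i j x y u 0 / b j x y u 0) (at 0)"
proof -
  note m = okD[OF assms]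
  have "((\<lambda>e. \<alpha> i j x y u e / b j x y u e) \<longlongrightarrow> \<alpha> i j x y u 0 / b j x y u 0) (at 0)"
    using slice_isCont(1)[OF hol4_slices(4)[OF hol_\<alpha>[OF m(1)] m(2-5)] open_ball zero_mem]
      slice_isCont(1)[OF hol4_slices(4)[OF hol_b[OF m(1)] m(2-5)] open_ball zero_mem] m(6)
    unfolding isCont_def by (intro tendsto_divide)
  moreover have "\<forall>\<^sub>F e in at 0. gh i x y u e = \<alpha> i j x y u e / b j x y u e"
  proof -
    have "\<forall>\<^sub>F e in at 0. ok j x y u e \<and> e \<noteq> 0"
      using ok_nhds(4)[OF assms] by (auto simp: eventually_at_filter elim: eventually_mono)
    then show ?thesis
    proof eventually_elim
      case (elim e)
      then have "g i x y u e = e ^ M * \<alpha> i j x y u e / b j x y u e"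
        using quot[of j x y u e i] a_eq[of j x y u e i] okD[of j x y u e] by auto
      then show ?case using elim by (simp add: gh_def)
    qed
  qed
  ultimately show ?thesis by (simp add: tendsto_cong)
qed

text \<open>\<open>Gh\<close> is defined by a limit that mentions no patch, so this shows in
  particular that the quotients of different patches agree at e = 0 wherever both denominators are
  nonzero.\<close>

lemma Gh_eq:
  assumes "ok j x y u e"
  shows "Gh i x y u e = \<alpha> i j x y u e / b j x y u e"
proof (cases "e = 0")
  case True
  then show ?thesis using tendsto_Lim[OF _ Gh_lim_quot[of j x y u i]] assms by (simp add: Gh_def)
next
  case False
  then show ?thesis
    using quot[of j x y u e i] a_eq[of j x y u e i] okD[OF assms] by (simp add: Gh_def gh_def)
qed

lemma Gh_lim: "ok j x y u 0 \<Longrightarrow> (gh i x y u \<longlongrightarrow> Gh i x y u 0) (at 0)"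
  using Gh_lim_quot Gh_eq by metis

definition quot_deriv :: "complex \<Rightarrow> complex \<Rightarrow> complex \<Rightarrow> complex \<Rightarrow> complex" where
  "quot_deriv p p' q q' = (p' * q - p * q') / q\<^sup>2"

lemma DERIV_quot:
  assumes "(p has_field_derivative p') (at t)" "(q has_field_derivative q') (at t)" "q t \<noteq> 0"
  shows "((\<lambda>t. p t / q t) has_field_derivative quot_deriv (p t) p' (q t) q') (at t)"
  using DERIV_divide[OF assms] by (simp add: quot_deriv_def power2_eq_square)

definition D1 where "D1 i j x y u e = quot_deriv (\<alpha> i j x y u e) (deriv (\<lambda>t. \<alpha> i j t y u e) x) (b j x y u e) (deriv (\<lambda>t. b j t y u e) x)"
definition D2 where "D2 i j x y u e = quot_deriv (\<alpha> i j x y u e) (deriv (\<lambda>t. \<alpha> i j x t u e) y) (b j x y u e) (deriv (\<lambda>t. b j x t u e) y)"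
definition D3 where "D3 i j x y u e = quot_deriv (\<alpha> i j x y u e) (deriv (\<lambda>t. \<alpha> i j x y t e) u) (b j x y u e) (deriv (\<lambda>t. b j x y t e) u)"

lemma Gh_DERIV:
  assumes "ok j x y u e"
  shows "((\<lambda>t. Gh i t y u e) has_field_derivative D1 i j x y u e) (at x)"
    "((\<lambda>t. Gh i x t u e) has_field_derivative D2 i j x y u e) (at y)"
    "((\<lambda>t. Gh i x y t e) has_field_derivative D3 i j x y u e) (at u)"
proof -
  note m = okD[OF assms]
  note s\<alpha> = hol4_slices[OF hol_\<alpha>[OF m(1)] m(2-5)] and sb = hol4_slices[OF hol_b[OF m(1)] m(2-5)]
  have oW: "open (W j)" using W m(1) by blast
  have "\<forall>\<^sub>F t in nhds x. Gh i t y u e = \<alpha> i j t y u e / b j t y u e"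
    using ok_nhds(1)[OF assms] by eventually_elim (rule Gh_eq)
  from DERIV_cong_ev[OF refl this refl] show "((\<lambda>t. Gh i t y u e) has_field_derivative D1 i j x y u e) (at x)"
    using DERIV_quot[OF slice_isCont(2)[OF s\<alpha>(1) AB(1) m(2)] slice_isCont(2)[OF sb(1) AB(1) m(2)] m(6)] unfolding D1_def by blast
  have "\<forall>\<^sub>F t in nhds y. Gh i x t u e = \<alpha> i j x t u e / b j x t u e"
    using ok_nhds(2)[OF assms] by eventually_elim (rule Gh_eq)
  from DERIV_cong_ev[OF refl this refl] show "((\<lambda>t. Gh i x t u e) has_field_derivative D2 i j x y u e) (at y)"
    using DERIV_quot[OF slice_isCont(2)[OF s\<alpha>(2) AB(3) m(3)] slice_isCont(2)[OF sb(2) AB(3) m(3)] m(6)] unfolding D2_def by blast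
  have "\<forall>\<^sub>F t in nhds u. Gh i x y t e = \<alpha> i j x y t e / b j x y t e"
    using ok_nhds(3)[OF assms] by eventually_elim (rule Gh_eq)
  from DERIV_cong_ev[OF refl this refl] show "((\<lambda>t. Gh i x y t e) has_field_derivative D3 i j x y u e) (at u)"
    using DERIV_quot[OF slice_isCont(2)[OF s\<alpha>(3) oW m(4)] slice_isCont(2)[OF sb(3) oW m(4)] m(6)] unfolding D3_def by blast
qed

lemma D_continuous: "continuous_on (Ok j) (\<lambda>(x, y, u, e). D1 i j x y u e)" "continuous_on (Ok j) (\<lambda>(x, y, u, e). D2 i j x y u e)"
    "continuous_on (Ok j) (\<lambda>(x, y, u, e). D3 i j x y u e)" "continuous_on (Ok j) (\<lambda>(x, y, u, e). \<alpha> i j x y u e / b j x y u e)"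
proof -
  have "continuous_on (Ok j) (\<lambda>(x, y, u, e). D1 i j x y u e) \<and> continuous_on (Ok j) (\<lambda>(x, y, u, e). D2 i j x y u e) \<and>
      continuous_on (Ok j) (\<lambda>(x, y, u, e). D3 i j x y u e) \<and> continuous_on (Ok j) (\<lambda>(x, y, u, e). \<alpha> i j x y u e / b j x y u e)"
  proof (cases "j \<in> J")
    case True
    have oW: "open (W j)" using W True by blast
    have sub: "Ok j \<subseteq> A \<times> B \<times> W j \<times> ball 0 \<rho>" by (auto simp: Ok_def ok_def)
    have nz: "b j (fst p) (fst (snd p)) (fst (snd (snd p))) (snd (snd (snd p))) \<noteq> 0" if "p \<in> Ok j" for p
      using that by (auto simp: Ok_def ok_def)
    note c\<alpha> = hol4_deriv_continuous[OF hol_\<alpha>[OF True, of i] AB(1,3) oW open_ball, THEN continuous_on_subset, OF sub]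
      and cb = hol4_deriv_continuous[OF hol_b[OF True] AB(1,3) oW open_ball, THEN continuous_on_subset, OF sub]
      and c0\<alpha> = hol4_continuous[OF hol_\<alpha>[OF True, of i], THEN continuous_on_subset, OF sub]
      and c0b = hol4_continuous[OF hol_b[OF True], THEN continuous_on_subset, OF sub]
    show "continuous_on (Ok j) (\<lambda>(x, y, u, e). D1 i j x y u e) \<and> continuous_on (Ok j) (\<lambda>(x, y, u, e). D2 i j x y u e) \<and>
      continuous_on (Ok j) (\<lambda>(x, y, u, e). D3 i j x y u e) \<and> continuous_on (Ok j) (\<lambda>(x, y, u, e). \<alpha> i j x y u e / b j x y u e)"
      using c\<alpha> cb c0\<alpha> c0b nz
      unfolding D1_def D2_def D3_def quot_deriv_def case_prod_unfold
      by (intro conjI continuous_on_divide continuous_on_diff continuous_on_mult continuous_on_power) auto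
  qed (auto simp: Ok_def ok_def case_prod_unfold)
  then show "continuous_on (Ok j) (\<lambda>(x, y, u, e). D1 i j x y u e)" "continuous_on (Ok j) (\<lambda>(x, y, u, e). D2 i j x y u e)"
    "continuous_on (Ok j) (\<lambda>(x, y, u, e). D3 i j x y u e)" "continuous_on (Ok j) (\<lambda>(x, y, u, e). \<alpha> i j x y u e / b j x y u e)"
    by blast+
qed

lemma D_isCont:
  fixes f :: "'z::t2_space \<Rightarrow> _"
  assumes "ok j x y u e" and f: "isCont f t" "f t = (x, y, u, e)"
  shows "isCont (\<lambda>t. (\<lambda>(x, y, u, e). D1 i j x y u e) (f t)) t" "isCont (\<lambda>t. (\<lambda>(x, y, u, e). D2 i j x y u e) (f t)) t"
    "isCont (\<lambda>t. (\<lambda>(x, y, u, e). D3 i j x y u e) (f t)) t" "isCont (\<lambda>t. (\<lambda>(x, y, u, e). \<alpha> i j x y u e / b j x y u e) (f t)) t"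
proof -
  have "(x, y, u, e) \<in> Ok j" using assms(1) by (simp add: Ok_def)
  then have c: "continuous_on (Ok j) h \<Longrightarrow> isCont h (f t)" for h :: "_ \<Rightarrow> complex"
    using continuous_on_eq_continuous_at[OF open_Ok, of j h] f(2) by auto
  show "isCont (\<lambda>t. (\<lambda>(x, y, u, e). D1 i j x y u e) (f t)) t" "isCont (\<lambda>t. (\<lambda>(x, y, u, e). D2 i j x y u e) (f t)) t"
    "isCont (\<lambda>t. (\<lambda>(x, y, u, e). D3 i j x y u e) (f t)) t" "isCont (\<lambda>t. (\<lambda>(x, y, u, e). \<alpha> i j x y u e / b j x y u e) (f t)) t"
    by (intro isCont_o2[OF f(1)] c D_continuous)+
qed

lemma D_pde:
  assumes "ok j x y u e" "e \<noteq> 0"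
  shows "(x + e * wu x y u) * D3 i j x y u e + e * (wx x y u * D1 i j x y u e + wy x y u * D2 i j x y u e) =
     e * (k i True x y u * Gh True x y u e + k i False x y u * Gh False x y u e)"
proof -
  note m = okD[OF assms(1)]
  obtain d1 d2 d3 where d: "((\<lambda>t. g i t y u e) has_field_derivative d1) (at x)"
     "((\<lambda>t. g i x t u e) has_field_derivative d2) (at y)" "((\<lambda>t. g i x y t e) has_field_derivative d3) (at u)"
     and eq: "(x + e * wu x y u) * d3 + e * (wx x y u * d1 + wy x y u * d2) =
            e * (k i True x y u * g True x y u e + k i False x y u * g False x y u e)"
    using pde[OF m(1-5) assms(2) m(6)] by blast
  have gG: "g i x y u e = e ^ M * Gh i x y u e" for i x y u using assms(2) by (simp add: Gh_def gh_def)
  have "d1 = e ^ M * D1 i j x y u e" "d2 = e ^ M * D2 i j x y u e" "d3 = e ^ M * D3 i j x y u e"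
    using d Gh_DERIV[OF assms(1), of i] unfolding gG
    by (auto intro!: DERIV_unique DERIV_cmult)
  with eq have "e ^ M * ((x + e * wu x y u) * D3 i j x y u e + e * (wx x y u * D1 i j x y u e + wy x y u * D2 i j x y u e)) =
     e ^ M * (e * (k i True x y u * Gh True x y u e + k i False x y u * Gh False x y u e))"
    unfolding gG by (simp add: algebra_simps)
  then show ?thesis using assms(2) by simp
qed

text \<open>As e tends to 0 every term of the differential equation except \<open>x * D3\<close>
  disappears, and 0 is not an amplitude in \<open>A\<close>.\<close>

lemma D3_zero:
  assumes "ok j x y u 0"
  shows "D3 i j x y u 0 = 0"
proof -
  have c: "isCont (\<lambda>e::complex. (x, y, u, e)) 0" by (intro continuous_intros)
  note cc = D_isCont[OF assms c refl, unfolded case_prod_conv isCont_def]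
  have lim: "((\<lambda>e. (x + e * wu x y u) * D3 i j x y u e + e * (wx x y u * D1 i j x y u e + wy x y u * D2 i j x y u e) -
     e * (k i True x y u * (\<alpha> True j x y u e / b j x y u e) + k i False x y u * (\<alpha> False j x y u e / b j x y u e))) \<longlongrightarrow>
    (x + 0 * wu x y u) * D3 i j x y u 0 + 0 * (wx x y u * D1 i j x y u 0 + wy x y u * D2 i j x y u 0) -
     0 * (k i True x y u * (\<alpha> True j x y u 0 / b j x y u 0) + k i False x y u * (\<alpha> False j x y u 0 / b j x y u 0))) (at 0)"
    by (intro tendsto_intros cc) 
  have ev: "\<forall>\<^sub>F e in at 0. (x + e * wu x y u) * D3 i j x y u e + e * (wx x y u * D1 i j x y u e + wy x y u * D2 i j x y u e) -
     e * (k i True x y u * (\<alpha> True j x y u e / b j x y u e) + k i False x y u * (\<alpha> False j x y u e / b j x y u e)) = 0"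
  proof -
    have "\<forall>\<^sub>F e in at 0. ok j x y u e \<and> e \<noteq> 0"
      using ok_nhds(4)[OF assms] by (auto simp: eventually_at_filter elim: eventually_mono)
    then show ?thesis
    proof eventually_elim
      case (elim e)
      then have o: "ok j x y u e" and "e \<noteq> 0" by auto
      from D_pde[OF this, of i] show ?case unfolding Gh_eq[OF o] by simp
    qed
  qed
  have "x * D3 i j x y u 0 = 0"
    using LIM_unique[OF lim tendsto_eventually[OF ev]] by simp
  then show ?thesis using AB(5) okD(2)[OF assms] by auto
qed

text \<open>Times at which some patch has a nonzero denominator at e = 0. For generic (x, y) only
  countably many times of \<open>\<Omega>\<close> are missing.\<close>

definition good where "good x y = {u. \<exists>j. ok j x y u 0}"

text \<open>The u-derivative vanishes on a whole box, so constancy in u holds simultaneously for all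
  nearby x' and y'; this uniformity is what passes to the partial derivatives in x and y.\<close>

lemma good_locally_constant:
  assumes "ok j x y u 0"
  obtains \<delta> where "\<delta> > 0" "\<And>x' y' u'. dist x x' < \<delta> \<Longrightarrow> dist y y' < \<delta> \<Longrightarrow> dist u u' < \<delta> \<Longrightarrow>
    ok j x' y' u' 0 \<and> (\<forall>i. Gh i x' y' u' 0 = Gh i x' y' u 0)"
proof -
  obtain \<delta> where d: "\<delta> > 0" "\<And>x' y' u' e'. dist x x' < \<delta> \<Longrightarrow> dist y y' < \<delta> \<Longrightarrow> dist u u' < \<delta> \<Longrightarrow> dist 0 e' < \<delta> \<Longrightarrow> ok j x' y' u' e'"
    by (rule ok_box[OF assms]) blast
  show ?thesis
  proof (rule that[OF d(1)])
    fix x' y' u' assume m: "dist x x' < \<delta>" "dist y y' < \<delta>" "dist u u' < \<delta>"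
    have okb: "ok j x' y' v 0" if "v \<in> ball u \<delta>" for v using d(2)[OF m(1,2), of v 0] that d(1) by simp
    have "Gh i x' y' u' 0 = Gh i x' y' u 0" for i
    proof -
      have "((\<lambda>t. Gh i x' y' t 0) has_field_derivative 0) (at v within ball u \<delta>)" if "v \<in> ball u \<delta>" for v
        using Gh_DERIV(3)[OF okb[OF that], of i] D3_zero[OF okb[OF that], of i] has_field_derivative_at_within by metis
      then obtain c where "\<forall>v\<in>ball u \<delta>. Gh i x' y' v 0 = c"
        using has_field_derivative_zero_constant[OF convex_ball] by blast
      then show ?thesis using m d(1) by simp
    qed
    then show "ok j x' y' u' 0 \<and> (\<forall>i. Gh i x' y' u' 0 = Gh i x' y' u 0)" using okb m by auto
  qed
qed

text \<open>A connected open set of the plane minus a countable set stays connected, and a locally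
  constant function on it is constant. Values on different patches are thus compared without
  crossing zeros of denominators.\<close>

lemma good_constant:
  assumes cnt: "countable (\<Omega> - good x y)" and v: "v \<in> good x y" and w: "w \<in> good x y"
  shows "Gh i x y v 0 = Gh i x y w 0" "deriv (\<lambda>t. Gh i t y v 0) x = deriv (\<lambda>t. Gh i t y w 0) x"
    "deriv (\<lambda>t. Gh i x t v 0) y = deriv (\<lambda>t. Gh i x t w 0) y"
proof -
  have gO: "good x y \<subseteq> \<Omega>" by (auto simp: good_def ok_def)
  then have "good x y = \<Omega> - (\<Omega> - good x y)" by auto
  then have con: "connected (good x y)"
    using connected_open_diff_countable[OF _ open_\<Omega> conn cnt] by simp
  let ?f = "\<lambda>v. (Gh i x y v 0, deriv (\<lambda>t. Gh i t y v 0) x, deriv (\<lambda>t. Gh i x t v 0) y)"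
  have "?f v = ?f w"
  proof (rule connected_local_const[OF con v w], rule ballI)
    fix v assume "v \<in> good x y"
    then obtain j where j: "ok j x y v 0" by (auto simp: good_def)
    obtain \<delta> where d: "\<delta> > 0" "\<And>x' y' u'. dist x x' < \<delta> \<Longrightarrow> dist y y' < \<delta> \<Longrightarrow> dist v u' < \<delta> \<Longrightarrow>
      ok j x' y' u' 0 \<and> (\<forall>i. Gh i x' y' u' 0 = Gh i x' y' v 0)"
      by (rule good_locally_constant[OF j]) blast
    have "?f v = ?f w" if w: "dist v w < \<delta>" for w
    proof -
      have eq: "Gh i x' y' v 0 = Gh i x' y' w 0" if "dist x' x < \<delta>" "dist y' y < \<delta>" for x' y'
        using d(2)[of x' y' w] that w by (simp add: dist_commute)
      have "\<forall>\<^sub>F t in nhds x. Gh i t y v 0 = Gh i t y w 0" "\<forall>\<^sub>F t in nhds y. Gh i x t v 0 = Gh i x t w 0"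
        unfolding eventually_nhds_metric using d(1) eq[of _ y] eq[of x] by (metis dist_self)+
      from deriv_cong_ev[OF this(1) refl] deriv_cong_ev[OF this(2) refl] eq[of x y] d(1)
      show ?thesis by simp
    qed
    then show "\<forall>\<^sub>F w in at v within good x y. ?f v = ?f w"
      unfolding eventually_at using d(1) by (metis dist_commute)
  qed
  then show "Gh i x y v 0 = Gh i x y w 0" "deriv (\<lambda>t. Gh i t y v 0) x = deriv (\<lambda>t. Gh i t y w 0) x"
    "deriv (\<lambda>t. Gh i x t v 0) y = deriv (\<lambda>t. Gh i x t w 0) y" by simp_all
qed

lemma generic_point:
  assumes "open A'" "A' \<noteq> {}" "A' \<subseteq> A" "open B'" "B' \<noteq> {}" "B' \<subseteq> B"
  obtains x y where "x \<in> A'" "y \<in> B'" "countable (\<Omega> - good x y)"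
proof -
  obtain x y where xy: "x \<in> A'" "y \<in> B'" "\<And>j. j \<in> J \<Longrightarrow> countable {u \<in> W j. b j x y u 0 = 0}"
    using hol4_generic[of J b A B W "ball 0 \<rho>" 0, OF J hol_b AB(1-4) W zero_mem b0 assms] by blast
  have "countable (\<Union>j\<in>J. {u \<in> W j. b j x y u 0 = 0})"
    using J xy(3) by (intro countable_UN) (auto intro: countable_finite)
  moreover have "\<Omega> - good x y \<subseteq> (\<Union>j\<in>J. {u \<in> W j. b j x y u 0 = 0})"
    using xy assms \<rho> by (auto simp: good_def ok_def)
  ultimately have "countable (\<Omega> - good x y)" using countable_subset by blast
  with xy that show ?thesis by blast
qed

end

section \<open>The order-one equation, integrated around the pole\<close>

context normalised_family
begin

text \<open>The bad times are countable, hence so are their distances from \<open>c0\<close>,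
  whereas the radii between \<open>r1\<close> and \<open>r2\<close> are uncountable.\<close>

lemma good_circle:
  assumes cnt: "countable (\<Omega> - good x y)"
  obtains r where "r1 < r" "r < r2" "sphere c0 r \<subseteq> good x y"
proof -
  have "countable (dist c0 ` (\<Omega> - good x y))" using cnt by simp
  moreover have "uncountable {r1<..<r2}" using ring by (simp add: uncountable_open_interval)
  ultimately have "\<not> {r1<..<r2} \<subseteq> dist c0 ` (\<Omega> - good x y)" using countable_subset by blast
  then obtain r where "r \<in> {r1<..<r2}" and r3: "r \<notin> dist c0 ` (\<Omega> - good x y)" by blast
  then have r: "r1 < r" "r < r2" by auto
  have "sphere c0 r \<subseteq> good x y"
  proof
    fix u assume "u \<in> sphere c0 r"
    then have u: "r = dist c0 u" by simp
    have uO: "u \<in> \<Omega>" by (rule ring(3)) (use r u in auto)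
    have "r \<in> dist c0 ` (\<Omega> - good x y)" if "u \<notin> good x y"
      by (rule image_eqI[of r "dist c0" u]) (use that uO u in auto)
    then show "u \<in> good x y" using r3 by blast
  qed
  with r that show ?thesis by blast
qed

lemma continuous_on_partials:
  shows "continuous_on {(e, u). \<exists>j. ok j x y u e} (\<lambda>(e, u). deriv (\<lambda>t. Gh i t y u e) x)"
    "continuous_on {(e, u). \<exists>j. ok j x y u e} (\<lambda>(e, u). deriv (\<lambda>t. Gh i x t u e) y)"
    "continuous_on {(e, u). \<exists>j. ok j x y u e} (\<lambda>(e, u). deriv (\<lambda>t. Gh i x y t e) u)"
    "continuous_on {(e, u). \<exists>j. ok j x y u e} (\<lambda>(e, u). Gh i x y u e)"
    and open_partials: "open {(e, u). \<exists>j. ok j x y u e}"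
proof -
  define f where "f = (\<lambda>p :: complex \<times> complex. (x, y, snd p, fst p))"
  have fc: "continuous_on UNIV f" unfolding f_def by (intro continuous_intros)
  have op: "open (f -` Ok j)" for j by (rule open_vimage[OF open_Ok fc])
  have U: "{(e, u). \<exists>j. ok j x y u e} = (\<Union>j. f -` Ok j)" by (auto simp: f_def Ok_def)
  show "open {(e, u). \<exists>j. ok j x y u e}" unfolding U using op by blast
  have piece: "continuous_on {(e, u). \<exists>j. ok j x y u e} h"
    if "\<And>j. continuous_on (Ok j) (k j)" "\<And>j u e. ok j x y u e \<Longrightarrow> h (e, u) = k j (x, y, u, e)" for h :: "_ \<Rightarrow> complex" and k
    unfolding U
  proof (rule continuous_on_open_UN[OF op])
    fix j
    have "continuous_on (f -` Ok j) (\<lambda>p. k j (f p))"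
      by (rule continuous_on_compose2[OF that(1) continuous_on_subset[OF fc]]) auto
    then show "continuous_on (f -` Ok j) h"
      by (rule continuous_on_eq) (use that(2) in \<open>auto simp: f_def Ok_def\<close>)
  qed
  show "continuous_on {(e, u). \<exists>j. ok j x y u e} (\<lambda>(e, u). deriv (\<lambda>t. Gh i t y u e) x)"
    by (rule piece[OF D_continuous(1)]) (auto simp: DERIV_imp_deriv[OF Gh_DERIV(1)])
  show "continuous_on {(e, u). \<exists>j. ok j x y u e} (\<lambda>(e, u). deriv (\<lambda>t. Gh i x t u e) y)"
    by (rule piece[OF D_continuous(2)]) (auto simp: DERIV_imp_deriv[OF Gh_DERIV(2)])
  show "continuous_on {(e, u). \<exists>j. ok j x y u e} (\<lambda>(e, u). deriv (\<lambda>t. Gh i x y t e) u)"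
    by (rule piece[OF D_continuous(3)]) (auto simp: DERIV_imp_deriv[OF Gh_DERIV(3)])
  show "continuous_on {(e, u). \<exists>j. ok j x y u e} (\<lambda>(e, u). Gh i x y u e)"
    by (rule piece[OF D_continuous(4)]) (auto simp: Gh_eq)
qed

text \<open>For e \<noteq> 0 the equation divided by e reads
  \<open>G e u = (- x / e) * T3 e u\<close>, and \<open>T3 e\<close> is the derivative of a
  single-valued function on the circle, so \<open>G e\<close> integrates to zero. The integral is
  continuous at e = 0, where \<open>T3\<close> vanishes and the other unknowns do not depend on u;
  they come out of the integral and leave \<open>R\<close> and \<open>K\<close>.\<close>

lemma ring_identity:
  assumes xy: "x \<in> A" "y \<in> B" and cnt: "countable (\<Omega> - good x y)" and u1: "u1 \<in> good x y"
  shows "R x y * deriv (\<lambda>t. Gh i t y u1 0) x = K i True x y * Gh True x y u1 0 + K i False x y * Gh False x y u1 0"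
proof -
  obtain r where r: "r1 < r" "r < r2" "sphere c0 r \<subseteq> good x y" by (rule good_circle[OF cnt])
  have r0: "r > 0" using r ring by simp
  define S where "S = sphere c0 r"
  define O' where "O' = {(e, u). \<exists>j. ok j x y u e}"
  have "{0} \<times> S \<subseteq> O'" using r(3) by (auto simp: O'_def S_def good_def)
  \<comment> \<open>Compactness of the circle yields one neighbourhood of e = 0 over which every
    point of the circle is regular.\<close>
  then obtain X where X: "0 \<in> X" "open X" "X \<times> S \<subseteq> O'"
    using Elementary_Topology.tube_lemma[of S O' 0] open_partials[of x y] unfolding O'_def S_def by auto
  have SO: "S \<subseteq> \<Omega>" using r(3) by (auto simp: S_def good_def ok_def)
  have pi: "path_image (circlepath c0 r) = S" using r0 by (simp add: S_def)
  define T1 T2 T3 where "T1 = (\<lambda>e u. deriv (\<lambda>t. Gh i t y u e) x)"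
    and "T2 = (\<lambda>e u. deriv (\<lambda>t. Gh i x t u e) y)" and "T3 = (\<lambda>e u. deriv (\<lambda>t. Gh i x y t e) u)"
  define G where "G = (\<lambda>e u. wu x y u * T3 e u + wx x y u * T1 e u + wy x y u * T2 e u
      - (k i True x y u * Gh True x y u e + k i False x y u * Gh False x y u e))"
  have cont: "continuous_on (X \<times> S) (\<lambda>(e, u). G e u)"
  proof -
    have w: "continuous_on (X \<times> S) (\<lambda>p. h (snd p))" if "continuous_on \<Omega> h" for h :: "complex \<Rightarrow> complex"
      by (rule continuous_on_compose2[OF that]) (use SO in \<open>auto intro!: continuous_intros\<close>)
    note c = continuous_on_partials(1-4)[of x y, folded O'_def, THEN continuous_on_subset, OF X(3), unfolded case_prod_unfold]
    show ?thesis
      unfolding G_def case_prod_unfold T1_def T2_def T3_def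
      by (intro continuous_intros c w) (use cont_w[OF xy] cont_k[OF xy] in auto)
  qed
  have T3_int: "(T3 e has_contour_integral 0) (circlepath c0 r)" if e: "e \<in> X" for e
  proof (rule Cauchy_theorem_primitive[where S = S and f = "\<lambda>t. Gh i x y t e"])
    fix u assume "u \<in> S"
    then obtain j where "ok j x y u e" using X(3) e by (auto simp: O'_def)
    from Gh_DERIV(3)[OF this, of i] show "((\<lambda>t. Gh i x y t e) has_field_derivative T3 e u) (at u within S)"
      unfolding T3_def using DERIV_imp_deriv has_field_derivative_at_within by metis
  qed (use pi in auto)
  have G_int: "(G e has_contour_integral 0) (circlepath c0 r)" if e: "e \<in> X" "e \<noteq> 0" for e
  proof -
    have "((\<lambda>u. (- x / e) * T3 e u) has_contour_integral (- x / e) * 0) (circlepath c0 r)"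
      by (rule has_contour_integral_lmul[OF T3_int[OF e(1)]])
    then have "((\<lambda>u. (- x / e) * T3 e u) has_contour_integral 0) (circlepath c0 r)" by simp
    then show ?thesis
    proof (rule has_contour_integral_eq)
      fix u assume "u \<in> path_image (circlepath c0 r)"
      then have "(e, u) \<in> O'" using X(3) e pi by blast
      then obtain j where j: "ok j x y u e" by (auto simp: O'_def)
      have T: "T1 e u = D1 i j x y u e" "T2 e u = D2 i j x y u e" "T3 e u = D3 i j x y u e"
        using Gh_DERIV[OF j] by (auto simp: T1_def T2_def T3_def intro!: DERIV_imp_deriv)
      from D_pde[OF j e(2), of i, folded T] show "(- x / e) * T3 e u = G e u"
        using e(2) by (simp add: G_def field_simps)
    qed
  qed
  have "continuous_on X (\<lambda>e. contour_integral (circlepath c0 r) (G e))"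
    by (rule continuous_on_contour_integral_circlepath[OF _ r0]) (use cont in \<open>simp add: S_def\<close>)
  then have lim: "isCont (\<lambda>e. contour_integral (circlepath c0 r) (G e)) 0"
    using X continuous_on_eq_continuous_at by blast
  have ev: "\<forall>\<^sub>F e in at 0. contour_integral (circlepath c0 r) (G e) = 0"
    using eventually_at_in_open[OF X(2,1)]
  proof eventually_elim
    case (elim e)
    then show ?case using contour_integral_unique[OF G_int[of e]] by blast
  qed
  have G0: "contour_integral (circlepath c0 r) (G 0) = 0"
    by (rule LIM_unique[OF lim[unfolded isCont_def] tendsto_eventually[OF ev]])
  have "((\<lambda>u. wx x y u * T1 0 u1 + wy x y u * T2 0 u1 - (k i True x y u * Gh True x y u1 0 + k i False x y u * Gh False x y u1 0))
     has_contour_integral R x y * T1 0 u1 + 0 * T2 0 u1 - (K i True x y * Gh True x y u1 0 + K i False x y * Gh False x y u1 0)) (circlepath c0 r)"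
    using int_w[OF xy r(1,2)] int_k[OF xy r(1,2)]
    by (intro has_contour_integral_add has_contour_integral_diff has_contour_integral_rmul) auto
  then have "(G 0 has_contour_integral R x y * T1 0 u1 + 0 * T2 0 u1 - (K i True x y * Gh True x y u1 0 + K i False x y * Gh False x y u1 0)) (circlepath c0 r)"
  proof (rule has_contour_integral_eq)
    fix u assume "u \<in> path_image (circlepath c0 r)"
    then have u: "u \<in> good x y" using r(3) pi by (auto simp: S_def)
    then obtain j where j: "ok j x y u 0" by (auto simp: good_def)
    have "T3 0 u = 0" using DERIV_imp_deriv[OF Gh_DERIV(3)[OF j, of i]] D3_zero[OF j, of i] by (simp add: T3_def)
    then show "wx x y u * T1 0 u1 + wy x y u * T2 0 u1 - (k i True x y u * Gh True x y u1 0 + k i False x y u * Gh False x y u1 0) = G 0 u"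
      using good_constant[OF cnt u u1] unfolding G_def T1_def T2_def by simp
  qed
  from contour_integral_unique[OF this] G0 show ?thesis by (simp add: T1_def)
qed

text \<open>Every nonempty open box contains a generic point, so the open set where \<open>F\<close>
  is nonzero must be empty.\<close>

lemma extend_generic:
  fixes F :: "complex \<times> complex \<Rightarrow> complex"
  assumes Z: "open Z" "Z \<subseteq> A \<times> B" and F: "continuous_on Z F"
    and gen: "\<And>x y. (x, y) \<in> Z \<Longrightarrow> countable (\<Omega> - good x y) \<Longrightarrow> F (x, y) = 0" and p: "p \<in> Z"
  shows "F p = 0"
proof (rule ccontr)
  assume nz: "F p \<noteq> 0"
  have "open (Z \<inter> F -` (- {0}))" by (rule continuous_open_preimage[OF F Z(1)]) auto
  moreover obtain x y where xy: "p = (x, y)" by (cases p)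
  then have "(x, y) \<in> Z \<inter> F -` (- {0})" using p nz by auto
  ultimately obtain A' B' where AB': "open A'" "open B'" "x \<in> A'" "y \<in> B'" "A' \<times> B' \<subseteq> Z \<inter> F -` (- {0})"
    using open_prod_elim by (metis mem_Sigma_iff)
  have "A' \<subseteq> A" "B' \<subseteq> B" using AB' Z(2) by blast+
  then obtain x' y' where "x' \<in> A'" "y' \<in> B'" "countable (\<Omega> - good x' y')"
    using generic_point[of A' B'] AB'(1-4) by blast
  then show False using gen[of x' y'] AB'(5) by blast
qed

section \<open>The limit equations at a fixed base time\<close>

context
  fixes j0 u1
  assumes j0: "j0 \<in> J" and u1: "u1 \<in> W j0" "u1 + P0 \<in> \<Omega>"
begin

lemma open_base: "open {(x, y). ok j0 x y u1 0}"
proof -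
  have c: "continuous_on UNIV (\<lambda>p. (fst p, snd p, u1, 0 :: complex))" by (intro continuous_intros)
  have "{(x, y). ok j0 x y u1 0} = (\<lambda>p. (fst p, snd p, u1, 0)) -` Ok j0" by (auto simp: Ok_def)
  then show ?thesis using open_vimage[OF open_Ok c] by simp
qed

lemma base_continuous:
  "continuous_on {(x, y). ok j0 x y u1 0} (\<lambda>(x, y). Gh i x y u1 0)"
  "continuous_on {(x, y). ok j0 x y u1 0} (\<lambda>(x, y). deriv (\<lambda>t. Gh i t y u1 0) x)"
proof -
  have c: "continuous_on {(x, y). ok j0 x y u1 0} (\<lambda>p. (fst p, snd p, u1, 0 :: complex))" by (intro continuous_intros)
  have sub: "(\<lambda>p. (fst p, snd p, u1, 0 :: complex)) ` {(x, y). ok j0 x y u1 0} \<subseteq> Ok j0" by (auto simp: Ok_def)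
  show "continuous_on {(x, y). ok j0 x y u1 0} (\<lambda>(x, y). Gh i x y u1 0)"
    by (rule continuous_on_eq[OF continuous_on_compose2[OF D_continuous(4)[where i = i] c sub]]) (auto simp: Gh_eq)
  show "continuous_on {(x, y). ok j0 x y u1 0} (\<lambda>(x, y). deriv (\<lambda>t. Gh i t y u1 0) x)"
    by (rule continuous_on_eq[OF continuous_on_compose2[OF D_continuous(1)[where i = i] c sub]])
       (auto simp: DERIV_imp_deriv[OF Gh_DERIV(1)])
qed

lemma base_ode:
  assumes "ok j0 x y u1 0"
  shows "R x y * deriv (\<lambda>t. Gh i t y u1 0) x = K i True x y * Gh True x y u1 0 + K i False x y * Gh False x y u1 0"
proof -
  let ?Z = "{(x, y). ok j0 x y u1 0}"
  let ?F = "\<lambda>p. R (fst p) (snd p) * deriv (\<lambda>t. Gh i t (snd p) u1 0) (fst p)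
     - (K i True (fst p) (snd p) * Gh True (fst p) (snd p) u1 0 + K i False (fst p) (snd p) * Gh False (fst p) (snd p) u1 0)"
  have sub: "?Z \<subseteq> A \<times> B" by (auto simp: ok_def)
  have "?F (x, y) = 0"
  proof (rule extend_generic[OF open_base sub])
    show "continuous_on ?Z ?F"
      using base_continuous[unfolded case_prod_unfold] cont_R[unfolded case_prod_unfold, THEN continuous_on_subset, OF sub]
      by (intro continuous_intros) (auto simp: case_prod_unfold)
    fix x y assume xy: "(x, y) \<in> ?Z" "countable (\<Omega> - good x y)"
    then have "x \<in> A" "y \<in> B" "u1 \<in> good x y" by (auto simp: ok_def good_def)
    from ring_identity[OF this(1,2) xy(2) this(3), of i] show "?F (x, y) = 0" by simp
  qed (use assms in auto)
  then show ?thesis by simp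
qed

text \<open>The shifted time \<open>u1 + P0\<close> may itself be bad. A nearby \<open>u\<close> is
  chosen for which \<open>u\<close> and \<open>u + P0\<close> are both good; there the relation is
  passed to the limit e = 0, and constancy in time transports it back to \<open>u1\<close>.\<close>

lemma base_twist:
  assumes "ok j0 x y u1 0" "ok j0 x (y + \<kappa> x) u1 0"
  shows "Gh True x y u1 0 = Gh True x (y + \<kappa> x) u1 0 \<and>
     Gh False x y u1 0 = Gh False x (y + \<kappa> x) u1 0 + \<tau> x * Gh True x (y + \<kappa> x) u1 0"
proof -
  let ?Z0 = "{(x, y). ok j0 x y u1 0}"
  have sub0: "?Z0 \<subseteq> A \<times> B" by (auto simp: ok_def)
  have c\<kappa>: "continuous_on ?Z0 (\<lambda>p. (fst p, snd p + \<kappa> (fst p)))" and c\<tau>: "continuous_on ?Z0 (\<lambda>p. \<tau> (fst p))"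
    using sub0 by (auto intro!: continuous_intros continuous_on_compose2[OF cont_tw(1)] continuous_on_compose2[OF cont_tw(2)])
  define Z where "Z = ?Z0 \<inter> (\<lambda>p. (fst p, snd p + \<kappa> (fst p))) -` ?Z0"
  have oZ: "open Z" unfolding Z_def by (rule continuous_open_preimage[OF c\<kappa> open_base open_base])
  have ZZ: "Z \<subseteq> ?Z0" by (auto simp: Z_def)
  have subZ: "Z \<subseteq> A \<times> B" using ZZ sub0 by blast
  have cG: "continuous_on Z (\<lambda>p. Gh i (fst p) (snd p) u1 0)" for i
    using continuous_on_subset[OF base_continuous(1) ZZ] by (simp add: case_prod_unfold)
  have cG': "continuous_on Z (\<lambda>p. Gh i (fst p) (snd p + \<kappa> (fst p)) u1 0)" for i
    using continuous_on_compose2[OF base_continuous(1)[of i] continuous_on_subset[OF c\<kappa> ZZ]]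
    by (force simp: Z_def case_prod_unfold)
  have key: "Gh True x y u1 0 = Gh True x (y + \<kappa> x) u1 0 \<and>
     Gh False x y u1 0 = Gh False x (y + \<kappa> x) u1 0 + \<tau> x * Gh True x (y + \<kappa> x) u1 0"
    if Z: "(x, y) \<in> Z" and cnt: "countable (\<Omega> - good x y)" for x y
  proof -
    have o1: "ok j0 x y u1 0" and o2: "ok j0 x (y + \<kappa> x) u1 0" using Z by (auto simp: Z_def)
    obtain \<delta> where d: "\<delta> > 0" "\<And>u'. dist u1 u' < \<delta> \<Longrightarrow> ok j0 x (y + \<kappa> x) u' 0 \<and> (\<forall>i. Gh i x (y + \<kappa> x) u' 0 = Gh i x (y + \<kappa> x) u1 0)"
      using good_locally_constant[OF o2] by (metis dist_self)
    obtain \<eta> where \<eta>: "\<eta> > 0" "ball (u1 + P0) \<eta> \<subseteq> \<Omega>" using u1(2) open_\<Omega> open_contains_ball by blast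
    have oW: "open (W j0)" using W j0 by blast
    obtain \<eta>' where \<eta>': "\<eta>' > 0" "ball u1 \<eta>' \<subseteq> W j0" using u1(1) oW open_contains_ball by blast
    define B1 where "B1 = ball u1 (min \<delta> (min \<eta> \<eta>'))"
    have "countable ((\<Omega> - good x y) \<union> (\<lambda>v. v - P0) ` (\<Omega> - good x y))" using cnt by simp
    moreover have "uncountable B1" using d \<eta> \<eta>' by (simp add: B1_def uncountable_ball)
    ultimately obtain u where u: "u \<in> B1" "u \<notin> \<Omega> - good x y" "u \<notin> (\<lambda>v. v - P0) ` (\<Omega> - good x y)"
      using countable_subset by (metis (no_types, lifting) UnI1 UnI2 subsetI)
    have uO: "u \<in> \<Omega>" "u + P0 \<in> \<Omega>"
      using u(1) \<eta>(2) \<eta>'(2) j0 by (auto simp: B1_def subset_iff dist_norm)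
    have ug: "u \<in> good x y" "u + P0 \<in> good x y"
    proof -
      show "u \<in> good x y" using u(2) uO by blast
      have "u \<in> (\<lambda>v. v - P0) ` (\<Omega> - good x y)" if "u + P0 \<notin> good x y"
        by (rule image_eqI[of _ _ "u + P0"]) (use that uO in auto)
      then show "u + P0 \<in> good x y" using u(3) by blast
    qed
    have u1g: "u1 \<in> good x y" using o1 by (auto simp: good_def)
    obtain j1 where j1: "ok j1 x y (u + P0) 0" using ug by (auto simp: good_def)
    have o3: "ok j0 x (y + \<kappa> x) u 0" and G3: "\<And>i. Gh i x (y + \<kappa> x) u 0 = Gh i x (y + \<kappa> x) u1 0"
      using d(2)[of u] u(1) by (auto simp: B1_def)
    have m: "x \<in> A" "y \<in> B" "y + \<kappa> x \<in> B" using o1 o2 by (auto simp: ok_def)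
    have ev: "\<forall>\<^sub>F e in at (0::complex). e \<in> ball 0 \<rho> \<and> e \<noteq> 0"
      using eventually_at_in_open[OF open_ball zero_mem] by eventually_elim auto
    have "\<forall>\<^sub>F e in at 0. gh True x y (u + P0) e = gh True x (y + \<kappa> x) u e"
      using ev by eventually_elim (use twist[OF m _ _ uO] in \<open>auto simp: gh_def\<close>)
    from tendsto_cong[OF this] have T: "Gh True x y (u + P0) 0 = Gh True x (y + \<kappa> x) u 0"
      using Gh_lim[OF j1, of True] Gh_lim[OF o3, of True] LIM_unique by blast
    have "\<forall>\<^sub>F e in at 0. gh False x y (u + P0) e = gh False x (y + \<kappa> x) u e + \<tau> x * gh True x (y + \<kappa> x) u e"
      using ev by eventually_elim (use twist[OF m _ _ uO] in \<open>auto simp: gh_def add_divide_distrib\<close>)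
    note cong = tendsto_cong[OF this]
    have "((\<lambda>e. gh False x (y + \<kappa> x) u e + \<tau> x * gh True x (y + \<kappa> x) u e) \<longlongrightarrow>
        Gh False x (y + \<kappa> x) u 0 + \<tau> x * Gh True x (y + \<kappa> x) u 0) (at 0)"
      by (intro tendsto_intros Gh_lim[OF o3])
    with cong have F: "Gh False x y (u + P0) 0 = Gh False x (y + \<kappa> x) u 0 + \<tau> x * Gh True x (y + \<kappa> x) u 0"
      using Gh_lim[OF j1, of False] LIM_unique by blast
    have "Gh i x y u1 0 = Gh i x y (u + P0) 0" for i by (rule good_constant(1)[OF cnt u1g ug(2)])
    with T F G3 show ?thesis by simp
  qed
  have xyZ: "(x, y) \<in> Z" using assms by (simp add: Z_def)
  have "(\<lambda>p. Gh True (fst p) (snd p) u1 0 - Gh True (fst p) (snd p + \<kappa> (fst p)) u1 0) (x, y) = 0"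
    by (rule extend_generic[OF oZ subZ continuous_on_diff[OF cG cG'] _ xyZ]) (use key in simp)
  moreover have "(\<lambda>p. Gh False (fst p) (snd p) u1 0 - (Gh False (fst p) (snd p + \<kappa> (fst p)) u1 0
      + \<tau> (fst p) * Gh True (fst p) (snd p + \<kappa> (fst p)) u1 0)) (x, y) = 0"
    by (rule extend_generic[OF oZ subZ continuous_on_diff[OF cG continuous_on_add[OF cG'
          continuous_on_mult[OF continuous_on_subset[OF c\<tau> ZZ] cG']]] _ xyZ]) (use key in simp)
  ultimately show ?thesis by simp
qed

text \<open>Normalisation provides a nonzero leading coefficient on some patch, possibly at another
  time. At a point (x, y) that is generic for this numerator and for all denominators at once,
  constancy in time brings it to \<open>u1\<close>.\<close>

lemma base_nonzero:
  assumes "ok j0 x0 y0 u1 0"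
  shows "\<exists>x y i. ok j0 x y u1 0 \<and> Gh i x y u1 0 \<noteq> 0"
proof (rule ccontr)
  assume neg: "\<not> ?thesis"
  obtain j1 i1 x1 y1 v1 where 1: "j1 \<in> J" "x1 \<in> A" "y1 \<in> B" "v1 \<in> W j1" "\<alpha> i1 j1 x1 y1 v1 0 \<noteq> 0" using \<alpha>_nz by blast
  note 0 = 1(5)
  obtain A' B' where AB': "open A'" "open B'" "x0 \<in> A'" "y0 \<in> B'" "A' \<times> B' \<subseteq> {(x, y). ok j0 x y u1 0}"
  proof -
    have "(x0, y0) \<in> {(x, y). ok j0 x y u1 0}" using assms by simp
    from open_prod_elim[OF open_base this] show ?thesis using that by (metis mem_Sigma_iff)
  qed
  \<comment> \<open>The index \<open>None\<close> stands for the numerator and \<open>Some j\<close>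
    for the denominator of patch j, so one application of \<open>hol4_generic\<close> handles them
    together.\<close>
  define J' where "J' = insert None (Some ` J)"
  define c where "c = (\<lambda>oj. case oj of None \<Rightarrow> \<alpha> i1 j1 | Some j \<Rightarrow> b j)"
  define W' where "W' = (\<lambda>oj. case oj of None \<Rightarrow> W j1 | Some j \<Rightarrow> W j)"
  have sub: "A' \<subseteq> A" "B' \<subseteq> B" using AB'(3-5) by (auto simp: ok_def)
  have h: "hol4 (c oj) A B (W' oj) (ball 0 \<rho>)" "open (W' oj) \<and> connected (W' oj)"
     "\<exists>x\<in>A. \<exists>y\<in>B. \<exists>u\<in>W' oj. c oj x y u 0 \<noteq> 0" if ojJ: "oj \<in> J'" for oj
  proof -
    consider "oj = None" | j where "j \<in> J" "oj = Some j" using ojJ by (auto simp: J'_def)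
    then have "hol4 (c oj) A B (W' oj) (ball 0 \<rho>) \<and> (open (W' oj) \<and> connected (W' oj)) \<and>
      (\<exists>x\<in>A. \<exists>y\<in>B. \<exists>u\<in>W' oj. c oj x y u 0 \<noteq> 0)"
    proof cases
      case 1
      have "\<exists>x\<in>A. \<exists>y\<in>B. \<exists>u\<in>W j1. \<alpha> i1 j1 x y u 0 \<noteq> 0" using \<open>x1 \<in> A\<close> \<open>y1 \<in> B\<close> \<open>v1 \<in> W j1\<close> 0 by blast
      with 1 show ?thesis using hol_\<alpha>[OF \<open>j1 \<in> J\<close>, of i1] W[OF \<open>j1 \<in> J\<close>] by (simp add: c_def W'_def)
    next
      case (2 j)
      then show ?thesis using hol_b[OF 2(1)] W[OF 2(1)] b0[OF 2(1)] by (simp add: c_def W'_def)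
    qed
    then show "hol4 (c oj) A B (W' oj) (ball 0 \<rho>)" "open (W' oj) \<and> connected (W' oj)"
     "\<exists>x\<in>A. \<exists>y\<in>B. \<exists>u\<in>W' oj. c oj x y u 0 \<noteq> 0" by blast+
  qed
  have ne: "A' \<noteq> {}" "B' \<noteq> {}" using AB' by auto
  have fJ: "finite J'" using J by (simp add: J'_def)
  obtain x y where xy: "x \<in> A'" "y \<in> B'" "\<And>oj. oj \<in> J' \<Longrightarrow> countable {u \<in> W' oj. c oj x y u 0 = 0}"
    by (rule hol4_generic[where c = c and W = W' and D = "ball 0 \<rho>" and e = 0, OF fJ h(1) AB(1-4) h(2) zero_mem h(3) AB'(1) ne(1) sub(1) AB'(2) ne(2) sub(2)])
       (assumption, assumption, assumption, blast)
  have xyAB: "x \<in> A" "y \<in> B" using xy sub by auto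
  have "countable (\<Union>j\<in>J. {u \<in> W j. b j x y u 0 = 0})"
    using J xy(3)[of "Some _"] by (intro countable_UN) (auto simp: J'_def c_def W'_def intro: countable_finite)
  moreover have "\<Omega> - good x y \<subseteq> (\<Union>j\<in>J. {u \<in> W j. b j x y u 0 = 0})"
    using xyAB \<rho> by (auto simp: good_def ok_def)
  ultimately have cnt: "countable (\<Omega> - good x y)" using countable_subset by blast
  have o: "ok j0 x y u1 0" using xy AB'(5) by auto
  have u1g: "u1 \<in> good x y" using o by (auto simp: good_def)
  have c1: "countable ({u \<in> W j1. \<alpha> i1 j1 x y u 0 = 0} \<union> {u \<in> W j1. b j1 x y u 0 = 0})"
    using xy(3)[of None] xy(3)[of "Some j1"] 1(1) by (auto simp: J'_def c_def W'_def)
  have "uncountable (W j1)"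
  proof -
    obtain r where "r > 0" "ball v1 r \<subseteq> W j1" using W[OF 1(1)] 1(4) by (meson open_contains_ball)
    then show ?thesis using uncountable_ball[of r v1] by (metis countable_subset)
  qed
  then have "\<not> W j1 \<subseteq> {u \<in> W j1. \<alpha> i1 j1 x y u 0 = 0} \<union> {u \<in> W j1. b j1 x y u 0 = 0}"
    using c1 countable_subset by blast
  then obtain v where v: "v \<in> W j1" "\<alpha> i1 j1 x y v 0 \<noteq> 0" "b j1 x y v 0 \<noteq> 0" by auto
  then have ov: "ok j1 x y v 0" using 1(1) xyAB \<rho> by (simp add: ok_def)
  then have vg: "v \<in> good x y" by (auto simp: good_def)
  have "Gh i1 x y v 0 \<noteq> 0" using Gh_eq[OF ov, of i1] v by simp
  then show False using good_constant(1)[OF cnt vg u1g, of i1] neg o by auto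
qed

end

end

section \<open>The functional equations of the leading coefficients\<close>

text \<open>\<open>F\<close> may be singular at the zeros of \<open>b\<close>; these are countable
  and do not disconnect \<open>A\<close>.\<close>

lemma const_off_zeros:
  assumes b: "b holomorphic_on A" "open A" "connected A" and x1: "x1 \<in> A" "b x1 \<noteq> 0"
    and F: "\<And>x. x \<in> A \<Longrightarrow> b x \<noteq> 0 \<Longrightarrow> (F has_field_derivative (0::complex)) (at x)"
    and x: "x \<in> A" "b x \<noteq> 0"
  shows "F x = F x1"
proof -
  define S where "S = A - {x \<in> A. b x = 0}"
  have "connected S"
    unfolding S_def by (rule connected_open_diff_countable[OF _ b(2,3) countable_zeros[OF b x1]]) simp
  moreover have "open S"
  proof -
    have "open (A \<inter> b -` (- {0}))"
      by (rule continuous_open_preimage[OF holomorphic_on_imp_continuous_on[OF b(1)] b(2)]) auto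
    also have "A \<inter> b -` (- {0}) = S" by (auto simp: S_def)
    finally show ?thesis .
  qed
  moreover have d: "(F has_field_derivative 0) (at x)" if "x \<in> S" for x using F that by (auto simp: S_def)
  moreover have "continuous_on S F" using d DERIV_isCont continuous_at_imp_continuous_on by blast
  ultimately obtain c where "\<And>x. x \<in> S \<Longrightarrow> F x = c"
    using DERIV_zero_connected_constant[of S "{}" F] by auto
  then show ?thesis using x x1 by (auto simp: S_def)
qed

lemma uncountable_open_complex: "open (S :: complex set) \<Longrightarrow> S \<noteq> {} \<Longrightarrow> uncountable S"
proof -
  assume S: "open S" "S \<noteq> {}"
  then obtain z where z: "z \<in> S" by auto
  then obtain r where "r > 0" "ball z r \<subseteq> S" using S(1) by (meson open_contains_ball)
  then show ?thesis using uncountable_ball[of r z] by (metis countable_subset)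
qed

lemma open_not_countable: "open (S :: complex set) \<Longrightarrow> S \<noteq> {} \<Longrightarrow> countable Z \<Longrightarrow> \<exists>z\<in>S. z \<notin> Z"
  by (metis countable_subset subsetI uncountable_open_complex)

context
  fixes A B :: "complex set" and b :: "complex \<Rightarrow> complex \<Rightarrow> complex" and \<kappa> :: "complex \<Rightarrow> complex"
    and \<alpha> \<kappa>0 :: complex
  assumes AB: "open A" "connected A" "open B" "connected B" "\<alpha> \<in> A" "0 \<notin> A"
    and b: "\<And>y. y \<in> B \<Longrightarrow> (\<lambda>t. b t y) holomorphic_on A" "\<And>x. x \<in> A \<Longrightarrow> (\<lambda>t. b x t) holomorphic_on B"
    and \<kappa>: "\<And>x. \<kappa> x = \<kappa>0 / x - \<kappa>0 / \<alpha>" "\<kappa>0 \<noteq> 0"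
begin

lemma twist_continuous: "continuous_on A \<kappa>"
  unfolding \<kappa>(1)[abs_def] using AB(6) by (intro continuous_intros) auto

lemma twist_near:
  assumes "s > 0"
  obtains \<delta> where "\<delta> > 0" "ball \<alpha> \<delta> \<subseteq> A" "\<And>x. x \<in> ball \<alpha> \<delta> \<Longrightarrow> norm (\<kappa> x) < s"
proof -
  have "isCont \<kappa> \<alpha>" using twist_continuous AB(1,5) continuous_on_eq_continuous_at by blast
  moreover have "\<kappa> \<alpha> = 0" by (simp add: \<kappa>)
  ultimately obtain d where d: "d > 0" "\<And>x. dist x \<alpha> < d \<Longrightarrow> norm (\<kappa> x) < s"
    using assms unfolding isCont_def LIM_def dist_norm by (metis diff_zero norm_zero)
  obtain d' where "d' > 0" "ball \<alpha> d' \<subseteq> A" using AB(1,5) open_contains_ball by blast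
  moreover have "ball \<alpha> (min d d') \<subseteq> ball \<alpha> d'" by (rule subset_ball) simp
  ultimately show ?thesis using d that[of "min d d'"] by (auto simp: dist_commute)
qed

text \<open>\<open>\<kappa>\<close> is invertible near \<alpha>, with inverse
  \<open>h w = \<kappa>0 / (w + \<kappa>0 / \<alpha>)\<close>. The dependence of the period on the
  amplitude thus makes every small phase shift available.\<close>

lemma twist_onto:
  assumes "\<delta> > 0"
  obtains s where "s > 0" "\<And>w. w \<in> ball 0 s \<Longrightarrow> \<exists>x\<in>ball \<alpha> \<delta>. \<kappa> x = w"
proof -
  have a0: "\<alpha> \<noteq> 0" using AB(5,6) by auto
  define h where "h = (\<lambda>w. \<kappa>0 / (w + \<kappa>0 / \<alpha>))"
  have "isCont h 0" unfolding h_def using a0 \<kappa>(2) by (intro continuous_intros) auto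
  moreover have "h 0 = \<alpha>" using \<kappa>(2) by (simp add: h_def)
  ultimately obtain s1 where s1: "s1 > 0" "\<And>w. norm w < s1 \<Longrightarrow> dist \<alpha> (h w) < \<delta>"
    using assms unfolding continuous_at_eps_delta by (metis dist_0_norm dist_commute)
  have "\<kappa> (h w) = w" if "norm w < norm (\<kappa>0 / \<alpha>)" for w
    using \<kappa>(2) by (simp add: \<kappa> h_def)
  note inv = this
  show ?thesis
  proof (rule that[of "min s1 (norm (\<kappa>0 / \<alpha>))"])
    show "\<exists>x\<in>ball \<alpha> \<delta>. \<kappa> x = w" if "w \<in> ball 0 (min s1 (norm (\<kappa>0 / \<alpha>)))" for w
      using that s1(2)[of w] inv[of w] by (intro bexI[of _ "h w"]) auto
  qed (use s1 a0 \<kappa>(2) in auto)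
qed

text \<open>The relation is known only where \<open>b\<close> is nonzero at both y and the shifted
  phase. For generic x this excludes countably many y, so by continuity of \<open>Q\<close> it holds
  on the whole box.\<close>

lemma extend_twisted:
  fixes Q :: "complex \<times> complex \<Rightarrow> complex"
  assumes y1: "x1 \<in> A" "y1 \<in> B" "b x1 y1 \<noteq> 0" and o: "open A2" "open B2" "A2 \<subseteq> A" "B2 \<subseteq> B"
    and Q: "continuous_on (A2 \<times> B2) Q"
    and z: "\<And>x y. x \<in> A2 \<Longrightarrow> y \<in> B2 \<Longrightarrow> b x y \<noteq> 0 \<Longrightarrow> b x (y + \<kappa> x) \<noteq> 0 \<Longrightarrow> Q (x, y) = 0"
    and sub: "\<And>x y. x \<in> A2 \<Longrightarrow> y \<in> B2 \<Longrightarrow> y + \<kappa> x \<in> B"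
    and xy: "x \<in> A2" "y \<in> B2"
  shows "Q (x, y) = 0"
proof (rule ccontr)
  assume nz: "Q (x, y) \<noteq> 0"
  have op: "open ((A2 \<times> B2) \<inter> Q -` (- {0}))" by (rule continuous_open_preimage[OF Q]) (use o in \<open>auto intro: open_Times\<close>)
  have "(x, y) \<in> (A2 \<times> B2) \<inter> Q -` (- {0})" using xy nz by auto
  from open_prod_elim[OF op this] obtain A' B' where AB': "open A'" "open B'" "x \<in> A'" "y \<in> B'"
     "A' \<times> B' \<subseteq> (A2 \<times> B2) \<inter> Q -` (- {0})" by (metis mem_Sigma_iff)
  have sA: "A' \<subseteq> A2" "B' \<subseteq> B2" using AB' by blast+
  have "countable {x \<in> A. b x y1 = 0}" by (rule countable_zeros[OF b(1)[OF y1(2)] AB(1,2) y1(1,3)])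
  moreover have ne: "A' \<noteq> {}" "B' \<noteq> {}" using AB'(3,4) by auto
  ultimately obtain x' where "x' \<in> A'" "x' \<notin> {x \<in> A. b x y1 = 0}"
    using open_not_countable[OF AB'(1)] by meson
  then have x': "x' \<in> A'" "b x' y1 \<noteq> 0" using sA o by auto
  have x'A: "x' \<in> A" using x' sA o by auto
  have c: "countable {y \<in> B. b x' y = 0}" by (rule countable_zeros[OF b(2)[OF x'A] AB(3,4) y1(2) x'(2)])
  then have cu: "countable ({y \<in> B. b x' y = 0} \<union> (\<lambda>y. y - \<kappa> x') ` {y \<in> B. b x' y = 0})" by simp
  then obtain y' where y': "y' \<in> B'" "y' \<notin> {y \<in> B. b x' y = 0}" "y' \<notin> (\<lambda>y. y - \<kappa> x') ` {y \<in> B. b x' y = 0}"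
    using open_not_countable[OF AB'(2) ne(2) cu] by blast
  have m2: "x' \<in> A2" "y' \<in> B2" using x' y' sA by auto
  then have yB: "y' \<in> B" "y' + \<kappa> x' \<in> B" using sub o by auto
  have "b x' y' \<noteq> 0" using y' yB by auto
  moreover have "y' \<in> (\<lambda>y. y - \<kappa> x') ` {y \<in> B. b x' y = 0}" if "b x' (y' + \<kappa> x') = 0"
    by (rule image_eqI[of _ _ "y' + \<kappa> x'"]) (use that yB in auto)
  then have "b x' (y' + \<kappa> x') \<noteq> 0" using y'(3) by blast
  ultimately have "Q (x', y') = 0" using z x'(1) y'(1) sA by blast
  then show False using AB'(5) x'(1) y'(1) by blast
qed

text \<open>With denominators cleared, the identity theorem is applied in x for fixed y in
  \<open>B1\<close>, then in y for fixed x.\<close>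

lemma proportional_extend:
  assumes a: "\<And>y. y \<in> B \<Longrightarrow> (\<lambda>t. a t y) holomorphic_on A" "\<And>x. x \<in> A \<Longrightarrow> (\<lambda>t. a x t) holomorphic_on B"
    and o: "open B1" "B1 \<noteq> {}" "B1 \<subseteq> B" and x1: "x1 \<in> A" "\<And>y. y \<in> B1 \<Longrightarrow> b x1 y \<noteq> 0"
    and e: "\<And>x y. x \<in> A \<Longrightarrow> y \<in> B1 \<Longrightarrow> b x y \<noteq> 0 \<Longrightarrow> a x y = c * b x y" and xy: "x \<in> A" "y \<in> B"
  shows "a x y = c * b x y"
proof -
  have 1: "a x y = c * b x y" if x: "x \<in> A" and y: "y \<in> B1" for x y
  proof -
    have yB: "y \<in> B" using y o by auto
    have "open (A \<inter> (\<lambda>t. b t y) -` (- {0}))"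
      by (rule continuous_open_preimage[OF holomorphic_on_imp_continuous_on[OF b(1)[OF yB]] AB(1)]) auto
    then show ?thesis
      by (rule analytic_continuation_open[where s' = A])
         (use x1 x y AB a(1)[OF yB] b(1)[OF yB] e in \<open>auto intro!: holomorphic_intros\<close>)
  qed
  show ?thesis
    by (rule analytic_continuation_open[OF o(1) AB(3) o(2) AB(4) o(3)])
       (use a(2)[OF xy(1)] b(2)[OF xy(1)] 1[OF xy(1)] xy in \<open>auto intro!: holomorphic_intros\<close>)
qed

text \<open>Later arguments divide by sin y, by cos y and, at the reference amplitude, by
  \<open>b\<close>. Each has countably many zeros in y, so a ball free of all of them
  exists.\<close>

lemma base_column:
  assumes nz: "x1 \<in> A" "y0 \<in> B" "b x1 y0 \<noteq> 0"
  obtains y1 r where "r > 0" "ball y1 r \<subseteq> B" "\<And>y. y \<in> ball y1 r \<Longrightarrow> b x1 y \<noteq> 0 \<and> sin y \<noteq> 0 \<and> cos y \<noteq> 0"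
proof -
  define h where "h = (\<lambda>y. b x1 y * (sin y * cos y))"
  have hB: "h holomorphic_on B" unfolding h_def by (intro holomorphic_intros b nz)
  have "countable {y \<in> B. b x1 y = 0}" by (rule countable_zeros[OF b(2)[OF nz(1)] AB(3,4) nz(2,3)])
  moreover have "countable {y \<in> UNIV. sin y * cos y = (0::complex)}"
  proof (rule countable_zeros[where z = 1])
    have "sin (of_real 1 :: complex) \<noteq> 0" "cos (of_real 1 :: complex) \<noteq> 0"
      unfolding sin_of_real cos_of_real of_real_eq_0_iff
      using sin_gt_zero_02[of 1] cos_gt_zero[of 1] pi_gt3 by auto
    then show "sin 1 * cos 1 \<noteq> (0::complex)" by simp
  qed (auto intro!: holomorphic_intros)
  ultimately have "countable ({y \<in> B. b x1 y = 0} \<union> {y \<in> UNIV. sin y * cos y = (0::complex)})" by simp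
  moreover have "B \<noteq> {}" using nz(2) by auto
  ultimately obtain y1 where "y1 \<in> B" "y1 \<notin> {y \<in> B. b x1 y = 0} \<union> {y \<in> UNIV. sin y * cos y = (0::complex)}"
    using open_not_countable[OF AB(3)] by meson
  then have y1: "y1 \<in> B" "h y1 \<noteq> 0" by (auto simp: h_def)
  have "open (B \<inter> h -` (- {0}))"
    by (rule continuous_open_preimage[OF holomorphic_on_imp_continuous_on[OF hB] AB(3)]) auto
  moreover have "y1 \<in> B \<inter> h -` (- {0})" using y1 by auto
  ultimately obtain r where "r > 0" "ball y1 r \<subseteq> B \<inter> h -` (- {0})" using open_contains_ball by blast
  then have "ball y1 r \<subseteq> B" "\<And>y. y \<in> ball y1 r \<Longrightarrow> h y \<noteq> 0" by blast+
  then show ?thesis using that[of r y1] \<open>r > 0\<close> unfolding h_def by (metis mult_zero_left mult_zero_right)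
qed

lemma column_DERIV:
  assumes a: "(\<lambda>t. a t y) holomorphic_on A" and y: "y \<in> B" and m: "x \<in> A" "b x y \<noteq> 0"
  shows "((\<lambda>x. a x y / b x y) has_field_derivative deriv (\<lambda>t. a t y / b t y) x) (at x)"
proof -
  have "(\<lambda>x. a x y / b x y) field_differentiable (at x)"
    using a b(1)[OF y] m AB(1)
    by (intro field_differentiable_divide holomorphic_on_imp_differentiable_at[where s = A]) auto
  then show ?thesis using field_differentiable_derivI by blast
qed

lemma column_constant:
  assumes a: "(\<lambda>t. a t y) holomorphic_on A" and y: "y \<in> B" and x0: "x0 \<in> A" "b x0 y \<noteq> 0"
    and d: "\<And>x. x \<in> A \<Longrightarrow> b x y \<noteq> 0 \<Longrightarrow> deriv (\<lambda>t. a t y / b t y) x = 0" and x: "x \<in> A" "b x y \<noteq> 0"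
  shows "a x y / b x y = a x0 y / b x0 y"
proof (rule const_off_zeros[where F = "\<lambda>x. a x y / b x y", OF b(1)[OF y] AB(1,2) x0 _ x])
  fix x assume m: "x \<in> A" "b x y \<noteq> 0"
  from column_DERIV[where a = a, OF a y m] d[OF m] show "((\<lambda>x. a x y / b x y) has_field_derivative 0) (at x)" by simp
qed

text \<open>Where sin y \<noteq> 0 the differential equation makes a / b a function f of y alone.
  The twist gives f y = f (y + \<kappa> x), and as x runs near \<alpha> the shifts fill a
  neighbourhood of 0; hence f is constant on a ball, and the identity theorem extends this.\<close>

lemma scalar_rigidity:
  assumes a: "\<And>y. y \<in> B \<Longrightarrow> (\<lambda>t. a t y) holomorphic_on A" "\<And>x. x \<in> A \<Longrightarrow> (\<lambda>t. a x t) holomorphic_on B"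
    and nz: "x0 \<in> A" "y0 \<in> B" "b x0 y0 \<noteq> 0"
    and ode: "\<And>x y. x \<in> A \<Longrightarrow> y \<in> B \<Longrightarrow> b x y \<noteq> 0 \<Longrightarrow> sin y * deriv (\<lambda>t. a t y / b t y) x = 0"
    and tw: "\<And>x y. x \<in> A \<Longrightarrow> y \<in> B \<Longrightarrow> y + \<kappa> x \<in> B \<Longrightarrow> b x y \<noteq> 0 \<Longrightarrow> b x (y + \<kappa> x) \<noteq> 0 \<Longrightarrow>
       a x y / b x y = a x (y + \<kappa> x) / b x (y + \<kappa> x)"
  shows "\<exists>c. \<forall>x\<in>A. \<forall>y\<in>B. a x y = c * b x y"
proof -
  obtain y1 r where r: "r > 0" "ball y1 r \<subseteq> B" "\<And>y. y \<in> ball y1 r \<Longrightarrow> b x0 y \<noteq> 0 \<and> sin y \<noteq> 0 \<and> cos y \<noteq> 0"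
    by (rule base_column[OF nz]) blast
  define f where "f = (\<lambda>y. a x0 y / b x0 y)"
  have col: "a x y / b x y = f y" if "x \<in> A" "y \<in> ball y1 r" "b x y \<noteq> 0" for x y
    unfolding f_def
  proof (rule column_constant)
    show yB: "y \<in> B" using that r by auto
    show "deriv (\<lambda>t. a t y / b t y) x = 0" if "x \<in> A" "b x y \<noteq> 0" for x
      using ode[OF that(1) yB that(2)] r(3)[OF \<open>y \<in> ball y1 r\<close>] by simp
  qed (use that r nz a in auto)
  have fh: "f holomorphic_on ball y1 r"
    unfolding f_def using r nz(1) by (intro holomorphic_intros holomorphic_on_subset[OF a(2)] holomorphic_on_subset[OF b(2)]) auto
  obtain \<delta> where d: "\<delta> > 0" "ball \<alpha> \<delta> \<subseteq> A" "\<And>x. x \<in> ball \<alpha> \<delta> \<Longrightarrow> norm (\<kappa> x) < r / 2"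
    by (rule twist_near[of "r/2"]) (use r in auto)
  have sub: "y + \<kappa> x \<in> ball y1 r" if "x \<in> ball \<alpha> \<delta>" "y \<in> ball y1 (r/2)" for x y
    using d(3)[OF that(1)] that(2) norm_triangle_ineq4[of "y1 - y" "\<kappa> x"] by (simp add: dist_norm algebra_simps)
  have inv: "f y = f (y + \<kappa> x)" if "x \<in> ball \<alpha> \<delta>" "y \<in> ball y1 (r/2)" for x y
  proof -
    have "(\<lambda>p. f (snd p) - f (snd p + \<kappa> (fst p))) (x, y) = 0"
    proof (rule extend_twisted[OF nz(1) _ _ open_ball open_ball d(2) _ _ _ _ that])
      show "y1 \<in> B" "b x0 y1 \<noteq> 0" "ball y1 (r/2) \<subseteq> B" using r by auto
      show "y + \<kappa> x \<in> B" if "x \<in> ball \<alpha> \<delta>" "y \<in> ball y1 (r/2)" for x y using sub[OF that] r by auto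
      show "continuous_on (ball \<alpha> \<delta> \<times> ball y1 (r/2)) (\<lambda>p. f (snd p) - f (snd p + \<kappa> (fst p)))"
      proof (intro continuous_on_diff continuous_on_compose2[OF holomorphic_on_imp_continuous_on[OF fh]]
            continuous_intros continuous_on_compose2[OF twist_continuous])
      qed (use r d sub in auto)
      fix x y assume m: "x \<in> ball \<alpha> \<delta>" "y \<in> ball y1 (r/2)" "b x y \<noteq> 0" "b x (y + \<kappa> x) \<noteq> 0"
      have xA: "x \<in> A" using m d by auto
      have "y \<in> ball y1 r" using m r by auto
      then show "(\<lambda>p. f (snd p) - f (snd p + \<kappa> (fst p))) (x, y) = 0"
        using col[OF xA _ m(3)] col[OF xA sub[OF m(1,2)] m(4)] tw[OF xA _ _ m(3,4)]
          subsetD[OF r(2)] sub[OF m(1,2)] by simp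
    qed
    then show ?thesis by simp
  qed
  obtain s where s: "s > 0" "\<And>w. w \<in> ball 0 s \<Longrightarrow> \<exists>x\<in>ball \<alpha> \<delta>. \<kappa> x = w" by (rule twist_onto[OF d(1)]) blast
  have fc: "f y = f y1" if "y \<in> ball y1 s" for y
  proof -
    have "y - y1 \<in> ball 0 s" using that by (simp add: dist_norm norm_minus_commute)
    then obtain x where "x \<in> ball \<alpha> \<delta>" "\<kappa> x = y - y1" using s(2) by blast
    then show ?thesis using inv[of x y1] r(1) by simp
  qed
  have "a x y = f y1 * b x y" if "x \<in> A" "y \<in> B" for x y
  proof (rule proportional_extend[OF a, where ?B1.0 = "ball y1 (min r s)" and ?x1.0 = x0])
    fix x y assume m: "x \<in> A" "y \<in> ball y1 (min r s)" "b x y \<noteq> 0"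
    then have "a x y / b x y = f y1" using col[of x y] fc[of y] by auto
    then show "a x y = f y1 * b x y" using m(3) by (simp add: field_simps)
  qed (use r s nz that in auto)
  then show ?thesis by blast
qed

text \<open>The other points with the same fourth power, \<open>- \<alpha>\<close> and
  \<open>\<plusminus> \<i> \<alpha>\<close>, lie at distance greater than
  \<open>norm \<alpha>\<close> from \<alpha>.\<close>

lemma fourth_power_near:
  assumes "x ^ 4 = \<alpha> ^ 4" "dist \<alpha> x < norm \<alpha>"
  shows "x = \<alpha>"
proof -
  have a0: "\<alpha> \<noteq> 0" using AB(5,6) by auto
  define z where "z = x / \<alpha>"
  have z4: "z ^ 4 = 1" using assms(1) a0 by (simp add: z_def power_divide)
  have "norm (z - 1) = dist \<alpha> x / norm \<alpha>" using a0 by (simp add: z_def dist_norm norm_divide[symmetric] diff_divide_distrib norm_minus_commute)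
  then have zn: "norm (z - 1) < 1" using assms(2) a0 by (simp add: divide_less_eq)
  have "(z - 1) * (z + 1) * (z - \<i>) * (z + \<i>) = z ^ 4 - 1"
    by (simp add: algebra_simps power4_eq_xxxx)
  then have "z = 1 \<or> z = - 1 \<or> z = \<i> \<or> z = - \<i>"
    using z4 by (auto simp: eq_neg_iff_add_eq_0)
  moreover have "z \<noteq> - 1" using zn by auto
  moreover have "z \<noteq> \<i>" "z \<noteq> - \<i>"
    using zn by (auto simp: cmod_def)
  ultimately show ?thesis using a0 by (auto simp: z_def)
qed

text \<open>Let f = q / b and g = f cot y. The equations integrate to f independent of x and x^3 (p
  / b) = x^4 g / 4 + h with h independent of x. At x = \<alpha> the shift is zero while the
  coefficient \<kappa>0 / x^2 of p is not, so p vanishes there and h = - \<alpha>^4 g / 4. The twist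
  of p now forces g to be a constant c, that is f = c tan y, and the twist of q makes c (tan y - tan
  (y + w)) independent of y, which is possible only for c = 0.\<close>

lemma vector_rigidity:
  assumes p: "\<And>y. y \<in> B \<Longrightarrow> (\<lambda>t. p t y) holomorphic_on A" "\<And>x. x \<in> A \<Longrightarrow> (\<lambda>t. p x t) holomorphic_on B"
    and q: "\<And>y. y \<in> B \<Longrightarrow> (\<lambda>t. q t y) holomorphic_on A" "\<And>x. x \<in> A \<Longrightarrow> (\<lambda>t. q x t) holomorphic_on B"
    and nz: "x0 \<in> A" "y0 \<in> B" "b x0 y0 \<noteq> 0"
    and ode_p: "\<And>x y. x \<in> A \<Longrightarrow> y \<in> B \<Longrightarrow> b x y \<noteq> 0 \<Longrightarrow>
      sin y * deriv (\<lambda>t. p t y / b t y) x = - 3 * sin y / x * (p x y / b x y) + cos y * (q x y / b x y)"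
    and ode_q: "\<And>x y. x \<in> A \<Longrightarrow> y \<in> B \<Longrightarrow> b x y \<noteq> 0 \<Longrightarrow> sin y * deriv (\<lambda>t. q t y / b t y) x = 0"
    and tw_p: "\<And>x y. x \<in> A \<Longrightarrow> y \<in> B \<Longrightarrow> y + \<kappa> x \<in> B \<Longrightarrow> b x y \<noteq> 0 \<Longrightarrow> b x (y + \<kappa> x) \<noteq> 0 \<Longrightarrow>
       p x y / b x y = p x (y + \<kappa> x) / b x (y + \<kappa> x)"
    and tw_q: "\<And>x y. x \<in> A \<Longrightarrow> y \<in> B \<Longrightarrow> y + \<kappa> x \<in> B \<Longrightarrow> b x y \<noteq> 0 \<Longrightarrow> b x (y + \<kappa> x) \<noteq> 0 \<Longrightarrow>
       q x y / b x y = q x (y + \<kappa> x) / b x (y + \<kappa> x) + \<kappa>0 / x\<^sup>2 * (p x (y + \<kappa> x) / b x (y + \<kappa> x))"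
  shows "\<forall>x\<in>A. \<forall>y\<in>B. p x y = 0 \<and> q x y = 0"
proof -
  have a0: "\<alpha> \<noteq> 0" using AB(5,6) by auto
  have \<kappa>\<alpha>: "\<kappa> \<alpha> = 0" by (simp add: \<kappa>)
  obtain y1 r where r: "r > 0" "ball y1 r \<subseteq> B" "\<And>y. y \<in> ball y1 r \<Longrightarrow> b x0 y \<noteq> 0 \<and> sin y \<noteq> 0 \<and> cos y \<noteq> 0"
    by (rule base_column[OF nz]) blast
  define f where "f = (\<lambda>y. q x0 y / b x0 y)"
  define g where "g = (\<lambda>y. f y * cos y / sin y)"
  \<comment> \<open>x^3 is the integrating factor of P' = - 3 P / x + g; \<open>h\<close> is the
    constant of integration, read off at \<open>x0\<close>.\<close>
  define h where "h = (\<lambda>y. x0 ^ 3 * (p x0 y / b x0 y) - x0 ^ 4 / 4 * g y)"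
  have colq: "q x y / b x y = f y" if "x \<in> A" "y \<in> ball y1 r" "b x y \<noteq> 0" for x y
    unfolding f_def
  proof (rule column_constant)
    show yB: "y \<in> B" using that r by auto
    show "deriv (\<lambda>t. q t y / b t y) x = 0" if "x \<in> A" "b x y \<noteq> 0" for x
      using ode_q[OF that(1) yB that(2)] r(3)[OF \<open>y \<in> ball y1 r\<close>] by simp
  qed (use that r nz q in auto)
  have colp: "p x y / b x y = (x ^ 4 / 4 * g y + h y) / x ^ 3" if xA: "x \<in> A" and y: "y \<in> ball y1 r" and bn: "b x y \<noteq> 0" for x y
  proof -
    have yB: "y \<in> B" using y r by auto
    have "(\<lambda>x. x ^ 3 * (p x y / b x y) - x ^ 4 / 4 * g y) x = (\<lambda>x. x ^ 3 * (p x y / b x y) - x ^ 4 / 4 * g y) x0"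
    proof (rule const_off_zeros[OF b(1)[OF yB] AB(1,2) nz(1) _ _ xA bn])
      show "b x0 y \<noteq> 0" using r(3)[OF y] by simp
      fix x assume m: "x \<in> A" "b x y \<noteq> 0"
      have x0: "x \<noteq> 0" using m AB(6) by auto
      have sn: "sin y \<noteq> 0" using r(3)[OF y] by simp
      define P where "P = p x y / b x y"
      define d where "d = deriv (\<lambda>t. p t y / b t y) x"
      have dP: "((\<lambda>x. p x y / b x y) has_field_derivative d) (at x)"
        unfolding d_def by (rule column_DERIV[where a = p, OF p(1)[OF yB] yB m])
      have "sin y * d = - 3 * sin y / x * P + cos y * f y"
        using ode_p[OF m(1) yB m(2)] colq[OF m(1) y m(2)] by (simp add: P_def d_def)
      then have dd: "d = - 3 / x * P + g y" using sn by (simp add: g_def field_simps)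
      have z: "3 * x ^ 2 * P + d * x ^ 3 - 4 * x ^ 3 / 4 * g y = 0"
      proof -
        have "3 * P + d * x - x * g y = 0" using x0 dd by (simp add: field_simps)
        moreover have "3 * x ^ 2 * P + d * x ^ 3 - 4 * x ^ 3 / 4 * g y = x ^ 2 * (3 * P + d * x - x * g y)"
          by (simp add: algebra_simps power2_eq_square power3_eq_cube)
        ultimately show ?thesis by simp
      qed
      have "((\<lambda>x. x ^ 3 * (p x y / b x y) - x ^ 4 / 4 * g y) has_field_derivative
          (3 * x ^ 2 * P + d * x ^ 3 - 4 * x ^ 3 / 4 * g y)) (at x)"
      proof -
        have gen: "((\<lambda>x. x ^ 3 * F x - x ^ 4 / 4 * c) has_field_derivative 3 * x ^ 2 * F x + d * x ^ 3 - 4 * x ^ 3 / 4 * c) (at x)"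
          if "(F has_field_derivative d) (at x)" for F :: "complex \<Rightarrow> complex" and c
          using that by (auto intro!: derivative_eq_intros)
        show ?thesis unfolding P_def by (rule gen[OF dP])
      qed
      then show "((\<lambda>x. x ^ 3 * (p x y / b x y) - x ^ 4 / 4 * g y) has_field_derivative 0) (at x)" unfolding z .
    qed
    then have "x ^ 3 * (p x y / b x y) = x ^ 4 / 4 * g y + h y" unfolding h_def by (metis add.commute diff_add_cancel)
    moreover have "x \<noteq> 0" using xA AB(6) by auto
    ultimately show ?thesis by (metis nonzero_mult_div_cancel_left power_not_zero)
  qed
  have fh: "f holomorphic_on ball y1 r"
    unfolding f_def using r nz(1) by (intro holomorphic_intros holomorphic_on_subset[OF q(2)] holomorphic_on_subset[OF b(2)]) auto
  have gh: "g holomorphic_on ball y1 r"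
    unfolding g_def using r by (intro holomorphic_intros fh) auto
  have hh: "h holomorphic_on ball y1 r"
    unfolding h_def using r nz(1)
    by (intro holomorphic_intros holomorphic_on_subset[OF p(2)] holomorphic_on_subset[OF b(2)] gh) auto
  obtain \<delta>0 where d0: "\<delta>0 > 0" "ball \<alpha> \<delta>0 \<subseteq> A" "\<And>x. x \<in> ball \<alpha> \<delta>0 \<Longrightarrow> norm (\<kappa> x) < r / 4"
    by (rule twist_near[of "r/4"]) (use r in auto)
  \<comment> \<open>A radius of at most \<open>norm \<alpha>\<close> leaves \<alpha> as the only
    point of the ball with fourth power \<alpha>^4.\<close>
  define \<delta> where "\<delta> = min \<delta>0 (norm \<alpha>)"
  have d: "\<delta> > 0" "ball \<alpha> \<delta> \<subseteq> A" "\<And>x. x \<in> ball \<alpha> \<delta> \<Longrightarrow> norm (\<kappa> x) < r / 4"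
    and d4: "\<And>x. x \<in> ball \<alpha> \<delta> \<Longrightarrow> x \<noteq> \<alpha> \<Longrightarrow> x ^ 4 \<noteq> \<alpha> ^ 4"
    using d0 a0 fourth_power_near by (auto simp: \<delta>_def)
  have x0: "x \<noteq> 0" if "x \<in> ball \<alpha> \<delta>" for x using subsetD[OF d(2) that] AB(6) by auto
  have shift: "y + w \<in> ball y1 (t + t')" if "norm w < t'" "y \<in> ball y1 t" for y w t t'
    using that norm_triangle_ineq4[of "y1 - y" w] by (simp add: dist_norm algebra_simps)
  have sub: "y + \<kappa> x \<in> ball y1 r" if "x \<in> ball \<alpha> \<delta>" "y \<in> ball y1 (r/2)" for x y
    using shift[OF d(3)[OF that(1)] that(2)] r(1) by auto
  have cf: "continuous_on (ball \<alpha> \<delta> \<times> ball y1 (r/2)) (\<lambda>z. F (snd z))"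
       "continuous_on (ball \<alpha> \<delta> \<times> ball y1 (r/2)) (\<lambda>z. F (snd z + \<kappa> (fst z)))"
    if "F holomorphic_on ball y1 r" for F
  proof -
    show "continuous_on (ball \<alpha> \<delta> \<times> ball y1 (r/2)) (\<lambda>z. F (snd z))"
      by (rule continuous_on_compose2[OF holomorphic_on_imp_continuous_on[OF that]])
         (use r in \<open>auto intro!: continuous_intros\<close>)
    show "continuous_on (ball \<alpha> \<delta> \<times> ball y1 (r/2)) (\<lambda>z. F (snd z + \<kappa> (fst z)))"
      by (rule continuous_on_compose2[OF holomorphic_on_imp_continuous_on[OF that]])
         (use d sub in \<open>auto intro!: continuous_intros continuous_on_compose2[OF twist_continuous]\<close>)
  qed
  have twQ: "x ^ 4 / 4 * (g y - g (y + \<kappa> x)) + (h y - h (y + \<kappa> x)) = 0 \<and>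
      f y - (f (y + \<kappa> x) + \<kappa>0 / x\<^sup>2 * ((x ^ 4 / 4 * g (y + \<kappa> x) + h (y + \<kappa> x)) / x ^ 3)) = 0"
    if m: "x \<in> ball \<alpha> \<delta>" "y \<in> ball y1 (r/2)" for x y
  proof -
    have B': "y1 \<in> B" "b x0 y1 \<noteq> 0" "ball y1 (r/2) \<subseteq> B" using r by auto
    have sB: "y + \<kappa> x \<in> B" if "x \<in> ball \<alpha> \<delta>" "y \<in> ball y1 (r/2)" for x y using sub[OF that] r by auto
    have pt: "x ^ 4 / 4 * (g y - g (y + \<kappa> x)) + (h y - h (y + \<kappa> x)) = 0 \<and>
      f y - (f (y + \<kappa> x) + \<kappa>0 / x\<^sup>2 * ((x ^ 4 / 4 * g (y + \<kappa> x) + h (y + \<kappa> x)) / x ^ 3)) = 0"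
      if m: "x \<in> ball \<alpha> \<delta>" "y \<in> ball y1 (r/2)" "b x y \<noteq> 0" "b x (y + \<kappa> x) \<noteq> 0" for x y
    proof
      have xA: "x \<in> A" and xn: "x \<noteq> 0" using m d x0 by auto
      have yr: "y \<in> ball y1 r" and yB: "y \<in> B" using m r by auto
      note s = sub[OF m(1,2)] sB[OF m(1,2)]
      note P = tw_p[OF xA yB s(2) m(3,4)] and Q = tw_q[OF xA yB s(2) m(3,4)]
      from P show "x ^ 4 / 4 * (g y - g (y + \<kappa> x)) + (h y - h (y + \<kappa> x)) = 0"
        unfolding colp[OF xA yr m(3)] colp[OF xA s(1) m(4)] using xn by (simp add: field_simps)
      from Q show "f y - (f (y + \<kappa> x) + \<kappa>0 / x\<^sup>2 * ((x ^ 4 / 4 * g (y + \<kappa> x) + h (y + \<kappa> x)) / x ^ 3)) = 0"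
        unfolding colq[OF xA yr m(3)] colq[OF xA s(1) m(4)] colp[OF xA s(1) m(4)] by simp
    qed
    have "(\<lambda>z. fst z ^ 4 / 4 * (g (snd z) - g (snd z + \<kappa> (fst z))) + (h (snd z) - h (snd z + \<kappa> (fst z)))) (x, y) = 0"
      by (rule extend_twisted[OF nz(1) B'(1,2) open_ball open_ball d(2) B'(3) _ _ sB m])
         (use pt in \<open>auto intro!: continuous_intros cf gh hh\<close>)
    moreover have "(\<lambda>z. f (snd z) - (f (snd z + \<kappa> (fst z)) + \<kappa>0 / (fst z)\<^sup>2 *
       ((fst z ^ 4 / 4 * g (snd z + \<kappa> (fst z)) + h (snd z + \<kappa> (fst z))) / fst z ^ 3))) (x, y) = 0"
      by (rule extend_twisted[OF nz(1) B'(1,2) open_ball open_ball d(2) B'(3) _ _ sB m])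
         (use pt x0 in \<open>auto intro!: continuous_intros cf fh gh hh\<close>)
    ultimately show ?thesis by simp
  qed
  \<comment> \<open>Taken at the resonant amplitude, where \<kappa> vanishes and the twist of q
    reduces to \<open>\<kappa>0 / \<alpha>^2\<close> times p being zero.\<close>
  have hg: "h y = - (\<alpha> ^ 4 / 4) * g y" if "y \<in> ball y1 (r/2)" for y
  proof -
    have "\<kappa>0 / \<alpha>\<^sup>2 * ((\<alpha> ^ 4 / 4 * g y + h y) / \<alpha> ^ 3) = 0"
      using twQ[of \<alpha> y] that d(1) by (simp add: \<kappa>\<alpha>)
    then have "\<alpha> ^ 4 / 4 * g y + h y = 0" using a0 \<kappa>(2) by simp
    then show ?thesis by (simp add: eq_neg_iff_add_eq_0 add.commute)
  qed
  obtain s0 where s0: "s0 > 0" "\<And>w. w \<in> ball 0 s0 \<Longrightarrow> \<exists>x\<in>ball \<alpha> \<delta>. \<kappa> x = w" by (rule twist_onto[OF d(1)]) blast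
  define s where "s = min s0 (min (r/4) 1)"
  have s: "s > 0" "s \<le> s0" "s \<le> r / 4" "s \<le> 1" using s0 r by (auto simp: s_def)
  have gc: "g y = g y1" if "y \<in> ball y1 s" for y
  proof (cases "y = y1")
    case False
    have "y - y1 \<in> ball 0 s0" using that s(2) by (simp add: dist_norm norm_minus_commute)
    then obtain x where x: "x \<in> ball \<alpha> \<delta>" "\<kappa> x = y - y1" using s0(2) by blast
    have "x \<noteq> \<alpha>" using x(2) \<kappa>\<alpha> False by auto
    then have x4: "x ^ 4 \<noteq> \<alpha> ^ 4" using d4 x by blast
    have yr: "y \<in> ball y1 (r/2)" using that s(3) r(1) by auto
    have "x ^ 4 / 4 * (g y1 - g y) + (h y1 - h y) = 0" using twQ[OF x(1), of y1] x(2) r(1) by simp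
    then have "(x ^ 4 - \<alpha> ^ 4) / 4 * (g y1 - g y) = 0"
      using hg[OF yr] hg[of y1] r(1) by (simp add: algebra_simps diff_divide_distrib)
    then show ?thesis using x4 by simp
  qed simp
  define c where "c = g y1"
  have fc: "f y = c * sin y / cos y" if "y \<in> ball y1 s" for y
  proof -
    have "c = f y * cos y / sin y" using gc[OF that] by (simp add: c_def g_def)
    moreover have "sin y \<noteq> 0" "cos y \<noteq> 0" using r(3)[of y] that s(3) r(1) by auto
    ultimately show ?thesis by (simp only:) simp
  qed
  have c0: "c = 0"
  proof (rule ccontr)
    assume cn: "c \<noteq> 0"
    \<comment> \<open>A positive real shift below 1, for which sin w \<noteq> 0 can be read off from
      the real sine.\<close>
    define w where "w = complex_of_real (s / 2)"
    have wn: "norm w = s / 2" unfolding w_def norm_of_real using s(1) by simp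
    have "sin (s / 2) > 0" using s by (intro sin_gt_zero_02) auto
    then have sw: "sin w \<noteq> 0" unfolding w_def sin_of_real of_real_eq_0_iff by simp
    have "w \<in> ball 0 s0" using wn s by simp
    then obtain x where x: "x \<in> ball \<alpha> \<delta>" "\<kappa> x = w" using s0(2) by blast
    define D where "D = \<kappa>0 / x\<^sup>2 * ((x ^ 4 / 4 * c + - (\<alpha> ^ 4 / 4) * c) / x ^ 3)"
    have eq: "D / c * (cos y * cos (y + w)) + sin w = 0" if y: "y \<in> ball y1 (s/2)" for y
    proof -
      have yw: "y + w \<in> ball y1 s"
        using norm_triangle_ineq4[of "y1 - y" w] wn y by (simp add: dist_norm algebra_simps)
      have ys: "y \<in> ball y1 s" using y s(1) by auto
      have yr: "y \<in> ball y1 (r/2)" "y + w \<in> ball y1 (r/2)" using ys yw s(3) r(1) by auto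
      have "f y - (f (y + w) + D) = 0"
        using twQ[OF x(1) yr(1)] hg[OF yr(2)] gc[OF yw] unfolding x(2) D_def c_def by simp
      then have "c * sin y / cos y - c * sin (y + w) / cos (y + w) = D"
        unfolding fc[OF ys] fc[OF yw] by (simp add: algebra_simps)
      moreover have "cos y \<noteq> 0" "cos (y + w) \<noteq> 0" using r(3)[of y] r(3)[of "y + w"] yr r(1) by auto
      ultimately have "c * (sin y * cos (y + w) - cos y * sin (y + w)) = D * (cos y * cos (y + w))"
        by (simp add: field_simps)
      also have "sin y * cos (y + w) - cos y * sin (y + w) = - sin w"
        using sin_diff[of y "y + w"] by simp
      finally have "D * (cos y * cos (y + w)) = c * - sin w" ..
      then have "D * (cos y * cos (y + w)) / c = - sin w" using cn by simp
      then show ?thesis by simp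
    qed
    \<comment> \<open>Both sides are entire in y, so the identity may be evaluated at the zero pi/2
      of cos, even if this lies outside the ball where it was derived.\<close>
    have "D / c * (cos (of_real (pi/2)) * cos (of_real (pi/2) + w)) + sin w = 0"
      by (rule analytic_continuation_open[where s = "ball y1 (s/2)" and s' = UNIV and
            f = "\<lambda>y. D / c * (cos y * cos (y + w)) + sin w" and g = "\<lambda>y. 0"])
         (use eq s(1) in \<open>auto intro!: holomorphic_intros\<close>)
    moreover have "cos (complex_of_real (pi/2)) = 0" unfolding cos_of_real by simp
    ultimately show False using sw by simp
  qed
  have z: "g y = 0 \<and> f y = 0 \<and> h y = 0" if "y \<in> ball y1 s" for y
    using gc[OF that] fc[OF that] hg[of y] that s(3) r(1) c0 by (auto simp: c_def)
  have sr: "ball y1 s \<subseteq> ball y1 r" using s(3) r(1) by auto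
  show ?thesis
  proof (intro ballI conjI)
    fix x y assume xy: "x \<in> A" "y \<in> B"
    have "p x y = 0 * b x y"
    proof (rule proportional_extend[OF p open_ball, of y1 s x0])
      fix x y assume m: "x \<in> A" "y \<in> ball y1 s" "b x y \<noteq> 0"
      then have "y \<in> ball y1 r" using sr by blast
      from colp[OF m(1) this m(3)] z[OF m(2)] m(3) show "p x y = 0 * b x y" by simp
    qed (use r s nz xy sr in auto)
    then show "p x y = 0" by simp
    have "q x y = 0 * b x y"
    proof (rule proportional_extend[OF q open_ball, of y1 s x0])
      fix x y assume m: "x \<in> A" "y \<in> ball y1 s" "b x y \<noteq> 0"
      then have "y \<in> ball y1 r" using sr by blast
      from colq[OF m(1) this m(3)] z[OF m(2)] m(3) show "q x y = 0 * b x y" by simp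
    qed (use r s nz xy sr in auto)
    then show "q x y = 0" by simp
  qed
qed

end

section \<open>Residues of the perturbation\<close>

context
  fixes C P c s Q T1 T2 :: "complex \<Rightarrow> complex" and u m x ix \<beta> \<delta> \<nu> i\<nu> :: complex
  assumes dC: "(C has_field_derivative P u) (at u)" and dP: "(P has_field_derivative - (C u * C u * C u)) (at u)"
    and dc: "(c has_field_derivative - (m * s u)) (at u)" and ds: "(s has_field_derivative m * c u) (at u)"
    and dQ: "(Q has_field_derivative 1) (at u)"
    and dT1: "(T1 has_field_derivative P u * P u) (at u)"
    and dT2: "(T2 has_field_derivative P u * (C u + Q u * P u)) (at u)"
begin

text \<open>The primitives come from integrating each coefficient by parts until an entire multiple
  of C is left. Here C and P stand for cn and its derivative, c and s for cosine and sine of the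
  phase, m, ix and \<open>i\<nu>\<close> for \<nu>/x, 1/x and 1/\<nu>, and Q for
  \<open>u - \<i> K\<close>. The damping terms leave no such multiple.\<close>

lemma ring_primitives:
  "((\<lambda>u. \<beta> * ix * (c u * C u) - \<delta> * x * T1 u) has_field_derivative
     (\<beta> * ix * c u * P u - \<delta> * x * (P u * P u)) - (\<beta> * ix * m * s u) * C u) (at u)"
  "((\<lambda>u. \<nu> * \<beta> * ix^3 * (c u * (Q u * C u)) - \<nu> * \<delta> * ix * T2 u) has_field_derivative
     (\<nu> * \<beta> * ix^3 * c u * (C u + Q u * P u) - \<nu> * \<delta> * ix * (P u * (C u + Q u * P u)))
       - (\<nu> * \<beta> * ix^3 * m * s u * Q u) * C u) (at u)"
  "((\<lambda>u. i\<nu> * (\<delta> * x^2 * (P u * P u) - \<beta> * (c u * P u + m * (s u * C u)))) has_field_derivative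
     i\<nu> * (\<beta> * c u * C u ^ 3 - 2 * \<delta> * x^2 * P u * C u ^ 3) - (i\<nu> * \<beta> * m^2 * c u) * C u) (at u)"
  "((\<lambda>u. - (\<beta> * ix^2) * (2 * (c u * C u) - c u * Q u * P u - m * (s u * Q u * C u)) - \<delta> * (Q u * (P u * P u))) has_field_derivative
     (\<delta> * (2 * Q u * P u * C u ^ 3 - P u * P u) - \<beta> * ix^2 * c u * (P u + Q u * C u ^ 3))
       - (- (\<beta> * ix^2) * (3 * m * s u + m^2 * c u * Q u)) * C u) (at u)"
  "((\<lambda>u. \<delta> * (P u * (C u + Q u * P u)) - \<beta> * ix^2 * (c u * (C u + Q u * P u) + m * (s u * (Q u * C u)))) has_field_derivative
     (\<delta> * (P u * (2 * P u - Q u * C u ^ 3) - C u ^ 3 * (C u + Q u * P u)) - \<beta> * ix^2 * c u * (2 * P u - Q u * C u ^ 3))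
       - (\<beta> * ix^2 * m^2 * c u * Q u) * C u) (at u)"
  "((\<lambda>u. \<nu> * ix^4 * \<beta> * (c u * Q u * (C u + Q u * P u) - 4 * (c u * (Q u * C u)) + m * (s u * (Q u * Q u) * C u))
       + \<nu> * ix^2 * \<delta> * (C u * (C u + Q u * P u) - (C u + Q u * P u) * (C u + Q u * P u) + 2 * T2 u)) has_field_derivative
     (\<nu> * ix^4 * \<beta> * c u * (Q u * (2 * P u - Q u * C u ^ 3) - 3 * (C u + Q u * P u))
       + \<nu> * ix^2 * \<delta> * (3 * (P u * (C u + Q u * P u)) - (2 * P u - Q u * C u ^ 3) * (C u + Q u * P u)
            - Q u * P u * (2 * P u - Q u * C u ^ 3)))
       - (- (\<nu> * ix^4 * \<beta>) * (5 * m * s u * Q u + m^2 * c u * (Q u * Q u))) * C u) (at u)"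
  by ((rule derivative_eq_intros dC dP dc ds dQ dT1 dT2 refl)+, simp add: algebra_simps power2_eq_square power3_eq_cube)+

end

text \<open>Up to the derivative of a single-valued function, each coefficient of the perturbation is an entire
  function times \<open>lcn\<close>, so that only the residue of \<open>lcn\<close> at \<open>\<i> K\<close> enters its integral around the pole.\<close>

abbreviation iK :: complex where "iK \<equiv> \<i> * of_real qK"

context
  fixes \<rho> :: real and h :: "complex \<Rightarrow> complex"
  assumes h: "h holomorphic_on ball iK \<rho>"
    and pole: "\<And>z. z \<in> ball iK \<rho> - {iK} \<Longrightarrow> z \<notin> lpoles \<and> lcn z = h z / (z - iK)"
begin

lemma ring_integral:
  assumes r: "0 < r" "r < \<rho>" and s: "s holomorphic_on UNIV"
    and T: "\<And>u. u \<notin> lpoles \<Longrightarrow> (T has_field_derivative f u - s u * lcn u) (at u)"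
  shows "(f has_contour_integral 2 * of_real pi * \<i> * (s iK * h iK)) (circlepath iK r)"
proof -
  have sp: "u \<in> ball iK \<rho> - {iK}" if "u \<in> sphere iK r" for u using that r by auto
  have "((\<lambda>u. f u - s u * lcn u) has_contour_integral 0) (circlepath iK r)"
  proof (rule Cauchy_theorem_primitive[where S = "sphere iK r"])
    show "(T has_field_derivative f u - s u * lcn u) (at u within sphere iK r)" if "u \<in> sphere iK r" for u
      using T pole[OF sp[OF that]] has_field_derivative_at_within by blast
  qed (use r in auto)
  moreover have "((\<lambda>u. (s u * h u) / (u - iK)) has_contour_integral 2 * of_real pi * \<i> * (s iK * h iK)) (circlepath iK r)"
    by (rule Cauchy_integral_circlepath_simple)
       (use r in \<open>auto intro!: holomorphic_intros holomorphic_on_subset[OF h] holomorphic_on_subset[OF s]\<close>)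
  ultimately have "((\<lambda>u. (f u - s u * lcn u) + (s u * h u) / (u - iK)) has_contour_integral
      0 + 2 * of_real pi * \<i> * (s iK * h iK)) (circlepath iK r)"
    by (rule has_contour_integral_add)
  then have "((\<lambda>u. (f u - s u * lcn u) + (s u * h u) / (u - iK)) has_contour_integral 2 * of_real pi * \<i> * (s iK * h iK)) (circlepath iK r)"
    by simp
  then show ?thesis
  proof (rule has_contour_integral_eq)
    fix u assume "u \<in> path_image (circlepath iK r)"
    then have "u \<in> sphere iK r" using r by simp
    then show "(f u - s u * lcn u) + (s u * h u) / (u - iK) = f u" using pole[OF sp] by simp
  qed
qed

end

definition phase :: "real \<Rightarrow> complex \<Rightarrow> complex \<Rightarrow> complex \<Rightarrow> complex" where
  "phase \<nu> x y u = y + of_real \<nu> * (u - iK) / x"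
text \<open>The unperturbed equation is invariant under rescaling amplitude and time.
  \<open>zq\<close> is the derivative at scale 1 of the solution dilated about the pole, hence a
  solution of the linearised equation next to \<open>lcn'\<close>; it grows linearly in time.
  \<open>zq'\<close> is its derivative.\<close>

definition zq :: "complex \<Rightarrow> complex" where "zq u = lcn u + (u - iK) * lcn' u"
definition zq' :: "complex \<Rightarrow> complex" where "zq' u = 2 * lcn' u - (u - iK) * lcn u ^ 3"

text \<open>The forcing, written in the coordinates \<open>(x, y, u)\<close> (amplitude, phase at the pole, scaled time),
  and the coefficients of the variational system for the components \<open>(dx, dy)\<close> of a commuting field.\<close>

definition wx :: "real \<Rightarrow> real \<Rightarrow> real \<Rightarrow> complex \<Rightarrow> complex \<Rightarrow> complex \<Rightarrow> complex" where
  "wx \<beta> \<delta> \<nu> x y u = of_real \<beta> * (1/x) * cos (phase \<nu> x y u) * lcn' u - of_real \<delta> * x * (lcn' u * lcn' u)"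
definition wy :: "real \<Rightarrow> real \<Rightarrow> real \<Rightarrow> complex \<Rightarrow> complex \<Rightarrow> complex \<Rightarrow> complex" where
  "wy \<beta> \<delta> \<nu> x y u = of_real \<nu> * of_real \<beta> * (1/x)^3 * cos (phase \<nu> x y u) * zq u - of_real \<nu> * of_real \<delta> * (1/x) * (lcn' u * zq u)"
definition wu :: "real \<Rightarrow> real \<Rightarrow> real \<Rightarrow> complex \<Rightarrow> complex \<Rightarrow> complex \<Rightarrow> complex" where
  "wu \<beta> \<delta> \<nu> x y u = of_real \<delta> * lcn' u * lcn u - of_real \<beta> * (1/x)^2 * cos (phase \<nu> x y u) * lcn u"
definition kk :: "real \<Rightarrow> real \<Rightarrow> real \<Rightarrow> bool \<Rightarrow> bool \<Rightarrow> complex \<Rightarrow> complex \<Rightarrow> complex \<Rightarrow> complex" where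
  "kk \<beta> \<delta> \<nu> i i' x y u = (if i then
     (if i' then of_real \<delta> * (2 * (u - iK) * lcn' u * lcn u ^ 3 - lcn' u * lcn' u) - of_real \<beta> * (1/x)^2 * cos (phase \<nu> x y u) * (lcn' u + (u - iK) * lcn u ^ 3)
      else (1 / of_real \<nu>) * (of_real \<beta> * cos (phase \<nu> x y u) * lcn u ^ 3 - 2 * of_real \<delta> * x^2 * lcn' u * lcn u ^ 3))
   else
     (if i' then of_real \<nu> * (1/x)^4 * of_real \<beta> * cos (phase \<nu> x y u) * ((u - iK) * zq' u - 3 * zq u)
         + of_real \<nu> * (1/x)^2 * of_real \<delta> * (3 * (lcn' u * zq u) - zq' u * zq u - (u - iK) * lcn' u * zq' u)
      else of_real \<delta> * (lcn' u * zq' u - lcn u ^ 3 * zq u) - of_real \<beta> * (1/x)^2 * cos (phase \<nu> x y u) * zq' u))"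

text \<open>\<open>h0\<close> is the residue of \<open>lcn\<close> at \<open>\<i> K\<close>; the
  sine is the derivative of the cosine of the phase, brought in by integration by parts.\<close>

definition ring_R :: "real \<Rightarrow> real \<Rightarrow> complex \<Rightarrow> complex \<Rightarrow> complex \<Rightarrow> complex" where
  "ring_R \<beta> \<nu> h0 x y = 2 * of_real pi * \<i> * (of_real \<beta> * (1/x) * (of_real \<nu> / x) * sin y * h0)"
definition ring_K :: "real \<Rightarrow> real \<Rightarrow> complex \<Rightarrow> bool \<Rightarrow> bool \<Rightarrow> complex \<Rightarrow> complex \<Rightarrow> complex" where
  "ring_K \<beta> \<nu> h0 i i' x y = (if i then
     (if i' then 2 * of_real pi * \<i> * (- (of_real \<beta> * (1/x)^2) * (3 * (of_real \<nu> / x) * sin y) * h0)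
      else 2 * of_real pi * \<i> * (1 / of_real \<nu> * of_real \<beta> * (of_real \<nu> / x)^2 * cos y * h0)) else 0)"

lemma phase_pole: "phase \<nu> x y iK = y" by (simp add: phase_def)

text \<open>The residue is the entire factor of \<open>lcn\<close> evaluated at the pole, times that
  of \<open>lcn\<close>. A factor \<open>u - \<i> K\<close> vanishes there, which is why
  \<open>wy\<close> and the whole second row of \<open>kk\<close> integrate to zero.\<close>

lemma ring_integrals:
  assumes h: "h holomorphic_on ball iK \<rho>"
    and pole: "\<And>z. z \<in> ball iK \<rho> - {iK} \<Longrightarrow> z \<notin> lpoles \<and> lcn z = h z / (z - iK)"
    and r: "0 < r" "r < \<rho>" and x: "x \<noteq> 0"
  shows "(wx \<beta> \<delta> \<nu> x y has_contour_integral ring_R \<beta> \<nu> (h iK) x y) (circlepath iK r)"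
    "(wy \<beta> \<delta> \<nu> x y has_contour_integral 0) (circlepath iK r)"
    "(kk \<beta> \<delta> \<nu> i i' x y has_contour_integral ring_K \<beta> \<nu> (h iK) i i' x y) (circlepath iK r)"
proof -
  define c s Q where "c = (\<lambda>u. cos (phase \<nu> x y u))" and "s = (\<lambda>u. sin (phase \<nu> x y u))" and "Q = (\<lambda>u. u - iK)"
  \<comment> \<open>By the energy relation the derivative of \<open>lcn * lcn'\<close> is
    \<open>3 * lcn'^2 - 1\<close>, which gives this single-valued primitive of
    \<open>lcn'^2\<close>; \<open>T2\<close> arises in the same way.\<close>
  define T1 where "T1 = (\<lambda>u. (lcn u * lcn' u + Q u) / 3)"
  define T2 where "T2 = (\<lambda>u. (lcn u * lcn u + Q u * lcn u * lcn' u) / 3 + Q u * Q u / 6)"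
  let ?m = "complex_of_real \<nu> / x"
  have dph: "(phase \<nu> x y has_field_derivative ?m) (at u)" for u
    unfolding phase_def using x by (auto intro!: derivative_eq_intros)
  have dc: "(c has_field_derivative - (?m * s u)) (at u)" and ds: "(s has_field_derivative ?m * c u) (at u)"
    and dQ: "(Q has_field_derivative 1) (at u)" for u
    unfolding c_def s_def Q_def by (auto intro!: derivative_eq_intros dph)
  have hs: "c holomorphic_on UNIV" "s holomorphic_on UNIV" "Q holomorphic_on UNIV"
    using dc ds dQ by (metis holomorphic_on_open open_UNIV)+
  have dC: "(lcn has_field_derivative lcn' u) (at u)" and dP: "(lcn' has_field_derivative - (lcn u * lcn u * lcn u)) (at u)"
    if "u \<notin> lpoles" for u
    using lcn_derivative[OF that] lcn'_derivative[OF that] by (simp_all add: power3_eq_cube mult.assoc)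
  have P2: "lcn u * lcn u * lcn u * lcn u = 1 - 2 * (lcn' u * lcn' u)" if "u \<notin> lpoles" for u
  proof -
    have "2 * (lcn' u * lcn' u) = 1 - lcn u ^ 4" using lcn'_square[OF that] by (simp add: power2_eq_square mult.commute)
    then show ?thesis by (simp add: power4_eq_xxxx)
  qed
  have dT1: "(T1 has_field_derivative lcn' u * lcn' u) (at u)" if "u \<notin> lpoles" for u
  proof -
    have "(T1 has_field_derivative (lcn' u * lcn' u + lcn u * - (lcn u * lcn u * lcn u) + 1) / 3) (at u)"
      unfolding T1_def by (rule derivative_eq_intros dC[OF that] dP[OF that] dQ refl | simp)+
    then show ?thesis using P2[OF that] by (simp add: mult.assoc)
  qed
  have dT2: "(T2 has_field_derivative lcn' u * (lcn u + Q u * lcn' u)) (at u)" if "u \<notin> lpoles" for u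
  proof -
    have "(T2 has_field_derivative (2 * lcn u * lcn' u + lcn u * lcn' u + Q u * (lcn' u * lcn' u - lcn u * (lcn u * lcn u * lcn u))) / 3 + Q u / 3) (at u)"
      unfolding T2_def
      by (rule derivative_eq_intros dC[OF that] dP[OF that] dQ refl | simp)+ (simp add: field_simps)
    note d = this
    have e: "lcn u * (lcn u * lcn u * lcn u) = 1 - 2 * (lcn' u * lcn' u)" using P2[OF that] by (simp add: mult.assoc)
    show ?thesis by (rule DERIV_cong[OF d]) (simp only: e, simp add: field_simps)
  qed
  note prim = ring_primitives[OF dC dP dc ds dQ dT1 dT2]
  have ri: "(f has_contour_integral 2 * of_real pi * \<i> * (s iK * h iK)) (circlepath iK r)"
    if "s holomorphic_on UNIV" "\<And>u. u \<notin> lpoles \<Longrightarrow> (T has_field_derivative f u - s u * lcn u) (at u)" for f s T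
    by (rule ring_integral[OF h _ r that]) (use pole in blast)+
  have iKv: "c iK = cos y" "s iK = sin y" "Q iK = 0" by (simp_all add: c_def s_def Q_def phase_pole)
  show "(wx \<beta> \<delta> \<nu> x y has_contour_integral ring_R \<beta> \<nu> (h iK) x y) (circlepath iK r)"
  proof -
    have "((\<lambda>u. of_real \<beta> * (1/x) * c u * lcn' u - of_real \<delta> * x * (lcn' u * lcn' u))
        has_contour_integral 2 * of_real pi * \<i> * (of_real \<beta> * (1/x) * ?m * s iK * h iK)) (circlepath iK r)"
      by (rule ri[OF _ prim(1)]) (intro holomorphic_intros hs | assumption)+
    then show ?thesis unfolding iKv by (simp add: wx_def[abs_def] ring_R_def c_def)
  qed
  show "(wy \<beta> \<delta> \<nu> x y has_contour_integral 0) (circlepath iK r)"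
  proof -
    have "((\<lambda>u. of_real \<nu> * of_real \<beta> * (1/x)^3 * c u * (lcn u + Q u * lcn' u) - of_real \<nu> * of_real \<delta> * (1/x) * (lcn' u * (lcn u + Q u * lcn' u)))
        has_contour_integral 2 * of_real pi * \<i> * (of_real \<nu> * of_real \<beta> * (1/x)^3 * ?m * s iK * Q iK * h iK)) (circlepath iK r)"
      by (rule ri[OF _ prim(2)]) (intro holomorphic_intros hs | assumption)+
    then show ?thesis unfolding iKv by (simp add: wy_def[abs_def] zq_def c_def Q_def)
  qed
  have k1: "(kk \<beta> \<delta> \<nu> True True x y has_contour_integral ring_K \<beta> \<nu> (h iK) True True x y) (circlepath iK r)"
  proof -
    have "((\<lambda>u. of_real \<delta> * (2 * Q u * lcn' u * lcn u ^ 3 - lcn' u * lcn' u) - of_real \<beta> * (1/x)^2 * c u * (lcn' u + Q u * lcn u ^ 3))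
        has_contour_integral 2 * of_real pi * \<i> * ((- (of_real \<beta> * (1/x)^2) * (3 * ?m * s iK + ?m^2 * c iK * Q iK)) * h iK)) (circlepath iK r)"
      by (rule ri[OF _ prim(4)]) (intro holomorphic_intros hs | assumption)+
    then show ?thesis unfolding iKv by (simp add: kk_def[abs_def] ring_K_def c_def Q_def)
  qed
  have k2: "(kk \<beta> \<delta> \<nu> True False x y has_contour_integral ring_K \<beta> \<nu> (h iK) True False x y) (circlepath iK r)"
  proof -
    have "((\<lambda>u. (1 / of_real \<nu>) * (of_real \<beta> * c u * lcn u ^ 3 - 2 * of_real \<delta> * x^2 * lcn' u * lcn u ^ 3))
        has_contour_integral 2 * of_real pi * \<i> * ((1 / of_real \<nu>) * of_real \<beta> * ?m^2 * c iK * h iK)) (circlepath iK r)"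
      by (rule ri[OF _ prim(3)]) (intro holomorphic_intros hs | assumption)+
    then show ?thesis unfolding iKv by (simp add: kk_def[abs_def] ring_K_def c_def Q_def)
  qed
  have k3: "(kk \<beta> \<delta> \<nu> False True x y has_contour_integral ring_K \<beta> \<nu> (h iK) False True x y) (circlepath iK r)"
  proof -
    have "((\<lambda>u. of_real \<nu> * (1/x)^4 * of_real \<beta> * c u * (Q u * (2 * lcn' u - Q u * lcn u ^ 3) - 3 * (lcn u + Q u * lcn' u))
       + of_real \<nu> * (1/x)^2 * of_real \<delta> * (3 * (lcn' u * (lcn u + Q u * lcn' u)) - (2 * lcn' u - Q u * lcn u ^ 3) * (lcn u + Q u * lcn' u)
            - Q u * lcn' u * (2 * lcn' u - Q u * lcn u ^ 3)))
        has_contour_integral 2 * of_real pi * \<i> * ((- (of_real \<nu> * (1/x)^4 * of_real \<beta>) * (5 * ?m * s iK * Q iK + ?m^2 * c iK * (Q iK * Q iK))) * h iK)) (circlepath iK r)"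
      by (rule ri[OF _ prim(6)]) (intro holomorphic_intros hs | assumption)+
    then show ?thesis unfolding iKv by (simp add: kk_def[abs_def] ring_K_def zq_def zq'_def c_def Q_def)
  qed
  have k4: "(kk \<beta> \<delta> \<nu> False False x y has_contour_integral ring_K \<beta> \<nu> (h iK) False False x y) (circlepath iK r)"
  proof -
    have "((\<lambda>u. of_real \<delta> * (lcn' u * (2 * lcn' u - Q u * lcn u ^ 3) - lcn u ^ 3 * (lcn u + Q u * lcn' u)) - of_real \<beta> * (1/x)^2 * c u * (2 * lcn' u - Q u * lcn u ^ 3))
        has_contour_integral 2 * of_real pi * \<i> * (of_real \<beta> * (1/x)^2 * ?m^2 * c iK * Q iK * h iK)) (circlepath iK r)"
      by (rule ri[OF _ prim(5)]) (intro holomorphic_intros hs | assumption)+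
    then show ?thesis unfolding iKv by (simp add: kk_def[abs_def] ring_K_def zq_def zq'_def c_def Q_def)
  qed
  show "(kk \<beta> \<delta> \<nu> i i' x y has_contour_integral ring_K \<beta> \<nu> (h iK) i i' x y) (circlepath iK r)"
    using k1 k2 k3 k4 by (cases i; cases i') simp_all
qed

section \<open>Coordinates near the resonant torus\<close>

lemma bounded_linear_smult: "bounded_linear (\<lambda>z. z *s (v :: complex ^ 'n::finite))"
  unfolding linear_conv_bounded_linear[symmetric]
  by (rule linearI) (simp_all add: vec_eq_iff algebra_simps)

lemma has_derivative_smult:
  "(f has_derivative f') F \<Longrightarrow> ((\<lambda>t. f t *s (v :: complex ^ 'n::finite)) has_derivative (\<lambda>h. f' h *s v)) F"
  by (rule bounded_linear.has_derivative[OF bounded_linear_smult])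

lemma continuous_on_smult: "continuous_on S f \<Longrightarrow> continuous_on S (\<lambda>t. f t *s (v :: complex ^ 'n::finite))"
  by (rule bounded_linear.continuous_on[OF bounded_linear_smult])

definition complex_linear :: "('n::finite spt \<Rightarrow> complex) \<Rightarrow> bool" where
  "complex_linear D \<longleftrightarrow> (\<forall>c v. D (c *s fst v, c * snd v) = c * D v)"

text \<open>\<open>x\<close> is the amplitude, \<open>y\<close> the phase at the pole \<open>\<i> K\<close>, and \<open>u\<close> the scaled time along the unperturbed
  solution.\<close>

definition Phi :: "real \<Rightarrow> complex \<Rightarrow> complex \<Rightarrow> complex \<Rightarrow> complex ^ 3" where
  "Phi \<nu> x y u = (x * lcn u) *s axis 1 1 + (x\<^sup>2 * lcn' u) *s axis 2 1 + phase \<nu> x y u *s axis 3 1"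

lemma axis3_nth [simp]:
  "axis 1 1 $ (1::3) = (1::complex)" "axis 1 1 $ (2::3) = (0::complex)" "axis 1 1 $ (3::3) = (0::complex)"
  "axis 2 1 $ (1::3) = (0::complex)" "axis 2 1 $ (2::3) = (1::complex)" "axis 2 1 $ (3::3) = (0::complex)"
  "axis 3 1 $ (1::3) = (0::complex)" "axis 3 1 $ (2::3) = (0::complex)" "axis 3 1 $ (3::3) = (1::complex)"
  by (simp_all add: axis_def)

lemma Phi_nth: "Phi \<nu> x y u $ 1 = x * lcn u" "Phi \<nu> x y u $ 2 = x\<^sup>2 * lcn' u" "Phi \<nu> x y u $ 3 = phase \<nu> x y u"
  by (simp_all add: Phi_def)

lemma vec3_eq_iff: "(v :: complex ^ 3) = w \<longleftrightarrow> v $ 1 = w $ 1 \<and> v $ 2 = w $ 2 \<and> v $ 3 = w $ 3"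
  by (auto simp: vec_eq_iff forall_3)

definition pull :: "real \<Rightarrow> (3 spt \<Rightarrow> 'a) \<Rightarrow> complex \<Rightarrow> complex \<Rightarrow> complex \<Rightarrow> complex \<Rightarrow> 'a" where
  "pull \<nu> F x y u e = F (Phi \<nu> x y u, e)"

text \<open>\<open>vx\<close>, \<open>vy\<close> and \<open>vu\<close> are the partial derivatives
  of \<open>Phi\<close>. None depends on y, which enters \<open>Phi\<close> only as a summand of the
  phase.\<close>

definition vx :: "real \<Rightarrow> complex \<Rightarrow> complex \<Rightarrow> complex ^ 3" where
  "vx \<nu> x u = lcn u *s axis 1 1 + (2 * x * lcn' u) *s axis 2 1 + (- of_real \<nu> * (u - iK) / x\<^sup>2) *s axis 3 1"
definition vy :: "complex ^ 3" where "vy = axis 3 1"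
definition vu :: "real \<Rightarrow> complex \<Rightarrow> complex \<Rightarrow> complex ^ 3" where
  "vu \<nu> x u = (x * lcn' u) *s axis 1 1 + (- x\<^sup>2 * lcn u ^ 3) *s axis 2 1 + (of_real \<nu> / x) *s axis 3 1"

lemma Phi_derivatives:
  assumes "x \<noteq> 0" "u \<notin> lpoles"
  shows "((\<lambda>t. Phi \<nu> t y u) has_derivative (\<lambda>h. h *s vx \<nu> x u)) (at x)"
    "((\<lambda>t. Phi \<nu> x t u) has_derivative (\<lambda>h. h *s vy)) (at y)"
    "((\<lambda>t. Phi \<nu> x y t) has_derivative (\<lambda>h. h *s vu \<nu> x u)) (at u)"
proof -
  note dC = lcn_derivative[OF assms(2)] and dP = lcn'_derivative[OF assms(2)]
  have *: "((\<lambda>t. f1 t *s axis 1 1 + f2 t *s axis 2 1 + f3 t *s (axis 3 1 :: complex ^ 3)) has_derivative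
      (\<lambda>h. h *s (d1 *s axis 1 1 + d2 *s axis 2 1 + d3 *s axis 3 1))) (at t)"
    if "(f1 has_field_derivative d1) (at t)" "(f2 has_field_derivative d2) (at t)" "(f3 has_field_derivative d3) (at t)"
    for f1 f2 f3 d1 d2 d3 t
  proof -
    have "((\<lambda>t. f1 t *s axis 1 1 + f2 t *s axis 2 1 + f3 t *s (axis 3 1 :: complex ^ 3)) has_derivative
      (\<lambda>h. (d1 * h) *s axis 1 1 + (d2 * h) *s axis 2 1 + (d3 * h) *s axis 3 1)) (at t)"
      using that unfolding has_field_derivative_def by (intro has_derivative_add has_derivative_smult)
    also have "(\<lambda>h. (d1 * h) *s axis 1 1 + (d2 * h) *s axis 2 1 + (d3 * h) *s (axis 3 1 :: complex ^ 3)) =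
      (\<lambda>h. h *s (d1 *s axis 1 1 + d2 *s axis 2 1 + d3 *s axis 3 1))"
      by (auto simp: fun_eq_iff vec3_eq_iff)
    finally show ?thesis .
  qed
  show "((\<lambda>t. Phi \<nu> t y u) has_derivative (\<lambda>h. h *s vx \<nu> x u)) (at x)"
    unfolding Phi_def vx_def phase_def using assms
    by (intro *) (auto intro!: derivative_eq_intros simp: power2_eq_square)
  show "((\<lambda>t. Phi \<nu> x y t) has_derivative (\<lambda>h. h *s vu \<nu> x u)) (at u)"
    unfolding Phi_def vu_def phase_def using assms
    by (intro *) (auto intro!: derivative_eq_intros dC dP simp: power2_eq_square)
  have "((\<lambda>t. Phi \<nu> x t u) has_derivative (\<lambda>h. h *s (0 *s axis 1 1 + 0 *s axis 2 1 + 1 *s axis 3 1))) (at y)"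
    unfolding Phi_def phase_def
    by (intro *) (auto intro!: derivative_eq_intros)
  then show "((\<lambda>t. Phi \<nu> x t u) has_derivative (\<lambda>h. h *s vy)) (at y)" by (simp add: vy_def)
qed

lemma curve_derivative:
  assumes D: "(F has_derivative D) (at (\<gamma> t, e))" "complex_linear D"
    and \<gamma>: "(\<gamma> has_derivative (\<lambda>h. h *s v)) (at t)"
  shows "((\<lambda>t. F (\<gamma> t, e)) has_field_derivative D (v, 0)) (at t)"
proof -
  have "((\<lambda>t. (\<gamma> t, e)) has_derivative (\<lambda>h. (h *s v, 0))) (at t)"
    by (intro has_derivative_Pair \<gamma> has_derivative_const)
  from has_derivative_compose[OF this D(1)]
  have "((\<lambda>t. F (\<gamma> t, e)) has_derivative (\<lambda>h. D (h *s v, 0))) (at t)" .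
  also have "(\<lambda>h. D (h *s v, 0)) = (*) (D (v, 0))"
  proof
    fix h show "D (h *s v, 0) = D (v, 0) * h"
      using D(2)[unfolded complex_linear_def, rule_format, of h "(v, 0)"] by (simp add: mult.commute)
  qed
  finally show ?thesis by (simp add: has_field_derivative_def)
qed

lemma parameter_derivative:
  assumes D: "(F has_derivative D) (at (p, e))" "complex_linear D"
  shows "((\<lambda>t. F (p, t)) has_field_derivative D (0, 1)) (at e)"
proof -
  have "((\<lambda>t. (p, t)) has_derivative (\<lambda>h. (0, h))) (at e)"
    by (intro has_derivative_Pair has_derivative_const has_derivative_ident)
  from has_derivative_compose[OF this D(1)]
  have "((\<lambda>t. F (p, t)) has_derivative (\<lambda>h. D (0, h))) (at e)" .
  also have "(\<lambda>h. D (0, h)) = (*) (D (0, 1))"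
  proof
    fix h show "D (0, h) = D (0, 1) * h"
      using D(2)[unfolded complex_linear_def, rule_format, of h "(0, 1)"] by (simp add: mult.commute vector_smult_rzero)
  qed
  finally show ?thesis by (simp add: has_field_derivative_def)
qed

lemma pull_derivatives:
  assumes "(F has_derivative D) (at (Phi \<nu> x y u, e))" "complex_linear D" "x \<noteq> 0" "u \<notin> lpoles"
  shows "((\<lambda>t. pull \<nu> F t y u e) has_field_derivative D (vx \<nu> x u, 0)) (at x)"
    "((\<lambda>t. pull \<nu> F x t u e) has_field_derivative D (vy, 0)) (at y)"
    "((\<lambda>t. pull \<nu> F x y t e) has_field_derivative D (vu \<nu> x u, 0)) (at u)"
    "((\<lambda>t. pull \<nu> F x y u t) has_field_derivative D (0, 1)) (at e)"
  unfolding pull_def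
  by (rule curve_derivative[OF assms(1,2) Phi_derivatives(1)[OF assms(3,4)]],
      rule curve_derivative[OF assms(1,2) Phi_derivatives(2)[OF assms(3,4)]],
      rule curve_derivative[OF assms(1,2) Phi_derivatives(3)[OF assms(3,4)]],
      rule parameter_derivative[OF assms(1,2)])

definition Phi4 :: "real \<Rightarrow> complex \<times> complex \<times> complex \<times> complex \<Rightarrow> 3 spt" where
  "Phi4 \<nu> = (\<lambda>(x, y, u, e). (Phi \<nu> x y u, e))"

definition coords :: "(complex \<times> complex \<times> complex \<times> complex) set" where
  "coords = {(x, y, u, e). x \<noteq> 0 \<and> u \<notin> lpoles}"

lemma open_coords: "open coords"
proof -
  have eq: "coords = (- {0}) \<times> UNIV \<times> (- lpoles) \<times> UNIV" by (auto simp: coords_def)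
  show ?thesis unfolding eq using closed_lpoles by (intro open_Times open_UNIV) auto
qed

lemma lcn_continuous: "continuous_on (- lpoles) lcn" "continuous_on (- lpoles) lcn'"
  by (auto intro!: continuous_at_imp_continuous_on DERIV_isCont[OF lcn_derivative] DERIV_isCont[OF lcn'_derivative])

lemma Phi4_continuous: "continuous_on coords (Phi4 \<nu>)"
proof -
  have c: "continuous_on coords (\<lambda>p. f (fst (snd (snd p))))" if "continuous_on (- lpoles) f" for f :: "complex \<Rightarrow> complex"
    by (rule continuous_on_compose2[OF that]) (auto simp: coords_def intro!: continuous_intros)
  show ?thesis
    unfolding Phi4_def Phi_def phase_def case_prod_unfold
    by (intro continuous_intros continuous_on_smult c lcn_continuous) (auto simp: coords_def)
qed

lemma hol4_pull:
  assumes a: "mv_holomorphic_on a V"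
    and sub: "\<And>x y u e. x \<in> A \<Longrightarrow> y \<in> B \<Longrightarrow> u \<in> C \<Longrightarrow> e \<in> D \<Longrightarrow> x \<noteq> 0 \<and> u \<notin> lpoles \<and> (Phi \<nu> x y u, e) \<in> V"
  shows "hol4 (pull \<nu> a) A B C D"
proof (rule hol4I)
  have "continuous_on V a"
    using a unfolding mv_holomorphic_on_def
    by (intro continuous_at_imp_continuous_on) (metis has_derivative_continuous)
  then have "continuous_on (A \<times> B \<times> C \<times> D) (\<lambda>p. a (Phi4 \<nu> p))"
    by (rule continuous_on_compose2[OF _ continuous_on_subset[OF Phi4_continuous]])
       (use sub in \<open>auto simp: coords_def Phi4_def\<close>)
  then show "continuous_on (A \<times> B \<times> C \<times> D) (\<lambda>p. pull \<nu> a (fst p) (fst (snd p)) (fst (snd (snd p))) (snd (snd (snd p))))"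
    by (simp add: pull_def Phi4_def case_prod_unfold)
  have d: "\<exists>D. (a has_derivative D) (at (Phi \<nu> x y u, e)) \<and> complex_linear D \<and> x \<noteq> 0 \<and> u \<notin> lpoles"
    if "x \<in> A" "y \<in> B" "u \<in> C" "e \<in> D" for x y u e
    using a sub[OF that] unfolding mv_holomorphic_on_def complex_linear_def by blast
  have h: "f holomorphic_on S" if "\<And>t. t \<in> S \<Longrightarrow> \<exists>f'. (f has_field_derivative f') (at t)" for f S
    using that unfolding holomorphic_on_def field_differentiable_def by (meson has_field_derivative_at_within)
  fix x y u e assume m: "x \<in> A" "y \<in> B" "u \<in> C" "e \<in> D"
  show "(\<lambda>t. pull \<nu> a t y u e) holomorphic_on A" using d[OF _ m(2-4)] pull_derivatives(1) by (intro h) blast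
  show "(\<lambda>t. pull \<nu> a x t u e) holomorphic_on B" using d[OF m(1) _ m(3,4)] pull_derivatives(2) by (intro h) blast
  show "(\<lambda>t. pull \<nu> a x y t e) holomorphic_on C" using d[OF m(1,2) _ m(4)] pull_derivatives(3) by (intro h) blast
  show "(\<lambda>t. pull \<nu> a x y u t) holomorphic_on D" using d[OF m(1-3)] pull_derivatives(4) by (intro h) blast
qed

text \<open>Up to sign and a power of x, the determinant of the coordinate fields is
  \<open>2 * lcn'^2 + lcn^4\<close>, which the energy relation makes 1. So the coordinates
  degenerate nowhere off x = 0 and the poles, and \<open>h1\<close>, \<open>h3\<close> are explicit
  dual coefficients.\<close>

lemma Phi_span:
  assumes "x \<noteq> 0" "u \<notin> lpoles"
  defines "h1 \<equiv> \<lambda>w :: complex ^ 3. lcn u ^ 3 * w $ 1 + lcn' u / x * w $ 2"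
    and "h3 \<equiv> \<lambda>w :: complex ^ 3. 2 * lcn' u / x * w $ 1 - lcn u / x\<^sup>2 * w $ 2"
  shows "(w :: complex ^ 3) = h1 w *s vx \<nu> x u + (w $ 3 + of_real \<nu> * (u - iK) / x\<^sup>2 * h1 w - of_real \<nu> / x * h3 w) *s vy + h3 w *s vu \<nu> x u"
proof -
  have P2: "2 * (lcn' u * lcn' u) + lcn u * lcn u ^ 3 = 1"
  proof -
    have "2 * (lcn' u)\<^sup>2 = 1 - lcn u ^ 4" using lcn'_square[OF assms(2)] by (simp add: mult.commute)
    then show ?thesis by (simp add: power2_eq_square power4_eq_xxxx power3_eq_cube mult.assoc)
  qed
  have 1: "h1 w * lcn u + h3 w * (x * lcn' u) = w $ 1"
  proof -
    have "h1 w * lcn u + h3 w * (x * lcn' u) = (2 * (lcn' u * lcn' u) + lcn u * lcn u ^ 3) * w $ 1"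
      using assms(1) by (simp add: h1_def h3_def field_simps power2_eq_square power3_eq_cube)
    then show ?thesis by (simp add: P2)
  qed
  have 2: "h1 w * (2 * x * lcn' u) + h3 w * (- x\<^sup>2 * lcn u ^ 3) = w $ 2"
  proof -
    have "h1 w * (2 * x * lcn' u) + h3 w * (- x\<^sup>2 * lcn u ^ 3) = (2 * (lcn' u * lcn' u) + lcn u * lcn u ^ 3) * w $ 2"
      using assms(1) by (simp add: h1_def h3_def field_simps power2_eq_square power3_eq_cube)
    then show ?thesis by (simp add: P2)
  qed
  show ?thesis
    unfolding vec3_eq_iff vx_def vy_def vu_def using 1 2 by (simp add: algebra_simps) (simp flip: add_divide_distrib)
qed

text \<open>The derivative of the coordinate map has a right inverse, so images of open sets have
  interior. This is how conditions in the original space, holding almost everywhere or off a set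
  without interior, become visible in the coordinates.\<close>

lemma Phi4_interior:
  assumes T: "open T" "T \<subseteq> coords" "T \<noteq> {}"
  shows "interior (Phi4 \<nu> ` T) \<noteq> {}"
proof -
  obtain x y u e where p: "(x, y, u, e) \<in> T" using T(3) by (metis ex_in_conv prod_cases4)
  have xu: "x \<noteq> 0" "u \<notin> lpoles" using p T(2) by (auto simp: coords_def)
  have dC: "(lcn has_derivative (*) (lcn' u)) (at u)" and dP: "(lcn' has_derivative (*) (- (lcn u ^ 3))) (at u)"
    using lcn_derivative[OF xu(2)] lcn'_derivative[OF xu(2)] by (auto simp: has_field_derivative_def)
  define f' where "f' = (\<lambda>h :: complex \<times> complex \<times> complex \<times> complex.
     (fst h *s vx \<nu> x u + fst (snd h) *s vy + fst (snd (snd h)) *s vu \<nu> x u, snd (snd (snd h))))"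
  have der: "(Phi4 \<nu> has_derivative f') (at (x, y, u, e))"
  proof -
    have pr: "((\<lambda>p. fst (snd (snd p))) has_derivative (\<lambda>h. fst (snd (snd h)))) (at (x, y, u, e))"
      by (auto intro!: derivative_eq_intros)
    have C4: "((\<lambda>p. lcn (fst (snd (snd p)))) has_derivative (\<lambda>h. lcn' u * fst (snd (snd h)))) (at (x, y, u, e))"
      using has_derivative_compose[OF pr, of lcn "(*) (lcn' u)"] dC by simp
    have P4: "((\<lambda>p. lcn' (fst (snd (snd p)))) has_derivative (\<lambda>h. - (lcn u ^ 3) * fst (snd (snd h)))) (at (x, y, u, e))"
      using has_derivative_compose[OF pr, of lcn' "(*) (- (lcn u ^ 3))"] dP by simp
    have x1: "((\<lambda>p. fst p * lcn (fst (snd (snd p)))) has_derivative (\<lambda>h. x * (lcn' u * fst (snd (snd h))) + fst h * lcn u)) (at (x, y, u, e))"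
      using has_derivative_mult[OF has_derivative_fst[OF has_derivative_ident] C4] by simp
    have x2: "((\<lambda>p. (fst p)\<^sup>2 * lcn' (fst (snd (snd p)))) has_derivative
        (\<lambda>h. x\<^sup>2 * (- (lcn u ^ 3) * fst (snd (snd h))) + (2 * x * fst h) * lcn' u)) (at (x, y, u, e))"
    proof -
      have "((\<lambda>p. (fst p)\<^sup>2) has_derivative (\<lambda>h. 2 * x * fst h)) (at (x, y, u, e))"
        by (auto intro!: derivative_eq_intros)
      from has_derivative_mult[OF this P4] show ?thesis by simp
    qed
    have x3: "((\<lambda>p. phase \<nu> (fst p) (fst (snd p)) (fst (snd (snd p)))) has_derivative
        (\<lambda>h. fst (snd h) + of_real \<nu> / x * fst (snd (snd h)) - of_real \<nu> * (u - iK) / x\<^sup>2 * fst h)) (at (x, y, u, e))"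
      unfolding phase_def using xu(1)
      by (auto intro!: derivative_eq_intros simp: fun_eq_iff field_simps power2_eq_square)
    have "((\<lambda>p. ((fst p * lcn (fst (snd (snd p)))) *s axis 1 1 + ((fst p)\<^sup>2 * lcn' (fst (snd (snd p)))) *s axis 2 1
        + phase \<nu> (fst p) (fst (snd p)) (fst (snd (snd p))) *s axis 3 1, snd (snd (snd p)))) has_derivative
      (\<lambda>h. ((x * (lcn' u * fst (snd (snd h))) + fst h * lcn u) *s axis 1 1 + (x\<^sup>2 * (- (lcn u ^ 3) * fst (snd (snd h))) + (2 * x * fst h) * lcn' u) *s axis 2 1
        + (fst (snd h) + of_real \<nu> / x * fst (snd (snd h)) - of_real \<nu> * (u - iK) / x\<^sup>2 * fst h) *s (axis 3 1 :: complex ^ 3), snd (snd (snd h))))) (at (x, y, u, e))"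
      by (intro has_derivative_Pair has_derivative_add has_derivative_smult x1 x2 x3 has_derivative_snd has_derivative_ident)
    also have "(\<lambda>h. ((x * (lcn' u * fst (snd (snd h))) + fst h * lcn u) *s axis 1 1 + (x\<^sup>2 * (- (lcn u ^ 3) * fst (snd (snd h))) + (2 * x * fst h) * lcn' u) *s axis 2 1
        + (fst (snd h) + of_real \<nu> / x * fst (snd (snd h)) - of_real \<nu> * (u - iK) / x\<^sup>2 * fst h) *s (axis 3 1 :: complex ^ 3), snd (snd (snd h)))) = f'"
      by (simp add: f'_def fun_eq_iff vec3_eq_iff vx_def vy_def vu_def algebra_simps) (simp flip: add_divide_distrib)
    finally show ?thesis by (simp add: Phi4_def Phi_def case_prod_unfold)
  qed
  define h1 where "h1 = (\<lambda>w :: complex ^ 3. lcn u ^ 3 * w $ 1 + lcn' u / x * w $ 2)"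
  define h3 where "h3 = (\<lambda>w :: complex ^ 3. 2 * lcn' u / x * w $ 1 - lcn u / x\<^sup>2 * w $ 2)"
  define g' where "g' = (\<lambda>z :: 3 spt. (h1 (fst z), fst z $ 3 + of_real \<nu> * (u - iK) / x\<^sup>2 * h1 (fst z) - of_real \<nu> / x * h3 (fst z), h3 (fst z), snd z))"
  have h_add: "h1 (v + w) = h1 v + h1 w" "h3 (v + w) = h3 v + h3 w" for v w
    by (simp_all add: h1_def h3_def ring_distribs add_divide_distrib)
  have h_scale: "h1 (r *\<^sub>R v) = r *\<^sub>R h1 v" "h3 (r *\<^sub>R v) = r *\<^sub>R h3 v" for r v
    by (simp_all add: h1_def h3_def scaleR_right_distrib scaleR_right_diff_distrib divide_inverse)
  have "bounded_linear g'"
    unfolding linear_conv_bounded_linear[symmetric] g'_def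
    by (rule linearI)
       (simp_all add: h_add h_scale scaleR_right_distrib scaleR_right_diff_distrib,
        simp add: ring_distribs add_divide_distrib diff_divide_distrib)
  moreover have "f' \<circ> g' = id"
    using Phi_span[OF xu] by (auto simp: f'_def g'_def h1_def h3_def fun_eq_iff)
  ultimately have "Phi4 \<nu> (x, y, u, e) \<in> interior (Phi4 \<nu> ` T)"
    using sussmann_open_mapping[OF open_coords Phi4_continuous _ der, of g' T] T p interior_open[OF T(1)] by auto
  then show ?thesis by blast
qed

lemma lcn_fourth_power: assumes "u \<notin> lpoles" shows "lcn u ^ 4 = 1 - 2 * lcn' u ^ 2"
  using lcn'_square[OF assms] by (simp add: mult.commute)

text \<open>At e = 0 only \<open>x *s vu\<close> remains, so u is time scaled by the amplitude.
  \<open>wx\<close> and \<open>wu\<close> are the dual coefficients \<open>h1\<close> and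
  \<open>h3\<close> of \<open>Phi_span\<close> for the perturbing force, and \<open>wy\<close>
  compensates the phase; the check again uses the energy relation.\<close>

lemma field_pull:
  assumes "x \<noteq> 0" "u \<notin> lpoles"
  shows "duffing_field \<beta> \<delta> \<nu> e (Phi \<nu> x y u) =
    (x + e * wu \<beta> \<delta> \<nu> x y u) *s vu \<nu> x u + (e * wx \<beta> \<delta> \<nu> x y u) *s vx \<nu> x u + (e * wy \<beta> \<delta> \<nu> x y u) *s vy"
proof -
  define c where "c = cos (phase \<nu> x y u)"
  have 1: "x\<^sup>2 * lcn' u = (x + e * wu \<beta> \<delta> \<nu> x y u) * (x * lcn' u) + e * wx \<beta> \<delta> \<nu> x y u * lcn u"
    using assms(1) by (simp add: wu_def wx_def c_def[symmetric] field_simps power2_eq_square)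
  have 2: "- ((x * lcn u) ^ 3) + e * (of_real \<beta> * c - of_real \<delta> * (x\<^sup>2 * lcn' u)) =
      (x + e * wu \<beta> \<delta> \<nu> x y u) * (- x\<^sup>2 * lcn u ^ 3) + e * wx \<beta> \<delta> \<nu> x y u * (2 * x * lcn' u)"
  proof -
    have "(x + e * wu \<beta> \<delta> \<nu> x y u) * (- x\<^sup>2 * lcn u ^ 3) + e * wx \<beta> \<delta> \<nu> x y u * (2 * x * lcn' u) =
       - ((x * lcn u) ^ 3) + e * (of_real \<beta> * c - of_real \<delta> * (x\<^sup>2 * lcn' u)) * (lcn u ^ 4 + 2 * lcn' u ^ 2)"
      using assms(1) by (simp add: wu_def wx_def c_def[symmetric] field_simps power2_eq_square power3_eq_cube power4_eq_xxxx)
    then show ?thesis using lcn_fourth_power[OF assms(2)] by simp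
  qed
  have 3: "of_real \<nu> = (x + e * wu \<beta> \<delta> \<nu> x y u) * (of_real \<nu> / x) + e * wx \<beta> \<delta> \<nu> x y u * (- of_real \<nu> * (u - iK) / x\<^sup>2) + e * wy \<beta> \<delta> \<nu> x y u"
    using assms(1) by (simp add: wu_def wx_def wy_def zq_def c_def[symmetric] field_simps power2_eq_square power3_eq_cube)
  show ?thesis
    unfolding vec3_eq_iff using 1 2 3
    by (simp add: duffing_field_def vector_3 Phi_nth vu_def vx_def vy_def c_def)
qed

text \<open>\<open>L\<close> is the derivative along \<open>duffing_field\<close>, by \<open>field_pull\<close>.\<close>

definition has_L :: "real \<Rightarrow> real \<Rightarrow> real \<Rightarrow> (complex \<Rightarrow> complex \<Rightarrow> complex \<Rightarrow> complex \<Rightarrow> complex) \<Rightarrow>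
    complex \<Rightarrow> complex \<Rightarrow> complex \<Rightarrow> complex \<Rightarrow> complex \<Rightarrow> bool" where
  "has_L \<beta> \<delta> \<nu> g x y u e v \<longleftrightarrow> (\<exists>d1 d2 d3. ((\<lambda>t. g t y u e) has_field_derivative d1) (at x) \<and>
     ((\<lambda>t. g x t u e) has_field_derivative d2) (at y) \<and> ((\<lambda>t. g x y t e) has_field_derivative d3) (at u) \<and>
     (x + e * wu \<beta> \<delta> \<nu> x y u) * d3 + e * (wx \<beta> \<delta> \<nu> x y u * d1 + wy \<beta> \<delta> \<nu> x y u * d2) = v)"

lemma has_L_pull:
  assumes "(F has_derivative D) (at (Phi \<nu> x y u, e))" "complex_linear D" "x \<noteq> 0" "u \<notin> lpoles"
  shows "has_L \<beta> \<delta> \<nu> (pull \<nu> F) x y u e (D (duffing_field \<beta> \<delta> \<nu> e (Phi \<nu> x y u), 0))"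
proof -
  have l: "linear D" using assms(1) has_derivative_linear by blast
  have s: "D (a *s v, 0) = a * D (v, 0)" for a v
    using assms(2)[unfolded complex_linear_def, rule_format, of a "(v, 0)"] by simp
  have a: "D (v + w, 0) = D (v, 0) + D (w, 0)" for v w
    using linear_add[OF l, of "(v, 0)" "(w, 0)"] by simp
  show ?thesis
    unfolding has_L_def field_pull[OF assms(3,4)] a s
    by (rule exI conjI pull_derivatives[OF assms])+ (simp add: algebra_simps)
qed

lemma has_L_add:
  assumes "has_L \<beta> \<delta> \<nu> f x y u e v" "has_L \<beta> \<delta> \<nu> g x y u e w"
  shows "has_L \<beta> \<delta> \<nu> (\<lambda>x y u e. f x y u e + g x y u e) x y u e (v + w)"
proof -
  obtain a1 a2 a3 where a: "((\<lambda>t. f t y u e) has_field_derivative a1) (at x)"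
    "((\<lambda>t. f x t u e) has_field_derivative a2) (at y)" "((\<lambda>t. f x y t e) has_field_derivative a3) (at u)"
    "v = (x + e * wu \<beta> \<delta> \<nu> x y u) * a3 + e * (wx \<beta> \<delta> \<nu> x y u * a1 + wy \<beta> \<delta> \<nu> x y u * a2)"
    using assms(1) unfolding has_L_def by blast
  obtain b1 b2 b3 where b: "((\<lambda>t. g t y u e) has_field_derivative b1) (at x)"
    "((\<lambda>t. g x t u e) has_field_derivative b2) (at y)" "((\<lambda>t. g x y t e) has_field_derivative b3) (at u)"
    "w = (x + e * wu \<beta> \<delta> \<nu> x y u) * b3 + e * (wx \<beta> \<delta> \<nu> x y u * b1 + wy \<beta> \<delta> \<nu> x y u * b2)"
    using assms(2) unfolding has_L_def by blast
  show ?thesis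
    unfolding has_L_def a(4) b(4)
    by (rule exI[of _ "a1 + b1"], rule exI[of _ "a2 + b2"], rule exI[of _ "a3 + b3"])
       (simp add: DERIV_add[OF a(1) b(1)] DERIV_add[OF a(2) b(2)] DERIV_add[OF a(3) b(3)] algebra_simps)
qed

lemma has_L_mult:
  assumes "has_L \<beta> \<delta> \<nu> f x y u e v" "has_L \<beta> \<delta> \<nu> g x y u e w"
  shows "has_L \<beta> \<delta> \<nu> (\<lambda>x y u e. f x y u e * g x y u e) x y u e (v * g x y u e + w * f x y u e)"
proof -
  obtain a1 a2 a3 where a: "((\<lambda>t. f t y u e) has_field_derivative a1) (at x)"
    "((\<lambda>t. f x t u e) has_field_derivative a2) (at y)" "((\<lambda>t. f x y t e) has_field_derivative a3) (at u)"
    "v = (x + e * wu \<beta> \<delta> \<nu> x y u) * a3 + e * (wx \<beta> \<delta> \<nu> x y u * a1 + wy \<beta> \<delta> \<nu> x y u * a2)"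
    using assms(1) unfolding has_L_def by blast
  obtain b1 b2 b3 where b: "((\<lambda>t. g t y u e) has_field_derivative b1) (at x)"
    "((\<lambda>t. g x t u e) has_field_derivative b2) (at y)" "((\<lambda>t. g x y t e) has_field_derivative b3) (at u)"
    "w = (x + e * wu \<beta> \<delta> \<nu> x y u) * b3 + e * (wx \<beta> \<delta> \<nu> x y u * b1 + wy \<beta> \<delta> \<nu> x y u * b2)"
    using assms(2) unfolding has_L_def by blast
  let ?d = "\<lambda>a b. a * g x y u e + b * f x y u e"
  show ?thesis
    unfolding has_L_def a(4) b(4)
    by (rule exI[of _ "?d a1 b1"], rule exI[of _ "?d a2 b2"], rule exI[of _ "?d a3 b3"])
       (intro conjI DERIV_mult[OF a(1) b(1)] DERIV_mult[OF a(2) b(2)] DERIV_mult[OF a(3) b(3)], simp add: algebra_simps)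
qed

lemma has_L_param: "has_L \<beta> \<delta> \<nu> (\<lambda>x y u e. f e) x y u e 0"
  unfolding has_L_def by (rule exI conjI DERIV_const)+ simp

lemma has_L_amplitude: "(f has_field_derivative f') (at x) \<Longrightarrow>
    has_L \<beta> \<delta> \<nu> (\<lambda>x y u e. f x) x y u e (e * wx \<beta> \<delta> \<nu> x y u * f')"
  unfolding has_L_def by (rule exI conjI DERIV_const | assumption)+ simp

lemma has_L_time: "(f has_field_derivative f') (at u) \<Longrightarrow>
    has_L \<beta> \<delta> \<nu> (\<lambda>x y u e. f u) x y u e ((x + e * wu \<beta> \<delta> \<nu> x y u) * f')"
  unfolding has_L_def by (rule exI conjI DERIV_const | assumption)+ simp

text \<open>For a field \<open>Y\<close> without \<open>\<phi>\<close>-component, written as \<open>p \<partial>\<^sub>x + q \<partial>\<^sub>y + r \<partial>\<^sub>u\<close>.\<close>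

definition comp_p :: "real \<Rightarrow> (3 spt \<Rightarrow> complex) \<Rightarrow> (3 spt \<Rightarrow> complex) \<Rightarrow> complex \<Rightarrow> complex \<Rightarrow> complex \<Rightarrow> complex \<Rightarrow> complex" where
  "comp_p \<nu> Y1 Y2 x y u e = lcn u ^ 3 * pull \<nu> Y1 x y u e + lcn' u * (1 / x) * pull \<nu> Y2 x y u e"
definition comp_q :: "real \<Rightarrow> (3 spt \<Rightarrow> complex) \<Rightarrow> (3 spt \<Rightarrow> complex) \<Rightarrow> complex \<Rightarrow> complex \<Rightarrow> complex \<Rightarrow> complex \<Rightarrow> complex" where
  "comp_q \<nu> Y1 Y2 x y u e = (- zq' u) * (of_real \<nu> / x\<^sup>2) * pull \<nu> Y1 x y u e + zq u * (of_real \<nu> / x ^ 3) * pull \<nu> Y2 x y u e"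

lemma zq_derivatives:
  assumes "u \<notin> lpoles"
  shows "(zq has_field_derivative zq' u) (at u)" "(zq' has_field_derivative - 3 * lcn u ^ 2 * zq u) (at u)"
  unfolding zq_def[abs_def] zq'_def[abs_def]
  by ((rule derivative_eq_intros lcn_derivative[OF assms] lcn'_derivative[OF assms] refl)+,
      simp add: zq_def algebra_simps power2_eq_square power3_eq_cube)+

text \<open>The solutions \<open>lcn'\<close> and \<open>zq\<close> of the linearised equation have
  Wronskian 1, which inverts the definitions of \<open>comp_p\<close> and
  \<open>comp_q\<close>.\<close>

lemma comp_inverse:
  assumes "x \<noteq> 0" "u \<notin> lpoles" "\<nu> \<noteq> 0"
  shows "pull \<nu> Y1 x y u e = zq u * comp_p \<nu> Y1 Y2 x y u e - x\<^sup>2 / of_real \<nu> * lcn' u * comp_q \<nu> Y1 Y2 x y u e"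
    "pull \<nu> Y2 x y u e = x * zq' u * comp_p \<nu> Y1 Y2 x y u e + x ^ 3 / of_real \<nu> * lcn u ^ 3 * comp_q \<nu> Y1 Y2 x y u e"
proof -
  have W: "lcn' u * zq' u + lcn u ^ 3 * zq u = 1"
    using lcn_fourth_power[OF assms(2)] by (simp add: zq_def zq'_def algebra_simps power2_eq_square power3_eq_cube power4_eq_xxxx)
  have "zq u * comp_p \<nu> Y1 Y2 x y u e - x\<^sup>2 / of_real \<nu> * lcn' u * comp_q \<nu> Y1 Y2 x y u e
      = (lcn' u * zq' u + lcn u ^ 3 * zq u) * pull \<nu> Y1 x y u e"
    using assms(1,3) by (simp add: comp_p_def comp_q_def field_simps power2_eq_square power3_eq_cube)
  then show "pull \<nu> Y1 x y u e = zq u * comp_p \<nu> Y1 Y2 x y u e - x\<^sup>2 / of_real \<nu> * lcn' u * comp_q \<nu> Y1 Y2 x y u e"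
    by (simp add: W)
  have "x * zq' u * comp_p \<nu> Y1 Y2 x y u e + x ^ 3 / of_real \<nu> * lcn u ^ 3 * comp_q \<nu> Y1 Y2 x y u e
      = (lcn' u * zq' u + lcn u ^ 3 * zq u) * pull \<nu> Y2 x y u e"
    using assms(1,3) by (simp add: comp_p_def comp_q_def field_simps power2_eq_square power3_eq_cube)
  then show "pull \<nu> Y2 x y u e = x * zq' u * comp_p \<nu> Y1 Y2 x y u e + x ^ 3 / of_real \<nu> * lcn u ^ 3 * comp_q \<nu> Y1 Y2 x y u e"
    by (simp add: W)
qed

text \<open>The algebra of the order-e terms in the equations for \<open>comp_p\<close> and
  \<open>comp_q\<close>. \<open>WU\<close> and \<open>WX\<close> are multiples of one quantity
  \<open>S\<close>; once \<open>Y1\<close> and \<open>Y2\<close> are inserted, both sides are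
  polynomials that agree modulo the energy relation.\<close>

lemma variational_identities:
  fixes C P Q z z' x n c \<beta> \<delta> p q Y1 Y2 WU WX :: complex
  assumes r: "C ^ 4 = 1 - 2 * P ^ 2" and z: "z = C + Q * P" "z' = 2 * P - Q * C ^ 3"
    and i: "x \<noteq> 0" "n \<noteq> 0"
    and Y: "Y1 = z * p - x^2 / n * P * q" "Y2 = x * z' * p + x^3 / n * C^3 * q"
    and W: "WU = \<delta> * P * C - \<beta> * (1/x)^2 * c * C" "WX = \<beta> * (1/x) * c * P - \<delta> * x * (P * P)"
  shows "- \<delta> * P * (1/x) * Y2 + WU * (3 * C^2 * P * Y1 - C^3 * (1/x) * Y2) - WX * P * (1/x)^2 * Y2 =
     (\<delta> * (2 * Q * P * C ^ 3 - P * P) - \<beta> * (1/x)^2 * c * (P + Q * C ^ 3)) * p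
      + (1/n * (\<beta> * c * C ^ 3 - 2 * \<delta> * x^2 * P * C ^ 3)) * q" (is "?L1 = ?R1")
   "- \<delta> * n * z * (1/x)^3 * Y2 + WU * (3 * n * (1/x)^2 * C^2 * z * Y1 + n * (1/x)^3 * z' * Y2)
      + WX * (2 * n * (1/x)^3 * z' * Y1 - 3 * n * (1/x)^4 * z * Y2) =
     (n * (1/x)^4 * \<beta> * c * (Q * z' - 3 * z) + n * (1/x)^2 * \<delta> * (3 * (P * z) - z' * z - Q * P * z')) * p
      + (\<delta> * (P * z' - C ^ 3 * z) - \<beta> * (1/x)^2 * c * z') * q" (is "?L2 = ?R2")
proof -
  \<comment> \<open>\<open>S\<close> is minus the acceleration due to forcing and damping, divided
    by x^2. \<open>E\<close> is kept symbolic until the polynomial identities have been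
    matched.\<close>
  define S where "S = \<delta> * P - \<beta> * c * (1/x)^2"
  define E where "E = C ^ 4 + 2 * P ^ 2"
  have W': "WU = S * C" "WX = - (x * P * S)"
    using i by (simp_all add: W S_def field_simps power2_eq_square)
  have S': "\<beta> * c = x^2 * (\<delta> * P - S)" using i by (simp add: S_def field_simps power2_eq_square)
  have \<beta>: "\<beta> * (1/x)^2 * c = \<delta> * P - S" by (simp add: S_def)
  have E: "E = 1" using r by (simp add: E_def)
  have Y2x: "(1/x) * Y2 = z' * p + x^2 / n * C^3 * q" and Y2x3: "(1/x)^3 * Y2 = (1/x)^2 * z' * p + C^3 / n * q"
    using i by (simp_all add: Y field_simps power2_eq_square power3_eq_cube)
  have "?L1 = - \<delta> * P * ((1/x) * Y2) + S * (3 * C^3 * P * Y1 - C^4 * ((1/x) * Y2) + P ^ 2 * ((1/x) * Y2))"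
    unfolding W' using i by (simp add: field_simps power2_eq_square power3_eq_cube power4_eq_xxxx)
  also have "\<dots> = (- \<delta> * P * z' + S * (P + Q * C ^ 3) * E) * p + 1 / n * (- \<delta> * x^2 * P * C^3 - x^2 * S * C^3 * E) * q"
    unfolding Y2x Y(1) z E_def by (simp add: algebra_simps power2_eq_square power3_eq_cube power4_eq_xxxx)
  also have "\<dots> = ?R1"
    unfolding \<beta> S' E z using i by (simp add: algebra_simps power2_eq_square power3_eq_cube power4_eq_xxxx)
  finally show "?L1 = ?R1" .
  have "?L2 = - \<delta> * n * z * ((1/x)^3 * Y2) + S * (3 * n * (1/x)^2 * C^3 * z * Y1 + n * C * z' * ((1/x)^3 * Y2))
      - S * (2 * n * (1/x)^2 * P * z' * Y1) + S * 3 * n * P * z * ((1/x)^3 * Y2)"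
    unfolding W' using i by (simp add: field_simps power2_eq_square power3_eq_cube power4_eq_xxxx)
  also have "\<dots> = (n * (1/x)^2 * (- \<delta> * z * z' + S * (3 * z - Q * z') * E)) * p + (- \<delta> * C^3 * z + S * z' * E) * q"
  proof -
    have x: "x^2 * (1/x)^2 = 1" using i by (simp add: field_simps)
    have n: "n / n = 1" using i by simp
    define k where "k = (1/x)^2"
    define m where "m = 1 / n"
    have nm: "n * m = 1" "x^2 * k = 1" using n x by (simp_all add: m_def k_def)
    have Z: "3 * C^3 * z * z + C * z' * z' + P * z * z' = (3 * z - Q * z') * E"
      "C * C^3 + 2 * P ^ 2 = E"
      unfolding z E_def by (simp_all add: algebra_simps power2_eq_square power3_eq_cube power4_eq_xxxx)
    have "- \<delta> * n * z * (k * z' * p + C^3 * m * q) + S * (3 * n * k * C^3 * z * (z * p - x^2 * m * P * q) + n * C * z' * (k * z' * p + C^3 * m * q))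
      - S * (2 * n * k * P * z' * (z * p - x^2 * m * P * q)) + S * 3 * n * P * z * (k * z' * p + C^3 * m * q)
      = n * k * (- \<delta> * z * z' + S * (3 * C^3 * z * z + C * z' * z' + P * z * z')) * p + (n * m) * (- \<delta> * z * C^3 + S * z' * (C * C^3) + 3 * S * P * z * C^3) * q
        + (n * m) * (x^2 * k) * (2 * S * P^2 * z' - 3 * S * C^3 * z * P) * q"
      by (simp add: algebra_simps power2_eq_square)
    also have "\<dots> = n * k * (- \<delta> * z * z' + S * ((3 * z - Q * z') * E)) * p + (- \<delta> * z * C^3 + S * z' * (C * C^3 + 2 * P^2)) * q"
      unfolding nm Z(1) by (simp add: algebra_simps)
    also have "\<dots> = (n * k * (- \<delta> * z * z' + S * (3 * z - Q * z') * E)) * p + (- \<delta> * C^3 * z + S * z' * E) * q"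
      unfolding Z(2) by (simp add: algebra_simps)
    finally show ?thesis unfolding Y2x3 Y(1) k_def m_def by simp
  qed
  also have "\<dots> = ?R2"
  proof -
    have b4: "n * (1/x)^4 * \<beta> * c = n * (1/x)^2 * (\<delta> * P - S)"
      unfolding \<beta>[symmetric] using i by (simp add: field_simps)
    show ?thesis unfolding b4 \<beta> E by (simp add: algebra_simps)
  qed
  finally show "?L2 = ?R2" .
qed

text \<open>The terms of order zero in e cancel up to multiples of \<open>1 - x * r\<close>, where
  \<open>r\<close> stands for 1 / x; in this form they are checked without division.\<close>

lemma comp_pde_expand:
  fixes x r e WU WX C P n z z' \<delta> y1 y2 :: complex
  assumes "x * r = 1"
  shows "(x + e * WU) * (3 * C ^ 2 * P) * y1 + y2 * C ^ 3 +
      (((x + e * WU) * - (C ^ 3) * r + e * WX * (- r\<^sup>2) * P) * y2 + (- 3 * (x * C)\<^sup>2 * y1 - e * \<delta> * y2) * (P * r)) =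
      e * (- \<delta> * P * r * y2 + WU * (3 * C ^ 2 * P * y1 - C ^ 3 * r * y2) - WX * P * r\<^sup>2 * y2)" (is "?L1 = ?R1")
    "(((x + e * WU) * (3 * C ^ 2 * z) * (n * r\<^sup>2) + e * WX * (- 2 * n * r ^ 3) * - z') * y1 + y2 * (- z' * (n * r\<^sup>2))) +
      (((x + e * WU) * z' * (n * r ^ 3) + e * WX * (- 3 * n * r ^ 4) * z) * y2 +
       (- 3 * (x * C)\<^sup>2 * y1 - e * \<delta> * y2) * (z * (n * r ^ 3))) =
     e * (- \<delta> * n * z * r^3 * y2 + WU * (3 * n * r^2 * C^2 * z * y1 + n * r^3 * z' * y2)
      + WX * (2 * n * r^3 * z' * y1 - 3 * n * r^4 * z * y2))" (is "?L2 = ?R2")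
proof -
  have "?L1 = ?R1 + (1 - x * r) * (y2 * C ^ 3 + 3 * x * C\<^sup>2 * P * y1)"
    by (simp add: algebra_simps power2_eq_square)
  then show "?L1 = ?R1" using assms by simp
  have "?L2 = ?R2 + (1 - x * r) * (3 * x * C\<^sup>2 * z * n * r\<^sup>2 * y1 - n * z' * r\<^sup>2 * y2)"
    by (simp add: algebra_simps power2_eq_square power3_eq_cube)
  then show "?L2 = ?R2" using assms by simp
qed

text \<open>Variation of constants. \<open>b1\<close> and \<open>b2\<close> express commutation with
  \<open>duffing_field\<close>, so that (Y1, Y2) solves the linearised equation along the flow. Its
  coefficients with respect to the solutions built from \<open>zq\<close> and \<open>lcn'\<close>
  are constant for e = 0, so their derivative along the flow carries a factor e.\<close>

lemma comp_pde:
  assumes xu: "x \<noteq> 0" "u \<notin> lpoles" "\<nu> \<noteq> 0"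
    and Y1: "(Y1 has_derivative D1) (at (Phi \<nu> x y u, e))" "complex_linear D1"
    and Y2: "(Y2 has_derivative D2) (at (Phi \<nu> x y u, e))" "complex_linear D2"
    and b1: "D1 (duffing_field \<beta> \<delta> \<nu> e (Phi \<nu> x y u), 0) = pull \<nu> Y2 x y u e"
    and b2: "D2 (duffing_field \<beta> \<delta> \<nu> e (Phi \<nu> x y u), 0) =
       - 3 * (Phi \<nu> x y u $ 1)\<^sup>2 * pull \<nu> Y1 x y u e - e * of_real \<delta> * pull \<nu> Y2 x y u e"
  shows "has_L \<beta> \<delta> \<nu> (comp_p \<nu> Y1 Y2) x y u e
      (e * (kk \<beta> \<delta> \<nu> True True x y u * comp_p \<nu> Y1 Y2 x y u e + kk \<beta> \<delta> \<nu> True False x y u * comp_q \<nu> Y1 Y2 x y u e))"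
    "has_L \<beta> \<delta> \<nu> (comp_q \<nu> Y1 Y2) x y u e
      (e * (kk \<beta> \<delta> \<nu> False True x y u * comp_p \<nu> Y1 Y2 x y u e + kk \<beta> \<delta> \<nu> False False x y u * comp_q \<nu> Y1 Y2 x y u e))"
proof -
  let ?y1 = "pull \<nu> Y1 x y u e" and ?y2 = "pull \<nu> Y2 x y u e"
  let ?p = "comp_p \<nu> Y1 Y2 x y u e" and ?q = "comp_q \<nu> Y1 Y2 x y u e"
  let ?WU = "wu \<beta> \<delta> \<nu> x y u" and ?WX = "wx \<beta> \<delta> \<nu> x y u"
  define r where "r = 1 / x"
  have xr: "x * r = 1" using xu(1) by (simp add: r_def)
  note dC = lcn_derivative[OF xu(2)] and dP = lcn'_derivative[OF xu(2)] and dz = zq_derivatives[OF xu(2)]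
  have P1: "has_L \<beta> \<delta> \<nu> (pull \<nu> Y1) x y u e ?y2"
    using has_L_pull[OF Y1 xu(1,2), of \<beta> \<delta>] by (simp only: b1)
  have P2: "has_L \<beta> \<delta> \<nu> (pull \<nu> Y2) x y u e (- 3 * (x * lcn u)\<^sup>2 * ?y1 - e * of_real \<delta> * ?y2)"
    using has_L_pull[OF Y2 xu(1,2), of \<beta> \<delta>] by (simp only: b2 Phi_nth)
  have t1: "has_L \<beta> \<delta> \<nu> (\<lambda>x y u e. lcn u ^ 3) x y u e ((x + e * ?WU) * (3 * lcn u ^ 2 * lcn' u))"
    by (rule has_L_time) (auto intro!: derivative_eq_intros dC)
  have t3: "has_L \<beta> \<delta> \<nu> (\<lambda>x y u e. 1 / x) x y u e (e * ?WX * (- r\<^sup>2))"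
    by (rule has_L_amplitude) (use xu in \<open>auto intro!: derivative_eq_intros simp: power2_eq_square r_def\<close>)
  have t4: "has_L \<beta> \<delta> \<nu> (\<lambda>x y u e. of_real \<nu> / x\<^sup>2) x y u e (e * ?WX * (- 2 * of_real \<nu> * r ^ 3))"
    by (rule has_L_amplitude) (use xu in \<open>auto intro!: derivative_eq_intros simp: power2_eq_square power3_eq_cube r_def divide_simps\<close>)
  have t5: "has_L \<beta> \<delta> \<nu> (\<lambda>x y u e. of_real \<nu> / x ^ 3) x y u e (e * ?WX * (- 3 * of_real \<nu> * r ^ 4))"
    by (rule has_L_amplitude) (use xu in \<open>auto intro!: derivative_eq_intros simp: power2_eq_square power3_eq_cube power4_eq_xxxx r_def divide_simps\<close>)
  have mz: "((\<lambda>u. - zq' u) has_field_derivative 3 * lcn u ^ 2 * zq u) (at u)"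
    using DERIV_minus[OF dz(2)] by simp
  have id: "?WU = of_real \<delta> * lcn' u * lcn u - of_real \<beta> * (1/x)^2 * cos (phase \<nu> x y u) * lcn u"
     "?WX = of_real \<beta> * (1/x) * cos (phase \<nu> x y u) * lcn' u - of_real \<delta> * x * (lcn' u * lcn' u)"
    by (simp_all add: wu_def wx_def)
  note inv = comp_inverse(1)[OF xu, of Y1 y e Y2] comp_inverse(2)[OF xu, of Y2 y e Y1]
  have \<nu>c: "complex_of_real \<nu> \<noteq> 0" using xu(3) by simp
  note vi = variational_identities[OF lcn_fourth_power[OF xu(2)] zq_def zq'_def xu(1) \<nu>c inv id, folded r_def]
  have kk: "kk \<beta> \<delta> \<nu> True True x y u = of_real \<delta> * (2 * (u - iK) * lcn' u * lcn u ^ 3 - lcn' u * lcn' u) - of_real \<beta> * r^2 * cos (phase \<nu> x y u) * (lcn' u + (u - iK) * lcn u ^ 3)"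
      "kk \<beta> \<delta> \<nu> True False x y u = (1 / of_real \<nu>) * (of_real \<beta> * cos (phase \<nu> x y u) * lcn u ^ 3 - 2 * of_real \<delta> * x^2 * lcn' u * lcn u ^ 3)"
      "kk \<beta> \<delta> \<nu> False True x y u = of_real \<nu> * r^4 * of_real \<beta> * cos (phase \<nu> x y u) * ((u - iK) * zq' u - 3 * zq u)
         + of_real \<nu> * r^2 * of_real \<delta> * (3 * (lcn' u * zq u) - zq' u * zq u - (u - iK) * lcn' u * zq' u)"
      "kk \<beta> \<delta> \<nu> False False x y u = of_real \<delta> * (lcn' u * zq' u - lcn u ^ 3 * zq u) - of_real \<beta> * r^2 * cos (phase \<nu> x y u) * zq' u"
    by (simp_all add: kk_def r_def)
  have "has_L \<beta> \<delta> \<nu> (comp_p \<nu> Y1 Y2) x y u e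
     ((x + e * ?WU) * (3 * lcn u ^ 2 * lcn' u) * ?y1 + ?y2 * lcn u ^ 3 +
      (((x + e * ?WU) * - (lcn u ^ 3) * (1 / x) + e * ?WX * (- r\<^sup>2) * lcn' u) * ?y2 +
       (- 3 * (x * lcn u)\<^sup>2 * ?y1 - e * of_real \<delta> * ?y2) * (lcn' u * (1 / x))))"
    unfolding comp_p_def[abs_def]
    by (rule has_L_add[OF has_L_mult[OF t1 P1] has_L_mult[OF has_L_mult[OF has_L_time[OF dP] t3] P2]])
  also have "(x + e * ?WU) * (3 * lcn u ^ 2 * lcn' u) * ?y1 + ?y2 * lcn u ^ 3 +
      (((x + e * ?WU) * - (lcn u ^ 3) * (1 / x) + e * ?WX * (- r\<^sup>2) * lcn' u) * ?y2 +
       (- 3 * (x * lcn u)\<^sup>2 * ?y1 - e * of_real \<delta> * ?y2) * (lcn' u * (1 / x))) =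
      e * (- of_real \<delta> * lcn' u * r * ?y2 + ?WU * (3 * lcn u ^ 2 * lcn' u * ?y1 - lcn u ^ 3 * r * ?y2) - ?WX * lcn' u * r\<^sup>2 * ?y2)"
    unfolding r_def[symmetric] by (rule comp_pde_expand(1)[OF xr])
  also have "\<dots> = e * (kk \<beta> \<delta> \<nu> True True x y u * ?p + kk \<beta> \<delta> \<nu> True False x y u * ?q)"
    unfolding kk using vi(1) by simp
  finally show "has_L \<beta> \<delta> \<nu> (comp_p \<nu> Y1 Y2) x y u e (e * (kk \<beta> \<delta> \<nu> True True x y u * ?p + kk \<beta> \<delta> \<nu> True False x y u * ?q))" .
  have "has_L \<beta> \<delta> \<nu> (comp_q \<nu> Y1 Y2) x y u e
     ((((x + e * ?WU) * (3 * lcn u ^ 2 * zq u) * (of_real \<nu> / x\<^sup>2) + e * ?WX * (- 2 * of_real \<nu> * r ^ 3) * - zq' u) * ?y1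
        + ?y2 * (- zq' u * (of_real \<nu> / x\<^sup>2))) +
      (((x + e * ?WU) * zq' u * (of_real \<nu> / x ^ 3) + e * ?WX * (- 3 * of_real \<nu> * r ^ 4) * zq u) * ?y2 +
       (- 3 * (x * lcn u)\<^sup>2 * ?y1 - e * of_real \<delta> * ?y2) * (zq u * (of_real \<nu> / x ^ 3))))"
    unfolding comp_q_def[abs_def]
    by (rule has_L_add[OF has_L_mult[OF has_L_mult[OF has_L_time[OF mz] t4] P1] has_L_mult[OF has_L_mult[OF has_L_time[OF dz(1)] t5] P2]])
  also have "(((x + e * ?WU) * (3 * lcn u ^ 2 * zq u) * (of_real \<nu> / x\<^sup>2) + e * ?WX * (- 2 * of_real \<nu> * r ^ 3) * - zq' u) * ?y1
        + ?y2 * (- zq' u * (of_real \<nu> / x\<^sup>2))) +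
      (((x + e * ?WU) * zq' u * (of_real \<nu> / x ^ 3) + e * ?WX * (- 3 * of_real \<nu> * r ^ 4) * zq u) * ?y2 +
       (- 3 * (x * lcn u)\<^sup>2 * ?y1 - e * of_real \<delta> * ?y2) * (zq u * (of_real \<nu> / x ^ 3))) =
     e * (- of_real \<delta> * of_real \<nu> * zq u * r^3 * ?y2 + ?WU * (3 * of_real \<nu> * r^2 * lcn u^2 * zq u * ?y1 + of_real \<nu> * r^3 * zq' u * ?y2)
      + ?WX * (2 * of_real \<nu> * r^3 * zq' u * ?y1 - 3 * of_real \<nu> * r^4 * zq u * ?y2))"
  proof -
    have "of_real \<nu> / x\<^sup>2 = of_real \<nu> * r\<^sup>2" "of_real \<nu> / x ^ 3 = of_real \<nu> * r ^ 3"
      by (simp_all add: r_def divide_simps)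
    then show ?thesis using comp_pde_expand(2)[OF xr] by (simp only:)
  qed
  also have "\<dots> = e * (kk \<beta> \<delta> \<nu> False True x y u * ?p + kk \<beta> \<delta> \<nu> False False x y u * ?q)"
    unfolding kk using vi(2) by simp
  finally show "has_L \<beta> \<delta> \<nu> (comp_q \<nu> Y1 Y2) x y u e (e * (kk \<beta> \<delta> \<nu> False True x y u * ?p + kk \<beta> \<delta> \<nu> False False x y u * ?q))" .
qed

section \<open>Meromorphic functions of the state and the parameter\<close>

definition mv_differential :: "('n::finite spt \<Rightarrow> complex) \<Rightarrow> 'n spt \<Rightarrow> ('n spt \<Rightarrow> complex) \<Rightarrow> bool" where
  "mv_differential g z D \<longleftrightarrow> (g has_derivative D) (at z) \<and> complex_linear D"

lemma mv_holomorphic_on_iff: "mv_holomorphic_on g V \<longleftrightarrow> (\<forall>z\<in>V. \<exists>D. mv_differential g z D)"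
  by (simp add: mv_holomorphic_on_def mv_differential_def complex_linear_def)

lemma mv_differential_mult:
  "mv_differential f z D \<Longrightarrow> mv_differential g z E \<Longrightarrow> mv_differential (\<lambda>w. f w * g w) z (\<lambda>h. f z * E h + D h * g z)"
  unfolding mv_differential_def complex_linear_def
  by (intro conjI has_derivative_mult) (auto simp: algebra_simps)

lemma mv_differential_diff:
  "mv_differential f z D \<Longrightarrow> mv_differential g z E \<Longrightarrow> mv_differential (\<lambda>w. f w - g w) z (\<lambda>h. D h - E h)"
  by (auto simp: mv_differential_def complex_linear_def algebra_simps intro!: has_derivative_diff)

lemma mv_differential_add:
  "mv_differential f z D \<Longrightarrow> mv_differential g z E \<Longrightarrow> mv_differential (\<lambda>w. f w + g w) z (\<lambda>h. D h + E h)"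
  by (auto simp: mv_differential_def complex_linear_def algebra_simps intro!: has_derivative_add)

lemma mv_differential_const: "mv_differential (\<lambda>w. c) z (\<lambda>h. 0)"
  by (auto simp: mv_differential_def complex_linear_def)

lemma mv_differential_state: "mv_differential (\<lambda>w. fst w $ i) z (\<lambda>h. fst h $ i)"
  by (auto simp: mv_differential_def complex_linear_def intro!: bounded_linear_imp_has_derivative
        bounded_linear_compose[OF bounded_linear_vec_nth] bounded_linear_fst)

lemma mv_differential_parameter: "mv_differential (\<lambda>w. snd w) z (\<lambda>h. snd h)"
  by (auto simp: mv_differential_def complex_linear_def intro!: bounded_linear_imp_has_derivative bounded_linear_snd)

lemma mv_differential_compose:
  assumes "mv_differential f z D" "(g has_field_derivative g') (at (f z))"
  shows "mv_differential (\<lambda>w. g (f w)) z (\<lambda>h. g' * D h)"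
  using assms has_derivative_compose[of f D z UNIV g "(*) g'"]
  by (auto simp: mv_differential_def complex_linear_def has_field_derivative_def)

lemma mv_differential_divide:
  assumes "mv_differential f z D" "mv_differential g z E" "g z \<noteq> 0"
  shows "\<exists>D. mv_differential (\<lambda>w. f w / g w) z D"
proof -
  have "mv_differential (\<lambda>w. inverse (g w)) z (\<lambda>h. - (inverse (g z) ^ Suc (Suc 0)) * E h)"
    using assms(3) by (intro mv_differential_compose[OF assms(2)] DERIV_inverse)
  from mv_differential_mult[OF assms(1) this] show ?thesis by (auto simp: divide_inverse)
qed

lemma mv_differential_cong:
  assumes "mv_differential f z D" "open S" "z \<in> S" "\<And>w. w \<in> S \<Longrightarrow> f w = g w"
  shows "mv_differential g z D"
  using assms has_derivative_transform_within_open[of f D z UNIV S g] by (auto simp: mv_differential_def)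

lemma mv_holomorphic_continuous: "mv_holomorphic_on g V \<Longrightarrow> continuous_on V g"
  unfolding mv_holomorphic_on_def
  by (intro continuous_at_imp_continuous_on) (metis has_derivative_continuous)

lemma mv_regular_differential: "mv_regular_at g z \<Longrightarrow> \<exists>D. mv_differential g z D"
  unfolding mv_regular_at_def mv_holomorphic_on_iff by blast

lemma state_deriv_differential:
  assumes "mv_differential g z D"
  shows "state_deriv g z v = D (v, 0)"
proof -
  have "((\<lambda>y. (y, snd z)) has_derivative (\<lambda>h. (h, 0))) (at (fst z))"
    by (intro has_derivative_Pair has_derivative_const has_derivative_ident)
  from has_derivative_compose[OF this, of g D]
  have "((\<lambda>y. g (y, snd z)) has_derivative (\<lambda>h. D (h, 0))) (at (fst z))"
    using assms by (simp add: mv_differential_def)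
  from frechet_derivative_at[OF this] show ?thesis unfolding state_deriv_def by metis
qed

lemma state_deriv_vec_differential:
  fixes X :: "'n::finite spt \<Rightarrow> complex ^ 'n"
  assumes "\<And>i. mv_differential (\<lambda>w. X w $ i) z (D i)"
  shows "state_deriv X z v $ i = D i (v, 0)"
proof -
  have s: "((\<lambda>y. (y, snd z)) has_derivative (\<lambda>h. (h, 0))) (at (fst z))"
    by (intro has_derivative_Pair has_derivative_const has_derivative_ident)
  have c: "((\<lambda>y. X (y, snd z) $ i) has_derivative (\<lambda>h. D i (h, 0))) (at (fst z))" for i
    using has_derivative_compose[OF s, of "\<lambda>w. X w $ i" "D i"] assms[of i] by (simp add: mv_differential_def)
  have "((\<lambda>y. \<Sum>i\<in>UNIV. X (y, snd z) $ i *s axis i 1) has_derivative (\<lambda>h. \<Sum>i\<in>UNIV. D i (h, 0) *s axis i 1)) (at (fst z))"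
    by (intro has_derivative_sum has_derivative_smult c)
  then have "((\<lambda>y. X (y, snd z)) has_derivative (\<lambda>h. \<chi> i. D i (h, 0))) (at (fst z))"
    using basis_expansion[of "\<chi> i. D i (_, 0)"] by (simp add: basis_expansion)
  from frechet_derivative_at[OF this] show ?thesis by (simp add: state_deriv_def) (metis vec_lambda_beta)
qed

lemma mv_holomorphic_prod:
  assumes "finite I" "\<And>i. i \<in> I \<Longrightarrow> mv_holomorphic_on (f i) V"
  shows "mv_holomorphic_on (\<lambda>z. \<Prod>i\<in>I. f i z) V"
  using assms
proof (induction I rule: finite_induct)
  case empty
  show ?case using mv_differential_const[of 1] by (auto simp: mv_holomorphic_on_iff)
next
  case (insert i I)
  then have "mv_holomorphic_on (f i) V" "mv_holomorphic_on (\<lambda>z. \<Prod>i\<in>I. f i z) V" by auto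
  then show ?case using insert(1,2) mv_differential_mult
    by (simp add: mv_holomorphic_on_iff) blast
qed

lemma mv_holomorphic_mult: "mv_holomorphic_on f V \<Longrightarrow> mv_holomorphic_on g V \<Longrightarrow> mv_holomorphic_on (\<lambda>z. f z * g z) V"
  unfolding mv_holomorphic_on_iff using mv_differential_mult by blast

lemma mv_holomorphic_subset: "mv_holomorphic_on f V \<Longrightarrow> W \<subseteq> V \<Longrightarrow> mv_holomorphic_on f W"
  unfolding mv_holomorphic_on_def by blast

lemma open_nonzero: "open V \<Longrightarrow> continuous_on V g \<Longrightarrow> open {z\<in>V. g z \<noteq> (0::complex)}"
proof -
  assume "open V" "continuous_on V g"
  then have "open (V \<inter> g -` (- {0}))" by (intro continuous_open_preimage) auto
  moreover have "V \<inter> g -` (- {0}) = {z\<in>V. g z \<noteq> 0}" by auto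
  ultimately show ?thesis by simp
qed

text \<open>Inside an open set of zeros of the product, the open part where \<open>f i\<close> is
  nonzero consists of zeros of the remaining product and is therefore empty; then \<open>f i\<close>
  vanishes on the whole open set.\<close>

lemma interior_zeros_prod:
  assumes "finite I" "open V" "\<And>i. i \<in> I \<Longrightarrow> mv_holomorphic_on (f i) V" "\<And>i. i \<in> I \<Longrightarrow> interior {z\<in>V. f i z = 0} = {}"
  shows "interior {z\<in>V. (\<Prod>i\<in>I. f i z) = 0} = {}"
  using assms
proof (induction I rule: finite_induct)
  case empty
  then show ?case by simp
next
  case (insert i I)
  define S where "S = interior {z\<in>V. (\<Prod>j\<in>insert i I. f j z) = 0}"
  have S: "open S" "S \<subseteq> {z\<in>V. (\<Prod>j\<in>insert i I. f j z) = 0}" unfolding S_def by (rule open_interior, rule interior_subset)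
  have "continuous_on V (f i)" using insert by (intro mv_holomorphic_continuous) auto
  then have "open (S \<inter> {z\<in>V. f i z \<noteq> 0})" using S(1) insert(4) by (intro open_Int open_nonzero) auto
  moreover have "S \<inter> {z\<in>V. f i z \<noteq> 0} \<subseteq> {z\<in>V. (\<Prod>j\<in>I. f j z) = 0}" using S(2) insert(1,2) by auto
  ultimately have "S \<inter> {z\<in>V. f i z \<noteq> 0} \<subseteq> interior {z\<in>V. (\<Prod>j\<in>I. f j z) = 0}" by (intro interior_maximal)
  moreover have "interior {z\<in>V. (\<Prod>j\<in>I. f j z) = 0} = {}" using insert by auto
  ultimately have "S \<inter> {z\<in>V. f i z \<noteq> 0} = {}" by simp
  then have "S \<subseteq> {z\<in>V. f i z = 0}" using S(2) by auto
  then have "S \<subseteq> interior {z\<in>V. f i z = 0}" using S(1) by (rule interior_maximal)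
  then show ?case using insert(6)[of i] S_def by auto
qed

text \<open>The product of the denominators of the components serves all of them, and where it is
  nonzero the field is regular, which is the condition under which the integrability identities are
  available.\<close>

lemma vf_common_denominator:
  fixes X :: "'n::finite spt \<Rightarrow> complex ^ 'n"
  assumes X: "vf_meromorphic_on X U" and p: "p \<in> U"
  obtains V a b where "open V" "p \<in> V" "V \<subseteq> U" "\<And>i. mv_holomorphic_on (a i) V" "mv_holomorphic_on b V"
    "interior {z\<in>V. b z = 0} = {}" "\<And>i z. z \<in> V \<Longrightarrow> b z \<noteq> 0 \<Longrightarrow> X z $ i = a i z / b z"
    "\<And>z. z \<in> V \<Longrightarrow> b z \<noteq> 0 \<Longrightarrow> vf_regular_at X z"
proof -
  define Q where "Q = (\<lambda>i (V, a, b). open V \<and> p \<in> V \<and> V \<subseteq> U \<and> mv_holomorphic_on a V \<and> mv_holomorphic_on b V \<and>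
        interior {z\<in>V. b z = 0} = {} \<and> (\<forall>z\<in>V. b z \<noteq> 0 \<longrightarrow> X z $ i = a z / b z))"
  have "\<exists>T. Q i T" for i
    using X[unfolded vf_meromorphic_on_def, rule_format, of i, unfolded mv_meromorphic_on_def, rule_format, OF p]
    by (simp add: Q_def)
  then obtain T where Q: "Q i (T i)" for i using choice[of Q] by blast
  define W c d where "W = (\<lambda>i. fst (T i))" and "c = (\<lambda>i. fst (snd (T i)))" and "d = (\<lambda>i. snd (snd (T i)))"
  have W: "open (W i)" "p \<in> W i" "W i \<subseteq> U" "mv_holomorphic_on (c i) (W i)"
      "mv_holomorphic_on (d i) (W i)" "interior {z\<in>W i. d i z = 0} = {}"
      "z \<in> W i \<Longrightarrow> d i z \<noteq> 0 \<Longrightarrow> X z $ i = c i z / d i z" for i z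
    using Q[of i] unfolding Q_def W_def c_def d_def case_prod_unfold by simp_all
  define V where "V = (\<Inter>i. W i)"
  define a where "a = (\<lambda>i z. c i z * (\<Prod>j\<in>UNIV - {i}. d j z))"
  define b where "b = (\<lambda>z. \<Prod>j\<in>UNIV. d j z)"
  have V: "open V" "p \<in> V" "V \<subseteq> U" "\<And>i. V \<subseteq> W i"
  proof -
    show "V \<subseteq> W i" for i unfolding V_def by blast
    then show "V \<subseteq> U" using W(3) by blast
  qed (use W(1,2) in \<open>auto simp: V_def intro!: open_INT\<close>)
  have hd: "mv_holomorphic_on (d i) V" "mv_holomorphic_on (c i) V" for i using W(4,5) V(4) mv_holomorphic_subset by blast+
  have ha: "mv_holomorphic_on (a i) V" for i
    unfolding a_def by (intro mv_holomorphic_mult mv_holomorphic_prod hd) auto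
  have hb: "mv_holomorphic_on b V" unfolding b_def by (intro mv_holomorphic_prod hd) auto
  have ib: "interior {z\<in>V. b z = 0} = {}"
    unfolding b_def
  proof (rule interior_zeros_prod[OF _ V(1) hd(1)])
    fix i
    have "interior {z\<in>V. d i z = 0} \<subseteq> interior {z\<in>W i. d i z = 0}" using V(4) by (intro interior_mono) auto
    then show "interior {z\<in>V. d i z = 0} = {}" using W(6) by auto
  qed auto
  have eq: "X z $ i = a i z / b z" if "z \<in> V" "b z \<noteq> 0" for i z
  proof -
    have "b z = d i z * (\<Prod>j\<in>UNIV - {i}. d j z)" unfolding b_def by (subst prod.remove[of _ i]) auto
    then show ?thesis using that W(7)[of z i] V(4) by (auto simp: a_def)
  qed
  have "vf_regular_at X z" if "z \<in> V" "b z \<noteq> 0" for z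
    unfolding vf_regular_at_def mv_regular_at_def
  proof
    fix i
    let ?S = "{z\<in>V. b z \<noteq> 0}"
    have o: "open ?S" by (rule open_nonzero[OF V(1) mv_holomorphic_continuous[OF hb]])
    have "\<exists>D. mv_differential (\<lambda>w. X w $ i) w D" if w: "w \<in> ?S" for w
    proof -
      obtain D E where "mv_differential (a i) w D" "mv_differential b w E"
        using ha[of i] hb w unfolding mv_holomorphic_on_iff by blast
      from mv_differential_divide[OF this] obtain D' where "mv_differential (\<lambda>w. a i w / b w) w D'" using w by auto
      then have "mv_differential (\<lambda>w. X w $ i) w D'"
        by (rule mv_differential_cong[OF _ o w]) (use eq in auto)
      then show ?thesis by blast
    qed
    then have "mv_holomorphic_on (\<lambda>w. X w $ i) ?S" by (simp add: mv_holomorphic_on_iff)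
    then show "\<exists>V. open V \<and> z \<in> V \<and> mv_holomorphic_on (\<lambda>w. X w $ i) V" using o that by blast
  qed
  then show ?thesis using V(1-3) ha hb ib eq by (intro that[of V a b])
qed

text \<open>Viewed as a field with equal components, a first integral passes through the patch
  construction made for fields.\<close>

lemma vf_meromorphic_const_vec:
  "mv_meromorphic_on F U \<Longrightarrow> vf_meromorphic_on (\<lambda>z. (\<chi> i. F z) :: complex ^ 'n::finite) (U :: 'n spt set)"
  by (simp add: vf_meromorphic_on_def)

text \<open>The total differential of the field, in state and parameter together; on vectors (v, 0)
  only the state part remains.\<close>

definition duffing_D :: "real \<Rightarrow> real \<Rightarrow> 3 spt \<Rightarrow> 3 \<Rightarrow> 3 spt \<Rightarrow> complex" where
  "duffing_D \<beta> \<delta> z i h = (if i = 1 then fst h $ 2 else if i = 2 then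
     - 3 * (fst z $ 1)\<^sup>2 * fst h $ 1 + (snd h * (of_real \<beta> * cos (fst z $ 3) - of_real \<delta> * fst z $ 2)
       + snd z * (- of_real \<beta> * sin (fst z $ 3) * fst h $ 3 - of_real \<delta> * fst h $ 2)) else 0)"

lemma duffing_differential:
  "mv_differential (\<lambda>w. duffing_field \<beta> \<delta> \<nu> (snd w) (fst w) $ i) z (duffing_D \<beta> \<delta> z i)"
proof -
  consider "i = 1" | "i = 2" | "i = 3" using exhaust_3 by blast
  then show ?thesis
  proof cases
    case 1
    then show ?thesis using mv_differential_state[of 2 z] by (simp add: duffing_field_def duffing_D_def[abs_def])
  next
    case 2
    have c: "((\<lambda>t :: complex. - (t ^ 3)) has_field_derivative - 3 * (fst z $ 1)\<^sup>2) (at (fst z $ 1))"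
      "((\<lambda>t :: complex. of_real \<beta> * cos t) has_field_derivative - of_real \<beta> * sin (fst z $ 3)) (at (fst z $ 3))"
      "((\<lambda>t :: complex. of_real \<delta> * t) has_field_derivative of_real \<delta>) (at (fst z $ 2))"
      by (auto intro!: derivative_eq_intros)
    note m = mv_differential_add[OF mv_differential_compose[OF mv_differential_state c(1)]
        mv_differential_mult[OF mv_differential_parameter mv_differential_diff[OF mv_differential_compose[OF mv_differential_state c(2)]
          mv_differential_compose[OF mv_differential_state c(3)]]]]
    show ?thesis using m by (simp add: 2 duffing_field_def duffing_D_def[abs_def] algebra_simps)
  next
    case 3
    then show ?thesis using mv_differential_const by (simp add: duffing_field_def duffing_D_def[abs_def])
  qed
qed

section \<open>Patches along the orbit\<close>

lemma patch_box:
  fixes V :: "3 spt set"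
  assumes V: "open V" "(Phi \<nu> x0 y0 u0, 0) \<in> V" and c: "x0 \<noteq> 0" "u0 \<notin> lpoles"
  obtains r :: real where "r > 0" "\<And>x y u e. x \<in> ball x0 r \<Longrightarrow> y \<in> ball y0 r \<Longrightarrow> u \<in> ball u0 r \<Longrightarrow> e \<in> ball 0 r \<Longrightarrow>
     x \<noteq> 0 \<and> u \<notin> lpoles \<and> (Phi \<nu> x y u, e) \<in> V"
proof -
  have o: "open (coords \<inter> Phi4 \<nu> -` V)"
    by (rule continuous_open_preimage[OF Phi4_continuous open_coords V(1)])
  have "(x0, y0, u0, 0) \<in> coords \<inter> Phi4 \<nu> -` V" using V c by (simp add: coords_def Phi4_def)
  from open_box4[OF o this] obtain r where "r > 0"
    "\<And>x' y' u' e'. dist x0 x' < r \<Longrightarrow> dist y0 y' < r \<Longrightarrow> dist u0 u' < r \<Longrightarrow> dist 0 e' < r \<Longrightarrow> (x', y', u', e') \<in> coords \<inter> Phi4 \<nu> -` V"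
    by blast
  then show ?thesis by (intro that[of r]) (auto simp: coords_def Phi4_def)
qed

lemma factor_parameter:
  assumes g: "hol4 g A B C (ball 0 r)" and o: "open A" "open B" "open C" "r > 0"
    and nz: "x0 \<in> A" "y0 \<in> B" "u0 \<in> C" "e0 \<in> ball 0 r" "g x0 y0 u0 e0 \<noteq> 0"
  shows "\<exists>m h. hol4 h A B C (ball 0 r) \<and> (\<forall>x\<in>A. \<forall>y\<in>B. \<forall>u\<in>C. \<forall>e. g x y u e = e ^ m * h x y u e) \<and>
    (\<exists>x\<in>A. \<exists>y\<in>B. \<exists>u\<in>C. h x y u 0 \<noteq> 0)"
proof -
  from nz(5) have d: "g x0 y0 u0 e0 \<noteq> 0 \<or> g x0 y0 u0 e0 \<noteq> 0" by simp
  obtain m h1 h2 where h: "hol4 h1 A B C (ball 0 r)" "hol4 h2 A B C (ball 0 r)"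
    "\<And>x y u e. x \<in> A \<Longrightarrow> y \<in> B \<Longrightarrow> u \<in> C \<Longrightarrow> g x y u e = e ^ m * h1 x y u e"
    "\<And>x y u e. x \<in> A \<Longrightarrow> y \<in> B \<Longrightarrow> u \<in> C \<Longrightarrow> g x y u e = e ^ m * h2 x y u e"
    "\<exists>x\<in>A. \<exists>y\<in>B. \<exists>u\<in>C. h1 x y u 0 \<noteq> 0 \<or> h2 x y u 0 \<noteq> 0"
    by (rule hol4_factor_pair[OF g g o nz(1-4) d]) blast
  have "hol4 h A B C (ball 0 r) \<and> (\<forall>x\<in>A. \<forall>y\<in>B. \<forall>u\<in>C. \<forall>e. g x y u e = e ^ m * h x y u e)" if "h = h1 \<or> h = h2" for h
    using that h(1-4) by auto
  then show ?thesis using h(5) by blast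
qed

text \<open>Radius, neighbourhood, numerators and denominator are packed into one tuple, so that a
  patch for every point of a compact set can be chosen in a single step.\<close>

definition patch_data where
  "patch_data \<nu> U X x0 y0 u0 = (\<lambda>(r :: real, V, a, b). r > 0 \<and> open V \<and> V \<subseteq> U \<and> (\<forall>i. mv_holomorphic_on (a i) V) \<and>
     mv_holomorphic_on b V \<and> interior {z\<in>V. b z = 0} = {} \<and>
     (\<forall>i. \<forall>z\<in>V. b z \<noteq> 0 \<longrightarrow> X z $ i = a i z / b z) \<and> (\<forall>z\<in>V. b z \<noteq> 0 \<longrightarrow> vf_regular_at X z) \<and>
     (\<forall>x\<in>ball x0 r. \<forall>y\<in>ball y0 r. \<forall>u\<in>ball u0 r. \<forall>e\<in>ball 0 r. x \<noteq> 0 \<and> u \<notin> lpoles \<and> (Phi \<nu> x y u, e) \<in> V))"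

lemma patch_data_exists:
  assumes X: "vf_meromorphic_on X U" and c: "x0 \<noteq> 0" "u0 \<notin> lpoles" "(Phi \<nu> x0 y0 u0, 0) \<in> U"
  shows "\<exists>T. patch_data \<nu> U X x0 y0 u0 T"
proof -
  obtain V a b where V: "open V" "(Phi \<nu> x0 y0 u0, 0) \<in> V" "V \<subseteq> U" "\<And>i. mv_holomorphic_on (a i) V" "mv_holomorphic_on b V"
    "interior {z\<in>V. b z = 0} = {}" "\<And>i z. z \<in> V \<Longrightarrow> b z \<noteq> 0 \<Longrightarrow> X z $ i = a i z / b z"
    "\<And>z. z \<in> V \<Longrightarrow> b z \<noteq> 0 \<Longrightarrow> vf_regular_at X z"
    by (rule vf_common_denominator[OF X c(3)]) blast
  obtain r where r: "r > 0" "\<And>x y u e. x \<in> ball x0 r \<Longrightarrow> y \<in> ball y0 r \<Longrightarrow> u \<in> ball u0 r \<Longrightarrow> e \<in> ball 0 r \<Longrightarrow>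
     x \<noteq> 0 \<and> u \<notin> lpoles \<and> (Phi \<nu> x y u, e) \<in> V"
    by (rule patch_box[OF V(1,2) c(1,2)]) blast
  have "patch_data \<nu> U X x0 y0 u0 (r, V, a, b)"
    unfolding patch_data_def prod.case using V r by (intro conjI allI ballI impI) simp_all
  then show ?thesis by blast
qed

text \<open>Finitely many balls centred on \<open>Q\<close> cover it, and their union is connected
  because every ball meets the connected \<open>Q\<close>. The least radius is a common size in x, y
  and e. A denominator may vanish identically at e = 0; the offending power of e is divided out of
  it, and the factor \<open>e ^ M\<close> in front of \<open>X\<close> absorbs the cost.\<close>

lemma patch_family:
  fixes X :: "3 spt \<Rightarrow> complex ^ 3" and x0 y0 :: complex
  assumes X: "vf_meromorphic_on X U" and x0: "x0 \<noteq> 0"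
    and Q: "compact Q" "connected Q" "Q \<noteq> {}" "\<And>u. u \<in> Q \<Longrightarrow> u \<notin> lpoles \<and> (Phi \<nu> x0 y0 u, 0) \<in> U"
  obtains \<rho> :: real and J :: "complex set" and W a b and M :: nat where
    "\<rho> > 0" "finite J" "\<And>j. j \<in> J \<Longrightarrow> open (W j) \<and> connected (W j)" "connected (\<Union>j\<in>J. W j)" "Q \<subseteq> (\<Union>j\<in>J. W j)"
    "\<And>x y u e. x \<in> ball x0 \<rho> \<Longrightarrow> y \<in> ball y0 \<rho> \<Longrightarrow> u \<in> (\<Union>j\<in>J. W j) \<Longrightarrow> e \<in> ball 0 \<rho> \<Longrightarrow>
       x \<noteq> 0 \<and> u \<notin> lpoles \<and> (Phi \<nu> x y u, e) \<in> U"
    "\<And>i j. j \<in> J \<Longrightarrow> hol4 (a i j) (ball x0 \<rho>) (ball y0 \<rho>) (W j) (ball 0 \<rho>)"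
    "\<And>j. j \<in> J \<Longrightarrow> hol4 (b j) (ball x0 \<rho>) (ball y0 \<rho>) (W j) (ball 0 \<rho>)"
    "\<And>j. j \<in> J \<Longrightarrow> \<exists>x\<in>ball x0 \<rho>. \<exists>y\<in>ball y0 \<rho>. \<exists>u\<in>W j. b j x y u 0 \<noteq> 0"
    "\<And>i j x y u e. j \<in> J \<Longrightarrow> x \<in> ball x0 \<rho> \<Longrightarrow> y \<in> ball y0 \<rho> \<Longrightarrow> u \<in> W j \<Longrightarrow> e \<in> ball 0 \<rho> \<Longrightarrow> e \<noteq> 0 \<Longrightarrow>
       b j x y u e \<noteq> 0 \<Longrightarrow> e ^ M * pull \<nu> X x y u e $ i = a i j x y u e / b j x y u e"
    "\<And>j x y u e. j \<in> J \<Longrightarrow> x \<in> ball x0 \<rho> \<Longrightarrow> y \<in> ball y0 \<rho> \<Longrightarrow> u \<in> W j \<Longrightarrow> e \<in> ball 0 \<rho> \<Longrightarrow> e \<noteq> 0 \<Longrightarrow>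
       b j x y u e \<noteq> 0 \<Longrightarrow> vf_regular_at X (Phi \<nu> x y u, e)"
proof -
  have "\<exists>T. patch_data \<nu> U X x0 y0 u T" if "u \<in> Q" for u
    using patch_data_exists[OF X x0] Q(4)[OF that] by blast
  then obtain T where T: "\<And>u. u \<in> Q \<Longrightarrow> patch_data \<nu> U X x0 y0 u (T u)" by metis
  define r V a0 b0 where "r = (\<lambda>u. fst (T u))" and "V = (\<lambda>u. fst (snd (T u)))"
    and "a0 = (\<lambda>u. fst (snd (snd (T u))))" and "b0 = (\<lambda>u. snd (snd (snd (T u))))"
  have P: "r u > 0" "open (V u)" "V u \<subseteq> U" "mv_holomorphic_on (a0 u i) (V u)" "mv_holomorphic_on (b0 u) (V u)"
     "interior {z\<in>V u. b0 u z = 0} = {}" "z \<in> V u \<Longrightarrow> b0 u z \<noteq> 0 \<Longrightarrow> X z $ i = a0 u i z / b0 u z"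
     "z \<in> V u \<Longrightarrow> b0 u z \<noteq> 0 \<Longrightarrow> vf_regular_at X z"
     "x \<in> ball x0 (r u) \<Longrightarrow> y \<in> ball y0 (r u) \<Longrightarrow> v \<in> ball u (r u) \<Longrightarrow> e \<in> ball 0 (r u) \<Longrightarrow>
        x \<noteq> 0 \<and> v \<notin> lpoles \<and> (Phi \<nu> x y v, e) \<in> V u"
     if "u \<in> Q" for u i z x y v e
    using T[OF that] unfolding patch_data_def r_def V_def a0_def b0_def case_prod_unfold by simp_all
  define W where "W = (\<lambda>u. ball u (r u))"
  have "Q \<subseteq> (\<Union>u\<in>Q. W u)" using P(1) by (auto simp: W_def)
  then obtain J where J: "J \<subseteq> Q" "finite J" "Q \<subseteq> (\<Union>u\<in>J. W u)"
    using compactE_image[OF Q(1), of Q W] by (auto simp: W_def)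
  have Jne: "J \<noteq> {}" using J(3) Q(3) by auto
  have jQ: "j \<in> Q" if "j \<in> J" for j using J that by auto
  have WJ: "open (W j) \<and> connected (W j) \<and> j \<in> W j" if "j \<in> J" for j using P(1)[OF jQ[OF that]] by (simp add: W_def)
  have conn: "connected (\<Union>j\<in>J. W j)"
  proof -
    have "connected (\<Union>j\<in>J. Q \<union> W j)"
    proof (rule connected_Union)
      show "connected s" if "s \<in> (\<lambda>j. Q \<union> W j) ` J" for s
        using that WJ jQ Q(2) by (auto intro!: connected_Un)
      show "\<Inter> ((\<lambda>j. Q \<union> W j) ` J) \<noteq> {}" using Q(3) Jne by auto
    qed
    moreover have "(\<Union>j\<in>J. Q \<union> W j) = (\<Union>j\<in>J. W j)" using J Jne by auto
    ultimately show ?thesis by simp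
  qed
  define \<rho> where "\<rho> = Min (r ` J)"
  have \<rho>: "\<rho> > 0" "\<And>j. j \<in> J \<Longrightarrow> \<rho> \<le> r j" using J Jne P(1)[OF jQ] by (auto simp: \<rho>_def)
  have box: "x \<noteq> 0 \<and> u \<notin> lpoles \<and> (Phi \<nu> x y u, e) \<in> V j"
    if "j \<in> J" "x \<in> ball x0 \<rho>" "y \<in> ball y0 \<rho>" "u \<in> W j" "e \<in> ball 0 \<rho>" for j x y u e
    using \<rho>(2)[OF that(1)] that(2-5) by (intro P(9)[OF jQ[OF that(1)]]) (auto simp: W_def)
  have ha: "hol4 (pull \<nu> (a0 j i)) (ball x0 \<rho>) (ball y0 \<rho>) (W j) (ball 0 \<rho>)"
    and hb: "hol4 (pull \<nu> (b0 j)) (ball x0 \<rho>) (ball y0 \<rho>) (W j) (ball 0 \<rho>)" if "j \<in> J" for i j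
    using box[OF that] by (intro hol4_pull[OF P(4)[OF jQ[OF that]]] hol4_pull[OF P(5)[OF jQ[OF that]]], blast)+
  have "\<exists>h. hol4 (snd h) (ball x0 \<rho>) (ball y0 \<rho>) (W j) (ball 0 \<rho>) \<and>
      (\<forall>x\<in>ball x0 \<rho>. \<forall>y\<in>ball y0 \<rho>. \<forall>u\<in>W j. \<forall>e. pull \<nu> (b0 j) x y u e = e ^ (fst h) * snd h x y u e) \<and>
      (\<exists>x\<in>ball x0 \<rho>. \<exists>y\<in>ball y0 \<rho>. \<exists>u\<in>W j. snd h x y u 0 \<noteq> 0)" if j: "j \<in> J" for j
  proof -
    let ?S = "ball x0 \<rho> \<times> ball y0 \<rho> \<times> W j \<times> ball (0 :: complex) \<rho>"
    have S1: "open ?S" using WJ[OF j] by (intro open_Times) auto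
    have S2: "?S \<subseteq> coords"
    proof
      fix p assume "p \<in> ?S"
      then obtain x y u e where p: "p = (x, y, u, e)" "x \<in> ball x0 \<rho>" "y \<in> ball y0 \<rho>" "u \<in> W j" "e \<in> ball 0 \<rho>" by blast
      show "p \<in> coords" using box[OF j p(2-5)] by (simp add: p(1) coords_def)
    qed
    have "(x0, y0, j, 0) \<in> ?S" using WJ[OF j] \<rho>(1) by auto
    then have S3: "?S \<noteq> {}" by blast
    \<comment> \<open>The image of the coordinate box has interior, the zero set of the denominator
      has none, so the box contains a point with nonzero denominator.\<close>
    from Phi4_interior[OF S1 S2 S3, of \<nu>] have "\<not> Phi4 \<nu> ` ?S \<subseteq> {z\<in>V j. b0 j z = 0}"
      using P(6)[OF jQ[OF j]] interior_mono by blast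
    then obtain p where "p \<in> ?S" "Phi4 \<nu> p \<notin> {z\<in>V j. b0 j z = 0}" by blast
    then obtain x y u e where mem: "x \<in> ball x0 \<rho>" "y \<in> ball y0 \<rho>" "u \<in> W j" "e \<in> ball 0 \<rho>"
      and nz: "Phi4 \<nu> (x, y, u, e) \<notin> {z\<in>V j. b0 j z = 0}" by blast
    have "pull \<nu> (b0 j) x y u e \<noteq> 0" using nz box[OF j mem] by (simp add: Phi4_def pull_def)
    from factor_parameter[OF hb[OF j] open_ball open_ball _ \<rho>(1) mem \<open>pull \<nu> (b0 j) x y u e \<noteq> 0\<close>] WJ[OF j] show ?thesis by auto
  qed
  then obtain mh where mh: "\<And>j. j \<in> J \<Longrightarrow> hol4 (snd (mh j)) (ball x0 \<rho>) (ball y0 \<rho>) (W j) (ball 0 \<rho>) \<and>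
      (\<forall>x\<in>ball x0 \<rho>. \<forall>y\<in>ball y0 \<rho>. \<forall>u\<in>W j. \<forall>e. pull \<nu> (b0 j) x y u e = e ^ (fst (mh j)) * snd (mh j) x y u e) \<and>
      (\<exists>x\<in>ball x0 \<rho>. \<exists>y\<in>ball y0 \<rho>. \<exists>u\<in>W j. snd (mh j) x y u 0 \<noteq> 0)" by metis
  define m b where "m = (\<lambda>j. fst (mh j))" and "b = (\<lambda>j. snd (mh j))"
  \<comment> \<open>The sum is a convenient common bound for the exponents of all patches.\<close>
  define M where "M = (\<Sum>j\<in>J. m j)"
  have mM: "m j \<le> M" if "j \<in> J" for j unfolding M_def using J(2) that by (intro member_le_sum) auto
  define a where "a = (\<lambda>i j x y u e. e ^ (M - m j) * pull \<nu> (a0 j i) x y u e)"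
  have b: "hol4 (b j) (ball x0 \<rho>) (ball y0 \<rho>) (W j) (ball 0 \<rho>)"
      "\<exists>x\<in>ball x0 \<rho>. \<exists>y\<in>ball y0 \<rho>. \<exists>u\<in>W j. b j x y u 0 \<noteq> 0" if "j \<in> J" for j
    using mh[OF that] unfolding m_def b_def by blast+
  have bm: "pull \<nu> (b0 j) x y u e = e ^ m j * b j x y u e"
      if "j \<in> J" "x \<in> ball x0 \<rho>" "y \<in> ball y0 \<rho>" "u \<in> W j" for j x y u e
    using mh[OF that(1)] that(2-4) unfolding m_def b_def by blast
  show ?thesis
  proof (rule that[OF \<rho>(1) J(2) _ conn J(3), where a = a and b = b and M = M])
    show "open (W j) \<and> connected (W j)" if "j \<in> J" for j using WJ[OF that] by blast
    show "x \<noteq> 0 \<and> u \<notin> lpoles \<and> (Phi \<nu> x y u, e) \<in> U"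
      if "x \<in> ball x0 \<rho>" "y \<in> ball y0 \<rho>" "u \<in> (\<Union>j\<in>J. W j)" "e \<in> ball 0 \<rho>" for x y u e
    proof -
      from that(3) obtain j where "j \<in> J" "u \<in> W j" by blast
      then show ?thesis using box[of j x y u e] that P(3)[OF jQ[of j]] by blast
    qed
    show "hol4 (a i j) (ball x0 \<rho>) (ball y0 \<rho>) (W j) (ball 0 \<rho>)" if "j \<in> J" for i j
      unfolding a_def by (intro hol4_mult hol4_of_4 ha[OF that] holomorphic_intros)
    show "e ^ M * pull \<nu> X x y u e $ i = a i j x y u e / b j x y u e"
      if j: "j \<in> J" and mem: "x \<in> ball x0 \<rho>" "y \<in> ball y0 \<rho>" "u \<in> W j" "e \<in> ball 0 \<rho>" and nz: "e \<noteq> 0" "b j x y u e \<noteq> 0" for i j x y u e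
    proof -
      have "b0 j (Phi \<nu> x y u, e) = e ^ m j * b j x y u e" using bm[OF j mem(1-3)] by (simp add: pull_def)
      moreover have "e ^ m j * b j x y u e \<noteq> 0" using nz by simp
      ultimately have "pull \<nu> X x y u e $ i = pull \<nu> (a0 j i) x y u e / (e ^ m j * b j x y u e)"
        using P(7)[OF jQ[OF j], of "(Phi \<nu> x y u, e)" i] box[OF j mem] by (simp add: pull_def)
      moreover have "e ^ M = e ^ (M - m j) * e ^ m j" using mM[OF j] by (simp flip: power_add)
      ultimately show ?thesis using nz by (simp add: a_def)
    qed
    show "vf_regular_at X (Phi \<nu> x y u, e)"
      if j: "j \<in> J" and mem: "x \<in> ball x0 \<rho>" "y \<in> ball y0 \<rho>" "u \<in> W j" "e \<in> ball 0 \<rho>" and nz: "e \<noteq> 0" "b j x y u e \<noteq> 0" for j x y u e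
    proof -
      have "b0 j (Phi \<nu> x y u, e) = e ^ m j * b j x y u e" using bm[OF j mem(1-3)] by (simp add: pull_def)
      then show ?thesis using P(8)[OF jQ[OF j], of "(Phi \<nu> x y u, e)"] box[OF j mem] nz by simp
    qed
  qed (use b in auto)
qed

text \<open>Connectedness is given in the quotient, and a preimage could fall apart into translates.
  Here the component of 0 contains the real line and is therefore invariant under the period, so its
  image and the image of the rest are disjoint open sets covering a connected set; the rest is
  empty.\<close>

lemma domain_mod_connected:
  assumes p: "p > 0" and G: "domain_mod p G" "\<real> \<subseteq> G"
  shows "connected G"
proof -
  define E :: "complex \<Rightarrow> complex" where "E = (\<lambda>\<tau>. exp (2 * of_real pi * \<i> * \<tau> / of_real p))"
  define G1 where "G1 = connected_component_set G 0"
  define G2 where "G2 = G - G1"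
  have oG: "open G" and inv: "\<And>\<tau>. \<tau> \<in> G \<longleftrightarrow> \<tau> + of_real p \<in> G" and cE: "connected (E ` G)"
    using G(1) unfolding domain_mod_def E_def by blast+
  have conR: "connected (\<real> :: complex set)"
    unfolding Reals_def by (intro connected_continuous_image continuous_intros connected_UNIV)
  have R: "\<real> \<subseteq> G1" unfolding G1_def by (rule connected_component_maximal[OF _ conR G(2)]) simp
  have c1: "connected G1" "G1 \<subseteq> G" "open G1" unfolding G1_def
    by (auto simp: connected_component_subset open_connected_component[OF oG])
  have max: "S \<subseteq> G1" if "connected S" "S \<subseteq> G" "x \<in> S" "x \<in> \<real>" for S x
  proof -
    have "x \<in> G1" using that R by auto
    then have "connected_component_set G x = G1" unfolding G1_def by (simp add: connected_component_eq)
    then show ?thesis using connected_component_maximal[OF that(3,1,2)] by simp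
  qed
  have inv1: "\<tau> \<in> G1 \<longleftrightarrow> \<tau> + of_real p \<in> G1" for \<tau>
  proof
    have "(\<lambda>\<tau>. \<tau> + of_real p) ` G1 \<subseteq> G1"
    proof (rule max)
      show "connected ((\<lambda>\<tau>. \<tau> + of_real p) ` G1)" by (intro connected_continuous_image continuous_intros c1)
      show "0 + of_real p \<in> (\<lambda>\<tau>. \<tau> + of_real p) ` G1" using R by (intro imageI) auto
    qed (use c1 inv in auto)
    then show "\<tau> \<in> G1 \<Longrightarrow> \<tau> + of_real p \<in> G1" by auto
    have "(\<lambda>\<tau>. \<tau> - of_real p) ` G1 \<subseteq> G1"
    proof (rule max)
      show "connected ((\<lambda>\<tau>. \<tau> - of_real p) ` G1)" by (intro connected_continuous_image continuous_intros c1)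
      show "0 - of_real p \<in> (\<lambda>\<tau>. \<tau> - of_real p) ` G1" using R by (intro imageI) auto
      show "(\<lambda>\<tau>. \<tau> - of_real p) ` G1 \<subseteq> G" using c1 inv[of "_ - of_real p"] by auto
    qed auto
    then have "\<tau> + of_real p - of_real p \<in> G1" if "\<tau> + of_real p \<in> G1" using that by (auto simp: image_subset_iff simp del: add_diff_cancel_right')
    then show "\<tau> + of_real p \<in> G1 \<Longrightarrow> \<tau> \<in> G1" by simp
  qed
  have invk: "\<tau> \<in> G1 \<longleftrightarrow> \<tau> + of_int k * of_real p \<in> G1" for \<tau> k
  proof (induction k rule: int_induct[of _ 0])
    case (step1 i)
    then show ?case using inv1[of "\<tau> + of_int i * of_real p"] by (simp add: algebra_simps)
  next
    case (step2 i)
    then show ?case using inv1[of "\<tau> + of_int (i - 1) * of_real p"] by (simp add: algebra_simps)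
  qed simp
  have o2: "open G2"
  proof -
    have "G2 = (\<Union>x\<in>G2. connected_component_set G x)"
    proof (intro equalityI subsetI)
      fix x assume "x \<in> G2" then show "x \<in> (\<Union>x\<in>G2. connected_component_set G x)"
        by (intro UN_I[of x]) (auto simp: G2_def)
    next
      fix z assume "z \<in> (\<Union>x\<in>G2. connected_component_set G x)"
      then obtain x where x: "x \<in> G2" "connected_component G x z" by auto
      then have "z \<in> G" using connected_component_in by blast
      moreover have "z \<notin> G1"
      proof
        assume "z \<in> G1"
        then have "connected_component G 0 x" using x(2) unfolding G1_def
          by (metis connected_component_sym connected_component_trans mem_Collect_eq)
        then show False using x(1) by (simp add: G2_def G1_def)
      qed
      ultimately show "z \<in> G2" by (simp add: G2_def)
    qed
    moreover have "open (\<Union>x\<in>G2. connected_component_set G x)" using open_connected_component[OF oG] by blast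
    ultimately show ?thesis by simp
  qed
  \<comment> \<open>The exponential is a covering of the punctured plane, hence an open map.\<close>
  have oE: "open (E ` S)" if "open S" for S
  proof -
    let ?c = "2 * of_real pi * \<i> / of_real p :: complex"
    have "open ((*) ?c ` S)" by (rule open_times_image[OF _ that]) (use p in auto)
    then have "openin (top_of_set (- {0})) (exp ` ((*) ?c ` S))"
      by (intro covering_space_open_map[OF covering_space_exp_punctured_plane]) auto
    then have "open (exp ` ((*) ?c ` S))" using openin_open_eq[of "- {0 :: complex}"] by blast
    then show ?thesis by (simp add: image_image E_def)
  qed
  have "E ` G1 \<inter> E ` G2 = {}"
  proof (rule ccontr)
    assume "\<not> ?thesis"
    then obtain s t where st: "s \<in> G1" "t \<in> G2" "E s = E t" by auto
    from st(3) obtain k :: int where "2 * of_real pi * \<i> * s / of_real p = 2 * of_real pi * \<i> * t / of_real p + (of_int (2 * k) * pi) * \<i>"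
      unfolding E_def exp_eq by blast
    then have "2 * of_real pi * \<i> * s = 2 * of_real pi * \<i> * (t + of_int k * of_real p)"
      using p by (simp add: divide_simps) (simp add: algebra_simps)
    then have "s = t + of_int k * of_real p" by simp
    then show False using invk[of t k] st by (simp add: G2_def)
  qed
  then have "E ` G1 \<inter> E ` G2 \<inter> E ` G = {}" by simp
  moreover have "E ` G \<subseteq> E ` G1 \<union> E ` G2" unfolding G2_def by blast
  ultimately have "E ` G1 \<inter> E ` G = {} \<or> E ` G2 \<inter> E ` G = {}"
    by (rule connectedD[OF cE oE[OF c1(3)] oE[OF o2]])
  moreover have g0: "0 \<in> G1" using R by auto
  have "0 \<in> G" using g0 c1(2) by (rule rev_subsetD)
  then have "E 0 \<in> E ` G1 \<inter> E ` G" using g0 by blast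
  ultimately have "E ` G2 \<inter> E ` G = {}" by blast
  then have "G2 = {}" unfolding G2_def by blast
  then have "G = G1" using c1(2) by (auto simp: G2_def)
  then show ?thesis using c1(1) by simp
qed

text \<open>\<open>Q\<close> consists of a real segment, over which the solution is followed through
  whole periods, a closed annulus around the pole, where residues are taken, and a path joining them
  inside the domain; the path exists because the poles are countable. Points of \<open>Q\<close> are
  scaled times, \<alpha> times points of \<open>G\<close>.\<close>

lemma resonance_path:
  assumes \<alpha>: "\<alpha> > 0" and G: "open G" "connected G" "\<real> \<subseteq> G" "iK / of_real \<alpha> \<in> G"
  obtains Q r r1 r2 h where "compact Q" "connected Q" "\<And>u. u \<in> Q \<Longrightarrow> u \<notin> lpoles \<and> u / of_real \<alpha> \<in> G"
    "0 \<in> Q" "of_real t \<in> Q" "0 < r1" "r1 < r2" "r2 < r" "\<And>u. r1 \<le> dist iK u \<Longrightarrow> dist iK u \<le> r2 \<Longrightarrow> u \<in> Q"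
    "h holomorphic_on ball iK r" "h iK \<noteq> 0" "\<And>z. z \<in> ball iK r - {iK} \<Longrightarrow> z \<notin> lpoles \<and> lcn z = h z / (z - iK)"
proof -
  obtain r h where h: "r > 0" "h holomorphic_on ball iK r" "h iK \<noteq> 0"
    "\<And>z. z \<in> ball iK r - {iK} \<Longrightarrow> z \<notin> lpoles \<and> lcn z = h z / (z - iK)"
    by (rule lcn_pole) blast
  define H where "H = (*) (of_real \<alpha>) ` G"
  have H: "u \<in> H \<longleftrightarrow> u / of_real \<alpha> \<in> G" for u unfolding H_def using \<alpha> by (force simp: image_iff)
  have oH: "open H" unfolding H_def by (rule open_times_image[OF _ G(1)]) (use \<alpha> in auto)
  have cH: "connected H" unfolding H_def by (intro connected_continuous_image continuous_intros G)
  have pH: "path_connected (H - lpoles)"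
    by (rule path_connected_open_diff_countable[OF _ oH cH countable_lpoles]) simp
  have Hreal: "of_real s \<in> H - lpoles" for s
    using G(3) of_real_notin_lpoles unfolding H by (metis Diff_iff H Reals_of_real of_real_divide subsetD)
  have "iK \<in> H" using G(4) H by simp
  then obtain s where s: "s > 0" "ball iK s \<subseteq> H" using oH open_contains_ball by blast
  define r2 where "r2 = min r s / 2"
  define r1 where "r1 = r2 / 2"
  have r: "0 < r1" "r1 < r2" "r2 < r" "r2 < s" using h(1) s(1) by (auto simp: r1_def r2_def min_def)
  define N where "N = {u. r1 \<le> norm (u - iK) \<and> norm (u - iK) \<le> r2}"
  have Nsub: "N \<subseteq> H - lpoles"
  proof
    fix u assume "u \<in> N"
    then have "u \<in> ball iK s" "u \<in> ball iK r - {iK}" using r by (auto simp: N_def dist_norm norm_minus_commute)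
    then show "u \<in> H - lpoles" using s(2) h(4) by blast
  qed
  have cN: "connected N" unfolding N_def by (rule connected_annulus) simp
  have kN: "compact N"
  proof (rule compact_Int_closed[of "cball iK r2" "- ball iK r1", THEN back_subst[where P = compact]])
    show "cball iK r2 \<inter> - ball iK r1 = N" by (auto simp: N_def dist_norm norm_minus_commute)
  qed auto
  have pN: "iK + of_real r1 \<in> N" using r by (simp add: N_def)
  have "0 \<in> H - lpoles" using Hreal[of 0] by simp
  then obtain g where g: "path g" "path_image g \<subseteq> H - lpoles" "pathstart g = 0" "pathfinish g = iK + of_real r1"
    using pH pN Nsub unfolding path_connected_def by blast
  define L where "L = closed_segment (0 :: complex) (of_real t)"
  have L: "compact L" "connected L" "L \<subseteq> H - lpoles" "0 \<in> L" "of_real t \<in> L"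
  proof -
    show "L \<subseteq> H - lpoles"
    proof
      fix z assume "z \<in> L"
      then obtain c where "z = of_real (c * t)" unfolding L_def closed_segment_def by (auto simp: scaleR_conv_of_real)
      then show "z \<in> H - lpoles" using Hreal by metis
    qed
  qed (auto simp: L_def)
  have gl: "0 \<in> path_image g" "iK + of_real r1 \<in> path_image g" using g(3,4) pathstart_in_path_image pathfinish_in_path_image by metis+
  show ?thesis
  proof (rule that[of "L \<union> path_image g \<union> N" r1 r2 r h])
    show "compact (L \<union> path_image g \<union> N)" using L(1) kN compact_path_image[OF g(1)] by auto
    have "connected (L \<union> path_image g)" by (rule connected_Un[OF L(2) connected_path_image[OF g(1)]]) (use L gl in blast)
    then show "connected (L \<union> path_image g \<union> N)" by (rule connected_Un[OF _ cN]) (use pN gl in blast)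
    show "u \<notin> lpoles \<and> u / of_real \<alpha> \<in> G" if "u \<in> L \<union> path_image g \<union> N" for u
      using that L(3) g(2) Nsub H by blast
    show "u \<in> L \<union> path_image g \<union> N" if "r1 \<le> dist iK u" "dist iK u \<le> r2" for u
      using that by (simp add: N_def dist_norm norm_minus_commute)
  qed (use r h L in auto)
qed

lemma lcn_shift: "lcn (u + of_nat m * (4 * of_real qK)) = lcn u" "lcn' (u + of_nat m * (4 * of_real qK)) = lcn' u"
proof (induction m)
  case (Suc m)
  { case 1 show ?case using Suc lcn_periodic(1)[of "u + of_nat m * (4 * of_real qK)"] by (simp add: algebra_simps) }
  { case 2 show ?case using Suc lcn_periodic(2)[of "u + of_nat m * (4 * of_real qK)"] by (simp add: algebra_simps) }
qed simp_all

text \<open>Whole periods of cn leave the oscillator alone and only advance the phase. The advance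
  is split into a shift of y and l full turns, invisible to functions periodic in \<phi>; after n
  periods at the resonant amplitude the shift of y is zero.\<close>

lemma Phi_shift:
  "Phi \<nu> x y (u + of_nat m * (4 * of_real qK)) =
     Phi \<nu> x (y + (of_real \<nu> * (of_nat m * (4 * of_real qK)) / x - of_nat l * (2 * of_real pi))) u + of_nat l *s phase_period"
  unfolding vec3_eq_iff phase_period_def
  by (simp add: Phi_nth lcn_shift phase_def axis_def add_divide_distrib diff_divide_distrib algebra_simps)

lemma shift_invariant_iterate:
  assumes U: "shift_invariant_set \<omega> U" and g: "shift_invariant_on \<omega> U g" and z: "(y, e) \<in> U"
  shows "g (y + of_nat l *s \<omega>, e) = g (y, e)"
proof -
  have "(y + of_nat l *s \<omega>, e) \<in> U \<and> g (y + of_nat l *s \<omega>, e) = g (y, e)"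
  proof (induction l)
    case (Suc l)
    have "y + of_nat (Suc l) *s \<omega> = (y + of_nat l *s \<omega>) + \<omega>" by (simp add: vec_eq_iff algebra_simps)
    then have s: "shift_state \<omega> (y + of_nat l *s \<omega>, e) = (y + of_nat (Suc l) *s \<omega>, e)" by (simp add: shift_state_def)
    show ?case using U[unfolded shift_invariant_set_def, rule_format, of "(y + of_nat l *s \<omega>, e)"]
      g[unfolded shift_invariant_on_def, rule_format, of "(y + of_nat l *s \<omega>, e)"] Suc unfolding s by simp
  qed (use z in simp)
  then show ?thesis by blast
qed

section \<open>Rigidity\<close>

text \<open>The data shared by all unknowns. Numerators are left out, since first integrals and
  commuting fields bring different ones over the same denominators.\<close>

locale forced_family =
  fixes \<beta> \<delta> \<nu> \<alpha> :: real and y0 :: complex and n l :: nat and \<rho> :: real and J :: "'j set" and W b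
    and r r1 r2 :: real and h :: "complex \<Rightarrow> complex"
  assumes pos: "\<beta> > 0" "\<nu> > 0" "\<alpha> > 0" "n > 0"
    and resonance: "of_real \<nu> * (of_nat n * (4 * of_real qK)) / of_real \<alpha> = of_nat l * (2 * of_real pi :: complex)"
    and \<rho>: "\<rho> > 0" and J: "finite J" and W: "\<And>j. j \<in> J \<Longrightarrow> open (W j) \<and> connected (W j)"
    and conn: "connected (\<Union>j\<in>J. W j)"
    and dom: "\<And>x. x \<in> ball (complex_of_real \<alpha>) \<rho> \<Longrightarrow> x \<noteq> 0" "\<And>u. u \<in> (\<Union>j\<in>J. W j) \<Longrightarrow> u \<notin> lpoles"
    and hol_b: "\<And>j. j \<in> J \<Longrightarrow> hol4 (b j) (ball (of_real \<alpha>) \<rho>) (ball y0 \<rho>) (W j) (ball 0 \<rho>)"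
    and b0: "\<And>j. j \<in> J \<Longrightarrow> \<exists>x\<in>ball (of_real \<alpha>) \<rho>. \<exists>y\<in>ball y0 \<rho>. \<exists>u\<in>W j. b j x y u 0 \<noteq> 0"
    and ring: "0 < r1" "r1 < r2" "r2 < r" "\<And>u. r1 \<le> dist iK u \<Longrightarrow> dist iK u \<le> r2 \<Longrightarrow> u \<in> (\<Union>j\<in>J. W j)"
    and h: "h holomorphic_on ball iK r" "h iK \<noteq> 0"
      "\<And>z. z \<in> ball iK r - {iK} \<Longrightarrow> z \<notin> lpoles \<and> lcn z = h z / (z - iK)"
    and ends: "0 \<in> (\<Union>j\<in>J. W j)" "of_nat n * (4 * of_real qK) \<in> (\<Union>j\<in>J. W j)"
begin

abbreviation A where "A \<equiv> ball (complex_of_real \<alpha>) \<rho>"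
abbreviation B where "B \<equiv> ball y0 \<rho>"
abbreviation \<Omega> where "\<Omega> \<equiv> (\<Union>j\<in>J. W j)"
abbreviation P0 :: complex where "P0 \<equiv> of_nat n * (4 * of_real qK)"
abbreviation \<kappa>0 :: complex where "\<kappa>0 \<equiv> of_real \<nu> * P0"
text \<open>The phase gained over n periods at amplitude x, less the gain at \<alpha>, which the
  resonance condition makes a multiple of 2 pi. It varies with x because the period depends on the
  amplitude.\<close>

definition \<kappa> :: "complex \<Rightarrow> complex" where "\<kappa> x = \<kappa>0 / x - \<kappa>0 / of_real \<alpha>"

lemma \<kappa>0: "\<kappa>0 \<noteq> 0" using pos qK_pos by auto

lemma A0: "0 \<notin> A" using dom(1) by blast

lemma Phi_twist: "Phi \<nu> x y (u + P0) = Phi \<nu> x (y + \<kappa> x) u + of_nat l *s phase_period"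
  unfolding Phi_shift[where l = l] \<kappa>_def resonance ..

lemma continuous_coefficients:
  assumes "x \<in> A"
  shows "continuous_on \<Omega> (wx \<beta> \<delta> \<nu> x y)" "continuous_on \<Omega> (wy \<beta> \<delta> \<nu> x y)" "continuous_on \<Omega> (wu \<beta> \<delta> \<nu> x y)"
    "continuous_on \<Omega> (kk \<beta> \<delta> \<nu> i i' x y)"
proof -
  have c: "continuous_on \<Omega> lcn" "continuous_on \<Omega> lcn'"
    using dom(2) by (auto intro!: continuous_on_subset[OF lcn_continuous(1)] continuous_on_subset[OF lcn_continuous(2)])
  have ph: "continuous_on \<Omega> (phase \<nu> x y)"
    unfolding phase_def[abs_def] using dom(1)[OF assms] by (intro continuous_intros) auto
  have z: "continuous_on \<Omega> zq" "continuous_on \<Omega> zq'"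
    unfolding zq_def[abs_def] zq'_def[abs_def] by (intro continuous_intros c)+
  show "continuous_on \<Omega> (wx \<beta> \<delta> \<nu> x y)" "continuous_on \<Omega> (wy \<beta> \<delta> \<nu> x y)" "continuous_on \<Omega> (wu \<beta> \<delta> \<nu> x y)"
    unfolding wx_def[abs_def] wy_def[abs_def] wu_def[abs_def] by (intro continuous_intros c ph z)+
  show "continuous_on \<Omega> (kk \<beta> \<delta> \<nu> i i' x y)"
    unfolding kk_def[abs_def] by (cases i; cases i'; simp only: if_True if_False; intro continuous_intros c ph z)
qed

lemma continuous_rings: "continuous_on (A \<times> B) (\<lambda>(x, y). ring_R \<beta> \<nu> c x y)" "continuous_on (A \<times> B) (\<lambda>(x, y). ring_K \<beta> \<nu> c i i' x y)"
proof -
  have n: "fst p \<noteq> 0" if "p \<in> A \<times> B" for p using that dom(1) by auto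
  show "continuous_on (A \<times> B) (\<lambda>(x, y). ring_R \<beta> \<nu> c x y)"
    unfolding ring_R_def case_prod_unfold using n by (intro continuous_intros) auto
  show "continuous_on (A \<times> B) (\<lambda>(x, y). ring_K \<beta> \<nu> c i i' x y)"
    unfolding ring_K_def case_prod_unfold using n pos(2)
    by (cases i; cases i'; simp only: if_True if_False; intro continuous_intros) auto
qed

text \<open>The alternative for \<open>k\<close> covers both uses: the matrix \<open>kk\<close> for
  a commuting field, zero for a first integral. The e-radius may shrink to \<rho>', since a first
  integral is normalised by its value at a base point, whose denominator is known to be nonzero only
  for small e.\<close>

lemma perturbed_family_forced:
  assumes \<rho>': "0 < \<rho>'" "\<rho>' \<le> \<rho>"
    and N: "\<And>i j. j \<in> J \<Longrightarrow> hol4 (N i j) A B (W j) (ball 0 \<rho>')"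
    and quot: "\<And>i j x y u e. j \<in> J \<Longrightarrow> x \<in> A \<Longrightarrow> y \<in> B \<Longrightarrow> u \<in> W j \<Longrightarrow> e \<in> ball 0 \<rho>' \<Longrightarrow> e \<noteq> 0 \<Longrightarrow>
        b j x y u e \<noteq> 0 \<Longrightarrow> g i x y u e = N i j x y u e / b j x y u e"
    and pde: "\<And>i j x y u e. j \<in> J \<Longrightarrow> x \<in> A \<Longrightarrow> y \<in> B \<Longrightarrow> u \<in> W j \<Longrightarrow> e \<in> ball 0 \<rho>' \<Longrightarrow> e \<noteq> 0 \<Longrightarrow>
        b j x y u e \<noteq> 0 \<Longrightarrow> has_L \<beta> \<delta> \<nu> (g i) x y u e (e * (k i True x y u * g True x y u e + k i False x y u * g False x y u e))"
    and nz: "\<exists>j\<in>J. \<exists>x\<in>A. \<exists>y\<in>B. \<exists>u\<in>W j. \<exists>e\<in>ball 0 \<rho>'. \<exists>i. N i j x y u e \<noteq> 0"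
    and k: "k = kk \<beta> \<delta> \<nu> \<and> K = ring_K \<beta> \<nu> (h iK) \<or> k = (\<lambda>i i' x y u. 0) \<and> K = (\<lambda>i i' x y. 0)"
    and twist: "\<And>x y u e. x \<in> A \<Longrightarrow> y \<in> B \<Longrightarrow> y + \<kappa> x \<in> B \<Longrightarrow> e \<in> ball 0 \<rho>' \<Longrightarrow> e \<noteq> 0 \<Longrightarrow>
        u \<in> \<Omega> \<Longrightarrow> u + P0 \<in> \<Omega> \<Longrightarrow>
        g True x y (u + P0) e = g True x (y + \<kappa> x) u e \<and>
        g False x y (u + P0) e = g False x (y + \<kappa> x) u e + \<tau> x * g True x (y + \<kappa> x) u e"
    and \<tau>: "continuous_on A \<tau>"
  shows "perturbed_family A B J W \<rho>' g N b (wx \<beta> \<delta> \<nu>) (wy \<beta> \<delta> \<nu>) (wu \<beta> \<delta> \<nu>) k iK r1 r2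
    (ring_R \<beta> \<nu> (h iK)) K P0 \<kappa> \<tau>"
proof
  have e: "e \<in> ball 0 \<rho>" if "e \<in> ball 0 \<rho>'" for e :: complex using that \<rho>' by auto
  show "hol4 (b j) A B (W j) (ball 0 \<rho>')" if "j \<in> J" for j
    by (rule hol4_subset[OF hol_b[OF that]]) (use \<rho>' in auto)
  show "\<exists>d1 d2 d3. ((\<lambda>t. g i t y u e) has_field_derivative d1) (at x) \<and>
          ((\<lambda>t. g i x t u e) has_field_derivative d2) (at y) \<and> ((\<lambda>t. g i x y t e) has_field_derivative d3) (at u) \<and>
          (x + e * wu \<beta> \<delta> \<nu> x y u) * d3 + e * (wx \<beta> \<delta> \<nu> x y u * d1 + wy \<beta> \<delta> \<nu> x y u * d2) =
            e * (k i True x y u * g True x y u e + k i False x y u * g False x y u e)"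
    if "j \<in> J" "x \<in> A" "y \<in> B" "u \<in> W j" "e \<in> ball 0 \<rho>'" "e \<noteq> 0" "b j x y u e \<noteq> 0" for i j x y u e
    using pde[OF that] unfolding has_L_def .
  show "(wx \<beta> \<delta> \<nu> x y has_contour_integral ring_R \<beta> \<nu> (h iK) x y) (circlepath iK s) \<and> (wy \<beta> \<delta> \<nu> x y has_contour_integral 0) (circlepath iK s)"
    if "x \<in> A" "y \<in> B" "r1 < s" "s < r2" for x y s
    using ring_integrals(1,2)[OF h(1) h(3) _ _ dom(1)[OF that(1)], of s] that ring by auto
  show "(k i i' x y has_contour_integral K i i' x y) (circlepath iK s)"
    if "x \<in> A" "y \<in> B" "r1 < s" "s < r2" for i i' x y s
    using k
  proof
    assume "k = kk \<beta> \<delta> \<nu> \<and> K = ring_K \<beta> \<nu> (h iK)"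
    then show ?thesis using ring_integrals(3)[OF h(1) h(3) _ _ dom(1)[OF that(1)], of s] that ring by auto
  next
    assume "k = (\<lambda>i i' x y u. 0) \<and> K = (\<lambda>i i' x y. 0)"
    then show ?thesis by (simp add: has_contour_integral_0)
  qed
  show "continuous_on \<Omega> (k i i' x y)" if "x \<in> A" "y \<in> B" for i i' x y
    using k continuous_coefficients(4)[OF that(1)] by auto
  show "continuous_on (A \<times> B) (\<lambda>(x, y). K i i' x y)" for i i'
    using k continuous_rings(2) by (auto simp: case_prod_unfold)
  show "continuous_on A \<kappa>"
    unfolding \<kappa>_def[abs_def] using dom(1) pos(3) by (intro continuous_intros) auto
  show "continuous_on \<Omega> (wx \<beta> \<delta> \<nu> x y) \<and> continuous_on \<Omega> (wy \<beta> \<delta> \<nu> x y) \<and> continuous_on \<Omega> (wu \<beta> \<delta> \<nu> x y)"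
    if "x \<in> A" "y \<in> B" for x y using continuous_coefficients[OF that(1)] by blast
qed (fact N quot nz twist \<tau> J W conn b0 \<rho>' ring(1,2,4) A0 continuous_rings(1) open_ball connected_ball)+

text \<open>Near u = 0 both u and u + P0 lie in the union of the patches, because 0 and P0 do; for
  generic (x, y) all but countably many of these times have a nonzero denominator.\<close>

lemma base_point:
  obtains j x y u where "j \<in> J" "x \<in> A" "y \<in> B" "u \<in> W j" "u + P0 \<in> \<Omega>" "b j x y u 0 \<noteq> 0"
proof -
  obtain j where j: "j \<in> J" "0 \<in> W j" using ends(1) by auto
  define S where "S = W j \<inter> (\<lambda>u. u + P0) -` \<Omega>"
  have "open S" unfolding S_def using W j by (intro open_Int open_vimage continuous_intros open_UN) auto
  moreover have "0 \<in> S" using j ends by (simp add: S_def)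
  ultimately have S: "open S" "S \<noteq> {}" by auto
  obtain x y where xy: "x \<in> A" "y \<in> B" "\<And>i. i \<in> {j} \<Longrightarrow> countable {u \<in> W i. b i x y u 0 = 0}"
  proof (rule hol4_generic[where J = "{j}" and c = b and A = A and B = B and W = W and D = "ball 0 \<rho>" and e = 0 and A' = A and B' = B])
    show "\<exists>x\<in>A. \<exists>y\<in>B. \<exists>u\<in>W i. b i x y u 0 \<noteq> 0" if "i \<in> {j}" for i using b0[of i] j that by simp
    show "hol4 (b i) A B (W i) (ball 0 \<rho>)" if "i \<in> {j}" for i using hol_b[of i] j that by simp
    show "open (W i) \<and> connected (W i)" if "i \<in> {j}" for i using W[of i] j that by simp
  qed (use \<rho> in auto)
  from open_not_countable[OF S xy(3)[of j]] obtain u where "u \<in> S" "u \<notin> {u \<in> W j. b j x y u 0 = 0}" by auto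
  then show ?thesis using that[OF j(1) xy(1,2), of u] by (auto simp: S_def)
qed

section \<open>From the limit equations to contradictions\<close>

lemma e0: "0 < \<rho>' \<Longrightarrow> (0 :: complex) \<in> ball 0 \<rho>'" by simp

text \<open>Restates the results on \<open>Gh\<close> at the base time in terms of numerators
  \<open>c\<close> and one denominator, all holomorphic in x and y, which is the form in which
  rigidity applies. The first two conclusions keep the link with the original numerators for all
  small e.\<close>

lemma limit_problem:
  assumes \<rho>': "0 < \<rho>'" "\<rho>' \<le> \<rho>"
    and N: "\<And>i j. j \<in> J \<Longrightarrow> hol4 (N i j) A B (W j) (ball 0 \<rho>')"
    and quot: "\<And>i j x y u e. j \<in> J \<Longrightarrow> x \<in> A \<Longrightarrow> y \<in> B \<Longrightarrow> u \<in> W j \<Longrightarrow> e \<in> ball 0 \<rho>' \<Longrightarrow> e \<noteq> 0 \<Longrightarrow>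
        b j x y u e \<noteq> 0 \<Longrightarrow> g i x y u e = N i j x y u e / b j x y u e"
    and pde: "\<And>i j x y u e. j \<in> J \<Longrightarrow> x \<in> A \<Longrightarrow> y \<in> B \<Longrightarrow> u \<in> W j \<Longrightarrow> e \<in> ball 0 \<rho>' \<Longrightarrow> e \<noteq> 0 \<Longrightarrow>
        b j x y u e \<noteq> 0 \<Longrightarrow> has_L \<beta> \<delta> \<nu> (g i) x y u e (e * (k i True x y u * g True x y u e + k i False x y u * g False x y u e))"
    and nz: "\<exists>j\<in>J. \<exists>x\<in>A. \<exists>y\<in>B. \<exists>u\<in>W j. \<exists>e\<in>ball 0 \<rho>'. \<exists>i. N i j x y u e \<noteq> 0"
    and k: "k = kk \<beta> \<delta> \<nu> \<and> K = ring_K \<beta> \<nu> (h iK) \<or> k = (\<lambda>i i' x y u. 0) \<and> K = (\<lambda>i i' x y. 0)"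
    and twist: "\<And>x y u e. x \<in> A \<Longrightarrow> y \<in> B \<Longrightarrow> y + \<kappa> x \<in> B \<Longrightarrow> e \<in> ball 0 \<rho>' \<Longrightarrow> e \<noteq> 0 \<Longrightarrow>
        u \<in> \<Omega> \<Longrightarrow> u + P0 \<in> \<Omega> \<Longrightarrow>
        g True x y (u + P0) e = g True x (y + \<kappa> x) u e \<and>
        g False x y (u + P0) e = g False x (y + \<kappa> x) u e + \<tau> x * g True x (y + \<kappa> x) u e"
    and \<tau>: "continuous_on A \<tau>"
    and base: "j0 \<in> J" "xs \<in> A" "ys \<in> B" "us \<in> W j0" "us + P0 \<in> \<Omega>" "b j0 xs ys us 0 \<noteq> 0"
  obtains M and c :: "bool \<Rightarrow> complex \<Rightarrow> complex \<Rightarrow> complex \<Rightarrow> complex" where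
    "\<And>i e. e \<in> ball 0 \<rho>' \<Longrightarrow> N i j0 xs ys us e = e ^ M * c i xs ys e"
    "\<And>i. (\<lambda>e. c i xs ys e) holomorphic_on ball 0 \<rho>'"
    "\<And>i y. y \<in> B \<Longrightarrow> (\<lambda>t. c i t y 0) holomorphic_on A" "\<And>i x. x \<in> A \<Longrightarrow> (\<lambda>t. c i x t 0) holomorphic_on B"
    "\<And>y. y \<in> B \<Longrightarrow> (\<lambda>t. b j0 t y us 0) holomorphic_on A" "\<And>x. x \<in> A \<Longrightarrow> (\<lambda>t. b j0 x t us 0) holomorphic_on B"
    "\<And>i x y. x \<in> A \<Longrightarrow> y \<in> B \<Longrightarrow> b j0 x y us 0 \<noteq> 0 \<Longrightarrow> ring_R \<beta> \<nu> (h iK) x y * deriv (\<lambda>t. c i t y 0 / b j0 t y us 0) x =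
       K i True x y * (c True x y 0 / b j0 x y us 0) + K i False x y * (c False x y 0 / b j0 x y us 0)"
    "\<And>x y. x \<in> A \<Longrightarrow> y \<in> B \<Longrightarrow> y + \<kappa> x \<in> B \<Longrightarrow> b j0 x y us 0 \<noteq> 0 \<Longrightarrow> b j0 x (y + \<kappa> x) us 0 \<noteq> 0 \<Longrightarrow>
       c True x y 0 / b j0 x y us 0 = c True x (y + \<kappa> x) 0 / b j0 x (y + \<kappa> x) us 0 \<and>
       c False x y 0 / b j0 x y us 0 = c False x (y + \<kappa> x) 0 / b j0 x (y + \<kappa> x) us 0
         + \<tau> x * (c True x (y + \<kappa> x) 0 / b j0 x (y + \<kappa> x) us 0)"
    "\<exists>x\<in>A. \<exists>y\<in>B. \<exists>i. c i x y 0 \<noteq> 0"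
proof -
  interpret p: perturbed_family A B J W \<rho>' g N b "wx \<beta> \<delta> \<nu>" "wy \<beta> \<delta> \<nu>" "wu \<beta> \<delta> \<nu>" k iK r1 r2
    "ring_R \<beta> \<nu> (h iK)" K P0 \<kappa> \<tau>
    by (rule perturbed_family_forced[OF \<rho>']) (fact N quot pde nz k twist \<tau>)+
  obtain M and \<alpha>' :: "bool \<Rightarrow> 'j \<Rightarrow> complex \<Rightarrow> complex \<Rightarrow> complex \<Rightarrow> complex \<Rightarrow> complex"
    where n: "\<And>i j. j \<in> J \<Longrightarrow> hol4 (\<alpha>' i j) A B (W j) (ball 0 \<rho>')"
    "\<And>i j x y u e. j \<in> J \<Longrightarrow> x \<in> A \<Longrightarrow> y \<in> B \<Longrightarrow> u \<in> W j \<Longrightarrow> e \<in> ball 0 \<rho>' \<Longrightarrow> N i j x y u e = e ^ M * \<alpha>' i j x y u e"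
    "\<exists>j\<in>J. \<exists>x\<in>A. \<exists>y\<in>B. \<exists>u\<in>W j. \<exists>i. \<alpha>' i j x y u 0 \<noteq> 0"
    by (rule p.normalise) blast
  interpret q: normalised_family A B J W \<rho>' g N b "wx \<beta> \<delta> \<nu>" "wy \<beta> \<delta> \<nu>" "wu \<beta> \<delta> \<nu>" k iK r1 r2
    "ring_R \<beta> \<nu> (h iK)" K P0 \<kappa> \<tau> M \<alpha>'
    by unfold_locales (fact n)+
  note bl = base(1,4,5)
  have z0: "(0 :: complex) \<in> ball 0 \<rho>'" using \<rho>'(1) by simp
  have ok: "q.ok j0 x y us 0 \<longleftrightarrow> x \<in> A \<and> y \<in> B \<and> b j0 x y us 0 \<noteq> 0" for x y
    unfolding q.ok_def using base(1,4) z0 by blast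
  define c where "c = (\<lambda>i x y e. \<alpha>' i j0 x y us e)"
  have Gh: "q.Gh i x y us 0 = c i x y 0 / b j0 x y us 0" if "x \<in> A" "y \<in> B" "b j0 x y us 0 \<noteq> 0" for x y i
    using q.Gh_eq[of j0 x y us 0 i] ok that by (simp add: c_def)
  have sl: "(\<lambda>t. f t y us 0) holomorphic_on A" "(\<lambda>t. f x t us 0) holomorphic_on B"
    if "hol4 f A B (W j0) (ball 0 \<rho>')" "x \<in> A" "y \<in> B" for f x y
    using hol4_slices(1,2)[OF that base(4) z0] .
  show ?thesis
  proof (rule that[of M c])
    show "N i j0 xs ys us e = e ^ M * c i xs ys e" if "e \<in> ball 0 \<rho>'" for i e
      unfolding c_def by (rule n(2)[OF base(1-4) that])
    show "c i xs ys holomorphic_on ball 0 \<rho>'" for i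
      unfolding c_def by (rule hol4_slices(4)[OF n(1)[OF base(1)] base(2-4) z0])
    show hb: "(\<lambda>t. b j0 t y us 0) holomorphic_on A" if "y \<in> B" for y by (rule sl(1)[OF p.hol_b[OF base(1)] base(2) that])
    show "(\<lambda>t. b j0 x t us 0) holomorphic_on B" if "x \<in> A" for x by (rule sl(2)[OF p.hol_b[OF base(1)] that base(3)])
    show "(\<lambda>t. c i t y 0) holomorphic_on A" if "y \<in> B" for i y unfolding c_def by (rule sl(1)[OF n(1)[OF base(1)] base(2) that])
    show "(\<lambda>t. c i x t 0) holomorphic_on B" if "x \<in> A" for i x unfolding c_def by (rule sl(2)[OF n(1)[OF base(1)] that base(3)])
    show "ring_R \<beta> \<nu> (h iK) x y * deriv (\<lambda>t. c i t y 0 / b j0 t y us 0) x =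
       K i True x y * (c True x y 0 / b j0 x y us 0) + K i False x y * (c False x y 0 / b j0 x y us 0)"
      if m: "x \<in> A" "y \<in> B" "b j0 x y us 0 \<noteq> 0" for i x y
    proof -
      have o: "open {t \<in> A. b j0 t y us 0 \<noteq> 0}"
        by (rule open_nonzero[OF open_ball holomorphic_on_imp_continuous_on[OF hb[OF m(2)]]])
      have "\<forall>\<^sub>F t in nhds x. q.Gh i t y us 0 = c i t y 0 / b j0 t y us 0"
        unfolding eventually_nhds
        by (rule exI[of _ "{t \<in> A. b j0 t y us 0 \<noteq> 0}"]) (use o m Gh[of _ y i] in simp)
      then have d: "deriv (\<lambda>t. q.Gh i t y us 0) x = deriv (\<lambda>t. c i t y 0 / b j0 t y us 0) x" by (rule deriv_cong_ev) simp
      have "q.ok j0 x y us 0" using ok m by blast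
      from q.base_ode[OF bl this, of i] show ?thesis unfolding d Gh[OF m] .
    qed
    show "c True x y 0 / b j0 x y us 0 = c True x (y + \<kappa> x) 0 / b j0 x (y + \<kappa> x) us 0 \<and>
       c False x y 0 / b j0 x y us 0 = c False x (y + \<kappa> x) 0 / b j0 x (y + \<kappa> x) us 0
         + \<tau> x * (c True x (y + \<kappa> x) 0 / b j0 x (y + \<kappa> x) us 0)"
      if m: "x \<in> A" "y \<in> B" "y + \<kappa> x \<in> B" "b j0 x y us 0 \<noteq> 0" "b j0 x (y + \<kappa> x) us 0 \<noteq> 0" for x y
    proof -
      have "q.ok j0 x y us 0" "q.ok j0 x (y + \<kappa> x) us 0" using ok m by blast+
      from q.base_twist[OF bl this] show ?thesis unfolding Gh[OF m(1,2,4)] Gh[OF m(1,3,5)] .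
    qed
    have "q.ok j0 xs ys us 0" using ok base by blast
    from q.base_nonzero[OF bl this] obtain x y i where "q.ok j0 x y us 0" "q.Gh i x y us 0 \<noteq> 0" by blast
    then have "x \<in> A" "y \<in> B" "c i x y 0 \<noteq> 0" using ok Gh[of x y i] by auto
    then show "\<exists>x\<in>A. \<exists>y\<in>B. \<exists>i. c i x y 0 \<noteq> 0" by blast
  qed
qed

lemma ring_R_factor: "ring_R \<beta> \<nu> (h iK) x y = (2 * of_real pi * \<i> * of_real \<beta> * of_real \<nu> * h iK / x\<^sup>2) * sin y"
  by (simp add: ring_R_def power2_eq_square)

lemma ring_factor_nonzero: "x \<in> A \<Longrightarrow> 2 * of_real pi * \<i> * of_real \<beta> * of_real \<nu> * h iK / x\<^sup>2 \<noteq> 0"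
  using pos h(2) dom(1) by auto

text \<open>By rigidity the leading coefficient is a constant d. Since N vanishes at the base point
  for e \<noteq> 0, its leading factor vanishes there too, and by continuity also at e = 0. The
  denominator does not, so d = 0, against the choice of the leading power.\<close>

lemma scalar_contradiction:
  assumes \<rho>': "0 < \<rho>'" "\<rho>' \<le> \<rho>"
    and N: "\<And>j. j \<in> J \<Longrightarrow> hol4 (N j) A B (W j) (ball 0 \<rho>')"
    and quot: "\<And>j x y u e. j \<in> J \<Longrightarrow> x \<in> A \<Longrightarrow> y \<in> B \<Longrightarrow> u \<in> W j \<Longrightarrow> e \<in> ball 0 \<rho>' \<Longrightarrow> e \<noteq> 0 \<Longrightarrow>
        b j x y u e \<noteq> 0 \<Longrightarrow> g x y u e = N j x y u e / b j x y u e"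
    and pde: "\<And>j x y u e. j \<in> J \<Longrightarrow> x \<in> A \<Longrightarrow> y \<in> B \<Longrightarrow> u \<in> W j \<Longrightarrow> e \<in> ball 0 \<rho>' \<Longrightarrow> e \<noteq> 0 \<Longrightarrow>
        b j x y u e \<noteq> 0 \<Longrightarrow> has_L \<beta> \<delta> \<nu> g x y u e 0"
    and twist: "\<And>x y u e. x \<in> A \<Longrightarrow> y \<in> B \<Longrightarrow> y + \<kappa> x \<in> B \<Longrightarrow> e \<in> ball 0 \<rho>' \<Longrightarrow> e \<noteq> 0 \<Longrightarrow>
        u \<in> \<Omega> \<Longrightarrow> u + P0 \<in> \<Omega> \<Longrightarrow> g x y (u + P0) e = g x (y + \<kappa> x) u e"
    and base: "j0 \<in> J" "xs \<in> A" "ys \<in> B" "us \<in> W j0" "us + P0 \<in> \<Omega>" "b j0 xs ys us 0 \<noteq> 0"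
    and vanish: "\<And>e. e \<in> ball 0 \<rho>' \<Longrightarrow> e \<noteq> 0 \<Longrightarrow> N j0 xs ys us e = 0"
    and j: "j \<in> J" and mem: "x \<in> A" "y \<in> B" "u \<in> W j" "e \<in> ball 0 \<rho>'"
  shows "N j x y u e = 0"
proof (rule ccontr)
  assume "N j x y u e \<noteq> 0"
  then have nz: "\<exists>j\<in>J. \<exists>x\<in>A. \<exists>y\<in>B. \<exists>u\<in>W j. \<exists>e\<in>ball 0 \<rho>'. \<exists>i::bool. N j x y u e \<noteq> 0" using j mem by blast
  have pde': "has_L \<beta> \<delta> \<nu> g x y u e (e * (0 * g x y u e + 0 * g x y u e))"
    if "j \<in> J" "x \<in> A" "y \<in> B" "u \<in> W j" "e \<in> ball 0 \<rho>'" "e \<noteq> 0" "b j x y u e \<noteq> 0" for j x y u e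
    using pde[OF that] by simp
  have k': "(\<lambda>i i' x y u. 0) = kk \<beta> \<delta> \<nu> \<and> (\<lambda>i i' x y. 0) = ring_K \<beta> \<nu> (h iK) \<or>
     (\<lambda>i i' x y u. 0 :: complex) = (\<lambda>(i :: bool) (i' :: bool) (x :: complex) (y :: complex) (u :: complex). 0) \<and>
     (\<lambda>i i' x y. 0 :: complex) = (\<lambda>(i :: bool) (i' :: bool) (x :: complex) (y :: complex). 0)" by simp
  have twist': "g x y (u + P0) e = g x (y + \<kappa> x) u e \<and> g x y (u + P0) e = g x (y + \<kappa> x) u e + 0 * g x (y + \<kappa> x) u e"
    if "x \<in> A" "y \<in> B" "y + \<kappa> x \<in> B" "e \<in> ball 0 \<rho>'" "e \<noteq> 0" "u \<in> \<Omega>" "u + P0 \<in> \<Omega>" for x y u e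
    using twist[OF that] by simp
  obtain M c where c: "\<And>i e. e \<in> ball 0 \<rho>' \<Longrightarrow> N j0 xs ys us e = e ^ M * c i xs ys e"
    "\<And>i. (\<lambda>e. c i xs ys e) holomorphic_on ball 0 \<rho>'"
    "\<And>i y. y \<in> B \<Longrightarrow> (\<lambda>t. c i t y 0) holomorphic_on A" "\<And>i x. x \<in> A \<Longrightarrow> (\<lambda>t. c i x t 0) holomorphic_on B"
    "\<And>y. y \<in> B \<Longrightarrow> (\<lambda>t. b j0 t y us 0) holomorphic_on A" "\<And>x. x \<in> A \<Longrightarrow> (\<lambda>t. b j0 x t us 0) holomorphic_on B"
    "\<And>i x y. x \<in> A \<Longrightarrow> y \<in> B \<Longrightarrow> b j0 x y us 0 \<noteq> 0 \<Longrightarrow> ring_R \<beta> \<nu> (h iK) x y * deriv (\<lambda>t. c i t y 0 / b j0 t y us 0) x =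
       0 * (c True x y 0 / b j0 x y us 0) + 0 * (c False x y 0 / b j0 x y us 0)"
    "\<And>x y. x \<in> A \<Longrightarrow> y \<in> B \<Longrightarrow> y + \<kappa> x \<in> B \<Longrightarrow> b j0 x y us 0 \<noteq> 0 \<Longrightarrow> b j0 x (y + \<kappa> x) us 0 \<noteq> 0 \<Longrightarrow>
       c True x y 0 / b j0 x y us 0 = c True x (y + \<kappa> x) 0 / b j0 x (y + \<kappa> x) us 0 \<and>
       c False x y 0 / b j0 x y us 0 = c False x (y + \<kappa> x) 0 / b j0 x (y + \<kappa> x) us 0
         + 0 * (c True x (y + \<kappa> x) 0 / b j0 x (y + \<kappa> x) us 0)"
    "\<exists>x\<in>A. \<exists>y\<in>B. \<exists>i. c i x y 0 \<noteq> 0"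
    by (rule limit_problem[where g = "\<lambda>i. g" and N = "\<lambda>i. N" and k = "\<lambda>i i' x y u. 0" and K = "\<lambda>i i' x y. 0" and \<tau> = "\<lambda>x. 0",
          OF \<rho>' N quot pde' nz k' twist' continuous_on_const base]) (assumption | (rule that; assumption))+
  obtain x1 y1 i where 1: "x1 \<in> A" "y1 \<in> B" "c i x1 y1 0 \<noteq> 0" using c(9) by blast
  have \<alpha>A: "of_real \<alpha> \<in> A" using \<rho> by simp
  have "\<exists>d. \<forall>x\<in>A. \<forall>y\<in>B. c i x y 0 = d * b j0 x y us 0"
  proof (rule scalar_rigidity[OF open_ball connected_ball open_ball connected_ball \<alpha>A A0 c(5,6) \<kappa>_def \<kappa>0 c(3,4) base(2,3,6)])
    show "sin y * deriv (\<lambda>t. c i t y 0 / b j0 t y us 0) x = 0" if m: "x \<in> A" "y \<in> B" "b j0 x y us 0 \<noteq> 0" for x y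
      using c(7)[OF m, of i] ring_factor_nonzero[OF m(1)] unfolding ring_R_factor by simp
    show "c i x y 0 / b j0 x y us 0 = c i x (y + \<kappa> x) 0 / b j0 x (y + \<kappa> x) us 0"
      if m: "x \<in> A" "y \<in> B" "y + \<kappa> x \<in> B" "b j0 x y us 0 \<noteq> 0" "b j0 x (y + \<kappa> x) us 0 \<noteq> 0" for x y
      using c(8)[OF m] by (cases i) auto
  qed
  then obtain d where d: "\<And>x y. x \<in> A \<Longrightarrow> y \<in> B \<Longrightarrow> c i x y 0 = d * b j0 x y us 0" by blast
  have "c i xs ys 0 = 0"
  proof (rule tendsto_unique[of "at (0 :: complex)"])
    have "0 \<in> ball (0 :: complex) \<rho>'" using \<rho>'(1) by simp
    then have "isCont (c i xs ys) 0"
      using holomorphic_on_imp_continuous_on[OF c(2)] continuous_on_eq_continuous_at[OF open_ball] by blast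
    then show "(c i xs ys \<longlongrightarrow> c i xs ys 0) (at 0)" by (simp add: isCont_def)
    have "\<forall>\<^sub>F t in at 0. 0 = c i xs ys t"
      unfolding eventually_at
    proof (intro exI[of _ \<rho>'] conjI ballI impI \<rho>'(1))
      fix t :: complex assume "t \<noteq> 0 \<and> dist t 0 < \<rho>'"
      then have "t \<in> ball 0 \<rho>'" "t \<noteq> 0" by auto
      then show "0 = c i xs ys t" using c(1)[of t i] vanish[of t] by auto
    qed
    then show "(c i xs ys \<longlongrightarrow> 0) (at 0)" by (rule Lim_transform_eventually[OF tendsto_const])
  qed simp
  then have "d = 0" using d[OF base(2,3)] base(6) by simp
  then show False using 1 d[of x1 y1] by auto
qed

text \<open>For pairs, rigidity excludes nonzero constants as well, so any nonzero pair is
  contradictory. Dividing the integrated equation by \<open>f\<close>, the nonzero coefficient of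
  sin y in \<open>ring_R\<close>, produces the normal form of
  \<open>vector_rigidity\<close>.\<close>

lemma vector_contradiction:
  assumes N: "\<And>i j. j \<in> J \<Longrightarrow> hol4 (N i j) A B (W j) (ball 0 \<rho>)"
    and quot: "\<And>i j x y u e. j \<in> J \<Longrightarrow> x \<in> A \<Longrightarrow> y \<in> B \<Longrightarrow> u \<in> W j \<Longrightarrow> e \<in> ball 0 \<rho> \<Longrightarrow> e \<noteq> 0 \<Longrightarrow>
        b j x y u e \<noteq> 0 \<Longrightarrow> g i x y u e = N i j x y u e / b j x y u e"
    and pde: "\<And>i j x y u e. j \<in> J \<Longrightarrow> x \<in> A \<Longrightarrow> y \<in> B \<Longrightarrow> u \<in> W j \<Longrightarrow> e \<in> ball 0 \<rho> \<Longrightarrow> e \<noteq> 0 \<Longrightarrow>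
        b j x y u e \<noteq> 0 \<Longrightarrow> has_L \<beta> \<delta> \<nu> (g i) x y u e (e * (kk \<beta> \<delta> \<nu> i True x y u * g True x y u e + kk \<beta> \<delta> \<nu> i False x y u * g False x y u e))"
    and twist: "\<And>x y u e. x \<in> A \<Longrightarrow> y \<in> B \<Longrightarrow> y + \<kappa> x \<in> B \<Longrightarrow> e \<in> ball 0 \<rho> \<Longrightarrow> e \<noteq> 0 \<Longrightarrow>
        u \<in> \<Omega> \<Longrightarrow> u + P0 \<in> \<Omega> \<Longrightarrow>
        g True x y (u + P0) e = g True x (y + \<kappa> x) u e \<and>
        g False x y (u + P0) e = g False x (y + \<kappa> x) u e + \<kappa>0 / x\<^sup>2 * g True x (y + \<kappa> x) u e"
    and j: "j \<in> J" and mem: "x \<in> A" "y \<in> B" "u \<in> W j" "e \<in> ball 0 \<rho>"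
  shows "N i j x y u e = 0"
proof (rule ccontr)
  assume "N i j x y u e \<noteq> 0"
  then have nz: "\<exists>j\<in>J. \<exists>x\<in>A. \<exists>y\<in>B. \<exists>u\<in>W j. \<exists>e\<in>ball 0 \<rho>. \<exists>i. N i j x y u e \<noteq> 0" using j mem by blast
  obtain j0 xs ys us where base: "j0 \<in> J" "xs \<in> A" "ys \<in> B" "us \<in> W j0" "us + P0 \<in> \<Omega>" "b j0 xs ys us 0 \<noteq> 0"
    by (rule base_point)
  have k': "kk \<beta> \<delta> \<nu> = kk \<beta> \<delta> \<nu> \<and> ring_K \<beta> \<nu> (h iK) = ring_K \<beta> \<nu> (h iK) \<or>
      kk \<beta> \<delta> \<nu> = (\<lambda>i i' x y u. 0) \<and> ring_K \<beta> \<nu> (h iK) = (\<lambda>i i' x y. 0)" by simp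
  have \<tau>: "continuous_on A (\<lambda>x. \<kappa>0 / x\<^sup>2)" using dom(1) by (intro continuous_intros) auto
  obtain M c where c: "\<And>i e. e \<in> ball 0 \<rho> \<Longrightarrow> N i j0 xs ys us e = e ^ M * c i xs ys e"
    "\<And>i. (\<lambda>e. c i xs ys e) holomorphic_on ball 0 \<rho>"
    "\<And>i y. y \<in> B \<Longrightarrow> (\<lambda>t. c i t y 0) holomorphic_on A" "\<And>i x. x \<in> A \<Longrightarrow> (\<lambda>t. c i x t 0) holomorphic_on B"
    "\<And>y. y \<in> B \<Longrightarrow> (\<lambda>t. b j0 t y us 0) holomorphic_on A" "\<And>x. x \<in> A \<Longrightarrow> (\<lambda>t. b j0 x t us 0) holomorphic_on B"
    "\<And>i x y. x \<in> A \<Longrightarrow> y \<in> B \<Longrightarrow> b j0 x y us 0 \<noteq> 0 \<Longrightarrow> ring_R \<beta> \<nu> (h iK) x y * deriv (\<lambda>t. c i t y 0 / b j0 t y us 0) x =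
       ring_K \<beta> \<nu> (h iK) i True x y * (c True x y 0 / b j0 x y us 0) + ring_K \<beta> \<nu> (h iK) i False x y * (c False x y 0 / b j0 x y us 0)"
    "\<And>x y. x \<in> A \<Longrightarrow> y \<in> B \<Longrightarrow> y + \<kappa> x \<in> B \<Longrightarrow> b j0 x y us 0 \<noteq> 0 \<Longrightarrow> b j0 x (y + \<kappa> x) us 0 \<noteq> 0 \<Longrightarrow>
       c True x y 0 / b j0 x y us 0 = c True x (y + \<kappa> x) 0 / b j0 x (y + \<kappa> x) us 0 \<and>
       c False x y 0 / b j0 x y us 0 = c False x (y + \<kappa> x) 0 / b j0 x (y + \<kappa> x) us 0
         + \<kappa>0 / x\<^sup>2 * (c True x (y + \<kappa> x) 0 / b j0 x (y + \<kappa> x) us 0)"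
    "\<exists>x\<in>A. \<exists>y\<in>B. \<exists>i. c i x y 0 \<noteq> 0"
    by (rule limit_problem[OF \<rho> order_refl N quot pde nz k' twist \<tau> base]) (assumption | (rule that; assumption))+
  have \<alpha>A: "of_real \<alpha> \<in> A" using \<rho> by simp
  have "\<forall>x\<in>A. \<forall>y\<in>B. c True x y 0 = 0 \<and> c False x y 0 = 0"
  proof (rule vector_rigidity[OF open_ball connected_ball open_ball connected_ball \<alpha>A A0 c(5,6) \<kappa>_def \<kappa>0 c(3,4) c(3,4) base(2,3,6)])
    fix x y assume m: "x \<in> A" "y \<in> B" "b j0 x y us 0 \<noteq> 0"
    define f where "f = 2 * of_real pi * \<i> * of_real \<beta> * of_real \<nu> * h iK / x\<^sup>2"
    have f: "f \<noteq> 0" unfolding f_def by (rule ring_factor_nonzero[OF m(1)])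
    have x: "x \<noteq> 0" using dom(1) m by blast
    have \<nu>: "complex_of_real \<nu> \<noteq> 0" using pos by simp
    have K: "ring_K \<beta> \<nu> (h iK) True True x y = f * (- 3 * sin y / x)" "ring_K \<beta> \<nu> (h iK) True False x y = f * cos y"
      "ring_K \<beta> \<nu> (h iK) False i x y = 0" for i
      using x \<nu> by (simp_all add: ring_K_def f_def field_simps power2_eq_square)
    have R: "ring_R \<beta> \<nu> (h iK) x y = f * sin y" by (simp add: ring_R_factor f_def)
    have "f * (sin y * deriv (\<lambda>t. c True t y 0 / b j0 t y us 0) x) =
      f * (- 3 * sin y / x * (c True x y 0 / b j0 x y us 0) + cos y * (c False x y 0 / b j0 x y us 0))"
      using c(7)[OF m, of True] unfolding K R by (simp add: ring_distribs mult.assoc)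
    then show "sin y * deriv (\<lambda>t. c True t y 0 / b j0 t y us 0) x =
      - 3 * sin y / x * (c True x y 0 / b j0 x y us 0) + cos y * (c False x y 0 / b j0 x y us 0)"
      using f mult_left_cancel by blast
    show "sin y * deriv (\<lambda>t. c False t y 0 / b j0 t y us 0) x = 0"
      using c(7)[OF m, of False] f unfolding K R by simp
  qed (use c(8) in blast)+
  moreover obtain x y i where "x \<in> A" "y \<in> B" "c i x y 0 \<noteq> 0" using c(9) by blast
  ultimately show False by (cases i) auto
qed

end

section \<open>Nonintegrability\<close>

text \<open>A set with nonempty interior is not negligible and so cannot lie in the exceptional null
  set.\<close>

lemma AE_witness:
  fixes P :: "'a::euclidean_space \<Rightarrow> bool"
  assumes ae: "AE z\<in>U in lborel. P z" and S: "interior S \<noteq> {}" "S \<subseteq> U"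
  shows "\<exists>z\<in>S. P z"
proof (rule ccontr)
  assume neg: "\<not> ?thesis"
  obtain N where N: "{z \<in> space lborel. \<not> (z \<in> U \<longrightarrow> P z)} \<subseteq> N" "emeasure lborel N = 0" "N \<in> sets lborel"
    using ae by (rule AE_E)
  have "N \<in> null_sets lborel" using N by (intro null_setsI)
  then have "negligible N" by (simp add: negligible_iff_null_sets null_sets_completionI)
  moreover have "interior S \<subseteq> N" using N(1) neg S(2) interior_subset by fastforce
  ultimately have "negligible (interior S)" by (rule negligible_subset)
  then show False using open_not_negligible[OF open_interior S(1)] by simp
qed

lemma field_shift: "duffing_field \<beta> \<delta> \<nu> e (y + phase_period) = duffing_field \<beta> \<delta> \<nu> e y"
proof -
  have "cos (2 * complex_of_real pi) = 1" "sin (2 * complex_of_real pi) = 0"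
    using cos_of_real[of "2 * pi", where 'a = complex] sin_of_real[of "2 * pi", where 'a = complex] by simp_all
  then show ?thesis by (simp add: duffing_field_def phase_period_def axis_def cos_add)
qed

context forced_family
begin

lemma generic_open:
  assumes j: "j \<in> J" and \<rho>': "0 < \<rho>'" "\<rho>' \<le> \<rho>"
  obtains T where "open T" "T \<noteq> {}" "T \<subseteq> coords" "\<And>x y u e. (x, y, u, e) \<in> T \<Longrightarrow>
    x \<in> A \<and> y \<in> B \<and> u \<in> W j \<and> e \<in> ball 0 \<rho>' \<and> e \<noteq> 0 \<and> b j x y u e \<noteq> 0"
proof -
  let ?D = "A \<times> B \<times> W j \<times> ball (0 :: complex) \<rho>'"
  have hb: "hol4 (b j) A B (W j) (ball 0 \<rho>')" by (rule hol4_subset[OF hol_b[OF j]]) (use \<rho>' in auto)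
  define F where "F = (\<lambda>p :: complex \<times> complex \<times> complex \<times> complex. snd (snd (snd p)) * b j (fst p) (fst (snd p)) (fst (snd (snd p))) (snd (snd (snd p))))"
  have "continuous_on ?D F"
    using hol4_continuous[OF hb] unfolding F_def case_prod_unfold by (intro continuous_intros)
  moreover have "open ?D" using W[OF j] by (intro open_Times) auto
  ultimately have o: "open {p \<in> ?D. F p \<noteq> 0}" by (intro open_nonzero)
  obtain x y u where p: "x \<in> A" "y \<in> B" "u \<in> W j" "b j x y u 0 \<noteq> 0" using b0[OF j] by blast
  have z0: "0 \<in> ball (0 :: complex) \<rho>'" using \<rho>' by simp
  have "open {e \<in> ball 0 \<rho>'. b j x y u e \<noteq> 0}"
    by (rule open_nonzero[OF open_ball holomorphic_on_imp_continuous_on[OF hol4_slices(4)[OF hb p(1-3) z0]]])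
  moreover have "0 \<in> {e \<in> ball 0 \<rho>'. b j x y u e \<noteq> 0}" using z0 p(4) by simp
  ultimately obtain e where e: "e \<in> {e \<in> ball 0 \<rho>'. b j x y u e \<noteq> 0}" "e \<notin> {0}"
    using open_not_countable[of "{e \<in> ball 0 \<rho>'. b j x y u e \<noteq> 0}" "{0}"] by blast
  have ne: "(x, y, u, e) \<in> {p \<in> ?D. F p \<noteq> 0}" using e p by (simp add: F_def)
  have sub: "{p \<in> ?D. F p \<noteq> 0} \<subseteq> coords"
  proof
    fix q assume "q \<in> {p \<in> ?D. F p \<noteq> 0}"
    then obtain x y u e where q: "q = (x, y, u, e)" "x \<in> A" "u \<in> W j" by blast
    then show "q \<in> coords" using dom(1)[of x] dom(2)[of u] j by (auto simp: coords_def)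
  qed
  show ?thesis
    by (rule that[OF o _ sub]) (use ne in blast, simp add: F_def)
qed

end

text \<open>Under the scaling u = \<alpha> \<tau> the points of the orbit become values of
  \<open>Phi\<close> at amplitude \<alpha> and phase \<open>y0\<close>, so a neighbourhood of the
  orbit at e = 0 contains what the patches along \<open>Q\<close> require.\<close>

lemma resonant_family:
  fixes X :: "3 spt \<Rightarrow> complex ^ 3" and \<beta> \<nu> \<alpha> \<theta> :: real and l n :: nat
  assumes pos: "\<beta> > 0" "\<nu> > 0" "\<alpha> > 0" "l > 0" "n > 0"
    and res: "real n * duffing_period \<alpha> = 2 * pi * real l / \<nu>"
    and G: "domain_mod (2 * pi * real l / \<nu>) G" "\<real> \<subseteq> G" "\<i> * of_real (elliptic_K duffing_modulus / \<alpha>) \<in> G"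
    and X: "vf_meromorphic_on X U" and U: "duffing_orbit \<alpha> \<nu> \<theta> G \<times> {0} \<subseteq> U"
  obtains y0 \<rho> and J :: "complex set" and W a b M r r1 r2 h where
    "forced_family \<beta> \<nu> \<alpha> y0 n l \<rho> J W b r r1 r2 h"
    "\<And>x y u e. x \<in> ball (of_real \<alpha>) \<rho> \<Longrightarrow> y \<in> ball y0 \<rho> \<Longrightarrow> u \<in> (\<Union>j\<in>J. W j) \<Longrightarrow> e \<in> ball 0 \<rho> \<Longrightarrow> (Phi \<nu> x y u, e) \<in> U"
    "\<And>i j. j \<in> J \<Longrightarrow> hol4 (a i j) (ball (of_real \<alpha>) \<rho>) (ball y0 \<rho>) (W j) (ball 0 \<rho>)"
    "\<And>i j x y u e. j \<in> J \<Longrightarrow> x \<in> ball (of_real \<alpha>) \<rho> \<Longrightarrow> y \<in> ball y0 \<rho> \<Longrightarrow> u \<in> W j \<Longrightarrow> e \<in> ball 0 \<rho> \<Longrightarrow> e \<noteq> 0 \<Longrightarrow>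
       b j x y u e \<noteq> 0 \<Longrightarrow> e ^ M * pull \<nu> X x y u e $ i = a i j x y u e / b j x y u e"
    "\<And>j x y u e. j \<in> J \<Longrightarrow> x \<in> ball (of_real \<alpha>) \<rho> \<Longrightarrow> y \<in> ball y0 \<rho> \<Longrightarrow> u \<in> W j \<Longrightarrow> e \<in> ball 0 \<rho> \<Longrightarrow> e \<noteq> 0 \<Longrightarrow>
       b j x y u e \<noteq> 0 \<Longrightarrow> vf_regular_at X (Phi \<nu> x y u, e)"
proof -
  define p where "p = 2 * pi * real l / \<nu>"
  have p: "p > 0" using pos by (simp add: p_def)
  have cG: "connected G" "open G"
    using domain_mod_connected[OF p G(1,2)[folded p_def]] G(1) unfolding domain_mod_def by blast+
  have iKG: "iK / of_real \<alpha> \<in> G" using G(3) by simp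
  \<comment> \<open>The complex phase \<nu> \<tau> + \<theta> reached at the pole \<tau> = \<i> K /
    \<alpha>.\<close>
  define y0 :: complex where "y0 = of_real \<theta> + of_real \<nu> * iK / of_real \<alpha>"
  have \<alpha>0: "complex_of_real \<alpha> \<noteq> 0" using pos by simp
  obtain Q r r1 r2 h where Q: "compact Q" "connected Q" "\<And>u. u \<in> Q \<Longrightarrow> u \<notin> lpoles \<and> u / of_real \<alpha> \<in> G"
    "0 \<in> Q" "of_real (real n * (4 * qK)) \<in> Q" "0 < r1" "r1 < r2" "r2 < r" "\<And>u. r1 \<le> dist iK u \<Longrightarrow> dist iK u \<le> r2 \<Longrightarrow> u \<in> Q"
    "h holomorphic_on ball iK r" "h iK \<noteq> 0" "\<And>z. z \<in> ball iK r - {iK} \<Longrightarrow> z \<notin> lpoles \<and> lcn z = h z / (z - iK)"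
    by (rule resonance_path[OF pos(3) cG(2,1) G(2) iKG]) (rule that; assumption)
  have QU: "u \<notin> lpoles \<and> (Phi \<nu> (of_real \<alpha>) y0 u, 0) \<in> U" if "u \<in> Q" for u
  proof -
    define t where "t = u / of_real \<alpha>"
    have u: "u = of_real \<alpha> * t" using \<alpha>0 by (simp add: t_def)
    have np: "u \<notin> lpoles" "t \<in> G" using Q(3)[OF that] by (auto simp: t_def)
    have e1: "duffing_x1 \<alpha> = (\<lambda>t. of_real \<alpha> * lcn (of_real \<alpha> * t))" by (simp add: duffing_x1_def[abs_def] lcn_def)
    have e2: "duffing_x2 \<alpha> = (\<lambda>t. (of_real \<alpha>)\<^sup>2 * lcn' (of_real \<alpha> * t))"
      by (auto simp: duffing_x2_def lcn'_def fun_eq_iff)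
    have np': "of_real \<alpha> * t \<notin> lpoles" using np u by simp
    have c: "isCont (\<lambda>s. f (of_real \<alpha> * s)) t" if "isCont f (of_real \<alpha> * t)" for f :: "complex \<Rightarrow> complex"
      by (rule isCont_o2[where f = "\<lambda>s. of_real \<alpha> * s"]) (use that in auto)
    have d: "isCont (duffing_x1 \<alpha>) t" "isCont (duffing_x2 \<alpha>) t"
      unfolding e1 e2
      by (intro continuous_mult continuous_const c DERIV_isCont[OF lcn_derivative[OF np']] DERIV_isCont[OF lcn'_derivative[OF np']])+
    have "\<not> is_pole f t" if "isCont f t" for f :: "complex \<Rightarrow> complex"
      using that not_tendsto_and_filterlim_at_infinity[of "at t" f "f t"] unfolding is_pole_def isCont_def by auto
    then have "\<not> is_pole (duffing_x1 \<alpha>) t" "\<not> is_pole (duffing_x2 \<alpha>) t" using d by blast+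
    then have "vector [duffing_x1 \<alpha> t, duffing_x2 \<alpha> t, of_real \<nu> * t + of_real \<theta>] \<in> duffing_orbit \<alpha> \<nu> \<theta> G"
      unfolding duffing_orbit_def using np by blast
    moreover have "vector [duffing_x1 \<alpha> t, duffing_x2 \<alpha> t, of_real \<nu> * t + of_real \<theta>] = Phi \<nu> (of_real \<alpha>) y0 u"
      unfolding vec3_eq_iff using \<alpha>0
      by (simp add: vector_3 Phi_nth e1 e2 u phase_def y0_def field_simps)
    ultimately have "Phi \<nu> (of_real \<alpha>) y0 u \<in> duffing_orbit \<alpha> \<nu> \<theta> G" by (simp only:)
    then have "(Phi \<nu> (of_real \<alpha>) y0 u, 0) \<in> U" using U by blast
    then show ?thesis using np(1) by blast
  qed
  have Qne: "Q \<noteq> {}" using Q(4) by auto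
  obtain \<rho> and J :: "complex set" and W a b and M :: nat where
    fam: "\<rho> > 0" "finite J" "\<And>j. j \<in> J \<Longrightarrow> open (W j) \<and> connected (W j)" "connected (\<Union>j\<in>J. W j)" "Q \<subseteq> (\<Union>j\<in>J. W j)"
    "\<And>x y u e. x \<in> ball (of_real \<alpha>) \<rho> \<Longrightarrow> y \<in> ball y0 \<rho> \<Longrightarrow> u \<in> (\<Union>j\<in>J. W j) \<Longrightarrow> e \<in> ball 0 \<rho> \<Longrightarrow>
       x \<noteq> 0 \<and> u \<notin> lpoles \<and> (Phi \<nu> x y u, e) \<in> U"
    "\<And>i j. j \<in> J \<Longrightarrow> hol4 (a i j) (ball (of_real \<alpha>) \<rho>) (ball y0 \<rho>) (W j) (ball 0 \<rho>)"
    "\<And>j. j \<in> J \<Longrightarrow> hol4 (b j) (ball (of_real \<alpha>) \<rho>) (ball y0 \<rho>) (W j) (ball 0 \<rho>)"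
    "\<And>j. j \<in> J \<Longrightarrow> \<exists>x\<in>ball (of_real \<alpha>) \<rho>. \<exists>y\<in>ball y0 \<rho>. \<exists>u\<in>W j. b j x y u 0 \<noteq> 0"
    "\<And>i j x y u e. j \<in> J \<Longrightarrow> x \<in> ball (of_real \<alpha>) \<rho> \<Longrightarrow> y \<in> ball y0 \<rho> \<Longrightarrow> u \<in> W j \<Longrightarrow> e \<in> ball 0 \<rho> \<Longrightarrow> e \<noteq> 0 \<Longrightarrow>
       b j x y u e \<noteq> 0 \<Longrightarrow> e ^ M * pull \<nu> X x y u e $ i = a i j x y u e / b j x y u e"
    "\<And>j x y u e. j \<in> J \<Longrightarrow> x \<in> ball (of_real \<alpha>) \<rho> \<Longrightarrow> y \<in> ball y0 \<rho> \<Longrightarrow> u \<in> W j \<Longrightarrow> e \<in> ball 0 \<rho> \<Longrightarrow> e \<noteq> 0 \<Longrightarrow>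
       b j x y u e \<noteq> 0 \<Longrightarrow> vf_regular_at X (Phi \<nu> x y u, e)"
    by (rule patch_family[OF X \<alpha>0 Q(1,2) Qne QU]) (assumption | (rule that; assumption))+
  have "forced_family \<beta> \<nu> \<alpha> y0 n l \<rho> J W b r r1 r2 h"
  proof
    have "real n * (4 * qK) * \<nu> / \<alpha> = 2 * pi * real l" using res pos by (simp add: duffing_period_def field_simps)
    then have "complex_of_real (real n * (4 * qK) * \<nu> / \<alpha>) = complex_of_real (2 * pi * real l)" by (simp only:)
    then show "of_real \<nu> * (of_nat n * (4 * of_real qK)) / of_real \<alpha> = of_nat l * (2 * of_real pi :: complex)"
      by (simp add: mult_ac)
    have z: "of_real \<alpha> \<in> ball (complex_of_real \<alpha>) \<rho>" "y0 \<in> ball y0 \<rho>" "0 \<in> ball (0 :: complex) \<rho>" using fam(1) by auto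
    have "0 \<in> (\<Union>j\<in>J. W j)" using Q(4) fam(5) by blast
    then show "x \<noteq> 0" if "x \<in> ball (complex_of_real \<alpha>) \<rho>" for x using fam(6)[OF that z(2) _ z(3)] by blast
    show "u \<notin> lpoles" if "u \<in> (\<Union>j\<in>J. W j)" for u using fam(6)[OF z(1,2) that z(3)] by blast
    show "0 \<in> (\<Union>j\<in>J. W j)" by fact
    have "of_real (real n * (4 * qK)) = of_nat n * (4 * complex_of_real qK)" by simp
    then show "of_nat n * (4 * of_real qK) \<in> (\<Union>j\<in>J. W j)" using Q(5) fam(5) by (metis subsetD)
    show "u \<in> (\<Union>j\<in>J. W j)" if "r1 \<le> dist iK u" "dist iK u \<le> r2" for u using Q(9)[OF that] fam(5) by blast
  qed (fact pos fam Q)+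
  then show ?thesis
    by (rule that[OF _ _ fam(7) fam(10) fam(11)]) (assumption | use fam(6) in blast)+
qed

section \<open>First integrals\<close>

lemma no_first_integral:
  fixes F :: "3 spt \<Rightarrow> complex" and \<beta> \<nu> \<delta> \<alpha> \<theta> :: real and l n :: nat
  assumes pos: "\<beta> > 0" "\<nu> > 0" "\<alpha> > 0" "l > 0" "n > 0"
    and res: "real n * duffing_period \<alpha> = 2 * pi * real l / \<nu>"
    and G: "domain_mod (2 * pi * real l / \<nu>) G" "\<real> \<subseteq> G" "\<i> * of_real (elliptic_K duffing_modulus / \<alpha>) \<in> G"
    and F: "mv_meromorphic_on F U" and U: "duffing_orbit \<alpha> \<nu> \<theta> G \<times> {0} \<subseteq> U"
    and sh: "shift_invariant_set phase_period U" "shift_invariant_on phase_period U F"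
    and int: "\<And>z. z \<in> U \<Longrightarrow> mv_regular_at F z \<Longrightarrow> state_deriv F z (duffing_field \<beta> \<delta> \<nu> (snd z) (fst z)) = 0"
    and ae: "AE z\<in>U in lborel. state_grad F z \<noteq> 0"
  shows False
proof -
  define X :: "3 spt \<Rightarrow> complex ^ 3" where "X = (\<lambda>z. \<chi> i. F z)"
  have "vf_meromorphic_on X U" unfolding X_def by (rule vf_meromorphic_const_vec[OF F])
  then obtain y0 \<rho> and J :: "complex set" and W a b M r r1 r2 h where
    fam: "forced_family \<beta> \<nu> \<alpha> y0 n l \<rho> J W b r r1 r2 h"
    "\<And>x y u e. x \<in> ball (of_real \<alpha>) \<rho> \<Longrightarrow> y \<in> ball y0 \<rho> \<Longrightarrow> u \<in> (\<Union>j\<in>J. W j) \<Longrightarrow> e \<in> ball 0 \<rho> \<Longrightarrow> (Phi \<nu> x y u, e) \<in> U"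
    "\<And>i j. j \<in> J \<Longrightarrow> hol4 (a i j) (ball (of_real \<alpha>) \<rho>) (ball y0 \<rho>) (W j) (ball 0 \<rho>)"
    "\<And>i j x y u e. j \<in> J \<Longrightarrow> x \<in> ball (of_real \<alpha>) \<rho> \<Longrightarrow> y \<in> ball y0 \<rho> \<Longrightarrow> u \<in> W j \<Longrightarrow> e \<in> ball 0 \<rho> \<Longrightarrow> e \<noteq> 0 \<Longrightarrow>
       b j x y u e \<noteq> 0 \<Longrightarrow> e ^ M * pull \<nu> X x y u e $ i = a i j x y u e / b j x y u e"
    "\<And>j x y u e. j \<in> J \<Longrightarrow> x \<in> ball (of_real \<alpha>) \<rho> \<Longrightarrow> y \<in> ball y0 \<rho> \<Longrightarrow> u \<in> W j \<Longrightarrow> e \<in> ball 0 \<rho> \<Longrightarrow> e \<noteq> 0 \<Longrightarrow>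
       b j x y u e \<noteq> 0 \<Longrightarrow> vf_regular_at X (Phi \<nu> x y u, e)"
    by (rule resonant_family[OF pos res G _ U]) (assumption | (rule that; assumption))+
  interpret forced_family \<beta> \<delta> \<nu> \<alpha> y0 n l \<rho> J W b r r1 r2 h by (rule fam(1))
  obtain j0 xs ys us where base: "j0 \<in> J" "xs \<in> A" "ys \<in> B" "us \<in> W j0" "us + P0 \<in> \<Omega>" "b j0 xs ys us 0 \<noteq> 0"
    by (rule base_point)
  have z0: "(0 :: complex) \<in> ball 0 \<rho>" using \<rho> by simp
  have "open {e \<in> ball 0 \<rho>. b j0 xs ys us e \<noteq> 0}"
    by (rule open_nonzero[OF open_ball holomorphic_on_imp_continuous_on[OF hol4_slices(4)[OF hol_b[OF base(1)] base(2-4) z0]]])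
  moreover have "0 \<in> {e \<in> ball 0 \<rho>. b j0 xs ys us e \<noteq> 0}" using z0 base(6) by simp
  ultimately obtain s where s: "s > 0" "ball 0 s \<subseteq> {e \<in> ball 0 \<rho>. b j0 xs ys us e \<noteq> 0}"
    using open_contains_ball by blast
  \<comment> \<open>For e within \<open>s\<close> the denominator at the base point is nonzero, so
    \<eta> below is holomorphic.\<close>
  define \<rho>' where "\<rho>' = min s \<rho>"
  have \<rho>': "0 < \<rho>'" "\<rho>' \<le> \<rho>" using s \<rho> by (auto simp: \<rho>'_def)
  have bs: "b j0 xs ys us e \<noteq> 0" if "e \<in> ball 0 \<rho>'" for e using s(2) that by (auto simp: \<rho>'_def)
  have eb: "e \<in> ball 0 \<rho>" if "e \<in> ball 0 \<rho>'" for e :: complex using that \<rho>' by auto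
  have ball': "ball (0 :: complex) \<rho>' \<subseteq> ball 0 \<rho>" using eb by blast
  \<comment> \<open>For e \<noteq> 0 this is the value of \<open>e ^ M * F\<close> at the base
    point. It depends on e only, so subtracting it yields again a first integral, now zero at the
    base point.\<close>
  define \<eta> where "\<eta> = (\<lambda>e. a 1 j0 xs ys us e / b j0 xs ys us e)"
  have h\<eta>: "\<eta> holomorphic_on ball 0 \<rho>'"
    unfolding \<eta>_def
    by (intro holomorphic_on_divide holomorphic_on_subset[OF hol4_slices(4)[OF fam(3)[OF base(1)] base(2-4) z0] ball']
          holomorphic_on_subset[OF hol4_slices(4)[OF hol_b[OF base(1)] base(2-4) z0] ball'] bs)
  define N where "N = (\<lambda>j x y u e. a 1 j x y u e - \<eta> e * b j x y u e)"
  define g where "g = (\<lambda>x y u e. e ^ M * pull \<nu> F x y u e + (- \<eta> e))"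
  have reg: "mv_regular_at F (Phi \<nu> x y u, e)"
    if "j \<in> J" "x \<in> A" "y \<in> B" "u \<in> W j" "e \<in> ball 0 \<rho>" "e \<noteq> 0" "b j x y u e \<noteq> 0" for j x y u e
    using fam(5)[OF that] by (simp add: vf_regular_at_def X_def)
  have Fq: "e ^ M * pull \<nu> F x y u e = a 1 j x y u e / b j x y u e"
    if "j \<in> J" "x \<in> A" "y \<in> B" "u \<in> W j" "e \<in> ball 0 \<rho>" "e \<noteq> 0" "b j x y u e \<noteq> 0" for j x y u e
    using fam(4)[OF that, of 1] by (simp add: X_def pull_def)
  have N0: "N j x y u e = 0" if "j \<in> J" "x \<in> A" "y \<in> B" "u \<in> W j" "e \<in> ball 0 \<rho>'" for j x y u e
  proof (rule scalar_contradiction[OF \<rho>' _ _ _ _ base _ that, where g = g])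
    show "hol4 (N j) A B (W j) (ball 0 \<rho>')" if j: "j \<in> J" for j
      unfolding N_def
      by (intro hol4_diff hol4_mult hol4_of_4 h\<eta> hol4_subset[OF fam(3)[OF j] _ _ _ ball'] hol4_subset[OF hol_b[OF j] _ _ _ ball'] order_refl)
    show "g x y u e = N j x y u e / b j x y u e"
      if "j \<in> J" "x \<in> A" "y \<in> B" "u \<in> W j" "e \<in> ball 0 \<rho>'" "e \<noteq> 0" "b j x y u e \<noteq> 0" for j x y u e
      using Fq[OF that(1-4) eb[OF that(5)] that(6,7)] that(7) by (simp add: g_def N_def diff_divide_distrib)
    show "has_L \<beta> \<delta> \<nu> g x y u e 0"
      if m: "j \<in> J" "x \<in> A" "y \<in> B" "u \<in> W j" "e \<in> ball 0 \<rho>'" "e \<noteq> 0" "b j x y u e \<noteq> 0" for j x y u e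
    proof -
      note m' = m(1-4) eb[OF m(5)] m(6,7)
      obtain D where D: "mv_differential F (Phi \<nu> x y u, e) D" using mv_regular_differential[OF reg[OF m']] by blast
      have u: "u \<in> \<Omega>" using m by blast
      have "D (duffing_field \<beta> \<delta> \<nu> e (Phi \<nu> x y u), 0) = 0"
        using int[OF fam(2)[OF m(2,3) u eb[OF m(5)]] reg[OF m']] state_deriv_differential[OF D] by simp
      then have "has_L \<beta> \<delta> \<nu> (pull \<nu> F) x y u e 0"
        using has_L_pull[of F D \<nu> x y u e \<beta> \<delta>] D dom(1)[OF m(2)] dom(2)[OF u] by (simp add: mv_differential_def)
      from has_L_add[OF has_L_mult[OF has_L_param[of \<beta> \<delta> \<nu> "\<lambda>e. e ^ M"] this] has_L_param[of \<beta> \<delta> \<nu> "\<lambda>e. - \<eta> e"]]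
      show ?thesis unfolding g_def by simp
    qed
    show "g x y (u + P0) e = g x (y + \<kappa> x) u e"
      if m: "x \<in> A" "y \<in> B" "y + \<kappa> x \<in> B" "e \<in> ball 0 \<rho>'" "e \<noteq> 0" "u \<in> \<Omega>" "u + P0 \<in> \<Omega>" for x y u e
      using shift_invariant_iterate[OF sh fam(2)[OF m(1,3,6) eb[OF m(4)]], of l]
      by (simp add: g_def pull_def Phi_twist)
    show "N j0 xs ys us e = 0" if "e \<in> ball 0 \<rho>'" for e
      using bs[OF that] by (simp add: N_def \<eta>_def)
  qed
  obtain T where T: "open T" "T \<noteq> {}" "T \<subseteq> coords" "\<And>x y u e. (x, y, u, e) \<in> T \<Longrightarrow>
    x \<in> A \<and> y \<in> B \<and> u \<in> W j0 \<and> e \<in> ball 0 \<rho>' \<and> e \<noteq> 0 \<and> b j0 x y u e \<noteq> 0"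
    by (rule generic_open[OF base(1) \<rho>']) blast
  have "Phi4 \<nu> ` T \<subseteq> U"
  proof
    fix z assume "z \<in> Phi4 \<nu> ` T"
    then obtain x y u e where "(x, y, u, e) \<in> T" "z = (Phi \<nu> x y u, e)" by (auto simp: Phi4_def)
    then show "z \<in> U" using T(4)[of x y u e] fam(2)[of x y u e] eb base(1) by blast
  qed
  from AE_witness[OF ae Phi4_interior[OF T(1,3,2)] this]
  obtain x y u e where p: "(x, y, u, e) \<in> T" "state_grad F (Phi \<nu> x y u, e) \<noteq> 0" by (auto simp: Phi4_def)
  have m: "x \<in> A" "y \<in> B" "u \<in> W j0" "e \<in> ball 0 \<rho>'" "e \<noteq> 0" "b j0 x y u e \<noteq> 0" using T(4)[OF p(1)] by blast+
  have xu: "x \<noteq> 0" "u \<notin> lpoles" using p(1) T(3) by (auto simp: coords_def)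
  obtain D where D: "mv_differential F (Phi \<nu> x y u, e) D"
    using mv_regular_differential[OF reg[OF base(1) m(1-3) eb[OF m(4)] m(5,6)]] by blast
  \<comment> \<open>On an open set F depends on e alone, so its derivatives along the three
    coordinate fields vanish; these fields span the state space, hence the state gradient is
    zero.\<close>
  have const: "pull \<nu> F x' y' u' e = \<eta> e / e ^ M" if "(x', y', u', e) \<in> T" for x' y' u'
  proof -
    note m' = T(4)[OF that]
    have "e ^ M * pull \<nu> F x' y' u' e = \<eta> e"
      using Fq[of j0 x' y' u' e] N0[of j0 x' y' u' e] m' base(1) eb by (simp add: N_def)
    then show ?thesis using m(5) by (simp add: field_simps)
  qed
  have zero: "d = 0" if o: "continuous_on UNIV f" and f: "f t = (x, y, u, e)" "\<And>s. snd (snd (snd (f s))) = e"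
     and d: "((\<lambda>s. pull \<nu> F (fst (f s)) (fst (snd (f s))) (fst (snd (snd (f s)))) e) has_field_derivative d) (at t)" for f d and t :: complex
  proof -
    have "open (f -` T)" using o T(1) by (rule open_vimage[rotated])
    moreover have "t \<in> f -` T" using f(1) p(1) by simp
    moreover have "pull \<nu> F (fst (f s)) (fst (snd (f s))) (fst (snd (snd (f s)))) e = \<eta> e / e ^ M" if "s \<in> f -` T" for s
      using that f(2)[of s] by (intro const) (metis prod.collapse vimageE)
    ultimately have "((\<lambda>s. \<eta> e / e ^ M) has_field_derivative d) (at t)"
      by (rule has_field_derivative_transform_within_open[OF d])
    then show ?thesis using DERIV_unique DERIV_const by blast
  qed
  have D': "(F has_derivative D) (at (Phi \<nu> x y u, e))" "complex_linear D" using D by (auto simp: mv_differential_def)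
  note pd = pull_derivatives[OF D' xu]
  have d1: "D (vx \<nu> x u, 0) = 0" by (rule zero[where f = "\<lambda>s. (s, y, u, e)" and t = x]) (use pd(1) in \<open>auto intro!: continuous_intros\<close>)
  have d2: "D (vy, 0) = 0" by (rule zero[where f = "\<lambda>s. (x, s, u, e)" and t = y]) (use pd(2) in \<open>auto intro!: continuous_intros\<close>)
  have d3: "D (vu \<nu> x u, 0) = 0" by (rule zero[where f = "\<lambda>s. (x, y, s, e)" and t = u]) (use pd(3) in \<open>auto intro!: continuous_intros\<close>)
  have l: "linear D" using D'(1) has_derivative_linear by blast
  have "D (w, 0) = 0" for w
  proof -
    obtain c1 c2 c3 where "w = c1 *s vx \<nu> x u + c2 *s vy + c3 *s vu \<nu> x u" using Phi_span[OF xu] by blast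
    then have "D (w, 0) = D (c1 *s vx \<nu> x u, c1 * 0) + D (c2 *s vy, c2 * 0) + D (c3 *s vu \<nu> x u, c3 * 0)"
      using linear_add[OF l, of "(c1 *s vx \<nu> x u + c2 *s vy, 0)" "(c3 *s vu \<nu> x u, 0)"]
        linear_add[OF l, of "(c1 *s vx \<nu> x u, 0)" "(c2 *s vy, 0)"] by simp
    also have "\<dots> = 0"
      using D'(2)[unfolded complex_linear_def, rule_format, of _ "(_, 0)"] d1 d2 d3 by simp
    finally show ?thesis .
  qed
  then have "state_grad F (Phi \<nu> x y u, e) = 0"
    by (simp add: state_grad_def state_deriv_differential[OF D] vec_eq_iff)
  then show False using p(2) by simp
qed

section \<open>Commuting fields\<close>

lemma lcn_holomorphic:
  "lcn holomorphic_on - lpoles" "lcn' holomorphic_on - lpoles" "zq holomorphic_on - lpoles" "zq' holomorphic_on - lpoles"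
  unfolding holomorphic_on_def field_differentiable_def
  by (meson ComplD has_field_derivative_at_within lcn_derivative lcn'_derivative zq_derivatives)+

text \<open>The third component of \<open>duffing_field\<close> is the constant \<nu>, so the third
  component of a commuting field is constant along the flow. Subtracting that multiple of the flow
  field therefore preserves commutation while removing the \<phi>-component.\<close>

lemma symmetry_differentials:
  fixes X :: "3 spt \<Rightarrow> complex ^ 3"
  assumes D: "\<And>i. mv_differential (\<lambda>w. X w $ i) z (D i)" and \<nu>: "\<nu> \<noteq> 0"
    and br: "\<And>i. D i (duffing_field \<beta> \<delta> \<nu> (snd z) (fst z), 0) = duffing_D \<beta> \<delta> z i (X z, 0)"
  defines "Y \<equiv> \<lambda>i w. X w $ i - (1 / of_real \<nu>) * X w $ 3 * duffing_field \<beta> \<delta> \<nu> (snd w) (fst w) $ i"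
  obtains D1 D2 where "mv_differential (Y 1) z D1" "mv_differential (Y 2) z D2"
    "D1 (duffing_field \<beta> \<delta> \<nu> (snd z) (fst z), 0) = Y 2 z"
    "D2 (duffing_field \<beta> \<delta> \<nu> (snd z) (fst z), 0) = - 3 * (fst z $ 1)\<^sup>2 * Y 1 z - snd z * of_real \<delta> * Y 2 z"
proof -
  let ?f = "duffing_field \<beta> \<delta> \<nu> (snd z) (fst z)"
  have d: "mv_differential (Y i) z (\<lambda>h. D i h - ((1 / of_real \<nu> * X z $ 3) * duffing_D \<beta> \<delta> z i h
      + ((1 / of_real \<nu>) * D 3 h + 0 * X z $ 3) * ?f $ i))" for i
    unfolding Y_def
    by (rule mv_differential_diff[OF D mv_differential_mult[OF mv_differential_mult[OF mv_differential_const D] duffing_differential]])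
  have f3: "?f $ 3 = of_real \<nu>" by (simp add: duffing_field_def)
  have f1: "?f $ 1 = fst z $ 2" by (simp add: duffing_field_def)
  have D3: "D 3 (?f, 0) = 0" by (simp add: br duffing_D_def)
  show ?thesis
  proof (rule that[OF d[of 1] d[of 2]])
    show "D 1 (?f, 0) - ((1 / of_real \<nu> * X z $ 3) * duffing_D \<beta> \<delta> z 1 (?f, 0) + ((1 / of_real \<nu>) * D 3 (?f, 0) + 0 * X z $ 3) * ?f $ 1) = Y 2 z"
      unfolding D3 br by (simp add: duffing_D_def Y_def)
    show "D 2 (?f, 0) - ((1 / of_real \<nu> * X z $ 3) * duffing_D \<beta> \<delta> z 2 (?f, 0) + ((1 / of_real \<nu>) * D 3 (?f, 0) + 0 * X z $ 3) * ?f $ 2) =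
      - 3 * (fst z $ 1)\<^sup>2 * Y 1 z - snd z * of_real \<delta> * Y 2 z"
      unfolding D3 br using \<nu> by (simp add: duffing_D_def Y_def f3 field_simps)
  qed
qed

lemma no_commuting_field:
  fixes X :: "3 spt \<Rightarrow> complex ^ 3" and \<beta> \<nu> \<delta> \<alpha> \<theta> :: real and l n :: nat
  assumes pos: "\<beta> > 0" "\<nu> > 0" "\<alpha> > 0" "l > 0" "n > 0"
    and res: "real n * duffing_period \<alpha> = 2 * pi * real l / \<nu>"
    and G: "domain_mod (2 * pi * real l / \<nu>) G" "\<real> \<subseteq> G" "\<i> * of_real (elliptic_K duffing_modulus / \<alpha>) \<in> G"
    and X: "vf_meromorphic_on X U" and U: "duffing_orbit \<alpha> \<nu> \<theta> G \<times> {0} \<subseteq> U"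
    and sh: "shift_invariant_set phase_period U" "shift_invariant_on phase_period U X"
    and br: "\<And>z i D. z \<in> U \<Longrightarrow> (\<And>i. mv_differential (\<lambda>w. X w $ i) z (D i)) \<Longrightarrow> vf_regular_at X z \<Longrightarrow>
       D i (duffing_field \<beta> \<delta> \<nu> (snd z) (fst z), 0) = duffing_D \<beta> \<delta> z i (X z, 0)"
    and ae: "AE z\<in>U in lborel. \<nexists>c. X z = c *s duffing_field \<beta> \<delta> \<nu> (snd z) (fst z)"
  shows False
proof -
  obtain y0 \<rho> and J :: "complex set" and W a b M r r1 r2 h where
    fam: "forced_family \<beta> \<nu> \<alpha> y0 n l \<rho> J W b r r1 r2 h"
    "\<And>x y u e. x \<in> ball (of_real \<alpha>) \<rho> \<Longrightarrow> y \<in> ball y0 \<rho> \<Longrightarrow> u \<in> (\<Union>j\<in>J. W j) \<Longrightarrow> e \<in> ball 0 \<rho> \<Longrightarrow> (Phi \<nu> x y u, e) \<in> U"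
    "\<And>i j. j \<in> J \<Longrightarrow> hol4 (a i j) (ball (of_real \<alpha>) \<rho>) (ball y0 \<rho>) (W j) (ball 0 \<rho>)"
    "\<And>i j x y u e. j \<in> J \<Longrightarrow> x \<in> ball (of_real \<alpha>) \<rho> \<Longrightarrow> y \<in> ball y0 \<rho> \<Longrightarrow> u \<in> W j \<Longrightarrow> e \<in> ball 0 \<rho> \<Longrightarrow> e \<noteq> 0 \<Longrightarrow>
       b j x y u e \<noteq> 0 \<Longrightarrow> e ^ M * pull \<nu> X x y u e $ i = a i j x y u e / b j x y u e"
    "\<And>j x y u e. j \<in> J \<Longrightarrow> x \<in> ball (of_real \<alpha>) \<rho> \<Longrightarrow> y \<in> ball y0 \<rho> \<Longrightarrow> u \<in> W j \<Longrightarrow> e \<in> ball 0 \<rho> \<Longrightarrow> e \<noteq> 0 \<Longrightarrow>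
       b j x y u e \<noteq> 0 \<Longrightarrow> vf_regular_at X (Phi \<nu> x y u, e)"
    by (rule resonant_family[OF pos res G X U]) (assumption | (rule that; assumption))+
  interpret forced_family \<beta> \<delta> \<nu> \<alpha> y0 n l \<rho> J W b r r1 r2 h by (rule fam(1))
  have \<nu>0: "\<nu> \<noteq> 0" using pos by simp
  let ?f = "\<lambda>z. duffing_field \<beta> \<delta> \<nu> (snd z) (fst z)"
  define Y where "Y = (\<lambda>i w. X w $ i - (1 / of_real \<nu>) * X w $ 3 * ?f w $ i)"
  define ya where "ya = (\<lambda>i j x y u e. a i j x y u e - (1 / of_real \<nu>) * a 3 j x y u e * pull \<nu> (\<lambda>z. ?f z $ i) x y u e)"
  define N where "N = (\<lambda>i j x y u e. if i then lcn u ^ 3 * ya 1 j x y u e + lcn' u * (1 / x) * ya 2 j x y u e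
     else (- zq' u) * (of_real \<nu> / x\<^sup>2) * ya 1 j x y u e + zq u * (of_real \<nu> / x ^ 3) * ya 2 j x y u e)"
  define g where "g = (\<lambda>i x y u e. e ^ M * (if i then comp_p \<nu> (Y 1) (Y 2) x y u e else comp_q \<nu> (Y 1) (Y 2) x y u e))"
  have gT: "g True = (\<lambda>x y u e. e ^ M * comp_p \<nu> (Y 1) (Y 2) x y u e)" and gF: "g False = (\<lambda>x y u e. e ^ M * comp_q \<nu> (Y 1) (Y 2) x y u e)"
    by (simp_all add: g_def)
  have Yq: "e ^ M * pull \<nu> (Y i) x y u e = ya i j x y u e / b j x y u e"
    if "j \<in> J" "x \<in> A" "y \<in> B" "u \<in> W j" "e \<in> ball 0 \<rho>" "e \<noteq> 0" "b j x y u e \<noteq> 0" for i j x y u e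
  proof -
    have "e ^ M * pull \<nu> (Y i) x y u e = e ^ M * pull \<nu> X x y u e $ i
        - (1 / of_real \<nu>) * (e ^ M * pull \<nu> X x y u e $ 3) * pull \<nu> (\<lambda>z. ?f z $ i) x y u e"
      by (simp add: Y_def pull_def algebra_simps)
    then show ?thesis unfolding fam(4)[OF that] by (simp add: ya_def diff_divide_distrib)
  qed
  have gq: "g i x y u e = N i j x y u e / b j x y u e"
    if "j \<in> J" "x \<in> A" "y \<in> B" "u \<in> W j" "e \<in> ball 0 \<rho>" "e \<noteq> 0" "b j x y u e \<noteq> 0" for i j x y u e
  proof (cases i)
    case True
    have "g True x y u e = lcn u ^ 3 * (e ^ M * pull \<nu> (Y 1) x y u e) + lcn' u * (1 / x) * (e ^ M * pull \<nu> (Y 2) x y u e)"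
      by (simp add: gT comp_p_def algebra_simps)
    then show ?thesis unfolding Yq[OF that] using True by (simp add: N_def add_divide_distrib)
  next
    case False
    have "g False x y u e = (- zq' u) * (of_real \<nu> / x\<^sup>2) * (e ^ M * pull \<nu> (Y 1) x y u e) + zq u * (of_real \<nu> / x ^ 3) * (e ^ M * pull \<nu> (Y 2) x y u e)"
      by (simp add: gF comp_q_def algebra_simps)
    then show ?thesis unfolding Yq[OF that] using False by (simp add: N_def add_divide_distrib diff_divide_distrib)
  qed
  have N0: "N i j x y u e = 0" if "j \<in> J" "x \<in> A" "y \<in> B" "u \<in> W j" "e \<in> ball 0 \<rho>" for i j x y u e
  proof (rule vector_contradiction[OF _ gq _ _ that])
    show "hol4 (N i j) A B (W j) (ball 0 \<rho>)" if j: "j \<in> J" for i j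
    proof -
      have sub: "W j \<subseteq> - lpoles" using dom(2) j by blast
      have f: "hol4 (pull \<nu> (\<lambda>z. ?f z $ i)) A B (W j) (ball 0 \<rho>)" for i
      proof (rule hol4_pull[where V = UNIV])
        show "mv_holomorphic_on (\<lambda>z. ?f z $ i) UNIV" unfolding mv_holomorphic_on_iff using duffing_differential by blast
      qed (use dom j in blast)
      have y: "hol4 (ya i j) A B (W j) (ball 0 \<rho>)" for i
        unfolding ya_def by (intro hol4_diff hol4_mult hol4_const fam(3)[OF j] f)
      have x0: "x \<noteq> 0" if "x \<in> A" for x using dom(1)[OF that] .
      show ?thesis
        unfolding N_def
        by (cases i; simp only: if_True if_False;
            intro hol4_add hol4_mult y hol4_of_1 hol4_of_3 holomorphic_intros lcn_holomorphic[THEN holomorphic_on_subset, OF sub])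
           (use x0 in auto)
    qed
    show "has_L \<beta> \<delta> \<nu> (g i) x y u e (e * (kk \<beta> \<delta> \<nu> i True x y u * g True x y u e + kk \<beta> \<delta> \<nu> i False x y u * g False x y u e))"
      if m: "j \<in> J" "x \<in> A" "y \<in> B" "u \<in> W j" "e \<in> ball 0 \<rho>" "e \<noteq> 0" "b j x y u e \<noteq> 0" for i j x y u e
    proof -
      have u: "u \<in> \<Omega>" using m by blast
      have zU: "(Phi \<nu> x y u, e) \<in> U" by (rule fam(2)[OF m(2,3) u m(5)])
      have "\<exists>D. mv_differential (\<lambda>w. X w $ i) (Phi \<nu> x y u, e) D" for i
        using fam(5)[OF m] mv_regular_differential unfolding vf_regular_at_def by blast
      then obtain D where D: "mv_differential (\<lambda>w. X w $ i) (Phi \<nu> x y u, e) (D i)" for i by metis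
      obtain D1 D2 where D12: "mv_differential (Y 1) (Phi \<nu> x y u, e) D1" "mv_differential (Y 2) (Phi \<nu> x y u, e) D2"
        "D1 (duffing_field \<beta> \<delta> \<nu> (snd (Phi \<nu> x y u, e)) (fst (Phi \<nu> x y u, e)), 0) = Y 2 (Phi \<nu> x y u, e)"
        "D2 (duffing_field \<beta> \<delta> \<nu> (snd (Phi \<nu> x y u, e)) (fst (Phi \<nu> x y u, e)), 0) =
           - 3 * (fst (Phi \<nu> x y u, e) $ 1)\<^sup>2 * Y 1 (Phi \<nu> x y u, e) - snd (Phi \<nu> x y u, e) * of_real \<delta> * Y 2 (Phi \<nu> x y u, e)"
        unfolding Y_def by (rule symmetry_differentials[OF D \<nu>0 br[OF zU D fam(5)[OF m]]]) blast
      have L: "has_L \<beta> \<delta> \<nu> (comp_p \<nu> (Y 1) (Y 2)) x y u e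
        (e * (kk \<beta> \<delta> \<nu> True True x y u * comp_p \<nu> (Y 1) (Y 2) x y u e + kk \<beta> \<delta> \<nu> True False x y u * comp_q \<nu> (Y 1) (Y 2) x y u e))"
        "has_L \<beta> \<delta> \<nu> (comp_q \<nu> (Y 1) (Y 2)) x y u e
        (e * (kk \<beta> \<delta> \<nu> False True x y u * comp_p \<nu> (Y 1) (Y 2) x y u e + kk \<beta> \<delta> \<nu> False False x y u * comp_q \<nu> (Y 1) (Y 2) x y u e))"
        using comp_pde[OF dom(1)[OF m(2)] dom(2)[OF u] \<nu>0, of "Y 1" D1 y e "Y 2" D2] D12
        by (simp_all add: mv_differential_def pull_def)
      note LM = has_L_mult[OF has_L_param[of \<beta> \<delta> \<nu> "\<lambda>e. e ^ M"] L(1)] has_L_mult[OF has_L_param[of \<beta> \<delta> \<nu> "\<lambda>e. e ^ M"] L(2)]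
      show ?thesis
      proof (cases i)
        case True
        then have "i = True" by simp
        show ?thesis unfolding \<open>i = True\<close> gT gF using LM(1) by (simp add: algebra_simps)
      next
        case False
        then have "i = False" by simp
        show ?thesis unfolding \<open>i = False\<close> gT gF using LM(2) by (simp add: algebra_simps)
      qed
    qed
    show "g True x y (u + P0) e = g True x (y + \<kappa> x) u e \<and>
        g False x y (u + P0) e = g False x (y + \<kappa> x) u e + \<kappa>0 / x\<^sup>2 * g True x (y + \<kappa> x) u e"
      if m: "x \<in> A" "y \<in> B" "y + \<kappa> x \<in> B" "e \<in> ball 0 \<rho>" "e \<noteq> 0" "u \<in> \<Omega>" "u + P0 \<in> \<Omega>" for x y u e
    proof -
      have Ysh: "shift_invariant_on phase_period U (Y i)" for i
        using sh(2) unfolding shift_invariant_on_def Y_def shift_state_def by (simp add: field_shift)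
      have Yt: "pull \<nu> (Y i) x y (u + P0) e = pull \<nu> (Y i) x (y + \<kappa> x) u e" for i
        using shift_invariant_iterate[OF sh(1) Ysh fam(2)[OF m(1,3,6,4)], of i l] by (simp add: pull_def Phi_twist)
      \<comment> \<open>Over n periods the scaling solution \<open>zq\<close> changes by a multiple
        of \<open>lcn'\<close>, being linear in time with periodic coefficients; this is the source
        of the unipotent twist of \<open>comp_q\<close> by \<open>comp_p\<close>.\<close>
      have z: "zq (u + P0) = zq u + P0 * lcn' u" "zq' (u + P0) = zq' u - P0 * lcn u ^ 3"
        unfolding zq_def zq'_def lcn_shift by (simp_all add: algebra_simps)
      have x0: "x \<noteq> 0" using dom(1)[OF m(1)] .
      have "comp_p \<nu> (Y 1) (Y 2) x y (u + P0) e = comp_p \<nu> (Y 1) (Y 2) x (y + \<kappa> x) u e"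
        unfolding comp_p_def lcn_shift Yt ..
      moreover have "comp_q \<nu> (Y 1) (Y 2) x y (u + P0) e = comp_q \<nu> (Y 1) (Y 2) x (y + \<kappa> x) u e
         + \<kappa>0 / x\<^sup>2 * comp_p \<nu> (Y 1) (Y 2) x (y + \<kappa> x) u e"
        unfolding comp_p_def comp_q_def lcn_shift Yt z using x0
        by (simp add: ring_distribs add_divide_distrib diff_divide_distrib power2_eq_square power3_eq_cube mult_ac)
      ultimately show ?thesis unfolding gT gF by (simp add: ring_distribs mult_ac)
    qed
  qed
  obtain j where j: "j \<in> J" using ends(1) by blast
  obtain T where T: "open T" "T \<noteq> {}" "T \<subseteq> coords" "\<And>x y u e. (x, y, u, e) \<in> T \<Longrightarrow>
    x \<in> A \<and> y \<in> B \<and> u \<in> W j \<and> e \<in> ball 0 \<rho> \<and> e \<noteq> 0 \<and> b j x y u e \<noteq> 0"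
    by (rule generic_open[OF j \<rho> order_refl]) blast
  have "Phi4 \<nu> ` T \<subseteq> U"
  proof
    fix z assume "z \<in> Phi4 \<nu> ` T"
    then obtain x y u e where "(x, y, u, e) \<in> T" "z = (Phi \<nu> x y u, e)" by (auto simp: Phi4_def)
    then show "z \<in> U" using T(4)[of x y u e] fam(2)[of x y u e] j by blast
  qed
  from AE_witness[OF ae Phi4_interior[OF T(1,3,2)] this]
  obtain x y u e where p: "(x, y, u, e) \<in> T" "\<nexists>c. X (Phi \<nu> x y u, e) = c *s ?f (Phi \<nu> x y u, e)" by (auto simp: Phi4_def)
  have m: "x \<in> A" "y \<in> B" "u \<in> W j" "e \<in> ball 0 \<rho>" "e \<noteq> 0" "b j x y u e \<noteq> 0" using T(4)[OF p(1)] by blast+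
  have xu: "x \<noteq> 0" "u \<notin> lpoles" using p(1) T(3) by (auto simp: coords_def)
  have "g i x y u e = 0" for i using gq[OF j m, of i] N0[OF j m(1-4), of i] by simp
  from this[of True] this[of False] have "comp_p \<nu> (Y 1) (Y 2) x y u e = 0" "comp_q \<nu> (Y 1) (Y 2) x y u e = 0"
    using m(5) by (simp_all add: gT gF)
  then have "pull \<nu> (Y 1) x y u e = 0" "pull \<nu> (Y 2) x y u e = 0"
    using comp_inverse(1)[OF xu \<nu>0, of "Y 1" y e "Y 2"] comp_inverse(2)[OF xu \<nu>0, of "Y 2" y e "Y 1"] by simp_all
  \<comment> \<open>The first two components of \<open>Y\<close> vanish and the third does so by
    construction, so \<open>X\<close> is a multiple of the flow field, against independence almost
    everywhere.\<close>
  then have "X (Phi \<nu> x y u, e) = ((1 / of_real \<nu>) * X (Phi \<nu> x y u, e) $ 3) *s ?f (Phi \<nu> x y u, e)"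
    unfolding vec3_eq_iff using \<nu>0 by (simp add: pull_def Y_def duffing_field_def)
  then show False using p(2) by blast
qed

theorem proposition4p3:
  fixes \<beta> \<nu> \<delta> \<alpha> \<theta> :: real and l n :: nat and G :: "complex set"
  assumes "\<beta> > 0" and "\<nu> > 0" and "\<delta> \<ge> 0" and "\<alpha> > 0"
    and "l > 0" and "n > 0" and "coprime l n"
    and "real n * duffing_period \<alpha> = 2 * pi * real l / \<nu>"
    and "domain_mod (2 * pi * real l / \<nu>) G"
    and "\<real> \<subseteq> G"
    and "\<i> * of_real (elliptic_K duffing_modulus / \<alpha>) \<in> G"
  shows "\<not> meromorphically_integrable_near phase_period (duffing_field \<beta> \<delta> \<nu>)
           (duffing_orbit \<alpha> \<nu> \<theta> G)"
proof
  let ?f = "\<lambda>z. duffing_field \<beta> \<delta> \<nu> (snd z) (fst z)"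
  assume "meromorphically_integrable_near phase_period (duffing_field \<beta> \<delta> \<nu>) (duffing_orbit \<alpha> \<nu> \<theta> G)"
  then obtain q U X F where q: "q \<in> {1..CARD(3)}" and U: "open U" "shift_invariant_set phase_period U" "duffing_orbit \<alpha> \<nu> \<theta> G \<times> {0} \<subseteq> U"
    and S: "bogoyavlenskij_system phase_period (duffing_field \<beta> \<delta> \<nu>) q U X F"
    unfolding meromorphically_integrable_near_def by blast
  have X1: "\<And>z. z \<in> U \<Longrightarrow> X 1 z = ?f z"
    and Xm: "\<And>j. j \<in> {1..q} \<Longrightarrow> vf_meromorphic_on (X j) U \<and> shift_invariant_on phase_period U (X j)"
    and Fm: "\<And>k. k \<in> {1..CARD(3) - q} \<Longrightarrow> mv_meromorphic_on (F k) U \<and> shift_invariant_on phase_period U (F k)"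
    and Xi: "AE z\<in>U in lborel. lin_indep_family {1..q} (\<lambda>j. X j z)"
    and Xb: "\<And>j k z. j \<in> {1..q} \<Longrightarrow> k \<in> {1..q} \<Longrightarrow> z \<in> U \<Longrightarrow> vf_regular_at (X j) z \<Longrightarrow> vf_regular_at (X k) z \<Longrightarrow> state_bracket (X j) (X k) z = 0"
    and Fi: "AE z\<in>U in lborel. lin_indep_family {1..CARD(3) - q} (\<lambda>k. state_grad (F k) z)"
    and FX: "\<And>j k z. j \<in> {1..q} \<Longrightarrow> k \<in> {1..CARD(3) - q} \<Longrightarrow> z \<in> U \<Longrightarrow> vf_regular_at (X j) z \<Longrightarrow> mv_regular_at (F k) z \<Longrightarrow> state_deriv (F k) z (X j z) = 0"
    using S unfolding bogoyavlenskij_system_def by blast+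
  \<comment> \<open>\<open>X 1\<close> agrees with the field only on \<open>U\<close>; as
    \<open>U\<close> is open, the differentials agree as well.\<close>
  have X1d: "mv_differential (\<lambda>w. X 1 w $ i) z (duffing_D \<beta> \<delta> z i)" if "z \<in> U" for z i
    by (rule mv_differential_cong[OF duffing_differential[of \<beta> \<delta> \<nu>] U(1) that]) (simp only: X1)
  have X1r: "vf_regular_at (X 1) z" if "z \<in> U" for z
    unfolding vf_regular_at_def mv_regular_at_def mv_holomorphic_on_iff using X1d U(1) that by blast
  have q1: "1 \<in> {1..q}" using q by simp
  show False
  proof (cases "q = 3")
    case False
    \<comment> \<open>Fewer than three fields leave at least one first integral.\<close>
    then have k: "1 \<in> {1..CARD(3) - q}" using q by simp linarith
    show False
    proof (rule no_first_integral[OF assms(1,2,4-6,8-11) _ U(3,2)])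
      show "mv_meromorphic_on (F 1) U" "shift_invariant_on phase_period U (F 1)" using Fm[OF k] by blast+
      show "state_deriv (F 1) z (duffing_field \<beta> \<delta> \<nu> (snd z) (fst z)) = 0" if "z \<in> U" "mv_regular_at (F 1) z" for z
        using FX[OF q1 k that(1) X1r[OF that(1)] that(2)] X1[OF that(1)] by simp
      show "AE z\<in>U in lborel. state_grad (F 1) z \<noteq> 0"
        using Fi
      proof (rule AE_mp, intro AE_I2 impI)
        fix z assume "z \<in> U \<longrightarrow> lin_indep_family {1..CARD(3) - q} (\<lambda>k. state_grad (F k) z)" "z \<in> U"
        then have "vec.independent ((\<lambda>k. state_grad (F k) z) ` {1..CARD(3) - q})" by (simp add: lin_indep_family_def)
        then have "0 \<notin> (\<lambda>k. state_grad (F k) z) ` {1..CARD(3) - q}" by (metis vec.dependent_zero)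
        moreover have "state_grad (F 1) z \<in> (\<lambda>k. state_grad (F k) z) ` {1..CARD(3) - q}" by (rule imageI[OF k])
        ultimately show "state_grad (F 1) z \<noteq> 0" by auto
      qed
    qed
  next
    case True
    then have q2: "2 \<in> {1..q}" by simp
    show False
    proof (rule no_commuting_field[OF assms(1,2,4-6,8-11) _ U(3,2)])
      show "vf_meromorphic_on (X 2) U" "shift_invariant_on phase_period U (X 2)" using Xm[OF q2] by blast+
      show "D i (duffing_field \<beta> \<delta> \<nu> (snd z) (fst z), 0) = duffing_D \<beta> \<delta> z i (X 2 z, 0)"
        if "z \<in> U" and D: "\<And>i. mv_differential (\<lambda>w. X 2 w $ i) z (D i)" and r: "vf_regular_at (X 2) z" for z i D
      proof -
        have "state_bracket (X 1) (X 2) z $ i = 0" using Xb[OF q1 q2 that(1) X1r[OF that(1)] r] by simp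
        then have "state_deriv (X 2) z (X 1 z) $ i = state_deriv (X 1) z (X 2 z) $ i" by (simp add: state_bracket_def)
        then show ?thesis
          unfolding state_deriv_vec_differential[OF D] state_deriv_vec_differential[OF X1d[OF that(1)]] X1[OF that(1)] .
      qed
      show "AE z\<in>U in lborel. \<nexists>c. X 2 z = c *s duffing_field \<beta> \<delta> \<nu> (snd z) (fst z)"
        using Xi
      proof (rule AE_mp, intro AE_I2 impI notI)
        fix z assume i: "z \<in> U \<longrightarrow> lin_indep_family {1..q} (\<lambda>j. X j z)" and z: "z \<in> U"
          and "\<exists>c. X 2 z = c *s duffing_field \<beta> \<delta> \<nu> (snd z) (fst z)"
        then obtain c where c: "X 2 z = c *s X 1 z" using X1 by auto
        have ind: "vec.independent ((\<lambda>j. X j z) ` {1..q})" "inj_on (\<lambda>j. X j z) {1..q}" using i z by (simp_all add: lin_indep_family_def)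
        \<comment> \<open>The case c = 1: independence of the image set cannot detect a repeated
          vector, so injectivity has to separate \<open>X 1 z\<close> from
          \<open>X 2 z\<close>.\<close>
        have ne: "X 1 z \<noteq> X 2 z" using inj_onD[OF ind(2), of 1 2] q1 q2 by auto
        have "X 1 z \<in> (\<lambda>j. X j z) ` {1..q} - {X 2 z}" using q1 ne by blast
        then have "X 2 z \<in> vec.span ((\<lambda>j. X j z) ` {1..q} - {X 2 z})"
          using c vec.span_scale[OF vec.span_base] by metis
        moreover have "X 2 z \<in> (\<lambda>j. X j z) ` {1..q}" by (rule imageI[OF q2])
        ultimately show False using ind(1) unfolding vec.dependent_def by blast
      qed
    qed
  qed
qed

end
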